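(* Let $A$ be a C*-algebra. Then $A$ has the total reduction property if and only if $A$ has the similarity property.
   Context: A representation of a Banach algebra $A$ on a complex Hilbert space $H$ is a continuous algebra homomorphism $\theta:A\to\mathcal B(H)$ (not required to be unital or to preserve any involution). A C*-algebra $A$ has the similarity property if for every representation $\theta:A\to\mathcal B(H)$ on a Hilbert space $H$ there is a bounded invertible $S\in\mathcal B(H)$ such that $a\mapsto S\theta(a)S^{-1}$ is a $*$-representation. $A$ has the total reduction property if for every representation $\theta:A\to\mathcal B(H)$ on a Hilbert space $H$ and every norm-closed $\theta(A)$-invariant subspace $V\subseteq H$ there is a norm-closed $\theta(A)$-invariant subspace $W\subseteq H$ with $H=V\oplus W$ (not necessarily orthogonal). *)

theory Defs
  imports "HOL-Analysis.Analysis" "HOL-Algebra.Module" "HOL-Algebra.AbelCoset"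
begin

section \<open>C*-algebras\<close>

text \<open>
  No unit is required, and the zero algebra is allowed.
\<close>

class cstar_algebra = real_normed_algebra + banach +
  fixes scaleC :: "complex \<Rightarrow> 'a \<Rightarrow> 'a" (infixr \<open>*\<^sub>C\<close> 75)
    and star :: "'a \<Rightarrow> 'a"
  assumes scaleR_scaleC: "r *\<^sub>R a = complex_of_real r *\<^sub>C a"
    and scaleC_add_right: "c *\<^sub>C (a + b) = c *\<^sub>C a + c *\<^sub>C b"
    and scaleC_add_left: "(c + d) *\<^sub>C a = c *\<^sub>C a + d *\<^sub>C a"
    and scaleC_scaleC: "c *\<^sub>C d *\<^sub>C a = (c * d) *\<^sub>C a"
    and mult_scaleC_left: "(c *\<^sub>C a) * b = c *\<^sub>C (a * b)"
    and mult_scaleC_right: "a * (c *\<^sub>C b) = c *\<^sub>C (a * b)"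
    and norm_scaleC: "norm (c *\<^sub>C a) = cmod c * norm a"
    and star_star: "star (star a) = a"
    and star_add: "star (a + b) = star a + star b"
    and star_scaleC: "star (c *\<^sub>C a) = cnj c *\<^sub>C star a"
    and star_mult: "star (a * b) = star b * star a"
    and norm_star_mult_self: "norm (star a * a) = (norm a)\<^sup>2"


section \<open>Complex Hilbert spaces\<close>

text \<open>
  Hilbert spaces are structures on a subset of a type, so that one can quantify over them
  inside a formula. The multiplication and unit fields inherited by \<^type>\<open>module\<close> carry no meaning
  here. The inner product is linear in its first argument.
\<close>

record 'h inner_structure = "(complex, 'h) module" +
  cinner :: "'h \<Rightarrow> 'h \<Rightarrow> complex"

definition complex_ring :: "complex ring"
  where "complex_ring =
    \<lparr>carrier = UNIV, monoid.mult = (*), one = 1, ring.zero = 0, add = (+)\<rparr>"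

lemma field_complex_ring: "field complex_ring"
proof -
  have "\<exists>y. x + y = 0" for x :: complex
    using add.right_inverse by blast
  moreover have "x \<noteq> 0 \<Longrightarrow> \<exists>y. x * y = 1" for x :: complex
    by (rule exI[of _ "inverse x"]) simp
  ultimately show ?thesis
    unfolding complex_ring_def
    by unfold_locales (auto simp: algebra_simps Units_def add_eq_0_iff)
qed

locale complex_inner_product_space = module complex_ring H
  for H :: "'h inner_structure" (structure) +
  assumes cinner_add_left:
      "\<lbrakk>x \<in> carrier H; y \<in> carrier H; z \<in> carrier H\<rbrakk>
        \<Longrightarrow> cinner H (x \<oplus>\<^bsub>H\<^esub> y) z = cinner H x z + cinner H y z"
    and cinner_smult_left:
      "\<lbrakk>x \<in> carrier H; y \<in> carrier H\<rbrakk> \<Longrightarrow> cinner H (c \<odot>\<^bsub>H\<^esub> x) y = c * cinner H x y"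
    and cinner_commute:
      "\<lbrakk>x \<in> carrier H; y \<in> carrier H\<rbrakk> \<Longrightarrow> cinner H y x = cnj (cinner H x y)"
    and cinner_self_nonneg: "x \<in> carrier H \<Longrightarrow> 0 \<le> Re (cinner H x x)"
    and cinner_self_eq_zero:
      "\<lbrakk>x \<in> carrier H; cinner H x x = 0\<rbrakk> \<Longrightarrow> x = \<zero>\<^bsub>H\<^esub>"

definition hnorm :: "'h inner_structure \<Rightarrow> 'h \<Rightarrow> real"
  where "hnorm H x = sqrt (Re (cinner H x x))"

text \<open>
  The locale \<^locale>\<open>Metric_space\<close> asks for nonnegativity and symmetry on the whole type, hence the
  case distinction.
\<close>

definition hdist :: "'h inner_structure \<Rightarrow> 'h \<Rightarrow> 'h \<Rightarrow> real"
  where "hdist H x y =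
    (if x \<in> carrier H \<and> y \<in> carrier H then hnorm H (x \<ominus>\<^bsub>H\<^esub> y) else 0)"

locale complex_hilbert_space = complex_inner_product_space +
  assumes complete: "Metric_space.mcomplete (carrier H) (hdist H)"

abbreviation htopology :: "'h inner_structure \<Rightarrow> 'h topology"
  where "htopology H \<equiv> Metric_space.mtopology (carrier H) (hdist H)"

context complex_inner_product_space
begin

lemma carrier_complex_ring: "c \<in> carrier complex_ring"
  by (simp add: complex_ring_def)

lemma smult_in_carrier: "x \<in> carrier H \<Longrightarrow> c \<odot>\<^bsub>H\<^esub> x \<in> carrier H"
  by (simp add: carrier_complex_ring)

lemma smult_minus_one: "x \<in> carrier H \<Longrightarrow> (- 1) \<odot>\<^bsub>H\<^esub> x = \<ominus>\<^bsub>H\<^esub> x"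
proof -
  assume x: "x \<in> carrier H"
  have "(-1) \<odot>\<^bsub>H\<^esub> x \<oplus>\<^bsub>H\<^esub> x = ((-1) \<oplus>\<^bsub>complex_ring\<^esub> \<one>\<^bsub>complex_ring\<^esub>) \<odot>\<^bsub>H\<^esub> x"
    using x smult_l_distr[OF carrier_complex_ring carrier_complex_ring x] by simp
  also have "(-1) \<oplus>\<^bsub>complex_ring\<^esub> \<one>\<^bsub>complex_ring\<^esub> = \<zero>\<^bsub>complex_ring\<^esub>"
    by (simp add: complex_ring_def)
  finally have "(-1) \<odot>\<^bsub>H\<^esub> x \<oplus>\<^bsub>H\<^esub> x = \<zero>\<^bsub>H\<^esub>" using x by simp
  then show ?thesis using x M.minus_equality smult_in_carrier by metis
qed

lemma cinner_add_right:
  "\<lbrakk>x \<in> carrier H; y \<in> carrier H; z \<in> carrier H\<rbrakk>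
    \<Longrightarrow> cinner H z (x \<oplus>\<^bsub>H\<^esub> y) = cinner H z x + cinner H z y"
  by (metis cinner_add_left cinner_commute complex_cnj_add M.a_closed)

lemma cinner_smult_right:
  "\<lbrakk>x \<in> carrier H; y \<in> carrier H\<rbrakk> \<Longrightarrow> cinner H x (c \<odot>\<^bsub>H\<^esub> y) = cnj c * cinner H x y"
  by (metis cinner_smult_left cinner_commute complex_cnj_mult smult_in_carrier)

lemma cinner_self: "x \<in> carrier H \<Longrightarrow> cinner H x x = complex_of_real ((hnorm H x)\<^sup>2)"
  using cinner_commute[of x x] cinner_self_nonneg[of x]
  by (simp add: hnorm_def complex_eq_iff)

lemma hnorm_nonneg: "x \<in> carrier H \<Longrightarrow> 0 \<le> hnorm H x"
  by (simp add: hnorm_def cinner_self_nonneg)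

lemma cauchy_schwarz:
  assumes x: "x \<in> carrier H" and y: "y \<in> carrier H"
  shows "cmod (cinner H x y) \<le> hnorm H x * hnorm H y"
proof (cases "hnorm H y = 0")
  case True
  then have "y = \<zero>\<^bsub>H\<^esub>" using cinner_self[OF y] cinner_self_eq_zero[OF y] by simp
  then have "cinner H x y = cinner H x (0 \<odot>\<^bsub>H\<^esub> y)"
    using y smult_l_null[OF y] by (simp add: complex_ring_def)
  then show ?thesis using cinner_smult_right[OF x y, of 0] True by simp
next
  case False
  then have pos: "hnorm H y > 0" using hnorm_nonneg[OF y] by simp
  define n where "n = (hnorm H y)\<^sup>2"
  define p where "p = cinner H x y"
  define c where "c = - p / complex_of_real n"
  have n: "n > 0" using pos by (simp add: n_def)
  have cy: "c \<odot>\<^bsub>H\<^esub> y \<in> carrier H" using y smult_in_carrier by simp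
  have "cinner H (x \<oplus>\<^bsub>H\<^esub> c \<odot>\<^bsub>H\<^esub> y) (x \<oplus>\<^bsub>H\<^esub> c \<odot>\<^bsub>H\<^esub> y)
      = cinner H x x + cnj c * p + c * cnj p + c * cnj c * cinner H y y"
    using x y cy cinner_commute[OF x y]
    by (simp add: cinner_add_left cinner_add_right cinner_smult_left cinner_smult_right p_def
        algebra_simps)
  also have "\<dots> = complex_of_real ((hnorm H x)\<^sup>2) - p * cnj p / complex_of_real n"
    using n by (simp add: cinner_self[OF x] cinner_self[OF y] c_def flip: n_def)
  also have "p * cnj p = complex_of_real ((cmod p)\<^sup>2)"
    by (rule complex_norm_square[symmetric])
  finally have "cinner H (x \<oplus>\<^bsub>H\<^esub> c \<odot>\<^bsub>H\<^esub> y) (x \<oplus>\<^bsub>H\<^esub> c \<odot>\<^bsub>H\<^esub> y)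
      = complex_of_real ((hnorm H x)\<^sup>2 - (cmod p)\<^sup>2 / n)"
    by simp
  then have "0 \<le> (hnorm H x)\<^sup>2 - (cmod p)\<^sup>2 / n"
    using cinner_self_nonneg[of "x \<oplus>\<^bsub>H\<^esub> c \<odot>\<^bsub>H\<^esub> y"] x cy by simp
  then have "(cmod p)\<^sup>2 \<le> (hnorm H x * hnorm H y)\<^sup>2"
    using n by (simp add: field_simps n_def)
  then show ?thesis
    unfolding p_def by (rule power2_le_imp_le) (simp add: hnorm_nonneg x y)
qed

lemma hnorm_triangle:
  assumes x: "x \<in> carrier H" and y: "y \<in> carrier H"
  shows "hnorm H (x \<oplus>\<^bsub>H\<^esub> y) \<le> hnorm H x + hnorm H y"
proof -
  have "complex_of_real ((hnorm H (x \<oplus>\<^bsub>H\<^esub> y))\<^sup>2)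
      = cinner H x x + cinner H x y + cnj (cinner H x y) + cinner H y y"
    using x y cinner_self[of "x \<oplus>\<^bsub>H\<^esub> y"] cinner_commute[OF x y]
    by (simp add: cinner_add_left cinner_add_right Groups.ac_simps)
  then have "(hnorm H (x \<oplus>\<^bsub>H\<^esub> y))\<^sup>2 = (hnorm H x)\<^sup>2 + 2 * Re (cinner H x y) + (hnorm H y)\<^sup>2"
    using cinner_self[OF x] cinner_self[OF y] by (simp add: complex_eq_iff)
  also have "Re (cinner H x y) \<le> hnorm H x * hnorm H y"
    by (rule order_trans[OF complex_Re_le_cmod cauchy_schwarz[OF x y]])
  finally have "(hnorm H (x \<oplus>\<^bsub>H\<^esub> y))\<^sup>2 \<le> (hnorm H x + hnorm H y)\<^sup>2"
    by (simp add: power2_sum)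
  then show ?thesis by (rule power2_le_imp_le) (simp add: hnorm_nonneg x y)
qed

lemma hnorm_minus: "x \<in> carrier H \<Longrightarrow> hnorm H (\<ominus>\<^bsub>H\<^esub> x) = hnorm H x"
  by (simp add: hnorm_def cinner_smult_left cinner_smult_right smult_in_carrier
      flip: smult_minus_one)

lemma hnorm_eq_zero: "x \<in> carrier H \<Longrightarrow> hnorm H x = 0 \<longleftrightarrow> x = \<zero>\<^bsub>H\<^esub>"
  using cinner_self[of x] cinner_self_eq_zero[of x] cinner_smult_left[of x x 0]
    smult_l_null[of x] by (auto simp: complex_ring_def)

lemma Metric_space_hdist: "Metric_space (carrier H) (hdist H)"
proof
  show "0 \<le> hdist H x y" for x y
    by (simp add: hdist_def hnorm_nonneg)
  show "hdist H x y = hdist H y x" for x y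
  proof (cases "x \<in> carrier H \<and> y \<in> carrier H")
    case True
    then have "\<ominus>\<^bsub>H\<^esub> (x \<ominus>\<^bsub>H\<^esub> y) = y \<ominus>\<^bsub>H\<^esub> x"
      by (simp add: a_minus_def M.minus_add M.a_comm)
    then show ?thesis using True hnorm_minus[of "x \<ominus>\<^bsub>H\<^esub> y"] by (simp add: hdist_def)
  qed (auto simp: hdist_def)
  show "hdist H x y = 0 \<longleftrightarrow> x = y" if "x \<in> carrier H" "y \<in> carrier H" for x y
    using that M.minus_equality[of x "\<ominus>\<^bsub>H\<^esub> y"]
    by (auto simp: hdist_def hnorm_eq_zero a_minus_def M.r_neg)
  show "hdist H x z \<le> hdist H x y + hdist H y z"
    if "x \<in> carrier H" "y \<in> carrier H" "z \<in> carrier H" for x y z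
  proof -
    have "x \<ominus>\<^bsub>H\<^esub> z = (x \<ominus>\<^bsub>H\<^esub> y) \<oplus>\<^bsub>H\<^esub> (y \<ominus>\<^bsub>H\<^esub> z)"
    proof -
      have "(x \<ominus>\<^bsub>H\<^esub> y) \<oplus>\<^bsub>H\<^esub> (y \<ominus>\<^bsub>H\<^esub> z)
          = x \<oplus>\<^bsub>H\<^esub> ((\<ominus>\<^bsub>H\<^esub> y \<oplus>\<^bsub>H\<^esub> y) \<oplus>\<^bsub>H\<^esub> \<ominus>\<^bsub>H\<^esub> z)"
        using that by (simp only: a_minus_def M.a_assoc M.a_closed M.a_inv_closed)
      then show ?thesis using that by (simp add: M.l_neg a_minus_def)
    qed
    then show ?thesis
      using that hnorm_triangle[of "x \<ominus>\<^bsub>H\<^esub> y" "y \<ominus>\<^bsub>H\<^esub> z"] by (simp add: hdist_def)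
  qed
qed

end


section \<open>Bounded operators and representations\<close>

text \<open>
  An operator on \<open>H\<close> is a function on the ambient type of which only the values on the carrier
  matter; in particular, two operators are identified when they agree on the carrier.
\<close>

definition bounded_operators :: "'h inner_structure \<Rightarrow> ('h \<Rightarrow> 'h) set"
  where "bounded_operators H = {T.
    T \<in> carrier H \<rightarrow> carrier H \<and>
    (\<forall>x\<in>carrier H. \<forall>y\<in>carrier H. T (x \<oplus>\<^bsub>H\<^esub> y) = T x \<oplus>\<^bsub>H\<^esub> T y) \<and>
    (\<forall>c. \<forall>x\<in>carrier H. T (c \<odot>\<^bsub>H\<^esub> x) = c \<odot>\<^bsub>H\<^esub> T x) \<and>
    (\<exists>K. \<forall>x\<in>carrier H. hnorm H (T x) \<le> K * hnorm H x)}"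

definition operator_norm :: "'h inner_structure \<Rightarrow> ('h \<Rightarrow> 'h) \<Rightarrow> real"
  where "operator_norm H T = (SUP x\<in>{x\<in>carrier H. hnorm H x \<le> 1}. hnorm H (T x))"

definition representation ::
  "'h inner_structure \<Rightarrow> ('a::cstar_algebra \<Rightarrow> 'h \<Rightarrow> 'h) \<Rightarrow> bool"
  where "representation H \<theta> \<longleftrightarrow>
    (\<forall>a. \<theta> a \<in> bounded_operators H) \<and>
    (\<forall>a b. \<forall>x\<in>carrier H. \<theta> (a + b) x = \<theta> a x \<oplus>\<^bsub>H\<^esub> \<theta> b x) \<and>
    (\<forall>c a. \<forall>x\<in>carrier H. \<theta> (c *\<^sub>C a) x = c \<odot>\<^bsub>H\<^esub> \<theta> a x) \<and>
    (\<forall>a b. \<forall>x\<in>carrier H. \<theta> (a * b) x = \<theta> a (\<theta> b x)) \<and>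
    (\<forall>a. ((\<lambda>b. operator_norm H (\<lambda>x. \<theta> b x \<ominus>\<^bsub>H\<^esub> \<theta> a x)) \<longlongrightarrow> 0) (at a))"

definition star_representation ::
  "'h inner_structure \<Rightarrow> ('a::cstar_algebra \<Rightarrow> 'h \<Rightarrow> 'h) \<Rightarrow> bool"
  where "star_representation H \<theta> \<longleftrightarrow> representation H \<theta> \<and>
    (\<forall>a. \<forall>x\<in>carrier H. \<forall>y\<in>carrier H. cinner H (\<theta> (star a) x) y = cinner H x (\<theta> a y))"

definition closed_invariant_subspace ::
  "'h inner_structure \<Rightarrow> ('a::cstar_algebra \<Rightarrow> 'h \<Rightarrow> 'h) \<Rightarrow> 'h set \<Rightarrow> bool"
  where "closed_invariant_subspace H \<theta> V \<longleftrightarrow>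
    submodule V complex_ring H \<and> closedin (htopology H) V \<and> (\<forall>a. \<theta> a ` V \<subseteq> V)"


section \<open>The similarity and total reduction properties\<close>

text \<open>
  Both are properties of a type \<open>'a\<close> of class \<^class>\<open>cstar_algebra\<close>. The second type argument is the
  universe: the Hilbert spaces quantified over are all those whose carrier is a subset of \<open>'h\<close>.
\<close>

definition similarity_property :: "'a::cstar_algebra itself \<Rightarrow> 'h itself \<Rightarrow> bool"
  where "similarity_property A U \<longleftrightarrow>
    (\<forall>(H :: 'h inner_structure) (\<theta> :: 'a \<Rightarrow> 'h \<Rightarrow> 'h).
      complex_hilbert_space H \<longrightarrow> representation H \<theta> \<longrightarrow>
      (\<exists>S\<in>bounded_operators H. \<exists>S'\<in>bounded_operators H.
        (\<forall>x\<in>carrier H. S' (S x) = x \<and> S (S' x) = x) \<and>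
        star_representation H (\<lambda>a x. S (\<theta> a (S' x)))))"

definition total_reduction_property :: "'a::cstar_algebra itself \<Rightarrow> 'h itself \<Rightarrow> bool"
  where "total_reduction_property A U \<longleftrightarrow>
    (\<forall>(H :: 'h inner_structure) (\<theta> :: 'a \<Rightarrow> 'h \<Rightarrow> 'h) V.
      complex_hilbert_space H \<longrightarrow> representation H \<theta> \<longrightarrow> closed_invariant_subspace H \<theta> V \<longrightarrow>
      (\<exists>W. closed_invariant_subspace H \<theta> W \<and>
        V <+>\<^bsub>H\<^esub> W = carrier H \<and> V \<inter> W = {\<zero>\<^bsub>H\<^esub>}))"

end

theory Submission
  imports Defs "HOL-Library.Function_Algebras" "HOL-Computational_Algebra.Polynomial"
begin

text \<open>
  A representation \<open>\<theta>\<close> on \<open>H\<close> is similar to a \<open>*\<close>-representation iff there is an inner product,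
  equivalent to that of \<open>H\<close>, for which \<open>\<theta> (star a)\<close> is adjoint to \<open>\<theta> a\<close>; the similarity is the square
  root of the positive operator relating the two inner products. Given such an inner product, the
  orthogonal complement of an invariant subspace is invariant.

  Conversely, let \<open>A\<close> have the total reduction property. The wanted inner product is a form
  \<open>p\<close>, invariant under the unitaries of the unitization, with \<open>e \<le> p \<le> C e\<close>, where \<open>e\<close> is the
  squared norm of \<open>H\<close>. Each vector functional is dominated by an invariant form bounded by a multiple of \<open>e\<close>;
  hence on finitely many vectors such a \<open>p\<close> exists, but with no control on \<open>C\<close>. To bound \<open>C\<close>, note that a form \<open>\<psi>\<close> with
  \<open>\<bar>\<psi> (u x) - \<psi> x\<bar> \<le> p x\<close> for all unitaries \<open>u\<close> defines a derivation, hence an extension of the completion of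
  \<open>p\<close> by itself. A complement of the subrepresentation splits this extension and yields an invariant form \<open>\<Xi>\<close> with
  \<open>\<bar>\<psi> - \<Xi>\<bar> \<le> \<tau> p\<close>. The constant \<open>\<tau>\<close> is uniform because countably many such extensions can be added up to one representation.
  Applied to a logarithm of \<open>p\<close> relative to \<open>e\<close>, this lowers the upper bound of \<open>p\<close> until it is a constant that
  depends on \<open>\<tau>\<close> only, and a compactness argument passes from finitely many vectors to all of \<open>H\<close>.

  The direct sums needed here live on the type \<open>'h\<close> again, since sequences in a
  Hilbert space \<open>H\<close> can be coded by vectors of \<open>H\<close>.
\<close>


text \<open>Hermitian forms on one total vector space replace operators: several inner products
  coexist on the same vectors, inequalities between them are inequalities of real functions, and
  pointwise limits exist by Tychonoff. A completion becomes a space of bounded antilinear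
  functionals, so null vectors are never divided out. Testing invariance on unitaries is enough,
  since four of them combine to any given element of a unital C*-algebra.

  No spectrum or functional calculus is used. That \<open>z\<close> is positive is expressed as
  \<open>norm (t - z) \<le> t\<close> or as \<open>z\<close> being a square, and roots come from an
  explicit iteration.

  The obstacle behind the logarithm is that a unitary distorts \<open>e\<close> by a factor up to
  \<open>M\<close>, while a coboundary may only be measured against \<open>p\<close>. A quantity of
  the shape \<open>p\<close> times a logarithm of \<open>p / e\<close> reacts to a rescaling of
  \<open>e\<close> by a bounded multiple of \<open>p\<close>, whatever the ratio of \<open>p\<close>
  to \<open>e\<close>. The bound obtained from it therefore does not feed on the constant that it is
  meant to control.\<close>

class cvec = ab_group_add +
  fixes csc :: "complex \<Rightarrow> 'a \<Rightarrow> 'a" (infixr \<open>*\<^sub>V\<close> 75)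
  assumes csc_add_right: "c *\<^sub>V (x + y) = c *\<^sub>V x + c *\<^sub>V y"
    and csc_add_left: "(c + d) *\<^sub>V x = c *\<^sub>V x + d *\<^sub>V x"
    and csc_csc [simp]: "c *\<^sub>V d *\<^sub>V x = (c * d) *\<^sub>V x"
    and csc_one [simp]: "1 *\<^sub>V x = x"
begin

lemma csc_zero_right [simp]: "c *\<^sub>V 0 = 0"
  using csc_add_right[of c 0 0] by simp

lemma csc_zero_left [simp]: "0 *\<^sub>V x = 0"
  using csc_add_left[of 0 0 x] by simp

lemma csc_minus_right [simp]: "c *\<^sub>V (- x) = - (c *\<^sub>V x)"
  using csc_add_right[of c x "- x"] by (simp add: eq_neg_iff_add_eq_0 add.commute)

lemma csc_minus_left [simp]: "(- c) *\<^sub>V x = - (c *\<^sub>V x)"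
  using csc_add_left[of c "- c" x] by (simp add: eq_neg_iff_add_eq_0 add.commute)

lemma csc_diff_right: "c *\<^sub>V (x - y) = c *\<^sub>V x - c *\<^sub>V y"
  using csc_add_right[of c x "- y"] by simp

lemma csc_diff_left: "(c - d) *\<^sub>V x = c *\<^sub>V x - d *\<^sub>V x"
  using csc_add_left[of c "- d" x] by simp

lemma csc_two: "2 *\<^sub>V x = x + x"
  using csc_add_left[of 1 1 x] by simp

end

instantiation complex :: cvec
begin
definition "csc_complex = ((*) :: complex \<Rightarrow> complex \<Rightarrow> complex)"
instance by standard (simp_all add: csc_complex_def algebra_simps)
end

instantiation "fun" :: (type, cvec) cvec
begin
definition "csc_fun c f = (\<lambda>x. c *\<^sub>V f x)"
instance by standard (simp_all add: csc_fun_def fun_eq_iff csc_add_right csc_add_left)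
end

instantiation prod :: (cvec, cvec) cvec
begin
definition "csc_prod c z = (c *\<^sub>V fst z, c *\<^sub>V snd z)"
instance by standard (simp_all add: csc_prod_def csc_add_right csc_add_left)
end

section \<open>Subspaces and Hermitian forms on them\<close>

definition csub :: "'v::cvec set \<Rightarrow> bool"
  where "csub S \<longleftrightarrow> 0 \<in> S \<and> (\<forall>x\<in>S. \<forall>y\<in>S. x + y \<in> S) \<and> (\<forall>c. \<forall>x\<in>S. c *\<^sub>V x \<in> S)"

lemma csub_UNIV [simp]: "csub UNIV"
  by (simp add: csub_def)

lemma csub_zero: "csub S \<Longrightarrow> 0 \<in> S"
  and csub_add: "csub S \<Longrightarrow> x \<in> S \<Longrightarrow> y \<in> S \<Longrightarrow> x + y \<in> S"
  and csub_csc: "csub S \<Longrightarrow> x \<in> S \<Longrightarrow> c *\<^sub>V x \<in> S"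
  by (auto simp: csub_def)

lemma csub_minus: "csub S \<Longrightarrow> x \<in> S \<Longrightarrow> - x \<in> S"
  using csub_csc[of S x "-1"] by simp

lemma csub_diff: "csub S \<Longrightarrow> x \<in> S \<Longrightarrow> y \<in> S \<Longrightarrow> x - y \<in> S"
  using csub_add[of S x "- y"] csub_minus[of S y] by simp

lemma csub_sum: "csub S \<Longrightarrow> (\<And>i. i \<in> I \<Longrightarrow> f i \<in> S) \<Longrightarrow> (\<Sum>i\<in>I. f i) \<in> S"
  by (induction I rule: infinite_finite_induct) (auto simp: csub_zero csub_add)

text \<open>Nothing is required off \<open>S\<close>. Like \<open>cinner\<close>, the form is linear
  in its first argument. Positivity is kept apart because differences such as coboundaries must be
  forms as well.\<close>

definition hform_on :: "'v::cvec set \<Rightarrow> ('v \<Rightarrow> 'v \<Rightarrow> complex) \<Rightarrow> bool"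
  where "hform_on S B \<longleftrightarrow> csub S \<and>
    (\<forall>x\<in>S. \<forall>y\<in>S. \<forall>z\<in>S. B (x + y) z = B x z + B y z) \<and>
    (\<forall>c. \<forall>x\<in>S. \<forall>y\<in>S. B (c *\<^sub>V x) y = c * B x y) \<and>
    (\<forall>x\<in>S. \<forall>y\<in>S. B y x = cnj (B x y))"

definition pform_on :: "'v::cvec set \<Rightarrow> ('v \<Rightarrow> 'v \<Rightarrow> complex) \<Rightarrow> bool"
  where "pform_on S B \<longleftrightarrow> hform_on S B \<and> (\<forall>x\<in>S. 0 \<le> Re (B x x))"

abbreviation "hform \<equiv> hform_on UNIV"
abbreviation "pform \<equiv> pform_on UNIV"

abbreviation qf :: "('v \<Rightarrow> 'v \<Rightarrow> complex) \<Rightarrow> 'v \<Rightarrow> real"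
  where "qf B x \<equiv> Re (B x x)"

lemma pform_onD: "pform_on S B \<Longrightarrow> hform_on S B" "pform_on S B \<Longrightarrow> x \<in> S \<Longrightarrow> 0 \<le> qf B x"
  unfolding pform_on_def by blast+

context
  fixes S :: "'v::cvec set" and B
  assumes B: "hform_on S B"
begin

lemma hf_csub: "csub S"
  using B unfolding hform_on_def by blast

lemma hf_addl: "x \<in> S \<Longrightarrow> y \<in> S \<Longrightarrow> z \<in> S \<Longrightarrow> B (x + y) z = B x z + B y z"
  and hf_cscl: "x \<in> S \<Longrightarrow> y \<in> S \<Longrightarrow> B (c *\<^sub>V x) y = c * B x y"
  and hf_sym: "x \<in> S \<Longrightarrow> y \<in> S \<Longrightarrow> B y x = cnj (B x y)"
  using B unfolding hform_on_def by blast+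

lemma hf_addr: "x \<in> S \<Longrightarrow> y \<in> S \<Longrightarrow> z \<in> S \<Longrightarrow> B z (x + y) = B z x + B z y"
  using hf_addl[of x y z] hf_sym[of "x + y" z] hf_sym[of x z] hf_sym[of y z] csub_add[OF hf_csub, of x y]
  by simp

lemma hf_cscr: "x \<in> S \<Longrightarrow> y \<in> S \<Longrightarrow> B y (c *\<^sub>V x) = cnj c * B y x"
  using hf_cscl[of x y c] hf_sym[of "c *\<^sub>V x" y] hf_sym[of x y] csub_csc[OF hf_csub, of x c]
  by simp

lemma hf_minusl: "x \<in> S \<Longrightarrow> y \<in> S \<Longrightarrow> B (- x) y = - B x y"
  using hf_cscl[of x y "-1"] by simp

lemma hf_minusr: "x \<in> S \<Longrightarrow> y \<in> S \<Longrightarrow> B y (- x) = - B y x"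
  using hf_cscr[of x y "-1"] by simp

lemma hf_diffl: "x \<in> S \<Longrightarrow> y \<in> S \<Longrightarrow> z \<in> S \<Longrightarrow> B (x - y) z = B x z - B y z"
  using hf_addl[of x "- y" z] hf_minusl[of y z] csub_minus[OF hf_csub, of y] by simp

lemma hf_diffr: "x \<in> S \<Longrightarrow> y \<in> S \<Longrightarrow> z \<in> S \<Longrightarrow> B z (x - y) = B z x - B z y"
  using hf_addr[of x "- y" z] hf_minusr[of y z] csub_minus[OF hf_csub, of y] by simp

lemma hf_zerol: "x \<in> S \<Longrightarrow> B 0 x = 0"
  using hf_cscl[of x x 0] by simp

lemma hf_zeror: "x \<in> S \<Longrightarrow> B x 0 = 0"
  using hf_cscr[of x x 0] by simp

lemma hf_real: "x \<in> S \<Longrightarrow> B x x = of_real (qf B x)"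
  using hf_sym[of x x] by (simp add: complex_eq_iff)

lemma hf_Re_sym: "x \<in> S \<Longrightarrow> y \<in> S \<Longrightarrow> Re (B y x) = Re (B x y)"
  using hf_sym[of x y] by simp

lemma qf_csc: "x \<in> S \<Longrightarrow> qf B (c *\<^sub>V x) = (cmod c)\<^sup>2 * qf B x"
proof -
  assume x: "x \<in> S"
  have "B (c *\<^sub>V x) (c *\<^sub>V x) = (c * cnj c) * B x x"
    using x csub_csc[OF hf_csub x] by (simp add: hf_cscl hf_cscr)
  moreover have "B x x = of_real (qf B x)" by (rule hf_real[OF x])
  moreover have "c * cnj c = of_real ((cmod c)\<^sup>2)" by (rule complex_norm_square[symmetric])
  ultimately have "B (c *\<^sub>V x) (c *\<^sub>V x) = of_real ((cmod c)\<^sup>2 * qf B x)" by (metis of_real_mult)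
  then show ?thesis
    by simp
qed

lemma qf_add: "x \<in> S \<Longrightarrow> y \<in> S \<Longrightarrow> qf B (x + y) = qf B x + 2 * Re (B x y) + qf B y"
  using csub_add[OF hf_csub, of x y] hf_Re_sym[of x y] by (simp add: hf_addl hf_addr)

lemma qf_diff: "x \<in> S \<Longrightarrow> y \<in> S \<Longrightarrow> qf B (x - y) = qf B x - 2 * Re (B x y) + qf B y"
  using csub_diff[OF hf_csub, of x y] hf_Re_sym[of x y] by (simp add: hf_diffl hf_diffr)

lemma qf_minus: "x \<in> S \<Longrightarrow> qf B (- x) = qf B x"
  using qf_csc[of x "-1"] by simp

lemma qf_zero: "qf B 0 = 0"
  using hf_zerol csub_zero[OF hf_csub] by simp

lemma qf_parallelogram: "x \<in> S \<Longrightarrow> y \<in> S \<Longrightarrow> qf B (x + y) + qf B (x - y) = 2 * qf B x + 2 * qf B y"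
  by (simp add: qf_add qf_diff)

end

lemma pf_cauchy_schwarz:
  assumes B: "pform_on S B" and x: "x \<in> S" and y: "y \<in> S"
  shows "(cmod (B x y))\<^sup>2 \<le> qf B x * qf B y"
proof -
  note h = pform_onD(1)[OF B] note s = hf_csub[OF h]
  define c where "c = B x y"
  \<comment> \<open>Positivity at \<open>x - t c y\<close> with \<open>c = B x y\<close>: this
    choice makes the cross term real for every real \<open>t\<close>. The case
    \<open>qf B y = 0\<close> follows by letting \<open>t\<close> be large, the other one from
    \<open>t = 1 / qf B y\<close>.\<close>
  have q: "0 \<le> qf B x - 2 * t * (cmod c)\<^sup>2 + t\<^sup>2 * (cmod c)\<^sup>2 * qf B y" for t :: real
  proof -
    have "0 \<le> qf B (x - (of_real t * c) *\<^sub>V y)"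
      by (rule pform_onD(2)[OF B]) (intro csub_diff csub_csc s x y)
    also have "\<dots> = qf B x - 2 * Re (cnj (of_real t * c) * c) + (cmod (of_real t * c))\<^sup>2 * qf B y"
      unfolding qf_diff[OF h x csub_csc[OF s y]] qf_csc[OF h y] hf_cscr[OF h y x] c_def ..
    also have "Re (cnj (of_real t * c) * c) = t * (cmod c)\<^sup>2"
      unfolding cmod_power2 by (simp add: algebra_simps power2_eq_square)
    also have "(cmod (of_real t * c))\<^sup>2 = t\<^sup>2 * (cmod c)\<^sup>2"
      by (simp add: norm_mult power_mult_distrib)
    finally show ?thesis by (simp add: mult.assoc)
  qed
  have y0: "0 \<le> qf B y" and x0: "0 \<le> qf B x" using pform_onD(2)[OF B] x y by auto
  show ?thesis
  proof (cases "qf B y = 0")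
    case True
    have "c = 0"
    proof (rule ccontr)
      assume "c \<noteq> 0"
      then have "(qf B x + 1) / (cmod c)\<^sup>2 * (cmod c)\<^sup>2 = qf B x + 1" by simp
      then have "0 \<le> qf B x - 2 * (qf B x + 1)"
        using q[of "(qf B x + 1) / (cmod c)\<^sup>2"] True \<open>c \<noteq> 0\<close> by (simp add: mult.assoc)
      then show False using x0 by simp
    qed
    then show ?thesis using x0 y0 by (simp add: c_def)
  next
    case False
    then have y1: "qf B y > 0" using y0 by simp
    from q[of "1 / qf B y"] have "0 \<le> qf B x - (cmod c)\<^sup>2 / qf B y"
      using y1 by (simp add: power2_eq_square field_simps)
    then show ?thesis using y1 by (simp add: c_def field_simps)
  qed
qed

lemma pf_cauchy_schwarz_sqrt:
  assumes "pform_on S B" "x \<in> S" "y \<in> S"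
  shows "cmod (B x y) \<le> sqrt (qf B x) * sqrt (qf B y)"
  using pf_cauchy_schwarz[OF assms] by (metis real_le_rsqrt real_sqrt_mult)

lemma pf_triangle:
  assumes B: "pform_on S B" and x: "x \<in> S" and y: "y \<in> S"
  shows "sqrt (qf B (x + y)) \<le> sqrt (qf B x) + sqrt (qf B y)"
proof (rule real_le_lsqrt)
  have x0: "0 \<le> qf B x" and y0: "0 \<le> qf B y" using pform_onD(2)[OF B] x y by auto
  then show "0 \<le> sqrt (qf B x) + sqrt (qf B y)" by simp
  have "Re (B x y) \<le> sqrt (qf B x) * sqrt (qf B y)"
    using complex_Re_le_cmod pf_cauchy_schwarz_sqrt[OF assms] by (rule order_trans)
  then show "qf B (x + y) \<le> (sqrt (qf B x) + sqrt (qf B y))\<^sup>2"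
    using x0 y0 by (simp add: qf_add[OF pform_onD(1)[OF B] x y] power2_sum)
qed

text \<open>The excess \<open>g t - t g 1\<close> is additive, bounded on \<open>[0,1]\<close> and vanishes at the integers.\<close>
lemma additive_locally_bounded_imp_linear:
  fixes g :: "real \<Rightarrow> real"
  assumes add: "\<And>s t. g (s + t) = g s + g t" and bd: "\<And>t. \<bar>t\<bar> \<le> 1 \<Longrightarrow> \<bar>g t\<bar> \<le> K"
  shows "g t = t * g 1"
proof -
  define h where "h t = g t - t * g 1" for t
  have hadd: "h (s + t) = h s + h t" for s t by (simp add: h_def add algebra_simps)
  have h0: "h 0 = 0" using hadd[of 0 0] by simp
  have hm: "h (- t) = - h t" for t using hadd[of t "- t"] h0 by simp
  have hn: "h (of_nat n * t) = of_nat n * h t" for n t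
    by (induction n) (simp_all add: h0 hadd algebra_simps)
  have h1: "h (of_int m) = 0" for m
  proof (cases m)
    case (nonneg n)
    then show ?thesis using hn[of n 1] by (simp add: h_def)
  next
    case (neg n)
    then show ?thesis using hn[of "Suc n" 1] hm[of "of_nat (Suc n)"] by (simp add: h_def)
  qed
  have hb: "\<bar>h t\<bar> \<le> K + \<bar>g 1\<bar>" for t
  proof -
    have "h t = h (frac t)" using hadd[of "frac t" "of_int \<lfloor>t\<rfloor>"] h1 by (simp add: frac_def)
    moreover have "\<bar>frac t\<bar> \<le> 1" using frac_lt_1[of t] frac_ge_0[of t] by simp
    moreover from this have "\<bar>frac t * g 1\<bar> \<le> \<bar>g 1\<bar>"
      using mult_right_mono[of "\<bar>frac t\<bar>" 1 "\<bar>g 1\<bar>"] by (simp add: abs_mult)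
    ultimately show ?thesis using bd[of "frac t"] by (simp add: h_def)
  qed
  have "h t = 0"
  proof (rule ccontr)
    assume "h t \<noteq> 0"
    then obtain n where "of_nat n * \<bar>h t\<bar> > K + \<bar>g 1\<bar>"
      using reals_Archimedean3[of "\<bar>h t\<bar>"] by auto
    then show False using hb[of "of_nat n * t"] by (simp add: hn abs_mult)
  qed
  then show ?thesis by (simp add: h_def)
qed

text \<open>\<open>N\<close> plays the role of a squared norm. The parallelogram law makes its
  polarization \<open>R\<close> additive; as no continuity is assumed, real homogeneity comes from
  the bound on \<open>R\<close> over \<open>\<bar>t\<bar> \<le> 1\<close>. The theorem turns
  quantities defined by a supremum or an infimum, dual norms and infimal convolutions, into inner
  products.\<close>

theorem jordan_von_neumann:
  fixes S :: "'v::cvec set"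
  assumes S: "csub S"
    and nonneg: "\<And>x. x \<in> S \<Longrightarrow> 0 \<le> N x"
    and par: "\<And>x y. x \<in> S \<Longrightarrow> y \<in> S \<Longrightarrow> N (x + y) + N (x - y) = 2 * N x + 2 * N y"
    and hom: "\<And>c x. x \<in> S \<Longrightarrow> N (c *\<^sub>V x) = (cmod c)\<^sup>2 * N x"
  obtains B where "pform_on S B" "\<And>x. x \<in> S \<Longrightarrow> B x x = of_real (N x)"
proof -
  define R where "R x y = (N (x + y) - N (x - y)) / 4" for x y
  note cl = csub_zero[OF S] csub_add[OF S] csub_csc[OF S] csub_diff[OF S] csub_minus[OF S]
  have neg: "N (- x) = N x" if "x \<in> S" for x using hom[OF that, of "-1"] by simp
  have R_sym: "R x y = R y x" if "x \<in> S" "y \<in> S" for x y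
    using neg[of "x - y"] that cl by (simp add: R_def add.commute)
  have R0: "R 0 y = 0" if "y \<in> S" for y using neg[OF that] by (simp add: R_def)
  have Rpm: "R (x + x') y + R (x - x') y = 2 * R x y" if "x \<in> S" "x' \<in> S" "y \<in> S" for x x' y
  proof -
    have e: "x + x' + y = x + y + x'" "x - x' + y = x + y - x'" "x + x' - y = x - y + x'" "x - x' - y = x - y - x'"
      by (simp_all add: algebra_simps)
    show ?thesis
      using par[OF cl(2)[OF that(1,3)] that(2)] par[OF cl(4)[OF that(1,3)] that(2)]
      unfolding R_def e add_divide_distrib[symmetric] by (simp add: diff_divide_distrib)
  qed
  have R2: "R (2 *\<^sub>V x) y = 2 * R x y" if "x \<in> S" "y \<in> S" for x y
    using Rpm[of x x y] that R0[of y] by (simp add: csc_two)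
  have Radd: "R (u + v) y = R u y + R v y" if "u \<in> S" "v \<in> S" "y \<in> S" for u v y
  proof -
    \<comment> \<open>Half sum and half difference: with them \<open>Rpm\<close> reads
      \<open>R u y + R v y = 2 R x y\<close>, and doubling \<open>x\<close> gives back
      \<open>u + v\<close>.\<close>
    define x x' where "x = (1/2) *\<^sub>V (u + v)" and "x' = (1/2) *\<^sub>V (u - v)"
    have h: "(1/2) *\<^sub>V w + (1/2) *\<^sub>V w = w" for w :: 'v
      using csc_two[of "(1/2) *\<^sub>V w"] by simp
    have "x + x' = u" "x - x' = v"
      unfolding x_def x'_def using h[of u] h[of v]
      by (simp_all add: csc_add_right csc_diff_right algebra_simps)
    moreover have "u + v = 2 *\<^sub>V x" by (simp add: x_def)
    moreover have "x \<in> S" "x' \<in> S" using that by (auto simp: x_def x'_def intro!: cl)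
    ultimately show ?thesis using Rpm[of x x' y] R2[of x y] that by simp
  qed
  have Rreal: "R (of_real t *\<^sub>V x) y = t * R x y" if xy: "x \<in> S" "y \<in> S" for x y t
  proof -
    have "R (of_real t *\<^sub>V x) y = t * R (of_real 1 *\<^sub>V x) y"
    proof (rule additive_locally_bounded_imp_linear[where K = "N x + N y"])
      fix s t show "R (of_real (s + t) *\<^sub>V x) y = R (of_real s *\<^sub>V x) y + R (of_real t *\<^sub>V x) y"
        using Radd[of "of_real s *\<^sub>V x" "of_real t *\<^sub>V x" y] xy cl by (simp add: csc_add_left)
    next
      fix t :: real assume t: "\<bar>t\<bar> \<le> 1"
      let ?x = "of_real t *\<^sub>V x"
      have x: "?x \<in> S" using xy cl by simp
      have "\<bar>R ?x y\<bar> \<le> (N (?x + y) + N (?x - y)) / 4"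
        using nonneg[of "?x + y"] nonneg[of "?x - y"] x xy cl by (simp add: R_def)
      also have "\<dots> = (N ?x + N y) / 2" using par[OF x xy(2)] by simp
      also have "N ?x = t\<^sup>2 * N x" using hom[OF xy(1), of "of_real t"] by simp
      also have "t\<^sup>2 * N x \<le> N x"
        using t nonneg[OF xy(1)] mult_right_mono[of "t\<^sup>2" 1 "N x"] by (simp add: abs_square_le_1)
      finally show "\<bar>R ?x y\<bar> \<le> N x + N y" using nonneg[OF xy(1)] nonneg[OF xy(2)] by simp
    qed
    then show ?thesis by simp
  qed
  have Rii: "R (\<i> *\<^sub>V x) (\<i> *\<^sub>V y) = R x y" if "x \<in> S" "y \<in> S" for x y
    using hom[of "x + y" \<i>] hom[of "x - y" \<i>] that cl by (simp add: R_def csc_add_right csc_diff_right)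
  have Rneg: "R (- x) y = - R x y" if "x \<in> S" "y \<in> S" for x y
    using Rreal[OF that, of "-1"] by simp
  have Ri: "R x (\<i> *\<^sub>V y) = - R (\<i> *\<^sub>V x) y" if "x \<in> S" "y \<in> S" for x y
  proof -
    have "R x (\<i> *\<^sub>V y) = R (\<i> *\<^sub>V x) (\<i> *\<^sub>V \<i> *\<^sub>V y)" using Rii[of x "\<i> *\<^sub>V y"] that cl by simp
    also have "\<i> *\<^sub>V \<i> *\<^sub>V y = - y" by simp
    also have "R (\<i> *\<^sub>V x) (- y) = - R (\<i> *\<^sub>V x) y"
      using Rneg[of y "\<i> *\<^sub>V x"] R_sym[of "\<i> *\<^sub>V x"] that cl by simp
    finally show ?thesis .
  qed
  \<comment> \<open>For a form that is antilinear in the second argument, the imaginary part at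
    \<open>(x, y)\<close> is the real part at \<open>(x, i y)\<close>.\<close>
  define B where "B x y = Complex (R x y) (R x (\<i> *\<^sub>V y))" for x y
  have Badd: "B (x + y) z = B x z + B y z" if "x \<in> S" "y \<in> S" "z \<in> S" for x y z
    using that cl by (simp add: B_def Radd complex_eq_iff)
  have Bi: "B (\<i> *\<^sub>V x) y = \<i> * B x y" if "x \<in> S" "y \<in> S" for x y
    using that cl Ri[of x y] Rii[of x y] by (simp add: B_def complex_eq_iff)
  have Breal: "B (of_real t *\<^sub>V x) y = of_real t * B x y" if "x \<in> S" "y \<in> S" for x y t
    using that cl by (simp add: B_def Rreal complex_eq_iff)
  have Bc: "B (c *\<^sub>V x) y = c * B x y" if xy: "x \<in> S" "y \<in> S" for c x y
  proof -
    have "c *\<^sub>V x = of_real (Re c) *\<^sub>V x + of_real (Im c) *\<^sub>V \<i> *\<^sub>V x"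
      by (simp add: csc_add_left[symmetric] complex_eq_iff) (metis complex_eq mult.commute)
    then have "B (c *\<^sub>V x) y = of_real (Re c) * B x y + of_real (Im c) * (\<i> * B x y)"
      using xy cl by (simp add: Badd Breal Bi del: csc_csc)
    also have "\<dots> = (of_real (Re c) + \<i> * of_real (Im c)) * B x y" by (simp add: algebra_simps)
    finally show ?thesis by (simp add: complex_eq[symmetric])
  qed
  have Bsym: "B y x = cnj (B x y)" if "x \<in> S" "y \<in> S" for x y
    using that cl Ri[of x y] R_sym[of x y] R_sym[of "\<i> *\<^sub>V x" y]
    by (simp add: B_def complex_eq_iff)
  have BN: "B x x = of_real (N x)" if x: "x \<in> S" for x
  proof -
    have "N 0 = 0" using hom[of 0 0] cl by simp
    then have "R x x = N x" using hom[OF x, of 2] by (simp add: R_def csc_two)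
    moreover have "R x (\<i> *\<^sub>V x) = 0" using Ri[OF x x] R_sym[of x "\<i> *\<^sub>V x"] x cl by simp
    ultimately show ?thesis by (simp add: B_def complex_eq_iff)
  qed
  have "pform_on S B"
    unfolding pform_on_def hform_on_def
  proof (intro conjI ballI allI)
    show "B y x = cnj (B x y)" if "x \<in> S" "y \<in> S" for x y by (rule Bsym[OF that])
  qed (simp_all add: S Badd Bc BN nonneg)
  with BN that show ?thesis by blast
qed

text \<open>Both \<open>p + d\<close> and \<open>p - d\<close> are positive and at most
  \<open>2 p\<close>. Cauchy-Schwarz for each of them bounds their difference
  \<open>2 d\<close>.\<close>

lemma bounded_hform_bound:
  assumes p: "pform_on S p" and d: "hform_on S d"
    and le: "\<And>x. x \<in> S \<Longrightarrow> \<bar>qf d x\<bar> \<le> qf p x" and x: "x \<in> S" and y: "y \<in> S"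
  shows "cmod (d x y) \<le> 2 * sqrt (qf p x) * sqrt (qf p y)"
proof -
  note h = pform_onD(1)[OF p] and s = hf_csub[OF d]
  have P: "pform_on S (\<lambda>x y. p x y + of_real e * d x y)" if "\<bar>e\<bar> = 1" for e :: real
    unfolding pform_on_def hform_on_def
  proof (intro conjI ballI allI)
    fix u assume u: "u \<in> S"
    have "\<bar>e * qf d u\<bar> \<le> qf p u" using le[OF u] that by (simp add: abs_mult)
    then show "0 \<le> Re (p u u + of_real e * d u u)" by simp
  next
    show "p v u + of_real e * d v u = cnj (p u v + of_real e * d u v)" if "u \<in> S" "v \<in> S" for u v
      using hf_sym[OF h that] hf_sym[OF d that] by simp
  qed (simp_all add: s hf_addl[OF h] hf_addl[OF d] hf_cscl[OF h] hf_cscl[OF d] algebra_simps)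
  have b: "cmod (p x y + of_real e * d x y) \<le> sqrt (2 * qf p x) * sqrt (2 * qf p y)" if "\<bar>e\<bar> = 1" for e :: real
  proof -
    have "qf (\<lambda>x y. p x y + of_real e * d x y) u \<le> 2 * qf p u" if u: "u \<in> S" for u
    proof -
      have "\<bar>e * qf d u\<bar> \<le> qf p u" using le[OF u] \<open>\<bar>e\<bar> = 1\<close> by (simp add: abs_mult)
      then show ?thesis by simp
    qed
    then show ?thesis
      using pf_cauchy_schwarz_sqrt[OF P[OF that] x y] pform_onD(2)[OF P[OF that]] x y
      by (smt (verit) mult_mono real_sqrt_ge_zero real_sqrt_le_mono)
  qed
  have "2 * cmod (d x y) = cmod ((p x y + of_real 1 * d x y) - (p x y + of_real (-1) * d x y))"
    using norm_mult[of 2 "d x y"] by simp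
  also have "\<dots> \<le> 2 * (sqrt (2 * qf p x) * sqrt (2 * qf p y))"
    using norm_triangle_ineq4[of "p x y + of_real 1 * d x y" "p x y + of_real (-1) * d x y"] b[of 1] b[of "-1"] 
    by linarith
  also have "sqrt (2 * qf p x) * sqrt (2 * qf p y) = 2 * sqrt (qf p x) * sqrt (qf p y)"
    by (simp add: real_sqrt_mult)
  finally show ?thesis by simp
qed

section \<open>Positivity in unital C*-algebras\<close>

lemma norm_star [simp]: "norm (star a) = norm (a :: 'a::cstar_algebra)"
proof -
  have le: "norm b \<le> norm (star b)" for b :: 'a
  proof (cases "b = 0")
    case False
    have "norm b * norm b \<le> norm (star b) * norm b"
      using norm_star_mult_self[of b] norm_mult_ineq[of "star b" b] by (simp add: power2_eq_square)
    then show ?thesis using False by simp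
  qed simp
  show ?thesis using le[of a] le[of "star a"] by (simp add: star_star)
qed

lemma star_zero [simp]: "star (0 :: 'a::cstar_algebra) = 0"
  using norm_star[of "0 :: 'a"] unfolding norm_zero by (simp only: norm_eq_zero)

lemma star_minus: "star (- a) = - star (a :: 'a::cstar_algebra)"
  using star_add[of a "- a"] by (simp add: eq_neg_iff_add_eq_0 add.commute)

lemma star_diff: "star (a - b) = star a - star (b :: 'a::cstar_algebra)"
  using star_add[of a "- b"] by (simp add: star_minus)

lemma star_scaleR: "star (r *\<^sub>R a) = r *\<^sub>R star (a :: 'a::cstar_algebra)"
  by (simp add: scaleR_scaleC star_scaleC)

lemma tendsto_star: "f \<longlonglongrightarrow> a \<Longrightarrow> (\<lambda>n. star (f n)) \<longlonglongrightarrow> star (a :: 'a::cstar_algebra)"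
  unfolding tendsto_iff dist_norm star_diff[symmetric] norm_star .

text \<open>The scalar multiplication of the algebra is identified with that of \<open>cvec\<close>,
  so that the theory of forms also applies to forms on the algebra itself.\<close>

class cstar1 = cstar_algebra + real_normed_algebra_1 + cvec +
  assumes csc_scaleC: "csc c a = c *\<^sub>C a"

lemma scaleR_csc: "r *\<^sub>R a = of_real r *\<^sub>V (a :: 'b::cstar1)"
  by (simp add: csc_scaleC scaleR_scaleC)

lemma mult_csc_left: "(c *\<^sub>V a) * b = c *\<^sub>V (a * (b :: 'b::cstar1))"
  and mult_csc_right: "a * (c *\<^sub>V b) = c *\<^sub>V (a * (b :: 'b::cstar1))"
  and norm_csc: "norm (c *\<^sub>V a) = cmod c * norm (a :: 'b::cstar1)"
  and star_csc: "star (c *\<^sub>V a) = cnj c *\<^sub>V star (a :: 'b::cstar1)"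
  by (simp_all add: csc_scaleC mult_scaleC_left mult_scaleC_right norm_scaleC star_scaleC)

lemma star_one [simp]: "star (1 :: 'b::cstar1) = 1"
  using star_mult[of "star 1" "1 :: 'b"] by (simp add: star_star)

section \<open>Self-adjoint and unitary elements\<close>

definition sa :: "'a::cstar_algebra \<Rightarrow> bool" where "sa a \<longleftrightarrow> star a = a"

lemma sa_simps [simp]: "sa (0 :: 'a::cstar_algebra)" "sa (1 :: 'b::cstar1)"
  by (simp_all add: sa_def)

lemma sa_intros:
  "sa a \<Longrightarrow> sa b \<Longrightarrow> sa (a + b)" "sa a \<Longrightarrow> sa b \<Longrightarrow> sa (a - b)" "sa a \<Longrightarrow> sa (- a)"
  "sa a \<Longrightarrow> sa (r *\<^sub>R a)" "sa (star a * a)" "sa (a * star a)"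
  for a b :: "'a::cstar_algebra"
  by (simp_all add: sa_def star_add star_diff star_minus star_scaleR star_mult star_star)

lemma sa_mult: "sa a \<Longrightarrow> sa b \<Longrightarrow> a * b = b * a \<Longrightarrow> sa (a * b)" for a b :: "'a::cstar_algebra"
  by (simp add: sa_def star_mult)

lemma norm_sa_square: "sa a \<Longrightarrow> norm (a * a) = (norm a)\<^sup>2" for a :: "'a::cstar_algebra"
  using norm_star_mult_self[of a] by (simp add: sa_def)

definition unitary :: "'b::cstar1 \<Rightarrow> bool"
  where "unitary u \<longleftrightarrow> star u * u = 1 \<and> u * star u = 1"

lemma unitary_star: "unitary u \<Longrightarrow> unitary (star u)"
  by (simp add: unitary_def star_star)

lemma unitary_one [simp]: "unitary 1"
  by (simp add: unitary_def)

lemma unitary_mult: "unitary u \<Longrightarrow> unitary v \<Longrightarrow> unitary (u * v)"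
proof -
  assume u: "unitary u" and v: "unitary v"
  have "star (u * v) * (u * v) = star v * (star u * u) * v" "(u * v) * star (u * v) = u * (v * star v) * star u"
    by (simp_all only: star_mult mult.assoc)
  then show "unitary (u * v)" using u v by (simp add: unitary_def)
qed

lemma norm_unitary: "unitary u \<Longrightarrow> norm u = 1"
proof -
  assume "unitary u"
  then have "(norm u)\<^sup>2 = 1\<^sup>2" using norm_star_mult_self[of u] by (simp add: unitary_def)
  then show "norm u = 1" by (metis power2_eq_imp_eq norm_ge_zero zero_le_one)
qed

lemma norm_mult_unitary_right: "unitary u \<Longrightarrow> norm (a * u) \<le> norm a"
  using norm_mult_ineq[of a u] by (simp add: norm_unitary)

text \<open>The solution \<open>y = 1 - sqrt (1 - x)\<close> of \<open>2 y = x + y\<^sup>2\<close>, obtained as the limit of the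
  iteration \<open>y \<mapsto> (x + y\<^sup>2) / 2\<close>, whose increments are dominated by those of the same iteration
  in the reals at \<open>x = 1\<close>. No unit is involved.\<close>

lemma sqrt_iteration:
  fixes x :: "'a::cstar_algebra"
  assumes x: "norm x \<le> 1"
  obtains y where "y + y = x + y * y" "norm y \<le> norm x" "\<And>z. z * x = x * z \<Longrightarrow> z * y = y * z"
    "sa x \<Longrightarrow> sa y"
proof -
  define f where "f y = (1/2) *\<^sub>R (x + y * y)" for y
  define s where "s n = (f ^^ n) 0" for n
  define e where "e n = ((\<lambda>t::real. (1 + t\<^sup>2) / 2) ^^ n) 0" for n
  have s0: "s 0 = 0" and sS: "s (Suc n) = (1/2) *\<^sub>R (x + s n * s n)" for n
    by (simp_all add: s_def f_def)
  have e0: "e 0 = 0" and eS: "e (Suc n) = (1 + (e n)\<^sup>2) / 2" for n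
    by (simp_all add: e_def)
  have eb: "0 \<le> e n \<and> e n \<le> 1" for n
  proof (induction n)
    case (Suc n)
    then have "(e n)\<^sup>2 \<le> 1" by (simp add: power_le_one)
    then show ?case by (simp add: eS)
  qed (simp add: e0)
  have einc: "e n \<le> e (Suc n)" for n
    using sum_power2_ge_zero[of "e n - 1" 0] by (simp add: eS power2_eq_square algebra_simps)
  then have "incseq e" by (rule incseq_SucI)
  then have ec: "convergent e"
    using incseq_convergent[of e 1] eb unfolding convergent_def by metis
  have sb: "norm (s n) \<le> norm x" for n
  proof (induction n)
    case (Suc n)
    have "norm (s n * s n) \<le> norm x * 1"
      using norm_mult_ineq[of "s n" "s n"] mult_mono[OF Suc order_trans[OF Suc x]] by simp
    then show ?case using norm_triangle_ineq[of x "s n * s n"] by (simp add: sS)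
  qed (simp add: s0)
  have se: "norm (s n) \<le> e n" for n
  proof (induction n)
    case (Suc n)
    have "norm (s n * s n) \<le> (e n)\<^sup>2"
      using norm_mult_ineq[of "s n" "s n"] Suc mult_mono[OF Suc Suc] eb[of n] by (simp add: power2_eq_square)
    then show ?case using norm_triangle_ineq[of x "s n * s n"] x by (simp add: sS eS)
  qed (simp add: s0 e0)
  have sd: "norm (s (Suc n) - s n) \<le> e (Suc n) - e n" for n
  proof (induction n)
    case 0 then show ?case using x by (simp add: sS eS s0 e0)
  next
    case (Suc n)
    let ?a = "s (Suc n)" and ?b = "s n" and ?p = "e (Suc n)" and ?q = "e n"
    have "s (Suc (Suc n)) - ?a = (1/2) *\<^sub>R (?a * (?a - ?b) + (?a - ?b) * ?b)"
    proof -
      have "s (Suc (Suc n)) - ?a = (1/2) *\<^sub>R ((x + ?a * ?a) - (x + ?b * ?b))"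
        using sS[of "Suc n"] sS[of n] by (simp only: scaleR_diff_right)
      also have "(x + ?a * ?a) - (x + ?b * ?b) = ?a * (?a - ?b) + (?a - ?b) * ?b"
        by (simp add: algebra_simps)
      finally show ?thesis .
    qed
    then have "norm (s (Suc (Suc n)) - ?a) \<le> (1/2) * (norm (?a * (?a - ?b)) + norm ((?a - ?b) * ?b))"
      using norm_triangle_ineq[of "?a * (?a - ?b)" "(?a - ?b) * ?b"] by simp
    also have "norm (?a * (?a - ?b)) \<le> ?p * (?p - ?q)"
      using norm_mult_ineq[of ?a "?a - ?b"] mult_mono[OF se[of "Suc n"] Suc] eb[of "Suc n"] by simp
    also have "norm ((?a - ?b) * ?b) \<le> (?p - ?q) * ?q"
      using norm_mult_ineq[of "?a - ?b" ?b] mult_mono[OF Suc se[of n]] eb[of n] einc[of n] by simp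
    also have "(1/2) * (?p * (?p - ?q) + (?p - ?q) * ?q) = e (Suc (Suc n)) - ?p"
      by (simp add: eS[of "Suc n"] eS[of n] power2_eq_square field_simps)
    finally show ?case by simp
  qed
  have sdm: "norm (s (n + m) - s n) \<le> e (n + m) - e n" for n m
  proof (induction m)
    case (Suc m)
    have "norm (s (n + Suc m) - s n) \<le> norm (s (Suc (n + m)) - s (n + m)) + norm (s (n + m) - s n)"
      using norm_triangle_ineq[of "s (Suc (n + m)) - s (n + m)" "s (n + m) - s n"] by simp
    then show ?case using Suc sd[of "n + m"] by simp
  qed simp
  have "Cauchy s"
    unfolding Cauchy_iff
  proof (intro allI impI)
    fix d :: real assume d: "0 < d"
    obtain N where N: "\<And>m n. m \<ge> N \<Longrightarrow> n \<ge> N \<Longrightarrow> norm (e m - e n) < d"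
      using convergent_Cauchy[OF ec] d unfolding Cauchy_iff by blast
    have "norm (s m - s n) < d" if "n \<ge> N" "m \<ge> N" "n \<le> m" for m n
      using sdm[of n "m - n"] N[of m n] that by simp
    then have "norm (s m - s n) < d" if "n \<ge> N" "m \<ge> N" for m n
      using that by (metis nle_le norm_minus_commute)
    then show "\<exists>M. \<forall>m\<ge>M. \<forall>n\<ge>M. norm (s m - s n) < d" by blast
  qed
  then obtain y where y: "s \<longlonglongrightarrow> y" using Cauchy_convergent_iff convergent_def by blast
  show ?thesis
  proof (rule that[of y])
    have "(\<lambda>n. (1/2) *\<^sub>R (x + s n * s n)) \<longlonglongrightarrow> (1/2) *\<^sub>R (x + y * y)"
      by (intro tendsto_intros y)
    moreover have "(\<lambda>n. (1/2) *\<^sub>R (x + s n * s n)) \<longlonglongrightarrow> y"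
      using LIMSEQ_Suc[OF y] by (simp add: sS)
    ultimately have "y = (1/2) *\<^sub>R (x + y * y)" by (rule LIMSEQ_unique[rotated])
    then have "2 *\<^sub>R y = x + y * y" by (metis scaleR_half_double scaleR_left_distrib scaleR_right_distrib scaleR_2)
    then show "y + y = x + y * y" by (simp add: scaleR_2)
    show "norm y \<le> norm x" by (rule LIMSEQ_le_const2[OF tendsto_norm[OF y]]) (use sb in auto)
  next
    fix z assume z: "z * x = x * z"
    have c: "z * s n = s n * z" for n
    proof (induction n)
      case (Suc n)
      have "z * (s n * s n) = (s n * s n) * z" by (metis Suc mult.assoc)
      then show ?case by (simp add: sS z algebra_simps)
    qed (simp add: s0)
    have "(\<lambda>n. z * s n) \<longlonglongrightarrow> z * y" "(\<lambda>n. s n * z) \<longlonglongrightarrow> y * z" by (intro tendsto_intros y)+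
    then show "z * y = y * z" unfolding c by (rule LIMSEQ_unique)
  next
    assume sx: "sa x"
    have "star (s n) = s n" for n
    proof (induction n)
      case (Suc n)
      have "star (s (Suc n)) = (1/2) *\<^sub>R (star x + star (s n) * star (s n))"
        by (simp only: sS star_scaleR star_add star_mult)
      also have "\<dots> = s (Suc n)" using sx by (simp only: sS Suc sa_def)
      finally show ?case .
    qed (simp add: s0)
    then have "s \<longlonglongrightarrow> star y" using tendsto_star[OF y] by simp
    then show "sa y" using LIMSEQ_unique[OF y] by (metis sa_def)
  qed
qed

text \<open>The last clause stands in for the functional calculus: the root commutes with whatever
  commutes with \<open>x\<close>, which is all that later algebra with roots needs.\<close>

lemma sqrt_one_minus:
  fixes x :: "'b::cstar1"
  assumes x: "norm x \<le> 1" "sa x"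
  obtains s where "sa s" "s * s = 1 - x" "norm (1 - s) \<le> norm x" "\<And>z. z * x = x * z \<Longrightarrow> z * s = s * z"
proof -
  obtain y where y: "y + y = x + y * y" "norm y \<le> norm x" "\<And>z. z * x = x * z \<Longrightarrow> z * y = y * z"
      "sa x \<Longrightarrow> sa y"
    using sqrt_iteration[OF x(1)] by metis
  show ?thesis
  proof (rule that[of "1 - y"])
    show "sa (1 - y)" by (intro sa_intros sa_simps y x)
    have "(1 - y) * (1 - y) = 1 - (y + y) + y * y" by (simp add: algebra_simps)
    then show "(1 - y) * (1 - y) = 1 - x" by (simp add: y(1))
    show "norm (1 - (1 - y)) \<le> norm x" using y(2) by simp
  next
    fix z assume "z * x = x * z"
    then have "z * y = y * z" by (rule y(3))
    then show "z * (1 - y) = (1 - y) * z" by (simp add: algebra_simps)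
  qed
qed

text \<open>\<open>s\<close> is the root of \<open>1 - k * k\<close> and commutes with
  \<open>k\<close>, so the pair behaves like cosine and sine. The estimate of \<open>1 - s\<close>
  says that \<open>s + i k\<close> is a unitary whose real part differs from 1 only to second order
  in \<open>k\<close>.\<close>

lemma unitary_dilation:
  fixes k :: "'b::cstar1"
  assumes k: "sa k" "norm k \<le> 1"
  obtains s where "sa s" "s * s = 1 - k * k" "s * k = k * s" "norm (1 - s) \<le> (norm k)\<^sup>2"
    "unitary (k + \<i> *\<^sub>V s)" "unitary (s + \<i> *\<^sub>V k)"
proof -
  have "norm (k * k) \<le> 1" using k by (simp add: norm_sa_square power_le_one)
  moreover have "sa (k * k)" using k by (simp add: sa_mult)
  ultimately obtain s where s: "sa s" "s * s = 1 - k * k" "norm (1 - s) \<le> norm (k * k)"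
      "\<And>z. z * (k * k) = (k * k) * z \<Longrightarrow> z * s = s * z"
    using sqrt_one_minus[of "k * k"] by metis
  have ks: "k * s = s * k" by (rule s(4)) (simp add: mult.assoc)
  have st: "star k = k" "star s = s" using k(1) s(1) by (simp_all add: sa_def)
  show ?thesis
  proof (rule that[OF s(1,2) ks[symmetric]])
    show "norm (1 - s) \<le> (norm k)\<^sup>2" using s(3) k by (simp add: norm_sa_square)
    show "unitary (k + \<i> *\<^sub>V s)" "unitary (s + \<i> *\<^sub>V k)"
      using s(2) ks unfolding unitary_def
      by (simp_all add: star_add star_csc st mult_csc_left mult_csc_right csc_add_right
          csc_diff_right algebra_simps)
  qed
qed

text \<open>This expresses that \<open>k * k\<close> lies between 0 and \<open>t\<close>. After
  scaling to \<open>t = 1\<close>, the element \<open>1 - l * l\<close> is the square of the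
  imaginary part \<open>s\<close> of a unitary, and such an \<open>s\<close> is a
  contraction.\<close>

lemma norm_scalar_minus_square:
  fixes k :: "'b::cstar1"
  assumes k: "sa k" and t: "(norm k)\<^sup>2 \<le> t"
  shows "norm (t *\<^sub>R 1 - k * k) \<le> t"
proof (cases "t = 0")
  case True
  then have "k = 0" using t by simp
  then show ?thesis using True by simp
next
  case False
  then have t0: "t > 0" using t by (smt (verit) zero_le_power2)
  define l where "l = (1 / sqrt t) *\<^sub>R k"
  have "norm k \<le> sqrt t" using t by (simp add: real_le_rsqrt)
  then have "norm l \<le> 1" using t0 by (simp add: l_def)
  moreover have "sa l" using k by (simp add: l_def sa_intros)
  ultimately obtain s where s: "sa s" "s * s = 1 - l * l" "unitary (l + \<i> *\<^sub>V s)"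
    using unitary_dilation[of l] by metis
  let ?w = "l + \<i> *\<^sub>V s"
  have "star l = l" "star s = s" using s(1) \<open>sa l\<close> by (simp_all add: sa_def)
  then have "?w - star ?w = (2 * \<i>) *\<^sub>V s"
    by (simp add: star_add star_csc csc_add_left[symmetric] add_diff_eq diff_add_eq algebra_simps)
  then have "2 * norm s = norm (?w - star ?w)" by (simp add: norm_csc norm_mult)
  also have "\<dots> \<le> 2" using norm_triangle_ineq4[of ?w "star ?w"] s(3) by (simp add: norm_unitary)
  finally have "norm s \<le> 1" by simp
  then have "norm (1 - l * l) \<le> 1" using s by (metis norm_sa_square norm_ge_zero power_le_one)
  moreover have "t *\<^sub>R 1 - k * k = t *\<^sub>R (1 - l * l)"
    using t0 by (simp add: l_def algebra_simps)
  ultimately show ?thesis using t0 by (simp add: mult_left_le)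
qed

text \<open>The hypothesis on the norm makes \<open>1 - z / t\<close> a contraction, to which the
  root of \<open>1 - x\<close> applies. The root satisfies a hypothesis of the same kind, so that a
  further root can be taken.\<close>

lemma sa_sqrt:
  fixes z :: "'b::cstar1"
  assumes z: "sa z" "norm (t *\<^sub>R 1 - z) \<le> t" "0 < t"
  obtains k where "sa k" "k * k = z" "norm (sqrt t *\<^sub>R 1 - k) \<le> sqrt t" "\<And>y. y * z = z * y \<Longrightarrow> y * k = k * y"
proof -
  define x where "x = 1 - (1 / t) *\<^sub>R z"
  have "t *\<^sub>R x = t *\<^sub>R 1 - z" using z(3) by (simp add: x_def algebra_simps)
  then have "t * norm x \<le> t" using z(2,3) by (metis abs_of_pos norm_scaleR)
  then have x1: "norm x \<le> 1" using z(3) by simp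
  have "sa x" unfolding x_def by (intro sa_intros sa_simps z)
  with x1 obtain s where s: "sa s" "s * s = 1 - x" "norm (1 - s) \<le> norm x"
      "\<And>y. y * x = x * y \<Longrightarrow> y * s = s * y"
    using sqrt_one_minus[of x] by metis
  show ?thesis
  proof (rule that[of "sqrt t *\<^sub>R s"])
    show "sa (sqrt t *\<^sub>R s)" by (intro sa_intros s)
    show "(sqrt t *\<^sub>R s) * (sqrt t *\<^sub>R s) = z" using s(2) z(3) by (simp add: x_def)
    have "sqrt t *\<^sub>R 1 - sqrt t *\<^sub>R s = sqrt t *\<^sub>R (1 - s)" by (simp add: algebra_simps)
    then show "norm (sqrt t *\<^sub>R 1 - sqrt t *\<^sub>R s) \<le> sqrt t"
      using s(3) x1 z(3) by (simp add: mult_left_le)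
  next
    fix y assume "y * z = z * y"
    then have "y * x = x * y" by (simp add: x_def algebra_simps)
    then show "y * (sqrt t *\<^sub>R s) = (sqrt t *\<^sub>R s) * y" using s(4) by simp
  qed
qed

text \<open>The positive elements form a cone because norm conditions of the form
  \<open>norm (t - z) \<le> t\<close> add up by the triangle inequality.\<close>

lemma sum_squares_is_square:
  fixes k l :: "'b::cstar1"
  assumes "sa k" "sa l"
  obtains m where "sa m" "m * m = k * k + l * l"
proof -
  \<comment> \<open>The summand 1 only ensures that \<open>a + b\<close> is positive when
    \<open>k\<close> and \<open>l\<close> both vanish.\<close>
  define a b where "a = (norm k)\<^sup>2 + 1" and "b = (norm l)\<^sup>2"
  have "norm ((a *\<^sub>R 1 - k * k) + (b *\<^sub>R 1 - l * l)) \<le> a + b"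
    using norm_scalar_minus_square[OF assms(1), of a] norm_scalar_minus_square[OF assms(2), of b]
    by (intro norm_triangle_le) (simp add: a_def b_def)
  moreover have "(a *\<^sub>R 1 - k * k) + (b *\<^sub>R 1 - l * l) = (a + b) *\<^sub>R 1 - (k * k + l * l)"
    by (simp add: algebra_simps)
  ultimately have "norm ((a + b) *\<^sub>R 1 - (k * k + l * l)) \<le> a + b" by metis
  moreover have "sa (k * k + l * l)" using assms by (intro sa_intros sa_mult) auto
  moreover have "0 < a + b"
    using zero_le_power2[of "norm k"] zero_le_power2[of "norm l"] unfolding a_def b_def by linarith
  ultimately show ?thesis using that by (metis sa_sqrt)
qed

text \<open>If \<open>a\<close> and \<open>- a\<close> are both squares then \<open>1 + c a\<close> has norm at most 1 for every fourth root of
  unity \<open>c\<close>, and \<open>8 a\<close> is a combination of the squares of these four elements.\<close>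

lemma sum_squares_eq_zero:
  fixes k l :: "'b::cstar1"
  assumes k: "sa k" and l: "sa l" and kl: "k * k + l * l = 0"
  shows "k = 0"
proof (rule ccontr)
  assume k0: "k \<noteq> 0"
  define t where "t = (norm k)\<^sup>2"
  define a where "a = (1 / t) *\<^sub>R (k * k)"
  have t0: "t > 0" using k0 by (simp add: t_def)
  have ll: "l * l = - (k * k)" using kl by (simp add: eq_neg_iff_add_eq_0 add.commute)
  then have tl: "(norm l)\<^sup>2 = t" using norm_sa_square[OF k] norm_sa_square[OF l] by (simp add: t_def)
  have sca: "norm (1 - (1 / t) *\<^sub>R x) \<le> 1" if "norm (t *\<^sub>R 1 - x) \<le> t" for x :: 'b
  proof -
    have "1 - (1 / t) *\<^sub>R x = (1 / t) *\<^sub>R (t *\<^sub>R 1 - x)" using t0 by (simp add: algebra_simps)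
    then show ?thesis using that t0 by simp
  qed
  have m: "norm (1 - a) \<le> 1"
    unfolding a_def by (intro sca norm_scalar_minus_square k) (simp add: t_def)
  have p: "norm (1 + a) \<le> 1"
    using sca[of "l * l"] norm_scalar_minus_square[OF l, of t] by (simp add: tl ll a_def)
  have n1: "norm a = 1" using t0 norm_sa_square[OF k] by (simp add: a_def t_def)
  have sa_a: "sa a" unfolding a_def by (intro sa_intros sa_mult k refl)
  then have sta: "star a = a" by (simp add: sa_def)
  have sq: "norm (x * x) \<le> 1" if "norm x \<le> 1" for x :: 'b
    using norm_mult_ineq[of x x] mult_mono[OF that that] by simp
  \<comment> \<open>Averaging the squares of \<open>1 + a\<close> and \<open>1 - a\<close> bounds
    \<open>1 + a * a\<close>, and by the C*-identity this is the squared norm of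
    \<open>1 + i a\<close> and of \<open>1 - i a\<close>.\<close>
  have "2 *\<^sub>R (1 + a * a) = (1 + a) * (1 + a) + (1 - a) * (1 - a)"
    by (simp add: algebra_simps scaleR_2)
  then have "2 * norm (1 + a * a) \<le> norm ((1 + a) * (1 + a)) + norm ((1 - a) * (1 - a))"
    using norm_triangle_ineq by (metis abs_numeral norm_scaleR)
  then have a2: "norm (1 + a * a) \<le> 1" using sq[OF p] sq[OF m] by simp
  have im: "norm (1 + c *\<^sub>V a) \<le> 1" if "c = \<i> \<or> c = - \<i>" for c
  proof -
    have "star (1 + c *\<^sub>V a) * (1 + c *\<^sub>V a) = 1 + a * a"
      using that by (auto simp: star_add star_csc star_minus sta algebra_simps mult_csc_left mult_csc_right
            csc_add_right csc_diff_right)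
    then have "(norm (1 + c *\<^sub>V a))\<^sup>2 \<le> 1" using a2 norm_star_mult_self by metis
    then show ?thesis by (simp add: abs_square_le_1)
  qed
  \<comment> \<open>Weighting the four squares by the conjugate roots of unity cancels their
    constant and quadratic terms. Each square has norm at most 1 while \<open>a\<close> has norm 1,
    so that 8 would be at most 4.\<close>
  define q where "q = (1 + a) * (1 + a) - (1 - a) * (1 - a)
      + (- \<i>) *\<^sub>V ((1 + \<i> *\<^sub>V a) * (1 + \<i> *\<^sub>V a)) + \<i> *\<^sub>V ((1 + (- \<i>) *\<^sub>V a) * (1 + (- \<i>) *\<^sub>V a))"
  have "q = 8 *\<^sub>R a"
  proof -
    have "8 *\<^sub>R a = 2 *\<^sub>R 2 *\<^sub>R 2 *\<^sub>R a" by simp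
    also have "\<dots> = a + a + a + a + (a + a + a + a)" by (simp only: scaleR_2 add.assoc)
    finally show ?thesis
      by (simp add: q_def algebra_simps mult_csc_left mult_csc_right csc_add_right csc_diff_right)
  qed
  moreover have "norm q \<le> 1 + 1 + 1 + 1"
    unfolding q_def
    by (intro norm_triangle_le norm_triangle_le_diff add_mono)
       (use sq[OF p] sq[OF m] sq[OF im[of \<i>]] sq[OF im[of "- \<i>"]] in \<open>simp_all only: norm_csc, simp_all\<close>)
  ultimately show False using n1 by simp
qed

text \<open>With \<open>h = star b * b\<close> and \<open>r\<close> the root of
  \<open>h * h\<close>, the task is to show that \<open>n = r - h\<close>, twice the negative part
  of \<open>h\<close>, vanishes. For \<open>y = b * n\<close> the element \<open>star y * y\<close>
  is minus a square; the usual argument now compares the spectra of \<open>star y * y\<close> and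
  \<open>y * star y\<close>. Multiplying once more by the root \<open>w\<close> of that square
  produces an element \<open>c\<close> for which both \<open>star c * c\<close> and
  \<open>c * star c\<close> are minus squares. Their sum is also half a sum of squares, so
  everything is zero.\<close>

theorem star_mult_self_is_square:
  fixes b :: "'b::cstar1"
  obtains k where "sa k" "k * k = star b * b"
proof -
  define h where "h = star b * b"
  have sh: "sa h" by (simp add: h_def sa_intros)
  define t where "t = (norm h)\<^sup>2 + 1"
  have t0: "t > 0" by (simp add: t_def add_nonneg_pos)
  have "norm (t *\<^sub>R 1 - h * h) \<le> t" by (rule norm_scalar_minus_square[OF sh]) (simp add: t_def)
  moreover have "sa (h * h)" by (rule sa_mult[OF sh sh refl])
  ultimately obtain r where r: "sa r" "r * r = h * h" "norm (sqrt t *\<^sub>R 1 - r) \<le> sqrt t"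
      "\<And>y. y * (h * h) = (h * h) * y \<Longrightarrow> y * r = r * y"
    using t0 by (metis sa_sqrt)
  have hr: "h * r = r * h" by (rule r(4)) (simp add: mult.assoc)
  obtain k where k: "sa k" "k * k = r" "\<And>y. y * r = r * y \<Longrightarrow> y * k = k * y"
    using sa_sqrt[OF r(1,3)] t0 by (metis real_sqrt_gt_zero)
  define n where "n = r - h"
  have sn: "sa n" unfolding n_def by (intro sa_intros r sh)
  have hk: "h * k = k * h" by (rule k(3)[OF hr])
  have rk: "r * k = k * r" by (rule k(3)) simp
  have nk: "n * k = k * n" by (simp add: n_def algebra_simps hk rk)
  have nr: "n * r = r * n" by (simp add: n_def algebra_simps hr)
  have hn: "h * n = - (r * n)" by (simp add: n_def algebra_simps r(2) hr)
  have nn: "n * n = r * n + r * n"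
  proof -
    have "n * n = r * n - h * n" by (simp add: n_def algebra_simps)
    then show ?thesis by (simp add: hn)
  qed
  define w where "w = k * n"
  have sw: "sa w" unfolding w_def by (rule sa_mult[OF k(1) sn nk[symmetric]])
  define y where "y = b * n"
  have yy: "star y * y = - (w * w)"
  proof -
    have "star y * y = n * (h * n)" using sn by (simp add: y_def h_def star_mult sa_def mult.assoc)
    also have "\<dots> = - (r * n * n)" by (simp add: hn nr mult.assoc[symmetric])
    also have "r * n * n = k * (k * n) * n" by (simp add: k(2)[symmetric] mult.assoc)
    also have "\<dots> = w * w" by (metis w_def nk mult.assoc)
    finally show ?thesis .
  qed
  \<comment> \<open>Inserting \<open>star y * y = - (w * w)\<close> from the inside gives
    \<open>star c * c\<close>, and replacing \<open>w * w\<close> by \<open>- (star y * y)\<close>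
    gives \<open>c * star c\<close>.\<close>
  define c where "c = y * w"
  define v where "v = y * star y"
  define W where "W = w * w"
  have sv: "sa v" and sW: "sa W" unfolding v_def W_def by (simp_all add: sa_intros sa_mult sw)
  have wst: "star w = w" using sw by (simp add: sa_def)
  have "star c * c = w * (star y * y) * w" by (simp add: c_def star_mult wst mult.assoc)
  then have cc1: "star c * c = - (W * W)" by (simp add: yy W_def mult.assoc)
  have "c * star c = y * (w * w) * star y" by (simp add: c_def star_mult wst mult.assoc)
  also have "w * w = - (star y * y)" by (simp add: yy)
  finally have cc2: "c * star c = - (v * v)" by (simp add: v_def mult.assoc)
  \<comment> \<open>Up to factors, the real and the imaginary part of \<open>c\<close>. The mixed
    terms of their squares cancel.\<close>
  define p q where "p = c + star c" and "q = \<i> *\<^sub>V (c - star c)"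
  have sp: "sa p" and sq: "sa q"
    by (simp_all add: p_def q_def sa_def star_add star_diff star_csc star_star add.commute csc_diff_right)
  have pq: "p * p + q * q = 2 *\<^sub>R (star c * c + c * star c)"
    by (simp add: p_def q_def mult_csc_left mult_csc_right algebra_simps scaleR_2 csc_add_right csc_diff_right)
  obtain m1 where m1: "sa m1" "m1 * m1 = p * p + q * q" by (rule sum_squares_is_square[OF sp sq])
  \<comment> \<open>The factor \<open>sqrt 2\<close> matches the 2 in \<open>pq\<close>, so that the
    squares of \<open>p\<close>, \<open>q\<close>, \<open>V\<close> and \<open>W'\<close> sum to
    zero.\<close>
  define V where "V = sqrt 2 *\<^sub>R v" define W' where "W' = sqrt 2 *\<^sub>R W"
  have sV: "sa V" and sW': "sa W'" by (simp_all add: V_def W'_def sa_intros sv sW)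
  obtain m2 where m2: "sa m2" "m2 * m2 = m1 * m1 + W' * W'" by (rule sum_squares_is_square[OF m1(1) sW'])
  have "V * V + m2 * m2 = 0"
    by (simp add: m2 m1 pq cc1 cc2 V_def W'_def algebra_simps)
  then have "V = 0" by (rule sum_squares_eq_zero[OF sV m2(1)])
  then have "v = 0" by (simp add: V_def)
  then have "star y = 0" using norm_star_mult_self[of "star y"] by (simp add: v_def star_star)
  then have "y = 0" by (metis norm_eq_zero norm_star)
  then have "w * w = 0" using yy by simp
  then have "w = 0" using norm_sa_square[OF sw] by simp
  then have "r * n = 0" using k(2) by (metis w_def mult.assoc mult_zero_right)
  then have "n = 0" using nn norm_sa_square[OF sn] by simp
  then have "k * k = star b * b" by (simp add: n_def k h_def)
  with k(1) show ?thesis by (rule that)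
qed

section \<open>Inverses, polar decomposition and combinations of unitaries\<close>

lemma neumann_inverse:
  fixes x :: "'b::{real_normed_algebra_1,banach}"
  assumes q: "norm x < 1"
  obtains g where "g * (1 - x) = 1" "(1 - x) * g = 1" "norm g \<le> 1 / (1 - norm x)"
proof -
  have gs: "summable (\<lambda>n. norm x ^ n)" using q by (simp add: summable_geometric)
  have ns: "summable (\<lambda>n. norm (x ^ n))"
    by (rule summable_comparison_test'[OF gs, of 0]) (simp add: norm_power_ineq)
  have s: "summable (\<lambda>n. x ^ n)" by (rule summable_norm_cancel[OF ns])
  define g where "g = (\<Sum>n. x ^ n)"
  have e: "g = 1 + (\<Sum>n. x ^ Suc n)" using suminf_split_head[OF s] by (simp add: g_def)
  have l: "x * g = (\<Sum>n. x ^ Suc n)" unfolding g_def using suminf_mult[OF s, of x] by simp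
  have r: "g * x = (\<Sum>n. x ^ Suc n)" unfolding g_def using suminf_mult2[OF s, of x]
    by (simp add: power_Suc2 del: power_Suc)
  have "norm g \<le> (\<Sum>n. norm (x ^ n))" unfolding g_def by (rule summable_norm[OF ns])
  also have "\<dots> \<le> (\<Sum>n. norm x ^ n)" by (rule suminf_le[OF _ ns gs]) (simp add: norm_power_ineq)
  also have "\<dots> = 1 / (1 - norm x)" using q by (simp add: suminf_geometric)
  finally have "norm g \<le> 1 / (1 - norm x)" .
  with e l r show ?thesis by (intro that[of g]) (simp_all add: algebra_simps)
qed

text \<open>\<open>star b * b\<close> need not be invertible. Adding \<open>d\<close> makes the root
  \<open>k\<close> invertible, and \<open>v\<close> is \<open>b\<close> times the inverse of
  \<open>k\<close>. Then \<open>star v * v = 1 - d G\<close> with \<open>G\<close> the inverse of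
  \<open>k * k\<close>, of norm at most \<open>1 / d\<close>, whence the bound 2.\<close>

lemma approximate_polar_decomposition:
  fixes b :: "'b::cstar1"
  assumes d: "0 < d"
  obtains k v where "sa k" "k * k = star b * b + d *\<^sub>R 1" "b = v * k" "(norm v)\<^sup>2 \<le> 2"
proof -
  define h where "h = star b * b"
  obtain k1 where k1: "sa k1" "k1 * k1 = h" unfolding h_def by (rule star_mult_self_is_square[of b])
  define s where "s = (norm k1)\<^sup>2"
  define t where "t = s + d"
  have s0: "s \<ge> 0" by (simp add: s_def)
  have t0: "t > 0" using s0 d by (simp add: t_def)
  \<comment> \<open>Scaled such that \<open>1 - x\<close> is \<open>(h + d) / t\<close>. As
    \<open>norm x \<le> s / t < 1\<close>, the Neumann series inverts it.\<close>
  define x where "x = (1 / t) *\<^sub>R (s *\<^sub>R 1 - h)"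
  have "norm (s *\<^sub>R 1 - h) \<le> s" using norm_scalar_minus_square[OF k1(1), of s] k1(2) by (simp add: s_def)
  then have nx: "norm x \<le> s / t" using t0 by (simp add: x_def divide_right_mono)
  have zx: "t *\<^sub>R (1 - x) = h + d *\<^sub>R 1" 
  proof -
    have "t *\<^sub>R x = s *\<^sub>R 1 - h" using t0 by (simp add: x_def)
    then have "t *\<^sub>R (1 - x) = t *\<^sub>R 1 - (s *\<^sub>R 1 - h)" by (simp only: scaleR_diff_right)
    then show ?thesis by (simp add: t_def algebra_simps)
  qed
  have st: "s / t < 1" using d s0 by (simp add: t_def)
  have sx: "sa x" unfolding x_def h_def by (intro sa_intros sa_simps)
  obtain g where g: "g * (1 - x) = 1" "(1 - x) * g = 1" "norm g \<le> 1 / (1 - norm x)"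
    using neumann_inverse[of x] nx st by force
  have ng: "norm g \<le> t / d"
  proof -
    have "1 - norm x \<ge> d / t" using nx t0 by (simp add: t_def field_simps)
    moreover have "0 < d / t" using d t0 by simp
    ultimately have "1 / (1 - norm x) \<le> 1 / (d / t)" by (intro frac_le) auto
    then show ?thesis using g(3) by simp
  qed
  have sg: "star g = g"
  proof -
    have "star g * (1 - x) = 1" using g(2) sx by (metis sa_def star_mult star_one star_diff)
    then show ?thesis using g(2) by (metis mult.assoc mult_1 mult_1_right)
  qed
  define z where "z = h + d *\<^sub>R 1"
  have "norm (t *\<^sub>R 1 - z) \<le> t"
  proof -
    have "t *\<^sub>R 1 - z = t *\<^sub>R x" by (simp add: z_def zx[symmetric] algebra_simps)
    moreover have "norm x \<le> 1" using nx st by linarith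
    ultimately show ?thesis using t0 by (simp add: mult_left_le)
  qed
  moreover have "sa z" unfolding z_def h_def by (intro sa_intros sa_simps)
  ultimately obtain k where k: "sa k" "k * k = z" "\<And>y. y * z = z * y \<Longrightarrow> y * k = k * y"
    using t0 by (metis sa_sqrt)
  define G where "G = (1 / t) *\<^sub>R g"
  have zG: "z * G = 1" and Gz: "G * z = 1" using g t0 by (simp_all add: G_def z_def zx[symmetric])
  have Gk: "G * k = k * G" by (rule k(3)) (simp add: zG Gz)
  have sG: "star G = G" by (simp add: G_def star_scaleR sg)
  have hz: "h = z - d *\<^sub>R 1" by (simp add: z_def)
  define v where "v = b * k * G"
  have "star v * v = G * k * h * k * G"
    using k(1) sG by (simp add: v_def h_def star_mult sa_def mult.assoc)
  also have "\<dots> = G * (k * k) * G * h"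
  proof -
    have hk: "h * k = k * h" using k(3)[of h] by (simp add: z_def algebra_simps)
    have hG: "h * G = G * h" by (simp add: hz algebra_simps zG Gz)
    show ?thesis by (metis hk hG mult.assoc)
  qed
  also have "\<dots> = 1 - d *\<^sub>R G" by (simp add: k(2) Gz hz algebra_simps)
  finally have "(norm v)\<^sup>2 = norm (1 - d *\<^sub>R G)" using norm_star_mult_self[of v] by simp
  also have "\<dots> \<le> 1 + d * norm G" using norm_triangle_ineq4[of 1 "d *\<^sub>R G"] d by simp
  also have "d * norm G \<le> 1" using ng t0 d by (simp add: G_def field_simps)
  finally have "(norm v)\<^sup>2 \<le> 2" by simp
  moreover have "b = v * k"
  proof -
    have "v * k = b * (k * (G * k))" by (simp only: v_def mult.assoc)
    also have "k * (G * k) = z * G" by (simp only: Gk mult.assoc[symmetric] k(2))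
    finally show ?thesis by (simp add: zG)
  qed
  ultimately show ?thesis using k(1,2) by (intro that[of k v]) (simp_all add: z_def h_def)
qed

text \<open>The real and imaginary parts, scaled to contractions, are averages of a unitary and its
  adjoint. Through this, identities and estimates known for unitaries reach all elements, with
  explicit constants.\<close>

lemma unitary_combination:
  fixes a :: "'b::cstar1"
  obtains u1 u2 u3 u4 where "unitary u1" "unitary u2" "unitary u3" "unitary u4"
    "a = (norm a / 2) *\<^sub>R (u1 + u2) + \<i> *\<^sub>V ((norm a / 2) *\<^sub>R (u3 + u4))"
proof (cases "a = 0")
  case True
  then show ?thesis using that[of 1 1 1 1] by simp
next
  case False
  have one: "\<exists>u1 u2. unitary u1 \<and> unitary u2 \<and> k = (1/2) *\<^sub>R (u1 + u2)" if k: "sa k" "norm k \<le> 1" for k :: 'b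
  proof -
    obtain s where s: "sa s" "unitary (k + \<i> *\<^sub>V s)" using unitary_dilation[OF k] by metis
    let ?w = "k + \<i> *\<^sub>V s"
    have "?w + star ?w = k + k" using s k by (simp add: star_add star_csc sa_def)
    then have "k = (1/2) *\<^sub>R (?w + star ?w)" by (metis scaleR_half_double)
    then show ?thesis using s(2) unitary_star by blast
  qed
  define p q where "p = (1 / (2 * norm a)) *\<^sub>R (a + star a)" and "q = (1 / (2 * norm a)) *\<^sub>R (- \<i> *\<^sub>V (a - star a))"
  have "sa p" "sa q"
    by (simp_all add: p_def q_def sa_def star_scaleR star_add star_diff star_minus star_csc star_star add.commute csc_diff_right)
  moreover have "norm (a + star a) \<le> 2 * norm a" "norm (a - star a) \<le> 2 * norm a"
    using norm_triangle_ineq[of a "star a"] norm_triangle_ineq4[of a "star a"] by simp_all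
  then have "norm p \<le> 1" "norm q \<le> 1" using False by (simp_all add: p_def q_def norm_csc)
  ultimately obtain u1 u2 u3 u4 where u: "unitary u1" "unitary u2" "p = (1/2) *\<^sub>R (u1 + u2)"
      "unitary u3" "unitary u4" "q = (1/2) *\<^sub>R (u3 + u4)"
    using one by metis
  have "norm a *\<^sub>R p = (1/2) *\<^sub>R (a + star a)" "norm a *\<^sub>R q = (1/2) *\<^sub>R (- \<i> *\<^sub>V (a - star a))"
    using False by (simp_all add: p_def q_def)
  moreover have "(1/2) *\<^sub>R (a + star a) + \<i> *\<^sub>V ((1/2) *\<^sub>R (- \<i> *\<^sub>V (a - star a))) = (1/2) *\<^sub>R (a + a)"
    by (simp add: scaleR_csc csc_diff_right csc_add_right algebra_simps)
  ultimately have "a = norm a *\<^sub>R p + \<i> *\<^sub>V (norm a *\<^sub>R q)" by simp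
  with u that show ?thesis by simp
qed

section \<open>The unitization of a C*-algebra\<close>

datatype 'a unitz = Unitz (usc: complex) (uel: 'a)

text \<open>The action of the unitization on the ideal \<open>'a\<close>. Its operator norm is the
  essential part of the norm of the unitization.\<close>

definition lmul :: "'a::cstar_algebra unitz \<Rightarrow> 'a \<Rightarrow> 'a"
  where "lmul x b = usc x *\<^sub>C b + uel x * b"

lemma scaleC_zero_right [simp]: "c *\<^sub>C (0 :: 'a::cstar_algebra) = 0"
  using scaleC_add_right[of c 0 "0 :: 'a"] by simp

lemma scaleC_zero_left [simp]: "0 *\<^sub>C (a :: 'a::cstar_algebra) = 0"
  using scaleC_add_left[of 0 0 a] by simp

lemma scaleC_one [simp]: "1 *\<^sub>C (a :: 'a::cstar_algebra) = a"
  using scaleR_scaleC[of 1 a] by simp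

lemma bounded_linear_lmul: "bounded_linear (lmul x)"
proof (rule bounded_linear_intro[where K = "cmod (usc x) + norm (uel x)"])
  show "lmul x (a + b) = lmul x a + lmul x b" for a b
    by (simp add: lmul_def scaleC_add_right distrib_left)
  show "lmul x (r *\<^sub>R a) = r *\<^sub>R lmul x a" for r a
    by (simp add: lmul_def scaleR_scaleC scaleC_add_right scaleC_scaleC mult_scaleC_right mult.commute)
  show "norm (lmul x a) \<le> norm a * (cmod (usc x) + norm (uel x))" for a
    using norm_triangle_ineq[of "usc x *\<^sub>C a" "uel x * a"] norm_mult_ineq[of "uel x" a]
    by (simp add: lmul_def norm_scaleC algebra_simps)
qed

lemma norm_lmul_le: "norm (lmul x b) \<le> onorm (lmul x) * norm b"
  by (rule onorm[OF bounded_linear_lmul])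

lemma onorm_lmul_nonneg: "0 \<le> onorm (lmul x)"
  by (rule onorm_pos_le[OF bounded_linear_lmul])

instantiation unitz :: (cstar_algebra) real_normed_vector
begin

definition "0 = Unitz 0 0"
definition "x + y = Unitz (usc x + usc y) (uel x + uel y)"
definition "- x = Unitz (- usc x) (- uel x)"
definition "x - y = Unitz (usc x - usc y) (uel x - uel y)"
definition "scaleR_unitz r x = Unitz (of_real r * usc x) (r *\<^sub>R uel x)"
text \<open>The first argument of the maximum is only needed when \<open>'a\<close> already has a unit: then the
  operator norm of left multiplication is degenerate.\<close>
definition "norm_unitz x = max (cmod (usc x)) (onorm (lmul x))"
definition "dist_unitz (x :: 'a unitz) y = norm (x - y)"
definition "sgn_unitz (x :: 'a unitz) = inverse (norm x) *\<^sub>R x"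
definition "uniformity = (INF e\<in>{0 <..}. principal {(x :: 'a unitz, y). dist x y < e})"
definition "open (U :: 'a unitz set) \<longleftrightarrow> (\<forall>x\<in>U. \<forall>\<^sub>F (x', y) in uniformity. x' = x \<longrightarrow> y \<in> U)"

lemmas unitz_defs0 = zero_unitz_def plus_unitz_def uminus_unitz_def minus_unitz_def scaleR_unitz_def

text \<open>Applying left multiplication to the vector \<open>star (uel x)\<close> recovers the
  squared norm of \<open>uel x\<close> up to a scalar term. Definiteness and completeness of the
  norm thereby reduce to the two components.\<close>

lemma norm_uel_le: "norm (uel x) \<le> 2 * norm x" for x :: "'a unitz"
proof -
  have "norm (uel x * star (uel x)) \<le> norm (lmul x (star (uel x))) + norm (usc x *\<^sub>C star (uel x))"
    using norm_triangle_ineq4[of "lmul x (star (uel x))" "usc x *\<^sub>C star (uel x)"] by (simp add: lmul_def)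
  also have "\<dots> \<le> onorm (lmul x) * norm (uel x) + cmod (usc x) * norm (uel x)"
    using norm_lmul_le[of x "star (uel x)"] by (simp add: norm_scaleC)
  also have "\<dots> \<le> norm x * norm (uel x) + norm x * norm (uel x)"
    by (intro add_mono mult_right_mono) (simp_all add: norm_unitz_def)
  also have "norm (uel x * star (uel x)) = norm (uel x) * norm (uel x)"
    using norm_star_mult_self[of "star (uel x)"] by (simp add: star_star power2_eq_square)
  finally have "norm (uel x) * norm (uel x) \<le> (2 * norm x) * norm (uel x)" by simp
  then show ?thesis
    by (cases "norm (uel x) = 0") (simp_all add: norm_unitz_def le_max_iff_disj)
qed

lemma norm_Unitz_le: "norm (Unitz c a) \<le> cmod c + norm a" for a :: 'a
proof -
  have "onorm (lmul (Unitz c a)) \<le> cmod c + norm a"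
  proof (rule onorm_bound)
    show "norm (lmul (Unitz c a) b) \<le> (cmod c + norm a) * norm b" for b
      using norm_triangle_ineq[of "c *\<^sub>C b" "a * b"] norm_mult_ineq[of a b]
      by (simp add: lmul_def norm_scaleC algebra_simps)
  qed simp
  then show ?thesis by (simp add: norm_unitz_def)
qed

instance
proof
  fix x y z :: "'a unitz" and r s :: real
  show "x + y + z = x + (y + z)" "x + y = y + x" "0 + x = x" "- x + x = 0" "x - y = x + - y"
    by (simp_all add: unitz_defs0 unitz.expand algebra_simps)
  show "r *\<^sub>R (x + y) = r *\<^sub>R x + r *\<^sub>R y" "(r + s) *\<^sub>R x = r *\<^sub>R x + s *\<^sub>R x"
      "r *\<^sub>R s *\<^sub>R x = (r * s) *\<^sub>R x" "1 *\<^sub>R x = x"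
    by (simp_all add: unitz_defs0 unitz.expand algebra_simps)
  show "dist x y = norm (x - y)" by (simp add: dist_unitz_def)
  show "sgn x = inverse (norm x) *\<^sub>R x" by (simp add: sgn_unitz_def)
  show "uniformity = (INF e\<in>{0 <..}. principal {(x :: 'a unitz, y). dist x y < e})"
    by (rule uniformity_unitz_def)
  show "open U \<longleftrightarrow> (\<forall>x\<in>U. \<forall>\<^sub>F (x', y) in uniformity. x' = x \<longrightarrow> y \<in> U)" for U :: "'a unitz set"
    by (rule open_unitz_def)
  have lR: "lmul (r *\<^sub>R x) = (\<lambda>b. r *\<^sub>R lmul x b)" for r and x :: "'a unitz"
    by (simp add: fun_eq_iff lmul_def unitz_defs0 scaleR_add_right) (simp add: scaleR_scaleC scaleC_scaleC)
  show nr: "norm (r *\<^sub>R x) = \<bar>r\<bar> * norm x"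
    unfolding norm_unitz_def lR onorm_scaleR[OF bounded_linear_lmul]
    by (simp add: scaleR_unitz_def norm_mult max_mult_distrib_left)
  show "norm x = 0 \<longleftrightarrow> x = 0"
  proof
    assume n: "norm x = 0"
    then have "usc x = 0" unfolding norm_unitz_def
      by (metis max.cobounded1 norm_le_zero_iff)
    moreover have "uel x = 0" using norm_uel_le[of x] n by simp
    ultimately show "x = 0" by (simp add: unitz_defs0 unitz.expand)
  next
    assume "x = 0"
    moreover have "lmul (0 :: 'a unitz) = (\<lambda>b. 0)" by (simp add: fun_eq_iff lmul_def zero_unitz_def)
    ultimately show "norm x = 0" by (simp add: norm_unitz_def onorm_zero) (simp add: zero_unitz_def)
  qed
  show "norm (x + y) \<le> norm x + norm y"
  proof -
    have "lmul (x + y) = (\<lambda>b. lmul x b + lmul y b)"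
      by (simp add: fun_eq_iff lmul_def unitz_defs0 scaleC_add_left distrib_right)
    then have "onorm (lmul (x + y)) \<le> onorm (lmul x) + onorm (lmul y)"
      using onorm_triangle[OF bounded_linear_lmul[of x] bounded_linear_lmul[of y]] by simp
    moreover have "cmod (usc (x + y)) \<le> cmod (usc x) + cmod (usc y)"
      by (simp add: unitz_defs0 norm_triangle_ineq)
    ultimately show ?thesis unfolding norm_unitz_def by linarith
  qed
qed

end

instance unitz :: (cstar_algebra) complete_space
proof
  fix X :: "nat \<Rightarrow> 'a unitz"
  assume X: "Cauchy X"
  have d: "dist x y = norm (x - y)" for x y :: "'a unitz" by (simp add: dist_unitz_def)
  have "Cauchy (\<lambda>n. usc (X n))"
  proof (rule metric_CauchyI)
    fix e :: real assume "0 < e"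
    then obtain M where M: "\<And>m n. m \<ge> M \<Longrightarrow> n \<ge> M \<Longrightarrow> norm (X m - X n) < e"
      using X unfolding Cauchy_def d by blast
    have "dist (usc (X m)) (usc (X n)) \<le> norm (X m - X n)" for m n
      by (simp add: dist_norm norm_unitz_def minus_unitz_def)
    then show "\<exists>M. \<forall>m\<ge>M. \<forall>n\<ge>M. dist (usc (X m)) (usc (X n)) < e" using M by (meson le_less_trans)
  qed
  then obtain c where c: "(\<lambda>n. usc (X n)) \<longlonglongrightarrow> c" using Cauchy_convergent_iff convergent_def by blast
  have "Cauchy (\<lambda>n. uel (X n))"
  proof (rule metric_CauchyI)
    fix e :: real assume "0 < e"
    then obtain M where M: "\<And>m n. m \<ge> M \<Longrightarrow> n \<ge> M \<Longrightarrow> norm (X m - X n) < e / 2"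
      using X unfolding Cauchy_def d by (meson half_gt_zero)
    have "dist (uel (X m)) (uel (X n)) \<le> 2 * norm (X m - X n)" for m n
      using norm_uel_le[of "X m - X n"] by (simp add: dist_norm minus_unitz_def)
    then show "\<exists>M. \<forall>m\<ge>M. \<forall>n\<ge>M. dist (uel (X m)) (uel (X n)) < e" using M by (smt (verit) field_sum_of_halves)
  qed
  then obtain a where a: "(\<lambda>n. uel (X n)) \<longlonglongrightarrow> a" using Cauchy_convergent_iff convergent_def by blast
  have "(\<lambda>n. cmod (usc (X n) - c) + norm (uel (X n) - a)) \<longlonglongrightarrow> 0 + 0"
    by (intro tendsto_add) (use a c in \<open>simp_all add: LIM_zero_iff tendsto_norm_zero_iff\<close>)
  then have l: "(\<lambda>n. cmod (usc (X n) - c) + norm (uel (X n) - a)) \<longlonglongrightarrow> 0" by simp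
  have "X \<longlonglongrightarrow> Unitz c a"
  proof (rule metric_LIMSEQ_I)
    fix e :: real assume "0 < e"
    then obtain N where N: "\<And>n. n \<ge> N \<Longrightarrow> cmod (usc (X n) - c) + norm (uel (X n) - a) < e"
      using l unfolding LIMSEQ_iff by fastforce
    have "dist (X n) (Unitz c a) \<le> cmod (usc (X n) - c) + norm (uel (X n) - a)" for n
      using norm_Unitz_le[of "usc (X n) - c" "uel (X n) - a"] by (simp add: d minus_unitz_def)
    then show "\<exists>N. \<forall>n\<ge>N. dist (X n) (Unitz c a) < e" using N by (meson le_less_trans)
  qed
  then show "convergent X" by (auto simp: convergent_def)
qed

instantiation unitz :: (cstar_algebra) cstar1
begin

definition "1 = Unitz 1 0"
definition "x * y = Unitz (usc x * usc y) (usc x *\<^sub>C uel y + usc y *\<^sub>C uel x + uel x * uel y)"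
definition "scaleC_unitz c x = Unitz (c * usc x) (c *\<^sub>C uel x)"
definition "csc_unitz c x = Unitz (c * usc x) (c *\<^sub>C uel x)"
definition "star_unitz x = Unitz (cnj (usc x)) (star (uel x))"

lemmas unitz_defs = unitz_defs0 one_unitz_def times_unitz_def scaleC_unitz_def csc_unitz_def star_unitz_def

lemma lmul_arith:
  "lmul (x + y) = (\<lambda>b. lmul x b + lmul y b)" "lmul (x * y) = lmul x \<circ> lmul y"
  "lmul (c *\<^sub>C x) = (\<lambda>b. c *\<^sub>C lmul x b)" "lmul 0 = (\<lambda>b. 0)" "lmul 1 = (\<lambda>b. b)"
  for x y :: "'a unitz"
  by (simp_all add: fun_eq_iff lmul_def unitz_defs scaleC_add_left scaleC_add_right scaleC_scaleC
      mult_scaleC_left mult_scaleC_right distrib_left distrib_right mult.assoc mult.commute[of "usc x" "usc y"])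

lemma onorm_lmul_scaleC: "onorm (lmul (c *\<^sub>C x)) = cmod c * onorm (lmul x)" for x :: "'a unitz"
proof -
  have le: "onorm (lmul (d *\<^sub>C y)) \<le> cmod d * onorm (lmul y)" for d and y :: "'a unitz"
  proof (rule onorm_bound)
    show "norm (lmul (d *\<^sub>C y) b) \<le> cmod d * onorm (lmul y) * norm b" for b
      using mult_left_mono[OF norm_lmul_le[of y b], of "cmod d"] by (simp add: lmul_arith norm_scaleC mult.assoc)
  qed (simp add: onorm_lmul_nonneg)
  show ?thesis
  proof (cases "c = 0")
    case True
    then have "c *\<^sub>C x = 0" by (simp add: unitz_defs)
    then show ?thesis by (simp add: True lmul_arith onorm_zero)
  next
    case False
    then have "inverse c *\<^sub>C (c *\<^sub>C x) = x" by (simp add: unitz_defs scaleC_scaleC unitz.expand)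
    then have "onorm (lmul x) \<le> cmod (inverse c) * onorm (lmul (c *\<^sub>C x))" using le[of "inverse c" "c *\<^sub>C x"] by simp
    then have "cmod c * onorm (lmul x) \<le> cmod c * (cmod (inverse c) * onorm (lmul (c *\<^sub>C x)))"
      by (rule mult_left_mono) simp
    moreover have "cmod c * cmod (inverse c) = 1" using False by (simp flip: norm_mult)
    ultimately have "cmod c * onorm (lmul x) \<le> onorm (lmul (c *\<^sub>C x))"
      by (simp only: mult.assoc[symmetric] mult_1)
    then show ?thesis using le[of c x] by simp
  qed
qed

text \<open>The C*-identity of the original algebra gives the squared norm of \<open>x b\<close> as
  the norm of \<open>star b (star x * x) b\<close>. This is one half of the C*-identity for the
  operator norm; submultiplicativity and invariance under \<open>star\<close> give the other
  half.\<close>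

lemma onorm_lmul_square: "(onorm (lmul x))\<^sup>2 \<le> onorm (lmul (star x * x))" for x :: "'a unitz"
proof -
  have "norm (lmul x b) \<le> sqrt (onorm (lmul (star x * x))) * norm b" for b
  proof -
    have "(norm (lmul x b))\<^sup>2 = norm (star (lmul x b) * lmul x b)" by (simp add: norm_star_mult_self)
    also have "star (lmul x b) * lmul x b = star b * lmul (star x * x) b"
      by (simp add: lmul_def unitz_defs star_add star_scaleC star_mult mult_scaleC_left mult_scaleC_right
          distrib_left distrib_right mult.assoc scaleC_scaleC scaleC_add_right mult.commute add_ac)
    also have "norm \<dots> \<le> norm b * (onorm (lmul (star x * x)) * norm b)"
      using norm_mult_ineq[of "star b" "lmul (star x * x) b"] mult_left_mono[OF norm_lmul_le[of "star x * x" b], of "norm b"]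
      by simp
    also have "\<dots> = (sqrt (onorm (lmul (star x * x))) * norm b)\<^sup>2"
      by (simp add: power_mult_distrib onorm_lmul_nonneg power2_eq_square)
    finally show ?thesis by (rule power2_le_imp_le) (simp add: onorm_lmul_nonneg)
  qed
  then have "onorm (lmul x) \<le> sqrt (onorm (lmul (star x * x)))"
    by (intro onorm_bound) (simp_all add: onorm_lmul_nonneg)
  then show ?thesis using onorm_lmul_nonneg
    by (metis power_mono real_sqrt_pow2)
qed

lemma onorm_lmul_mult: "onorm (lmul (x * y)) \<le> onorm (lmul x) * onorm (lmul y)" for x y :: "'a unitz"
  unfolding lmul_arith by (rule onorm_compose[OF bounded_linear_lmul bounded_linear_lmul])

lemma onorm_lmul_star: "onorm (lmul (star x)) = onorm (lmul x)" for x :: "'a unitz"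
proof -
  have le: "onorm (lmul y) \<le> onorm (lmul (star y))" for y :: "'a unitz"
  proof (cases "onorm (lmul y) = 0")
    case False
    then have "0 < onorm (lmul y)" using onorm_lmul_nonneg[of y] by simp
    moreover have "onorm (lmul y) * onorm (lmul y) \<le> onorm (lmul (star y)) * onorm (lmul y)"
      using onorm_lmul_square[of y] onorm_lmul_mult[of "star y" y] by (simp add: power2_eq_square)
    ultimately show ?thesis by simp
  qed (simp add: onorm_lmul_nonneg)
  have "star (star x) = x" by (simp add: unitz_defs star_star)
  then show ?thesis using le[of x] le[of "star x"] by simp
qed

instance
proof
  fix x y z :: "'a unitz" and c d :: complex and r s :: real
  show "x * y * z = x * (y * z)"
    by (simp add: unitz_defs mult.assoc distrib_left distrib_right scaleC_add_right scaleC_scaleC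
        mult_scaleC_left mult_scaleC_right add_ac mult.commute)
  show "1 * x = x" "x * 1 = x"
    by (simp_all add: unitz_defs unitz.expand)
  show "(x + y) * z = x * z + y * z" "x * (y + z) = x * y + x * z"
    by (simp_all add: unitz_defs distrib_left distrib_right scaleC_add_right scaleC_add_left add_ac)
  show "(0 :: 'a unitz) \<noteq> 1" by (simp add: unitz_defs)
  show "r *\<^sub>R x * y = r *\<^sub>R (x * y)" "x * r *\<^sub>R y = r *\<^sub>R (x * y)"
    by (simp_all add: unitz_defs scaleR_scaleC scaleC_add_right scaleC_scaleC mult_scaleC_left mult_scaleC_right
        mult.commute mult.left_commute)
  show "r *\<^sub>R x = complex_of_real r *\<^sub>C x" by (simp add: unitz_defs scaleR_scaleC)
  show "c *\<^sub>C (x + y) = c *\<^sub>C x + c *\<^sub>C y" "(c + d) *\<^sub>C x = c *\<^sub>C x + d *\<^sub>C x" "c *\<^sub>C d *\<^sub>C x = (c * d) *\<^sub>C x"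
    by (simp_all add: unitz_defs scaleC_add_right scaleC_add_left scaleC_scaleC algebra_simps)
  show "c *\<^sub>V (x + y) = c *\<^sub>V x + c *\<^sub>V y" "(c + d) *\<^sub>V x = c *\<^sub>V x + d *\<^sub>V x" "c *\<^sub>V d *\<^sub>V x = (c * d) *\<^sub>V x"
    by (simp_all add: unitz_defs scaleC_add_right scaleC_add_left scaleC_scaleC algebra_simps)
  show "1 *\<^sub>V x = x" by (simp add: unitz_defs unitz.expand)
  show "c *\<^sub>V x = c *\<^sub>C x" by (simp add: unitz_defs)
  show "(c *\<^sub>C x) * y = c *\<^sub>C (x * y)" "x * (c *\<^sub>C y) = c *\<^sub>C (x * y)"
    by (simp_all add: unitz_defs scaleC_add_right scaleC_scaleC mult_scaleC_left mult_scaleC_right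
        mult.commute mult.left_commute)
  have nc: "norm (c *\<^sub>C x) = cmod c * norm x" for c and x :: "'a unitz"
    using onorm_lmul_scaleC[of c x]
    by (simp add: norm_unitz_def norm_mult max_mult_distrib_left) (simp add: unitz_defs norm_mult)
  show "norm (c *\<^sub>C x) = cmod c * norm x" by (rule nc)
  show "star (star x) = x" by (simp add: unitz_defs star_star)
  show "star (x + y) = star x + star y" by (simp add: unitz_defs star_add)
  show "star (c *\<^sub>C x) = cnj c *\<^sub>C star x" by (simp add: unitz_defs star_scaleC)
  show "star (x * y) = star y * star x"
    by (simp add: unitz_defs star_add star_scaleC star_mult mult.commute add_ac)
  show "norm (star x * x) = (norm x)\<^sup>2"
  proof -
    have "onorm (lmul (star x * x)) = (onorm (lmul x))\<^sup>2"
      using onorm_lmul_square[of x] onorm_lmul_mult[of "star x" x] by (simp add: onorm_lmul_star power2_eq_square)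
    moreover have "cmod (usc (star x * x)) = (cmod (usc x))\<^sup>2"
      by (simp add: unitz_defs norm_mult power2_eq_square)
    moreover have "max (a\<^sup>2) (b\<^sup>2) = (max a b)\<^sup>2" if "0 \<le> a" "0 \<le> b" for a b :: real
      using that by (auto simp: max_def power2_le_iff_abs_le)
    ultimately show ?thesis by (simp add: norm_unitz_def onorm_lmul_nonneg)
  qed
  show "norm (x * y) \<le> norm x * norm y"
  proof -
    have le: "onorm (lmul z) \<le> norm z" "cmod (usc z) \<le> norm z" for z :: "'a unitz" by (simp_all add: norm_unitz_def)
    have "onorm (lmul (x * y)) \<le> norm x * norm y"
      using onorm_lmul_mult[of x y] mult_mono[OF le(1)[of x] le(1)[of y] norm_ge_zero onorm_lmul_nonneg]
      by (rule order_trans)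
    moreover have "cmod (usc (x * y)) \<le> norm x * norm y"
      using mult_mono[OF le(2)[of x] le(2)[of y] norm_ge_zero norm_ge_zero]
      by (simp add: times_unitz_def norm_mult)
    ultimately show ?thesis by (simp add: norm_unitz_def[of "x * y"])
  qed
  show "norm (1 :: 'a unitz) = 1"
  proof -
    have "onorm (\<lambda>b :: 'a. b) \<le> 1" by (rule onorm_bound) simp_all
    then show ?thesis by (simp add: norm_unitz_def lmul_arith) (simp add: one_unitz_def max_def)
  qed
qed

end

lemma unitz_split: "x = usc x *\<^sub>V 1 + Unitz 0 (uel (x :: 'a::cstar_algebra unitz))"
  by (simp add: unitz_defs unitz.expand)

section \<open>Compactness of pointwise bounded families\<close>

lemma compact_pointwise_bounded: "compact {f :: 'i \<Rightarrow> complex. \<forall>i. cmod (f i) \<le> B i}"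
proof -
  have "compactin (product_topology (\<lambda>_. euclidean) UNIV) (\<Pi>\<^sub>E i\<in>UNIV. cball (0 :: complex) (B i))"
    unfolding compactin_PiE by simp
  then have "compact (\<Pi>\<^sub>E i\<in>UNIV. cball (0 :: complex) (B i))"
    by (simp add: euclidean_product_topology)
  moreover have "(\<Pi>\<^sub>E i\<in>UNIV. cball (0 :: complex) (B i)) = {f. \<forall>i. cmod (f i) \<le> B i}"
    by (auto simp: PiE_def Pi_def extensional_def)
  ultimately show ?thesis by simp
qed

text \<open>Compactness in the form in which limits are taken below: if any finitely many closed
  conditions have a solution within fixed pointwise bounds, then all of them have a common
  one.\<close>

lemma pointwise_bounded_fip:
  fixes B :: "'i \<Rightarrow> real"
  assumes cl: "\<And>S. S \<in> \<F> \<Longrightarrow> closed S"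
    and fip: "\<And>F. finite F \<Longrightarrow> F \<subseteq> \<F> \<Longrightarrow> \<exists>f\<in>\<Inter>F. \<forall>i. cmod (f i) \<le> B i"
  obtains f where "f \<in> \<Inter>\<F>" "\<And>i. cmod (f i) \<le> B i"
proof -
  have "{f :: 'i \<Rightarrow> complex. \<forall>i. cmod (f i) \<le> B i} \<inter> \<Inter>\<F> \<noteq> {}"
    by (rule compact_imp_fip[OF compact_pointwise_bounded cl]) (use fip in blast)+
  then show ?thesis using that by blast
qed

section \<open>Domination by a positive functional\<close>

text \<open>Along unitaries \<open>u\<close> that nearly maximize \<open>E\<close>, the functionals \<open>b \<mapsto> E (u b) u\<close> nearly
  dominate \<open>E\<close> on squares: expand \<open>E (u w)\<close> to second order at the unitary
  \<open>w = sqrt (1 - t\<^sup>2 k\<^sup>2) + i t k\<close>. The polar decomposition reduces general elements to squares.\<close>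

theorem dominating_functional:
  fixes E :: "'b::cstar1 \<Rightarrow> 'b \<Rightarrow> complex"
  assumes E: "pform E" and bd: "\<And>c b. qf E (c * b) \<le> K * (norm c)\<^sup>2 * qf E b" and K: "1 \<le> K"
  obtains f where "\<And>a b. f (a + b) = f a + f b" "\<And>c a. f (c *\<^sub>V a) = c * f a"
    "\<And>b. qf E b \<le> 2 * K * Re (f (star b * b))"
proof -
  note h = pform_onD(1)[OF E]
  define e1 where "e1 = qf E 1"
  have e1: "0 \<le> e1" unfolding e1_def by (rule pform_onD(2)[OF E]) simp
  define \<phi> where "\<phi> u b = E (u * b) u" for u b
  have Eb: "qf E b \<le> K * (norm b)\<^sup>2 * e1" for b using bd[of b 1] by (simp add: e1_def)
  have Eu: "qf E u \<le> K * e1" if "unitary u" for u using Eb[of u] norm_unitary[OF that] by simp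
  have \<phi>_bd: "cmod (\<phi> u b) \<le> K * e1 * norm b" if u: "unitary u" for u b
  proof -
    have "norm (u * b) \<le> norm b" using norm_mult_ineq[of u b] norm_unitary[OF u] by simp
    then have "(norm (u * b))\<^sup>2 \<le> (norm b)\<^sup>2" by (simp add: power_mono)
    then have "K * e1 * (norm (u * b))\<^sup>2 \<le> K * e1 * (norm b)\<^sup>2" using K e1 by (intro mult_left_mono) auto
    then have "qf E (u * b) \<le> K * e1 * (norm b)\<^sup>2" using Eb[of "u * b"] by (simp add: mult.commute mult.left_commute)
    then have "qf E (u * b) * qf E u \<le> (K * e1 * (norm b)\<^sup>2) * (K * e1)"
      using Eu[OF u] pform_onD(2)[OF E, of u] K e1 by (intro mult_mono) auto
    then have "(cmod (\<phi> u b))\<^sup>2 \<le> (K * e1 * (norm b)\<^sup>2) * (K * e1)"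
      unfolding \<phi>_def by (rule order_trans[OF pf_cauchy_schwarz[OF E UNIV_I UNIV_I]])
    then have "(cmod (\<phi> u b))\<^sup>2 \<le> (K * e1 * norm b)\<^sup>2"
      by (simp add: power2_eq_square mult_ac)
    then show ?thesis by (rule power2_le_imp_le) (use K e1 in simp)
  qed
  have \<phi>_add: "\<phi> u (a + b) = \<phi> u a + \<phi> u b" for u a b by (simp add: \<phi>_def distrib_left hf_addl[OF h])
  have \<phi>_csc: "\<phi> u (c *\<^sub>V a) = c * \<phi> u a" for u c a by (simp add: \<phi>_def mult_csc_right hf_cscl[OF h])
  define near where "near \<epsilon> u \<longleftrightarrow> unitary u \<and> (\<forall>v. unitary v \<longrightarrow> qf E v \<le> qf E u + \<epsilon>)" for \<epsilon> u
  have square: "t\<^sup>2 * qf E (u * k) \<le> t\<^sup>2 * Re (\<phi> u (k * k)) + K * e1 * (t\<^sup>2 * (norm k)\<^sup>2)\<^sup>2 + \<epsilon>"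
    if u: "near \<epsilon> u" and k: "sa k" and t: "0 < t" "t * norm k \<le> 1" for \<epsilon> u k t
  proof -
    define l where "l = t *\<^sub>R k"
    have l: "sa l" "norm l \<le> 1" using k t by (simp_all add: l_def sa_intros)
    obtain s where s: "sa s" "s * s = 1 - l * l" "norm (1 - s) \<le> (norm l)\<^sup>2" "unitary (s + \<i> *\<^sub>V l)"
      using unitary_dilation[OF l] by metis
    define y where "y = 1 - s"
    \<comment> \<open>So \<open>y\<close> is half of \<open>l * l\<close> up to fourth order,
      without any power series.\<close>
    have yy: "y + y = l * l + y * y" by (simp add: y_def algebra_simps s(2))
    have uu: "unitary u" using u by (simp add: near_def)
    have "star (s + \<i> *\<^sub>V l) = s - \<i> *\<^sub>V l" using s(1) l(1) by (simp add: star_add star_csc sa_def)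
    then have "unitary (s - \<i> *\<^sub>V l)" using unitary_star[OF s(4)] by simp
    then have "qf E (u * (s + \<i> *\<^sub>V l)) \<le> qf E u + \<epsilon>" "qf E (u * (s - \<i> *\<^sub>V l)) \<le> qf E u + \<epsilon>"
      using u s(4) unitary_mult[OF uu] by (auto simp: near_def)
    \<comment> \<open>Adding the two signs of \<open>i l\<close> removes the first-order term in
      \<open>l\<close>.\<close>
    moreover have "qf E (u * (s + \<i> *\<^sub>V l)) + qf E (u * (s - \<i> *\<^sub>V l)) = 2 * qf E (u * s) + 2 * qf E (u * l)"
    proof -
      have "qf E (\<i> *\<^sub>V (u * l)) = qf E (u * l)" using qf_csc[OF h, of "u * l" \<i>] by simp
      then show ?thesis
        using qf_parallelogram[OF h, of "u * s" "\<i> *\<^sub>V (u * l)"]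
        by (simp add: distrib_left right_diff_distrib mult_csc_right)
    qed
    ultimately have a: "qf E (u * s) + qf E (u * l) \<le> qf E u + \<epsilon>" by linarith
    have "qf E (u * s) = qf E (u - u * y)" by (simp add: y_def algebra_simps)
    also have "\<dots> = qf E u - 2 * Re (E u (u * y)) + qf E (u * y)" by (rule qf_diff[OF h]) simp_all
    also have "Re (E u (u * y)) = Re (\<phi> u y)" unfolding \<phi>_def by (rule hf_Re_sym[OF h]) simp_all
    finally have "qf E (u * l) \<le> 2 * Re (\<phi> u y) + \<epsilon>"
      using a pform_onD(2)[OF E, of "u * y"] by simp
    also have "2 * Re (\<phi> u y) = Re (\<phi> u (l * l)) + Re (\<phi> u (y * y))"
      using arg_cong[OF yy, of "\<lambda>z. Re (\<phi> u z)"] by (simp add: \<phi>_add)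
    also have "Re (\<phi> u (y * y)) \<le> K * e1 * ((norm l)\<^sup>2)\<^sup>2"
    proof -
      have "Re (\<phi> u (y * y)) \<le> K * e1 * norm (y * y)"
        by (rule order_trans[OF complex_Re_le_cmod \<phi>_bd[OF uu]])
      also have "norm (y * y) \<le> norm y * norm y" by (rule norm_mult_ineq)
      also have "\<dots> \<le> ((norm l)\<^sup>2)\<^sup>2"
        unfolding power2_eq_square[of "(norm l)\<^sup>2"] using s(3) by (intro mult_mono) (simp_all add: y_def)
      finally show ?thesis using K e1 by (simp add: mult_left_mono)
    qed
    also have "qf E (u * l) = t\<^sup>2 * qf E (u * k)"
      using qf_csc[OF h, of "u * k" "of_real t"] by (simp add: l_def scaleR_csc mult_csc_right)
    also have "\<phi> u (l * l) = of_real (t\<^sup>2) * \<phi> u (k * k)"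
      by (simp add: l_def scaleR_csc mult_csc_right mult_csc_left \<phi>_csc power2_eq_square)
    also have "norm l = t * norm k" using t by (simp add: l_def)
    finally show ?thesis by (simp add: power_mult_distrib)
  qed
  have dom: "\<exists>\<epsilon>>0. \<forall>u. near \<epsilon> u \<longrightarrow> qf E b \<le> 2 * K * (Re (\<phi> u (star b * b)) + \<eta>)" if \<eta>: "0 < \<eta>" for b \<eta>
  proof -
    define d where "d = \<eta> / (3 * (K * e1 + 1))"
    have Ke: "0 \<le> K * e1" using K e1 by simp
    have d: "0 < d" "d * (K * e1) \<le> \<eta> / 3"
      using \<eta> Ke by (auto simp: d_def field_simps)
    obtain k v where kv: "sa k" "k * k = star b * b + d *\<^sub>R 1" "b = v * k" "(norm v)\<^sup>2 \<le> 2"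
      by (rule approximate_polar_decomposition[OF d(1)])
    define C where "C = K * e1 * (norm k)\<^sup>2 * (norm k)\<^sup>2"
    have C: "0 \<le> C" using Ke by (simp add: C_def)
    \<comment> \<open>The first argument makes \<open>t k\<close> a contraction; the second makes
      the fourth-order error, after division by the square of \<open>t\<close>, at most
      \<open>\<eta> / 3\<close>. The other two thirds of \<open>\<eta>\<close> pay for the near
      maximality of \<open>u\<close>, through \<open>\<epsilon>\<close>, and for the shift
      \<open>d\<close>.\<close>
    define t where "t = min (1 / (norm k + 1)) (sqrt (\<eta> / (3 * (C + 1))))"
    have nk: "0 < norm k + 1" by (simp add: add_nonneg_pos)
    then have t: "0 < t" using \<eta> C by (simp add: t_def)
    have "t * norm k \<le> (1 / (norm k + 1)) * norm k" by (rule mult_right_mono) (simp_all add: t_def)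
    also have "\<dots> \<le> 1" using nk by simp
    finally have tk: "t * norm k \<le> 1" .
    have "t\<^sup>2 \<le> (sqrt (\<eta> / (3 * (C + 1))))\<^sup>2" using t by (intro power_mono) (simp_all add: t_def)
    also have "\<dots> = \<eta> / (3 * (C + 1))" using \<eta> C by simp
    finally have "t\<^sup>2 * C \<le> \<eta> / (3 * (C + 1)) * C" using C by (rule mult_right_mono)
    also have "\<dots> \<le> \<eta> / 3" using \<eta> C by (simp add: field_simps)
    finally have tC: "t\<^sup>2 * C \<le> \<eta> / 3" .
    define \<epsilon> where "\<epsilon> = t\<^sup>2 * (\<eta> / 3)"
    have "qf E b \<le> 2 * K * (Re (\<phi> u (star b * b)) + \<eta>)" if u: "near \<epsilon> u" for u
    proof -
      have uu: "unitary u" using u by (simp add: near_def)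
      have "t\<^sup>2 * qf E (u * k) \<le> t\<^sup>2 * Re (\<phi> u (k * k)) + K * e1 * (t\<^sup>2 * (norm k)\<^sup>2)\<^sup>2 + \<epsilon>"
        by (rule square[OF u kv(1) t tk])
      also have "\<dots> = t\<^sup>2 * (Re (\<phi> u (k * k)) + t\<^sup>2 * C + \<eta> / 3)"
        by (simp add: \<epsilon>_def C_def power2_eq_square algebra_simps)
      finally have "qf E (u * k) \<le> Re (\<phi> u (k * k)) + t\<^sup>2 * C + \<eta> / 3" using t by simp
      moreover have "\<phi> u (k * k) = \<phi> u (star b * b) + of_real d * E u u"
        by (simp add: kv(2) \<phi>_add scaleR_csc \<phi>_csc) (simp add: \<phi>_def)
      moreover have "d * qf E u \<le> \<eta> / 3"
        using mult_left_mono[OF Eu[OF uu], of d] d by linarith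
      ultimately have uk: "qf E (u * k) \<le> Re (\<phi> u (star b * b)) + \<eta>" using tC by simp
      \<comment> \<open>The bound \<open>bd\<close> carries the estimate from \<open>u * k\<close>
        over to \<open>b\<close> at the cost of \<open>K\<close> times the squared norm of
        \<open>v\<close>, which is at most \<open>2 * K\<close>. This is the constant of the
        conclusion.\<close>
      have "b = (v * star u) * (u * k)"
      proof -
        have "(v * star u) * (u * k) = v * (star u * u) * k" by (simp only: mult.assoc)
        then show ?thesis using uu kv(3) by (simp add: unitary_def)
      qed
      then have "qf E b \<le> K * (norm (v * star u))\<^sup>2 * qf E (u * k)" using bd by metis
      also have "\<dots> \<le> K * 2 * qf E (u * k)"
      proof -
        have "(norm (v * star u))\<^sup>2 \<le> (norm v)\<^sup>2"
          using norm_mult_unitary_right[OF unitary_star[OF uu], of v] by (simp add: power_mono)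
        then have "(norm (v * star u))\<^sup>2 \<le> 2" using kv(4) by linarith
        then show ?thesis using K pform_onD(2)[OF E, of "u * k"]
          by (intro mult_right_mono mult_left_mono) auto
      qed
      also have "\<dots> \<le> K * 2 * (Re (\<phi> u (star b * b)) + \<eta>)" using uk K by (intro mult_left_mono) auto
      finally show ?thesis by (simp add: mult.commute)
    qed
    moreover have "0 < \<epsilon>" using t \<eta> by (simp add: \<epsilon>_def)
    ultimately show ?thesis by blast
  qed
  \<comment> \<open>The sets that contain \<open>\<phi> u\<close> for all unitaries \<open>u\<close>
    close enough to the supremum. They are stable under finite intersections, and \<open>f\<close>
    is a cluster point of the resulting filter.\<close>
  define good where "good S \<longleftrightarrow> (\<exists>\<epsilon>>0. \<forall>u. near \<epsilon> u \<longrightarrow> \<phi> u \<in> S)" for S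
  have near_mono: "near \<epsilon> u \<Longrightarrow> \<epsilon> \<le> \<epsilon>' \<Longrightarrow> near \<epsilon>' u" for \<epsilon> \<epsilon>' u unfolding near_def by force
  have near_ex: "\<exists>u. near \<epsilon> u" if \<epsilon>: "0 < \<epsilon>" for \<epsilon>
  proof -
    define U where "U = qf E ` {u. unitary u}"
    have ne: "U \<noteq> {}" unfolding U_def using unitary_one by blast
    have bdd: "bdd_above U" unfolding U_def by (rule bdd_aboveI2[of _ _ "K * e1"]) (simp add: Eu)
    obtain x where x: "x \<in> U" "Sup U - \<epsilon> < x" using less_cSupD[OF ne, of "Sup U - \<epsilon>"] \<epsilon> by auto
    then obtain u where u: "unitary u" "x = qf E u" by (auto simp: U_def)
    have "qf E v \<le> qf E u + \<epsilon>" if "unitary v" for v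
      using cSup_upper[OF _ bdd, of "qf E v"] that x u by (auto simp: U_def)
    then show ?thesis using u by (auto simp: near_def)
  qed
  obtain f where f: "f \<in> \<Inter>{S. closed S \<and> good S}"
  proof (rule pointwise_bounded_fip)
    show "closed S" if "S \<in> {S. closed S \<and> good S}" for S using that by simp
    fix F assume F: "finite F" "F \<subseteq> {S. closed S \<and> good S}"
    from F have "good (\<Inter>F)"
    proof (induction rule: finite_induct)
      case empty
      show ?case by (auto simp: good_def intro: exI[of _ 1])
    next
      case (insert S F)
      then obtain \<epsilon>1 \<epsilon>2 where "0 < \<epsilon>1" "0 < \<epsilon>2" "\<forall>u. near \<epsilon>1 u \<longrightarrow> \<phi> u \<in> S" "\<forall>u. near \<epsilon>2 u \<longrightarrow> \<phi> u \<in> \<Inter>F"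
        by (auto simp: good_def)
      then have "0 < min \<epsilon>1 \<epsilon>2 \<and> (\<forall>u. near (min \<epsilon>1 \<epsilon>2) u \<longrightarrow> \<phi> u \<in> \<Inter>(insert S F))"
        using near_mono[of "min \<epsilon>1 \<epsilon>2"] by auto
      then show ?case unfolding good_def by blast
    qed
    then obtain u \<epsilon> where "near \<epsilon> u" "\<phi> u \<in> \<Inter>F" using near_ex unfolding good_def by metis
    then show "\<exists>f\<in>\<Inter>F. \<forall>b. cmod (f b) \<le> K * e1 * norm b"
      using \<phi>_bd unfolding near_def by blast
  qed
  have inS: "f \<in> S" if "closed S" "good S" for S using f that by blast
  have goodI: "good S" if "\<And>u. near 1 u \<Longrightarrow> \<phi> u \<in> S" for S
    unfolding good_def using that zero_less_one by blast
  show ?thesis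
  proof (rule that[of f])
    fix a b
    have "f \<in> {f. f (a + b) = f a + f b}"
    proof (rule inS[OF closed_Collect_eq goodI])
      show "\<phi> u \<in> {f. f (a + b) = f a + f b}" for u by (simp add: \<phi>_add)
    qed (intro continuous_intros continuous_on_product_coordinates)+
    then show "f (a + b) = f a + f b" by simp
  next
    fix c a
    have "f \<in> {f. f (c *\<^sub>V a) = c * f a}"
    proof (rule inS[OF closed_Collect_eq goodI])
      show "\<phi> u \<in> {f. f (c *\<^sub>V a) = c * f a}" for u by (simp add: \<phi>_csc)
    qed (intro continuous_intros continuous_on_product_coordinates)+
    then show "f (c *\<^sub>V a) = c * f a" by simp
  next
    fix b
    have le: "qf E b \<le> 2 * K * (Re (f (star b * b)) + \<eta>)" if \<eta>: "0 < \<eta>" for \<eta>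
    proof -
      have "f \<in> {f. qf E b \<le> 2 * K * (Re (f (star b * b)) + \<eta>)}"
      proof (rule inS[OF closed_Collect_le])
        show "good {f. qf E b \<le> 2 * K * (Re (f (star b * b)) + \<eta>)}"
          using dom[OF \<eta>, of b] by (simp add: good_def)
      qed (intro continuous_intros continuous_on_product_coordinates)+
      then show ?thesis by simp
    qed
    show "qf E b \<le> 2 * K * Re (f (star b * b))"
    proof (rule field_le_epsilon)
      fix \<eta> :: real assume "0 < \<eta>"
      then have "0 < \<eta> / (2 * K)" using K by simp
      from le[OF this] show "qf E b \<le> 2 * K * Re (f (star b * b)) + \<eta>" 
        using K by (simp add: distrib_left)
    qed
  qed
qed

section \<open>The dual space of a semi-inner product space\<close>

lemma fun_csc [simp]: "(c *\<^sub>V v) x = c * v x" for v :: "'v \<Rightarrow> complex"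
  by (simp add: csc_fun_def csc_complex_def)

definition antilin :: "('v::cvec \<Rightarrow> complex) \<Rightarrow> bool"
  where "antilin v \<longleftrightarrow> (\<forall>x y. v (x + y) = v x + v y) \<and> (\<forall>c x. v (c *\<^sub>V x) = cnj c * v x)"

text \<open>The Hilbert space completion of \<open>q\<close> modulo null vectors. Functionals are
  taken antilinear so that \<open>x \<mapsto> q x\<close> is a linear map into the space.\<close>

definition dualsp :: "('v::cvec \<Rightarrow> 'v \<Rightarrow> complex) \<Rightarrow> ('v \<Rightarrow> complex) set"
  where "dualsp q = {v. antilin v \<and> (\<exists>C. \<forall>x. (cmod (v x))\<^sup>2 \<le> C * qf q x)}"

text \<open>The square of the dual norm, written as a Legendre transform. This avoids quotients by
  \<open>qf q x\<close>, which may vanish, and turns shifts of the variable into completions of the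
  square.\<close>

definition dualnorm :: "('v::cvec \<Rightarrow> 'v \<Rightarrow> complex) \<Rightarrow> ('v \<Rightarrow> complex) \<Rightarrow> real"
  where "dualnorm q v = (SUP x. 2 * Re (v x) - qf q x)"

lemma antilin_diff: "antilin v \<Longrightarrow> v (x - y) = v x - v y"
proof -
  assume v: "antilin v"
  have "v (x + (-1) *\<^sub>V y) = v x + cnj (-1) * v y" using v unfolding antilin_def by metis
  then show ?thesis by simp
qed

lemma antilin_zero: "antilin v \<Longrightarrow> v 0 = 0"
  using antilin_diff[of v 0 0] by simp

lemma hform_eqI:
  assumes A: "hform_on S A" and B: "hform_on S B" and eq: "\<And>x. x \<in> S \<Longrightarrow> qf A x = qf B x"
    and x: "x \<in> S" and y: "y \<in> S"
  shows "A x y = B x y"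
proof -
  have Re: "Re (A x z) = Re (B x z)" if z: "z \<in> S" for z
    using qf_add[OF A x z] qf_add[OF B x z] eq[OF csub_add[OF hf_csub[OF A] x z]] eq[OF x] eq[OF z] by simp
  have "Re (A x (\<i> *\<^sub>V y)) = Re (B x (\<i> *\<^sub>V y))" by (rule Re[OF csub_csc[OF hf_csub[OF A] y]])
  then have "Im (A x y) = Im (B x y)" by (simp add: hf_cscr[OF A y x] hf_cscr[OF B y x])
  then show ?thesis using Re[OF y] by (simp add: complex_eq_iff)
qed

context
  fixes q :: "'v::cvec \<Rightarrow> 'v \<Rightarrow> complex"
  assumes q: "pform q"
begin

private lemmas h = pform_onD(1)[OF q]

private lemma q0: "0 \<le> qf q x"
  by (rule pform_onD(2)[OF q]) simp

lemma dual_bound_nonneg: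
  assumes "v \<in> dualsp q"
  obtains C where "0 \<le> C" "\<And>x. (cmod (v x))\<^sup>2 \<le> C * qf q x"
proof -
  obtain C where C: "\<And>x. (cmod (v x))\<^sup>2 \<le> C * qf q x" using assms by (auto simp: dualsp_def)
  have "(cmod (v x))\<^sup>2 \<le> max 0 C * qf q x" for x
    by (rule order_trans[OF C]) (simp add: mult_right_mono q0)
  then show ?thesis using that[of "max 0 C"] by simp
qed

lemma Re_le_of_square_le:
  assumes C: "0 \<le> C" and le: "(cmod z)\<^sup>2 \<le> C * qf q x"
  shows "2 * Re z - qf q x \<le> C"
proof -
  have "cmod z \<le> sqrt (C * qf q x)" using le by (rule real_le_rsqrt)
  also have "\<dots> = sqrt C * sqrt (qf q x)" by (rule real_sqrt_mult)
  finally have "2 * Re z \<le> 2 * (sqrt C * sqrt (qf q x))" using complex_Re_le_cmod[of z] by simp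
  moreover have "0 \<le> (sqrt C - sqrt (qf q x))\<^sup>2" by simp
  then have "2 * (sqrt C * sqrt (qf q x)) \<le> C + qf q x" using C q0 by (simp add: power2_diff)
  ultimately show ?thesis by simp
qed

lemma dualnorm_le: "0 \<le> C \<Longrightarrow> (\<And>x. (cmod (v x))\<^sup>2 \<le> C * qf q x) \<Longrightarrow> dualnorm q v \<le> C"
  unfolding dualnorm_def by (rule cSUP_least) (simp_all add: Re_le_of_square_le)

lemma dualnorm_least: "(\<And>x. 2 * Re (v x) - qf q x \<le> B) \<Longrightarrow> dualnorm q v \<le> B"
  unfolding dualnorm_def by (rule cSUP_least) simp_all

lemma dualnorm_upper: "v \<in> dualsp q \<Longrightarrow> 2 * Re (v x) - qf q x \<le> dualnorm q v"
proof -
  assume "v \<in> dualsp q"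
  then obtain C where "0 \<le> C" "\<And>x. (cmod (v x))\<^sup>2 \<le> C * qf q x" by (rule dual_bound_nonneg) blast
  then have "bdd_above (range (\<lambda>x. 2 * Re (v x) - qf q x))"
    by (intro bdd_aboveI2[of _ _ C]) (simp add: Re_le_of_square_le)
  then show ?thesis unfolding dualnorm_def by (rule cSUP_upper[OF UNIV_I])
qed

lemma dualnorm_nonneg: "v \<in> dualsp q \<Longrightarrow> 0 \<le> dualnorm q v"
  using dualnorm_upper[of v 0] antilin_zero[of v] qf_zero[OF h] by (simp add: dualsp_def)

lemma dualsp_antilin: "v \<in> dualsp q \<Longrightarrow> antilin v"
  by (simp add: dualsp_def)

lemma dualnorm_cauchy_schwarz:
  assumes v: "v \<in> dualsp q"
  shows "(cmod (v x))\<^sup>2 \<le> dualnorm q v * qf q x"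
proof (cases "qf q x = 0 \<or> v x = 0")
  case True
  obtain C where "0 \<le> C" "\<And>x. (cmod (v x))\<^sup>2 \<le> C * qf q x" using v by (rule dual_bound_nonneg) blast
  then have "v x = 0" using True by (metis mult_zero_right norm_le_zero_iff power2_le_iff_abs_le abs_norm_cancel order_refl real_sqrt_le_iff real_sqrt_zero real_sqrt_abs)
  then show ?thesis using dualnorm_nonneg[OF v] q0[of x] by simp
next
  case False
  then have qx: "0 < qf q x" using q0[of x] by simp
  \<comment> \<open>\<open>c *\<^sub>V x\<close> maximizes the expression in \<open>dualnorm\<close>
    along the line through \<open>x\<close>.\<close>
  define c where "c = v x / of_real (qf q x)"
  have "v (c *\<^sub>V x) = cnj c * v x" using dualsp_antilin[OF v] by (simp add: antilin_def)
  also have "\<dots> = of_real ((cmod (v x))\<^sup>2 / qf q x)"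
    using complex_norm_square[of "v x"] by (simp add: c_def mult.commute)
  finally have 1: "Re (v (c *\<^sub>V x)) = (cmod (v x))\<^sup>2 / qf q x" by simp
  have "qf q (c *\<^sub>V x) = (cmod c)\<^sup>2 * qf q x" by (rule qf_csc[OF h]) simp
  also have "\<dots> = (cmod (v x))\<^sup>2 / qf q x"
    using qx by (simp add: c_def norm_divide power_divide power2_eq_square)
  finally have "(cmod (v x))\<^sup>2 / qf q x \<le> dualnorm q v"
    using dualnorm_upper[OF v, of "c *\<^sub>V x"] 1 by simp
  then show ?thesis using qx by (simp add: field_simps)
qed

lemma csub_dualsp: "csub (dualsp q)"
  unfolding csub_def
proof (intro conjI ballI allI)
  show "0 \<in> dualsp q" by (auto simp: dualsp_def antilin_def intro!: exI[of _ 0])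
next
  fix v w assume v: "v \<in> dualsp q" and w: "w \<in> dualsp q"
  obtain C D where C: "\<And>x. (cmod (v x))\<^sup>2 \<le> C * qf q x" and D: "\<And>x. (cmod (w x))\<^sup>2 \<le> D * qf q x"
    using v w by (auto simp: dualsp_def)
  have "(cmod ((v + w) x))\<^sup>2 \<le> (2 * C + 2 * D) * qf q x" for x
  proof -
    have "(cmod (v x + w x))\<^sup>2 \<le> (cmod (v x) + cmod (w x))\<^sup>2" by (intro power_mono norm_triangle_ineq) simp
    also have "\<dots> \<le> 2 * (cmod (v x))\<^sup>2 + 2 * (cmod (w x))\<^sup>2"
      using zero_le_power2[of "cmod (v x) - cmod (w x)"] by (simp add: power2_sum power2_diff)
    finally show ?thesis using C[of x] D[of x] by (simp add: distrib_right)
  qed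
  moreover have "antilin (v + w)"
    using dualsp_antilin[OF v] dualsp_antilin[OF w] by (simp add: antilin_def algebra_simps)
  ultimately show "v + w \<in> dualsp q" unfolding dualsp_def by blast
next
  fix c v assume v: "v \<in> dualsp q"
  obtain C where C: "\<And>x. (cmod (v x))\<^sup>2 \<le> C * qf q x" using v by (auto simp: dualsp_def)
  have "(cmod ((c *\<^sub>V v) x))\<^sup>2 \<le> ((cmod c)\<^sup>2 * C) * qf q x" for x
    using mult_left_mono[OF C[of x], of "(cmod c)\<^sup>2"] by (simp add: norm_mult power_mult_distrib mult.assoc)
  moreover have "antilin (c *\<^sub>V v)"
    using dualsp_antilin[OF v] by (simp add: antilin_def algebra_simps)
  ultimately show "c *\<^sub>V v \<in> dualsp q" unfolding dualsp_def by blast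
qed

lemma dual_embed: "q x \<in> dualsp q"
proof -
  have "antilin (q x)" by (simp add: antilin_def hf_addr[OF h] hf_cscr[OF h])
  then show ?thesis using pf_cauchy_schwarz[OF q, of x] by (auto simp: dualsp_def)
qed

text \<open>Replacing the variable of the supremum by \<open>x + y\<close> completes the square. The
  norm of \<open>q x\<close>, the density of these elements and the formula
  \<open>ip v (q x) = v x\<close> all follow from this identity.\<close>

lemma dualnorm_add_embed:
  assumes v: "v \<in> dualsp q"
  shows "dualnorm q (v + q x) = dualnorm q v + 2 * Re (v x) + qf q x"
proof -
  have key: "2 * Re ((v + q x) (x + y)) - qf q (x + y) = (2 * Re (v y) - qf q y) + 2 * Re (v x) + qf q x" for y
    using dualsp_antilin[OF v] qf_add[OF h UNIV_I UNIV_I, of x y] hf_addr[OF h UNIV_I UNIV_I UNIV_I, of x x y]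
    by (simp add: antilin_def)
  note vx = csub_add[OF csub_dualsp v dual_embed[of x]]
  have "2 * Re (v y) - qf q y \<le> dualnorm q (v + q x) - 2 * Re (v x) - qf q x" for y
    using dualnorm_upper[OF vx, of "x + y"] unfolding key by linarith
  then have "dualnorm q v \<le> dualnorm q (v + q x) - 2 * Re (v x) - qf q x" by (rule dualnorm_least)
  moreover have "dualnorm q (v + q x) \<le> dualnorm q v + 2 * Re (v x) + qf q x"
  proof (rule dualnorm_least)
    fix z show "2 * Re ((v + q x) z) - qf q z \<le> dualnorm q v + 2 * Re (v x) + qf q x"
      using dualnorm_upper[OF v, of "z - x"] key[of "z - x"] by simp
  qed
  ultimately show ?thesis by linarith
qed

lemma dualnorm_zero: "dualnorm q 0 = 0"
proof -
  have "dualnorm q 0 \<le> 0" by (rule dualnorm_least) (simp add: q0)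
  then show ?thesis using dualnorm_nonneg[OF csub_zero[OF csub_dualsp]] by simp
qed

lemma dualnorm_embed: "dualnorm q (q x) = qf q x"
  using dualnorm_add_embed[OF csub_zero[OF csub_dualsp], of x] dualnorm_zero by simp

text \<open>Density of the image of \<open>q\<close>: by completion of the square, the amount by
  which \<open>x\<close> misses the supremum for \<open>v\<close> is exactly the squared distance of
  \<open>v\<close> from \<open>q x\<close>. The sign of \<open>x\<close> is reversed to obtain a
  sum.\<close>

lemma dualnorm_approx:
  assumes v: "v \<in> dualsp q" and e: "0 < e"
  obtains x where "dualnorm q (v + q x) < e"
proof -
  have "\<not> (\<forall>x. 2 * Re (v x) - qf q x \<le> dualnorm q v - e)"
    using dualnorm_least[of v "dualnorm q v - e"] e by auto
  then obtain x where "dualnorm q v - e < 2 * Re (v x) - qf q x" by (auto simp: not_le)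
  moreover have "v (- x) = - v x" using antilin_diff[OF dualsp_antilin[OF v], of 0 x] antilin_zero[OF dualsp_antilin[OF v]] by simp
  ultimately have "dualnorm q (v + q (- x)) < e"
    using dualnorm_add_embed[OF v, of "- x"] qf_minus[OF h, of x] by simp
  then show ?thesis by (rule that)
qed

lemma dualnorm_csc:
  assumes v: "v \<in> dualsp q"
  shows "dualnorm q (c *\<^sub>V v) = (cmod c)\<^sup>2 * dualnorm q v"
proof -
  have le: "dualnorm q (d *\<^sub>V w) \<le> (cmod d)\<^sup>2 * dualnorm q w" if w: "w \<in> dualsp q" for d w
  proof (rule dualnorm_le)
    show "0 \<le> (cmod d)\<^sup>2 * dualnorm q w" using dualnorm_nonneg[OF w] by simp
    show "(cmod ((d *\<^sub>V w) x))\<^sup>2 \<le> (cmod d)\<^sup>2 * dualnorm q w * qf q x" for x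
      using mult_left_mono[OF dualnorm_cauchy_schwarz[OF w, of x], of "(cmod d)\<^sup>2"]
      by (simp add: norm_mult power_mult_distrib mult.assoc)
  qed
  show ?thesis
  proof (cases "c = 0")
    case True then show ?thesis by (simp add: dualnorm_zero)
  next
    case False
    then have "dualnorm q v \<le> (cmod (inverse c))\<^sup>2 * dualnorm q (c *\<^sub>V v)"
      using le[OF csub_csc[OF csub_dualsp v], of "inverse c" c] by simp
    then have "(cmod c)\<^sup>2 * dualnorm q v \<le> ((cmod c)\<^sup>2 * (cmod (inverse c))\<^sup>2) * dualnorm q (c *\<^sub>V v)"
      unfolding mult.assoc by (rule mult_left_mono) simp
    also have "(cmod c)\<^sup>2 * (cmod (inverse c))\<^sup>2 = 1" 
      using False by (simp add: power_mult_distrib[symmetric] norm_mult[symmetric])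
    finally show ?thesis using le[OF v, of c] by linarith
  qed
qed

text \<open>Testing the suprema for \<open>v + w\<close> and \<open>v - w\<close> at
  \<open>x + y\<close> and \<open>x - y\<close> gives one inequality. Applied to
  \<open>v + w\<close> and \<open>v - w\<close> in place of \<open>v\<close> and \<open>w\<close> it
  gives the other.\<close>

lemma dualnorm_parallelogram:
  assumes v: "v \<in> dualsp q" and w: "w \<in> dualsp q"
  shows "dualnorm q (v + w) + dualnorm q (v - w) = 2 * dualnorm q v + 2 * dualnorm q w"
proof -
  note av = dualsp_antilin
  have ge: "2 * dualnorm q v + 2 * dualnorm q w \<le> dualnorm q (v + w) + dualnorm q (v - w)"
    if v: "v \<in> dualsp q" and w: "w \<in> dualsp q" for v w
  proof -
    have *: "2 * (2 * Re (v x) - qf q x) + 2 * (2 * Re (w y) - qf q y) \<le> dualnorm q (v + w) + dualnorm q (v - w)" for x y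
    proof -
      have "2 * Re ((v + w) (x + y)) - qf q (x + y) \<le> dualnorm q (v + w)"
        by (rule dualnorm_upper[OF csub_add[OF csub_dualsp v w]])
      moreover have "2 * Re ((v - w) (x - y)) - qf q (x - y) \<le> dualnorm q (v - w)"
        by (rule dualnorm_upper[OF csub_diff[OF csub_dualsp v w]])
      moreover have "(v + w) (x + y) + (v - w) (x - y) = 2 * v x + 2 * w y"
        using av[OF v] av[OF w] by (simp add: antilin_diff) (simp add: antilin_def algebra_simps)
      then have "Re ((v + w) (x + y)) + Re ((v - w) (x - y)) = 2 * Re (v x) + 2 * Re (w y)"
        by (simp add: complex_eq_iff)
      ultimately show ?thesis using qf_parallelogram[OF h, of x y] by simp
    qed
    let ?S = "dualnorm q (v + w) + dualnorm q (v - w)"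
    have "2 * Re (v x) - qf q x \<le> (?S - 2 * (2 * Re (w y) - qf q y)) / 2" for x y using *[of x y] by simp
    then have "dualnorm q v \<le> (?S - 2 * (2 * Re (w y) - qf q y)) / 2" for y by (rule dualnorm_least)
    then have "2 * Re (w y) - qf q y \<le> (?S - 2 * dualnorm q v) / 2" for y by (simp add: field_simps)
    then have "dualnorm q w \<le> (?S - 2 * dualnorm q v) / 2" by (rule dualnorm_least)
    then show ?thesis by simp
  qed
  note vw = csub_add[OF csub_dualsp v w] csub_diff[OF csub_dualsp v w]
  have 2: "dualnorm q (z + z) = 4 * dualnorm q z" if "z \<in> dualsp q" for z
    using dualnorm_csc[OF that, of 2] by (simp add: csc_two)
  have "2 * dualnorm q (v + w) + 2 * dualnorm q (v - w)
      \<le> dualnorm q ((v + w) + (v - w)) + dualnorm q ((v + w) - (v - w))" by (rule ge[OF vw])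
  also have "(v + w) + (v - w) = v + v" by (simp add: algebra_simps)
  also have "(v + w) - (v - w) = w + w" by (simp add: algebra_simps)
  finally show ?thesis using ge[OF v w] 2[OF v] 2[OF w] by linarith
qed

theorem dual_inner_product:
  obtains ip where "pform_on (dualsp q) ip" "\<And>v. v \<in> dualsp q \<Longrightarrow> qf ip v = dualnorm q v"
    "\<And>v x. v \<in> dualsp q \<Longrightarrow> ip v (q x) = v x"
proof -
  obtain ip where ip: "pform_on (dualsp q) ip" "\<And>v. v \<in> dualsp q \<Longrightarrow> ip v v = of_real (dualnorm q v)"
    using jordan_von_neumann[of "dualsp q" "dualnorm q", OF csub_dualsp]
      dualnorm_nonneg dualnorm_parallelogram dualnorm_csc by metis
  note hi = pform_onD(1)[OF ip(1)]
  have Re: "Re (ip v (q x)) = Re (v x)" if v: "v \<in> dualsp q" for v x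
    using qf_add[OF hi v dual_embed[of x]] dualnorm_add_embed[OF v, of x] ip(2) v dual_embed[of x]
      csub_add[OF csub_dualsp v dual_embed[of x]] by (simp add: dualnorm_embed)
  have "ip v (q x) = v x" if v: "v \<in> dualsp q" for v x
  proof -
    have "Re (ip ((- \<i>) *\<^sub>V v) (q x)) = Re (((- \<i>) *\<^sub>V v) x)" by (rule Re[OF csub_csc[OF csub_dualsp v]])
    then have "Im (ip v (q x)) = Im (v x)"
      unfolding fun_csc hf_cscl[OF hi v dual_embed] by simp
    with Re[OF v] show ?thesis by (simp add: complex_eq_iff)
  qed
  then show ?thesis using ip by (intro that[of ip]) simp_all
qed

lemma dualnorm_eq_zero: "v \<in> dualsp q \<Longrightarrow> dualnorm q v = 0 \<Longrightarrow> v = 0"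
  using dualnorm_cauchy_schwarz[of v] by (auto simp: fun_eq_iff)

theorem dual_complete:
  assumes v: "\<And>n. v n \<in> dualsp q"
    and C: "\<And>e. 0 < e \<Longrightarrow> \<exists>N. \<forall>m\<ge>N. \<forall>n\<ge>N. dualnorm q (v m - v n) < e"
  obtains l where "l \<in> dualsp q" "(\<lambda>n. dualnorm q (v n - l)) \<longlonglongrightarrow> 0"
proof -
  note d = csub_diff[OF csub_dualsp v v]
  have cs: "(cmod (v m x - v n x))\<^sup>2 \<le> dualnorm q (v m - v n) * qf q x" for m n x
    using dualnorm_cauchy_schwarz[OF d[of m n], of x] by simp
  have "Cauchy (\<lambda>n. v n x)" for x
  proof (rule metric_CauchyI)
    fix e :: real assume e: "0 < e"
    then have "0 < e\<^sup>2 / (qf q x + 1)" using q0[of x] by simp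
    then obtain N where N: "\<And>m n. m \<ge> N \<Longrightarrow> n \<ge> N \<Longrightarrow> dualnorm q (v m - v n) < e\<^sup>2 / (qf q x + 1)"
      using C by blast
    have "dist (v m x) (v n x) < e" if "m \<ge> N" "n \<ge> N" for m n
    proof -
      have "(cmod (v m x - v n x))\<^sup>2 \<le> dualnorm q (v m - v n) * (qf q x + 1)"
        using cs[of m x n] dualnorm_nonneg[OF d[of m n]] by (simp add: distrib_left)
      also have "\<dots> < e\<^sup>2 / (qf q x + 1) * (qf q x + 1)"
        using N[OF that] q0[of x] by (intro mult_strict_right_mono) auto
      also have "\<dots> = e\<^sup>2" using q0[of x] by simp
      finally show ?thesis using e by (simp add: dist_norm power_less_imp_less_base)
    qed
    then show "\<exists>M. \<forall>m\<ge>M. \<forall>n\<ge>M. dist (v m x) (v n x) < e" by blast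
  qed
  then have "\<exists>l. (\<lambda>n. v n x) \<longlonglongrightarrow> l" for x using Cauchy_convergent_iff convergent_def by blast
  then obtain l where l: "\<And>x. (\<lambda>n. v n x) \<longlonglongrightarrow> l x" by metis
  have al: "antilin l"
    unfolding antilin_def
  proof (intro conjI allI)
    fix x y c
    have "(\<lambda>n. v n (x + y)) \<longlonglongrightarrow> l x + l y" "(\<lambda>n. v n (c *\<^sub>V x)) \<longlonglongrightarrow> cnj c * l x"
      using dualsp_antilin[OF v] by (auto simp: antilin_def intro!: tendsto_add tendsto_mult_left l)
    then show "l (x + y) = l x + l y" "l (c *\<^sub>V x) = cnj c * l x" by (auto intro: LIMSEQ_unique l)
  qed
  have lim: "(cmod (v n x - l x))\<^sup>2 \<le> e * qf q x" if "\<And>m. m \<ge> N \<Longrightarrow> dualnorm q (v n - v m) \<le> e" for n N e x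
  proof (rule LIMSEQ_le_const2)
    show "(\<lambda>m. (cmod (v n x - v m x))\<^sup>2) \<longlonglongrightarrow> (cmod (v n x - l x))\<^sup>2" by (intro tendsto_intros l)
    show "\<exists>N. \<forall>m\<ge>N. (cmod (v n x - v m x))\<^sup>2 \<le> e * qf q x"
      using that cs[of n x] q0[of x] by (meson mult_right_mono order_trans)
  qed
  have conv: "\<exists>N. \<forall>n\<ge>N. \<forall>x. (cmod ((v n - l) x))\<^sup>2 \<le> e * qf q x" if e: "0 < e" for e
  proof -
    obtain N where "\<And>m n. m \<ge> N \<Longrightarrow> n \<ge> N \<Longrightarrow> dualnorm q (v m - v n) < e" using C[OF e] by blast
    then have "(cmod ((v n - l) x))\<^sup>2 \<le> e * qf q x" if "n \<ge> N" for n x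
      using lim[of N n e x] that by (simp add: less_imp_le)
    then show ?thesis by blast
  qed
  have avl: "antilin (v n - l)" for n using al dualsp_antilin[OF v[of n]] by (simp add: antilin_def algebra_simps)
  obtain N where "\<forall>x. (cmod ((v N - l) x))\<^sup>2 \<le> 1 * qf q x" using conv[of 1] by auto
  then have "v N - l \<in> dualsp q" unfolding dualsp_def using avl by blast
  then have "v N - (v N - l) \<in> dualsp q" by (rule csub_diff[OF csub_dualsp v])
  then have ld: "l \<in> dualsp q" by simp
  have "(\<lambda>n. dualnorm q (v n - l)) \<longlonglongrightarrow> 0"
  proof (rule LIMSEQ_I)
    fix e :: real assume e: "0 < e"
    then obtain N where N: "\<forall>n\<ge>N. \<forall>x. (cmod ((v n - l) x))\<^sup>2 \<le> e / 2 * qf q x" using conv[of "e / 2"] by auto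
    have "norm (dualnorm q (v n - l) - 0) < e" if "n \<ge> N" for n
    proof -
      have "dualnorm q (v n - l) \<le> e / 2" using N that e by (intro dualnorm_le) auto
      then show ?thesis using dualnorm_nonneg[OF csub_diff[OF csub_dualsp v ld], of n] e by simp
    qed
    then show "\<exists>N. \<forall>n\<ge>N. norm (dualnorm q (v n - l) - 0) < e" by blast
  qed
  with ld show ?thesis by (rule that)
qed

end

section \<open>Invariant forms on a bounded module\<close>

lemma hform_sum:
  assumes "\<And>i. i \<in> I \<Longrightarrow> hform (f i)"
  shows "hform (\<lambda>x y. \<Sum>i\<in>I. f i x y)"
  unfolding hform_on_def
proof (intro conjI ballI allI)
  fix x y
  show "(\<Sum>i\<in>I. f i y x) = cnj (\<Sum>i\<in>I. f i x y)"
    unfolding cnj_sum by (rule sum.cong[OF refl hf_sym[OF assms UNIV_I UNIV_I]])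
qed (simp_all add: sum.distrib sum_distrib_left hf_addl[OF assms] hf_cscl[OF assms])

lemma pform_sum:
  assumes "\<And>i. i \<in> I \<Longrightarrow> pform (f i)"
  shows "pform (\<lambda>x y. \<Sum>i\<in>I. f i x y)"
  unfolding pform_on_def
proof
  show "hform (\<lambda>x y. \<Sum>i\<in>I. f i x y)" by (rule hform_sum[OF pform_onD(1)[OF assms]])
  show "\<forall>x\<in>UNIV. 0 \<le> qf (\<lambda>x y. \<Sum>i\<in>I. f i x y) x"
    using pform_onD(2)[OF assms] by (simp add: sum_nonneg)
qed

lemma hform_lincomb:
  assumes "hform f" "hform g"
  shows "hform (\<lambda>x y. of_real a * f x y + of_real b * g x y)"
  unfolding hform_on_def
proof (intro conjI ballI allI)
  fix x y
  show "of_real a * f y x + of_real b * g y x = cnj (of_real a * f x y + of_real b * g x y)"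
    using hf_sym[OF assms(1) UNIV_I UNIV_I, of x y] hf_sym[OF assms(2) UNIV_I UNIV_I, of x y] by simp
qed (simp_all add: hf_addl[OF assms(1)] hf_addl[OF assms(2)] hf_cscl[OF assms(1)] hf_cscl[OF assms(2)] algebra_simps)

lemma pform_scale:
  assumes "pform f" "0 \<le> a"
  shows "pform (\<lambda>x y. of_real a * f x y)"
  using hform_lincomb[OF pform_onD(1)[OF assms(1)] pform_onD(1)[OF assms(1)], of a 0] pform_onD(2)[OF assms(1)] assms(2)
  by (simp add: pform_on_def)

lemma rank_one_pform:
  assumes e: "hform e"
  shows "pform (\<lambda>x y. e x a * cnj (e y a))"
  unfolding pform_on_def hform_on_def
  by (simp add: hf_addl[OF e] hf_cscl[OF e] algebra_simps flip: power2_eq_square)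

lemma qf_rank_one: "Re (z * cnj z) = (cmod z)\<^sup>2"
  by (simp flip: complex_norm_square)

locale bmod =
  fixes act :: "'b::cstar1 \<Rightarrow> 'v::cvec \<Rightarrow> 'v"
  assumes act_addl: "act (a + b) x = act a x + act b x"
    and act_addr: "act a (x + y) = act a x + act a y"
    and act_mult: "act (a * b) x = act a (act b x)"
    and act_one [simp]: "act 1 x = x"
    and act_csc: "act (c *\<^sub>V a) x = c *\<^sub>V act a x"
begin

lemma act_cscr: "act a (c *\<^sub>V x) = c *\<^sub>V act a x"
proof -
  have "act a (c *\<^sub>V x) = act (a * (c *\<^sub>V 1)) x" by (simp add: act_mult act_csc)
  then show ?thesis by (simp add: mult_csc_right act_csc)
qed

lemma act_diffr: "act a (x - y) = act a x - act a y"
  using act_addr[of a "x - y" y] by (simp add: eq_diff_eq)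

lemma act_unitary [simp]:
  "unitary u \<Longrightarrow> act (star u) (act u x) = x" "unitary u \<Longrightarrow> act u (act (star u) x) = x"
  by (simp_all add: unitary_def flip: act_mult)

text \<open>By \<open>invf_adjoint\<close> this makes \<open>act (star b)\<close> adjoint to
  \<open>act b\<close>. The formulation by unitaries can be checked on the quadratic form alone and
  is a closed condition.\<close>

definition invf :: "('v \<Rightarrow> 'v \<Rightarrow> complex) \<Rightarrow> bool"
  where "invf p \<longleftrightarrow> (\<forall>u x y. unitary u \<longrightarrow> p (act u x) (act u y) = p x y)"

lemma hform_act:
  assumes p: "hform p"
  shows "hform (\<lambda>x y. p (act u x) (act u y))"
  unfolding hform_on_def
proof (intro conjI ballI allI)
  show "p (act u y) (act u x) = cnj (p (act u x) (act u y))" for x y by (rule hf_sym[OF p]) simp_all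
qed (simp_all add: act_addr act_cscr hf_addl[OF p] hf_cscl[OF p])

lemma invfI:
  assumes p: "hform p" and eq: "\<And>u x. unitary u \<Longrightarrow> qf p (act u x) = qf p x"
  shows "invf p"
  unfolding invf_def
proof (intro allI impI)
  fix u x y assume "unitary (u :: 'b)"
  then show "p (act u x) (act u y) = p x y"
    by (intro hform_eqI[OF hform_act[OF p] p]) (simp_all add: eq)
qed

lemma invf_qf: "invf p \<Longrightarrow> unitary u \<Longrightarrow> qf p (act u x) = qf p x"
  by (simp add: invf_def)

end

locale bounded_bmod = bmod act for act :: "'b::cstar1 \<Rightarrow> 'v::cvec \<Rightarrow> 'v" +
  fixes e :: "'v \<Rightarrow> 'v \<Rightarrow> complex" and M :: real
  assumes e: "pform e" and M: "1 \<le> M" and act_bound: "qf e (act b x) \<le> M * (norm b)\<^sup>2 * qf e x"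
begin

lemmas he = pform_onD(1)[OF e]

lemma e0: "0 \<le> qf e x"
  by (rule pform_onD(2)[OF e]) simp

text \<open>Here the constant may depend on \<open>p\<close>. Removing that dependence is the
  purpose of \<open>uniform_bound\<close>.\<close>

definition bddf :: "('v \<Rightarrow> 'v \<Rightarrow> complex) \<Rightarrow> bool"
  where "bddf p \<longleftrightarrow> (\<exists>C. \<forall>x. qf p x \<le> C * qf e x)"

lemma bddf_sum:
  assumes "\<And>i. i \<in> I \<Longrightarrow> bddf (p i)"
  shows "bddf (\<lambda>x y. \<Sum>i\<in>I. p i x y)"
proof -
  have "\<exists>C. \<forall>i\<in>I. \<forall>x. qf (p i) x \<le> C i * qf e x"
    using assms unfolding bddf_def by metis
  then obtain C where "\<And>i x. i \<in> I \<Longrightarrow> qf (p i) x \<le> C i * qf e x" by blast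
  then have "qf (\<lambda>x y. \<Sum>i\<in>I. p i x y) x \<le> (\<Sum>i\<in>I. C i) * qf e x" for x
    by (simp add: sum_distrib_right sum_mono)
  then show ?thesis unfolding bddf_def by blast
qed

text \<open>Every vector functional \<open>e x0\<close> is dominated by an invariant form: its orbit
  \<open>b \<mapsto> e x0 (b\<^sup>* \<cdot>)\<close> in the dual is dominated by a positive functional on the algebra, which is
  left invariant, and \<open>p\<close> is the norm dual to that functional.\<close>

theorem point_domination:
  obtains p L where "pform p" "invf p" "bddf p" "0 < L" "\<And>y. (cmod (e x0 y))\<^sup>2 \<le> L * qf p y"
proof -
  define v where "v b = (\<lambda>y. e x0 (act (star b) y))" for b
  obtain ip where ip: "pform_on (dualsp e) ip" "\<And>v. v \<in> dualsp e \<Longrightarrow> qf ip v = dualnorm e v"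
    using dual_inner_product[OF e] by metis
  note hip = pform_onD(1)[OF ip(1)]
  have v_add: "v (a + b) = v a + v b" for a b
    by (simp add: v_def fun_eq_iff star_add act_addl hf_addr[OF he])
  have v_csc: "v (c *\<^sub>V a) = c *\<^sub>V v a" for c a
    by (simp add: v_def fun_eq_iff star_csc act_csc hf_cscr[OF he])
  have v_dual: "v b \<in> dualsp e" for b
  proof -
    have "antilin (v b)" by (simp add: antilin_def v_def act_addr act_cscr hf_addr[OF he] hf_cscr[OF he])
    moreover have "(cmod (v b y))\<^sup>2 \<le> (qf e x0 * (M * (norm b)\<^sup>2)) * qf e y" for y
    proof -
      have "(cmod (v b y))\<^sup>2 \<le> qf e x0 * qf e (act (star b) y)"
        unfolding v_def by (rule pf_cauchy_schwarz[OF e]) simp_all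
      also have "\<dots> \<le> qf e x0 * (M * (norm b)\<^sup>2 * qf e y)"
        using act_bound[of "star b" y] by (intro mult_left_mono e0) simp
      finally show ?thesis by (simp add: mult.assoc)
    qed
    ultimately show ?thesis unfolding dualsp_def by blast
  qed
  define E where "E a b = ip (v a) (v b)" for a b
  have pE: "pform E"
    unfolding pform_on_def hform_on_def E_def
  proof (intro conjI ballI allI)
    show "ip (v b) (v a) = cnj (ip (v a) (v b))" for a b by (rule hf_sym[OF hip v_dual v_dual])
  qed (simp_all add: v_add v_csc v_dual hf_addl[OF hip] hf_cscl[OF hip] pform_onD(2)[OF ip(1)])
  have qE: "qf E b = dualnorm e (v b)" for b by (simp add: E_def ip(2) v_dual)
  have "qf E (c * b) \<le> M * (norm c)\<^sup>2 * qf E b" for c b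
    unfolding qE
  proof (rule dualnorm_le[OF e])
    show "0 \<le> M * (norm c)\<^sup>2 * dualnorm e (v b)" using M dualnorm_nonneg[OF e v_dual] by simp
    fix y
    have "v (c * b) y = v b (act (star c) y)" by (simp add: v_def star_mult act_mult)
    then have "(cmod (v (c * b) y))\<^sup>2 \<le> dualnorm e (v b) * qf e (act (star c) y)"
      using dualnorm_cauchy_schwarz[OF e v_dual] by simp
    also have "\<dots> \<le> dualnorm e (v b) * (M * (norm c)\<^sup>2 * qf e y)"
      using act_bound[of "star c" y] by (intro mult_left_mono dualnorm_nonneg[OF e] v_dual) simp
    finally show "(cmod (v (c * b) y))\<^sup>2 \<le> M * (norm c)\<^sup>2 * dualnorm e (v b) * qf e y"
      by (simp add: mult_ac)
  qed
  then obtain f where f: "\<And>a b. f (a + b) = f a + f b" "\<And>c a. f (c *\<^sub>V a) = c * f a"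
      "\<And>b. qf E b \<le> 2 * M * Re (f (star b * b))"
    using dominating_functional[OF pE _ M] by metis
  \<comment> \<open>The semi-inner product that the functional \<open>f\<close> induces on the
    algebra, as in the GNS construction. Since \<open>f\<close> is not known to be Hermitian, the
    form is symmetrized; the factor \<open>M\<close> makes it dominate \<open>E\<close>.\<close>
  define F where "F a b = of_real M * (f (star b * a) + cnj (f (star a * b)))" for a b
  have qF: "qf F b = 2 * M * Re (f (star b * b))" for b by (simp add: F_def)
  have F0: "0 \<le> qf F b" for b using f(3)[of b] pform_onD(2)[OF pE, of b] unfolding qF by simp
  have pF: "pform F"
    unfolding pform_on_def hform_on_def
  proof (intro conjI ballI allI)
    show "0 \<le> qf F b" for b by (rule F0)
    show "F b a = cnj (F a b)" for a b by (simp add: F_def)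
  qed (simp_all add: F_def f distrib_left distrib_right star_add star_csc mult_csc_left mult_csc_right algebra_simps)
  define w where "w y = (\<lambda>b. e (act (star b) y) x0)" for y
  have wv: "w y b = cnj (v b y)" for y b
    unfolding w_def v_def by (rule hf_sym[OF he]) simp_all
  have w_bd: "(cmod (w y b))\<^sup>2 \<le> qf e y * qf F b" for y b
  proof -
    have "(cmod (v b y))\<^sup>2 \<le> qf E b * qf e y" unfolding qE by (rule dualnorm_cauchy_schwarz[OF e v_dual])
    also have "\<dots> \<le> qf F b * qf e y" using f(3)[of b] unfolding qF by (intro mult_right_mono e0)
    finally show ?thesis by (simp add: wv mult.commute)
  qed
  have w_dual: "w y \<in> dualsp F" for y
  proof -
    have "antilin (w y)"
      by (simp add: antilin_def w_def star_add star_csc act_addl act_csc hf_addl[OF he] hf_cscl[OF he])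
    then show ?thesis using w_bd unfolding dualsp_def by blast
  qed
  have w_add: "w (x + y) = w x + w y" and w_csc: "w (c *\<^sub>V x) = c *\<^sub>V w x" for x y c
    by (simp_all add: w_def fun_eq_iff act_addr act_cscr hf_addl[OF he] hf_cscl[OF he])
  obtain jp where jp: "pform_on (dualsp F) jp" "\<And>v. v \<in> dualsp F \<Longrightarrow> qf jp v = dualnorm F v"
    using dual_inner_product[OF pF] by metis
  note hjp = pform_onD(1)[OF jp(1)]
  define p where "p x y = jp (w x) (w y)" for x y
  have pp: "pform p"
    unfolding pform_on_def hform_on_def p_def
  proof (intro conjI ballI allI)
    show "jp (w b) (w a) = cnj (jp (w a) (w b))" for a b by (rule hf_sym[OF hjp w_dual w_dual])
  qed (simp_all add: w_add w_csc w_dual hf_addl[OF hjp] hf_cscl[OF hjp] pform_onD(2)[OF jp(1)])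
  have qp: "qf p y = dualnorm F (w y)" for y by (simp add: p_def jp(2) w_dual)
  have le: "dualnorm F (w (act u y)) \<le> dualnorm F (w y)" if u: "unitary u" for u y
  proof (rule dualnorm_le[OF pF])
    show "0 \<le> dualnorm F (w y)" by (rule dualnorm_nonneg[OF pF w_dual])
    fix b
    have "w (act u y) b = w y (star u * b)" by (simp add: w_def star_mult star_star act_mult)
    then have "(cmod (w (act u y) b))\<^sup>2 \<le> dualnorm F (w y) * qf F (star u * b)"
      using dualnorm_cauchy_schwarz[OF pF w_dual] by simp
    also have "star (star u * b) * (star u * b) = star b * (u * star u) * b"
      by (simp add: star_mult star_star mult.assoc)
    then have "qf F (star u * b) = qf F b" using u by (simp add: qF unitary_def)
    finally show "(cmod (w (act u y) b))\<^sup>2 \<le> dualnorm F (w y) * qf F b" .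
  qed
  show ?thesis
  proof (rule that[of p "qf F 1 + 1"])
    show "pform p" by (rule pp)
    show "invf p"
    proof (rule invfI[OF pform_onD(1)[OF pp]])
      fix u x assume u: "unitary (u :: 'b)"
      show "qf p (act u x) = qf p x"
        using le[OF u, of x] le[OF unitary_star[OF u], of "act u x"] u by (simp add: qp)
    qed
    have "qf p x \<le> 1 * qf e x" for x
      unfolding qp by (simp, rule dualnorm_le[OF pF e0]) (simp add: w_bd)
    then show "bddf p" unfolding bddf_def by blast
    show "0 < qf F 1 + 1" using F0[of 1] by simp
    fix y
    have "cmod (e x0 y) = cmod (w y 1)" by (simp add: wv v_def)
    then have "(cmod (e x0 y))\<^sup>2 \<le> qf p y * qf F 1"
      using dualnorm_cauchy_schwarz[OF pF w_dual, of y 1] by (simp add: qp)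
    then show "(cmod (e x0 y))\<^sup>2 \<le> (qf F 1 + 1) * qf p y"
      using pform_onD(2)[OF pp, of y] by (simp add: algebra_simps)
  qed
qed

end

section \<open>Parallel sums of forms\<close>

text \<open>For numbers this is \<open>p e / (p + e)\<close>: the quadratic form of the parallel
  sum, the inverse of the sum of the inverses when these exist.\<close>

definition infconv :: "('v::cvec \<Rightarrow> 'v \<Rightarrow> complex) \<Rightarrow> ('v \<Rightarrow> 'v \<Rightarrow> complex) \<Rightarrow> 'v \<Rightarrow> real"
  where "infconv p e x = (INF y. qf p (x - y) + qf e y)"

context
  fixes p e :: "'v::cvec \<Rightarrow> 'v \<Rightarrow> complex"
  assumes p: "pform p" and e: "pform e"
begin

private lemma pe0: "0 \<le> qf p x" "0 \<le> qf e x"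
  using pform_onD(2)[OF p] pform_onD(2)[OF e] by simp_all

lemma infconv_le: "infconv p e x \<le> qf p (x - y) + qf e y"
  unfolding infconv_def by (rule cINF_lower) (auto intro!: bdd_belowI2[of _ 0] simp: pe0 add_nonneg_nonneg)

lemma infconv_ge: "(\<And>y. B \<le> qf p (x - y) + qf e y) \<Longrightarrow> B \<le> infconv p e x"
  unfolding infconv_def by (rule cINF_greatest) simp_all

lemma infconv_nonneg: "0 \<le> infconv p e x"
  by (rule infconv_ge) (simp add: pe0 add_nonneg_nonneg)

lemma infconv_csc: "infconv p e (c *\<^sub>V x) = (cmod c)\<^sup>2 * infconv p e x"
proof -
  note hp = pform_onD(1)[OF p] and he = pform_onD(1)[OF e]
  have zero: "infconv p e 0 = 0"
    using infconv_le[of 0 0] infconv_nonneg[of 0] by (simp add: qf_zero[OF hp, simplified] qf_zero[OF he, simplified])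
  have ge: "(cmod d)\<^sup>2 * infconv p e z \<le> infconv p e (d *\<^sub>V z)" for d z
  proof (cases "d = 0")
    case True then show ?thesis by (simp add: zero)
  next
    case False
    show ?thesis
    proof (rule infconv_ge)
      fix y :: 'v
      let ?y = "inverse d *\<^sub>V y"
      have y: "y = d *\<^sub>V ?y" using False by simp
      have "d *\<^sub>V z - y = d *\<^sub>V (z - ?y)" using False by (simp add: csc_diff_right)
      then have "qf p (d *\<^sub>V z - y) = (cmod d)\<^sup>2 * qf p (z - ?y)" using qf_csc[OF hp, of "z - ?y" d] by simp
      moreover have "qf e y = (cmod d)\<^sup>2 * qf e ?y" using qf_csc[OF he, of ?y d] y by simp
      ultimately show "(cmod d)\<^sup>2 * infconv p e z \<le> qf p (d *\<^sub>V z - y) + qf e y"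
        using mult_left_mono[OF infconv_le[of z ?y], of "(cmod d)\<^sup>2"] by (simp add: distrib_left)
    qed
  qed
  show ?thesis
  proof (cases "c = 0")
    case True then show ?thesis by (simp add: zero)
  next
    case False
    then have "(cmod (inverse c))\<^sup>2 * infconv p e (c *\<^sub>V x) \<le> infconv p e x"
      using ge[of "inverse c" "c *\<^sub>V x"] by simp
    then have "(cmod c)\<^sup>2 * ((cmod (inverse c))\<^sup>2 * infconv p e (c *\<^sub>V x)) \<le> (cmod c)\<^sup>2 * infconv p e x"
      by (rule mult_left_mono) simp
    moreover have "(cmod c)\<^sup>2 * (cmod (inverse c))\<^sup>2 = 1"
      using False by (simp add: power_mult_distrib[symmetric] norm_mult[symmetric])
    ultimately have "infconv p e (c *\<^sub>V x) \<le> (cmod c)\<^sup>2 * infconv p e x"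
      by (simp only: mult.assoc[symmetric] mult_1)
    then show ?thesis using ge[of c x] by simp
  qed
qed

text \<open>Adding and subtracting near minimizers for \<open>x\<close> and \<open>z\<close> gives
  competitors for \<open>x + z\<close> and \<open>x - z\<close>, hence one inequality. Applied to
  \<open>x + z\<close> and \<open>x - z\<close> it gives the other one.\<close>

lemma infconv_parallelogram: "infconv p e (x + z) + infconv p e (x - z) = 2 * infconv p e x + 2 * infconv p e z"
proof -
  note hp = pform_onD(1)[OF p] and he = pform_onD(1)[OF e]
  have le: "infconv p e (x + z) + infconv p e (x - z) \<le> 2 * infconv p e x + 2 * infconv p e z" for x z
  proof -
    let ?S = "infconv p e (x + z) + infconv p e (x - z)"
    have *: "?S \<le> 2 * (qf p (x - y) + qf e y) + 2 * (qf p (z - w) + qf e w)" for y w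
    proof -
      define a b where "a = x - y" and "b = z - w"
      have E1: "x + z - (y + w) = a + b" and E2: "x - z - (y - w) = a - b"
        by (simp_all add: a_def b_def algebra_simps)
      show ?thesis
        using infconv_le[of "x + z" "y + w", unfolded E1] infconv_le[of "x - z" "y - w", unfolded E2]
          qf_parallelogram[OF hp UNIV_I UNIV_I, of a b] qf_parallelogram[OF he UNIV_I UNIV_I, of y w]
        unfolding a_def[symmetric] b_def[symmetric] by argo
    qed
    have "(?S - 2 * (qf p (z - w) + qf e w)) / 2 \<le> qf p (x - y) + qf e y" for y w using *[of y w] by simp
    then have "(?S - 2 * (qf p (z - w) + qf e w)) / 2 \<le> infconv p e x" for w by (rule infconv_ge)
    then have "(?S - 2 * infconv p e x) / 2 \<le> qf p (z - w) + qf e w" for w by (simp add: field_simps)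
    then have "(?S - 2 * infconv p e x) / 2 \<le> infconv p e z" by (rule infconv_ge)
    then show ?thesis by simp
  qed
  have "infconv p e ((x + z) + (x - z)) + infconv p e ((x + z) - (x - z))
      \<le> 2 * infconv p e (x + z) + 2 * infconv p e (x - z)" by (rule le)
  also have "(x + z) + (x - z) = 2 *\<^sub>V x" by (simp add: csc_two)
  also have "(x + z) - (x - z) = 2 *\<^sub>V z" by (simp add: csc_two)
  finally show ?thesis using le[of x z] infconv_csc[of 2 x] infconv_csc[of 2 z] by simp
qed

lemma infconv_form:
  obtains f where "pform f" "\<And>x. qf f x = infconv p e x"
  using jordan_von_neumann[of UNIV "infconv p e", OF csub_UNIV infconv_nonneg infconv_parallelogram infconv_csc]
  by (metis Re_complex_of_real UNIV_I)

end

section \<open>Truncations of an invariant form\<close>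

context bounded_bmod
begin

text \<open>Where \<open>p\<close> is \<open>\<lambda> e\<close>, this is
  \<open>\<lambda> c / (\<lambda> + c)\<close> times \<open>e\<close>, a smooth truncation of
  \<open>p\<close> at height \<open>c\<close>.\<close>

definition psum :: "('v \<Rightarrow> 'v \<Rightarrow> complex) \<Rightarrow> real \<Rightarrow> 'v \<Rightarrow> real"
  where "psum p c = infconv p (\<lambda>x y. of_real c * e x y)"

lemma psum_le: "pform p \<Longrightarrow> 0 \<le> c \<Longrightarrow> psum p c x \<le> qf p (x - y) + c * qf e y"
  unfolding psum_def using infconv_le[OF _ pform_scale[OF e]] by simp

lemma psum_ge: "pform p \<Longrightarrow> 0 \<le> c \<Longrightarrow> (\<And>y. B \<le> qf p (x - y) + c * qf e y) \<Longrightarrow> B \<le> psum p c x"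
  unfolding psum_def by (rule infconv_ge[OF _ pform_scale[OF e]]) simp_all

lemma psum_nonneg: "pform p \<Longrightarrow> 0 \<le> c \<Longrightarrow> 0 \<le> psum p c x"
  unfolding psum_def using infconv_nonneg[OF _ pform_scale[OF e]] .

lemma psum_le_self: "pform p \<Longrightarrow> 0 \<le> c \<Longrightarrow> psum p c x \<le> qf p x"
  using psum_le[of p c x 0] by (simp add: qf_zero[OF he, simplified])

text \<open>The form \<open>p\<close> is invariant and a unitary enlarges \<open>e\<close> by at
  most the factor \<open>M\<close>, so acting on \<open>x\<close> merely moves the truncation height
  from \<open>c\<close> to at most \<open>c * d\<close>.\<close>

lemma psum_act:
  assumes p: "pform p" "invf p" and c: "0 \<le> c" and u: "unitary u" and d: "M \<le> d"
  shows "psum p c (act u x) \<le> psum p (c * d) x"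
proof (rule psum_ge[OF p(1)])
  show "0 \<le> c * d" using c d M by simp
  fix y
  have "qf e (act u y) \<le> d * qf e y"
    using act_bound[of u y] norm_unitary[OF u] mult_right_mono[OF d e0[of y]] by simp
  then have "c * qf e (act u y) \<le> c * d * qf e y" using c by (simp add: mult_left_mono mult.assoc)
  moreover have "qf p (act u x - act u y) = qf p (x - y)"
    using invf_qf[OF p(2) u, of "x - y"] by (simp add: act_diffr)
  ultimately show "psum p c (act u x) \<le> qf p (x - y) + c * d * qf e y"
    using psum_le[OF p(1) c, of "act u x" "act u y"] by simp
qed

lemma psum_upper:
  assumes p: "pform p" and c: "0 < c" and N: "0 < N"
  shows "psum p c x \<le> (c / (N + c))\<^sup>2 * qf p x + c * (N / (N + c))\<^sup>2 * qf e x"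
proof -
  \<comment> \<open>The fraction of \<open>x\<close> that would be optimal if \<open>p\<close> were
    exactly \<open>N e\<close>.\<close>
  let ?l = "N / (N + c)"
  have "1 - ?l = c / (N + c)" using c N by (simp add: field_simps)
  then have x: "x - of_real ?l *\<^sub>V x = of_real (c / (N + c)) *\<^sub>V x"
    using csc_diff_left[of 1 "of_real ?l" x] by (metis csc_one of_real_1 of_real_diff)
  have "qf p (x - of_real ?l *\<^sub>V x) = (c / (N + c))\<^sup>2 * qf p x"
    unfolding x using qf_csc[OF pform_onD(1)[OF p], of x "of_real (c / (N + c))"] by (simp add: norm_divide power_divide flip: of_real_add)
  moreover have "qf e (of_real ?l *\<^sub>V x) = ?l\<^sup>2 * qf e x"
    using qf_csc[OF he, of x "of_real ?l"] by (simp add: norm_divide power_divide flip: of_real_add)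
  ultimately show ?thesis using psum_le[OF p less_imp_le[OF c], of x "of_real ?l *\<^sub>V x"] by (simp add: mult.assoc)
qed

text \<open>By monotonicity the parallel sum of \<open>p\<close> and \<open>c e\<close> dominates
  that of \<open>r\<close> and \<open>c r\<close>, which is \<open>c / (1 + c)\<close> times
  \<open>r\<close>. The latter value follows from positivity of \<open>r\<close> at
  \<open>(x - y) - c y\<close>.\<close>

lemma psum_lower:
  assumes p: "pform p" and c: "0 < c" and r: "pform r" "\<And>x. qf r x \<le> qf p x" "\<And>x. qf r x \<le> qf e x"
  shows "c / (1 + c) * qf r x \<le> psum p c x"
proof (rule psum_ge[OF p less_imp_le[OF c]])
  fix y
  note hr = pform_onD(1)[OF r(1)]
  let ?a = "x - y"
  have "0 \<le> qf r (?a - of_real c *\<^sub>V y)" using pform_onD(2)[OF r(1)] by simp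
  also have "\<dots> = qf r ?a - 2 * (c * Re (r ?a y)) + c\<^sup>2 * qf r y"
    using qf_diff[OF hr UNIV_I UNIV_I, of ?a "of_real c *\<^sub>V y"] qf_csc[OF hr UNIV_I, where c = "of_real c" and x = y]
      hf_cscr[OF hr UNIV_I UNIV_I, where c = "of_real c" and x = y and y = ?a] by simp
  finally have pos: "0 \<le> qf r ?a - 2 * (c * Re (r ?a y)) + c\<^sup>2 * qf r y" .
  have "qf r x = qf r ?a + 2 * Re (r ?a y) + qf r y"
    using qf_add[OF hr UNIV_I UNIV_I, of ?a y] by simp
  then have "c * qf r x \<le> (1 + c) * (qf r ?a + c * qf r y)"
    using pos by (simp add: algebra_simps power2_eq_square)
  then have "c / (1 + c) * qf r x \<le> qf r ?a + c * qf r y" using c by (simp add: field_simps)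
  also have "\<dots> \<le> qf p ?a + c * qf e y" by (intro add_mono mult_left_mono r less_imp_le[OF c])
  finally show "c / (1 + c) * qf r x \<le> qf p (x - y) + c * qf e y" .
qed

end

section \<open>Uniform bounds from uniformly inner derivations\<close>

text \<open>The hypothesis on \<open>\<tau>\<close> is that forms with bounded coboundary are, uniformly, close to invariant
  ones. The form \<open>\<psi>\<close> below, a sum of parallel sums of \<open>p\<close> with \<open>4\<^sup>k e\<close> for \<open>k < n\<close>, behaves
  like \<open>p\<close> times a truncated logarithm of \<open>p\<close> relative to \<open>e\<close>. As \<open>e\<close> is invariant up to a
  bounded factor, \<open>\<psi>\<close> has bounded coboundary; moving \<open>p\<close> slightly towards the
  invariant form close to \<open>\<psi>\<close> lowers its upper bound without losing the lower bound \<open>r\<close>, as long as the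
  upper bound is large.\<close>

locale split_bmod = bounded_bmod act e M
  for act :: "'b::cstar1 \<Rightarrow> 'v::cvec \<Rightarrow> 'v" and e M +
  fixes \<tau> :: real
  assumes split: "\<And>p \<psi> c. pform p \<Longrightarrow> invf p \<Longrightarrow> bddf p \<Longrightarrow> hform \<psi> \<Longrightarrow>
      (\<And>x. 0 \<le> qf \<psi> x) \<Longrightarrow> (\<And>x. qf \<psi> x \<le> c * qf p x) \<Longrightarrow>
      (\<And>u x. unitary u \<Longrightarrow> \<bar>qf \<psi> (act u x) - qf \<psi> x\<bar> \<le> qf p x) \<Longrightarrow>
      \<exists>\<Xi>. hform \<Xi> \<and> invf \<Xi> \<and> (\<forall>x. \<bar>qf \<psi> x - qf \<Xi> x\<bar> \<le> \<tau> * qf p x)"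
begin

lemma sum_geometric_4: "(\<Sum>k<n. 4 ^ k :: real) \<le> 4 ^ n"
proof (induction n)
  case (Suc n)
  have "(0 :: real) < 4 ^ n" by simp
  then have "(4 :: real) ^ n + 4 ^ n \<le> 4 ^ Suc n" unfolding power_Suc by linarith
  then show ?case using Suc unfolding sum.lessThan_Suc by linarith
qed simp

lemma improve:
  obtains B s where "0 < B" "0 < s" "s < 1"
    "\<And>p r N. pform p \<Longrightarrow> invf p \<Longrightarrow> pform r \<Longrightarrow> (\<And>x. qf r x \<le> qf e x) \<Longrightarrow> (\<And>x. qf r x \<le> qf p x) \<Longrightarrow>
      (\<And>x. qf p x \<le> N * qf e x) \<Longrightarrow> B \<le> N \<Longrightarrow>
      \<exists>p'. pform p' \<and> invf p' \<and> (\<forall>x. qf r x \<le> qf p' x) \<and> (\<forall>x. qf p' x \<le> N * (1 - s) * qf e x)"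
proof -
  \<comment> \<open>With \<open>M \<le> 4 ^ m\<close>, a unitary shifts the heights
    \<open>4 ^ k\<close> by at most \<open>m\<close> places. Only \<open>m\<close> summands of
    \<open>\<psi>\<close> are then not matched, each at most \<open>p\<close>, so the coboundary of
    \<open>\<psi>\<close> is at most \<open>m p\<close>. The successor makes \<open>m\<close>
    positive.\<close>
  obtain m0 where "M < 4 ^ m0" using real_arch_pow[of 4 M] by auto
  define m where "m = Suc m0"
  have m: "M \<le> 4 ^ m" "0 < m" using \<open>M < 4 ^ m0\<close> zero_less_power[of "4 :: real" m0]
    by (simp_all add: m_def, linarith)
  define T where "T = real m * max \<tau> 0"
  have T: "0 \<le> T" by (simp add: T_def)
  \<comment> \<open>Enough truncation heights to make \<open>\<beta>\<close>, which is at least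
    \<open>n / 2\<close>, exceed \<open>2 * T + 2\<close>: the splitting error \<open>T\<close>
    enters twice and a surplus of 2 is spent in the upper bound.\<close>
  obtain n0 where n0: "4 * T + 4 < real n0" using reals_Archimedean2 by blast
  define n where "n = Suc n0"
  have n: "0 < n" "4 * T + 4 \<le> real n" "1 < n" using n0 T by (simp_all add: n_def) 
  \<comment> \<open>The factor by which \<open>\<psi>\<close> would exceed \<open>p\<close> if
    \<open>p\<close> were equal to \<open>e\<close>.\<close>
  define \<beta> where "\<beta> = (\<Sum>k<n. 4 ^ k / (1 + 4 ^ k) :: real)"
  have half: "1 / 2 \<le> 4 ^ k / (1 + 4 ^ k :: real)" for k
  proof -
    have "1 \<le> (4 :: real) ^ k" by simp
    then show ?thesis by (subst le_divide_eq) (simp add: add_pos_pos)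
  qed
  have "real n * (1 / 2) \<le> \<beta>"
    unfolding \<beta>_def using sum_mono[of "{..<n}" "\<lambda>_. 1 / 2" "\<lambda>k. 4 ^ k / (1 + 4 ^ k :: real)"] half by simp
  then have \<beta>1: "2 * T + 2 \<le> \<beta>" using n by linarith
  have "4 ^ k / (1 + 4 ^ k) \<le> (1 :: real)" for k
    by (subst divide_le_eq) (simp add: add_pos_pos)
  then have \<beta>2: "\<beta> \<le> real n"
    unfolding \<beta>_def using sum_mono[of "{..<n}" "\<lambda>k. 4 ^ k / (1 + 4 ^ k :: real)" "\<lambda>_. 1"] by simp
  \<comment> \<open>The step size. Because \<open>\<beta> \<le> n\<close>, the combination
    \<open>(1 - s \<beta>) p + s \<beta> r\<close> has nonnegative coefficients.\<close>
  define s where "s = 1 / real n"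
  have s: "0 < s" "s < 1" "s * \<beta> \<le> 1" using n \<beta>2 by (auto simp: s_def field_simps)
  define \<mu> where "\<mu> = \<beta> - T"
  show ?thesis
  \<comment> \<open>From the threshold \<open>4 ^ n\<close> on, the truncation heights together are
    at most \<open>N\<close>, so the truncated sum is at most about \<open>N e\<close> at the top of
    \<open>p\<close>.\<close>
  proof (rule that[of "4 ^ n" s])
    show "0 < (4 :: real) ^ n" "0 < s" "s < 1" using s by simp_all
  next
    fix p r N
    assume p: "pform p" "invf p" and r: "pform r" "\<And>x. qf r x \<le> qf e x" "\<And>x. qf r x \<le> qf p x"
      and pN: "\<And>x. qf p x \<le> N * qf e x" and N: "4 ^ n \<le> N"
    have N0: "0 < N" using N by (smt (verit) zero_less_power)
    note hp = pform_onD(1)[OF p(1)]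
    have p0: "0 \<le> qf p x" for x using pform_onD(2)[OF p(1)] by simp
    have "\<forall>k. \<exists>f. pform f \<and> (\<forall>x. qf f x = psum p (4 ^ k) x)"
    proof
      fix k :: nat
      show "\<exists>f. pform f \<and> (\<forall>x. qf f x = psum p (4 ^ k) x)"
        using infconv_form[OF p(1) pform_scale[OF e, of "4 ^ k"]] unfolding psum_def by (metis zero_le_numeral zero_le_power)
    qed
    then obtain g where g: "\<And>k. pform (g k)" "\<And>k x. qf (g k) x = psum p (4 ^ k) x" by metis
    define \<psi> where "\<psi> x y = (\<Sum>k<n. g k x y)" for x y
    have q\<psi>: "qf \<psi> x = (\<Sum>k<n. psum p (4 ^ k) x)" for x by (simp add: \<psi>_def g)
    have p\<psi>: "pform \<psi>" unfolding \<psi>_def by (rule pform_sum[OF g(1)])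
    note h\<psi> = pform_onD(1)[OF p\<psi>]
    have \<psi>_act: "qf \<psi> (act u x) \<le> qf \<psi> x + m * qf p x" if u: "unitary u" for u x
    proof -
      have "qf \<psi> (act u x) \<le> (\<Sum>k<n. psum p (4 ^ k * 4 ^ m) x)"
        unfolding q\<psi> by (intro sum_mono psum_act p u m) simp
      also have "\<dots> = (\<Sum>k<n. psum p (4 ^ (k + m)) x)" by (simp add: power_add)
      also have "\<dots> = (\<Sum>k=m..<n+m. psum p (4 ^ k) x)"
        using sum.shift_bounds_nat_ivl[of "\<lambda>k. psum p (4 ^ k) x" 0 m n] by (simp add: lessThan_atLeast0)
      also have "\<dots> \<le> (\<Sum>k=0..<n+m. psum p (4 ^ k) x)"
        by (intro sum_mono2) (auto simp: psum_nonneg p)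
      also have "\<dots> = qf \<psi> x + (\<Sum>k=n..<n+m. psum p (4 ^ k) x)"
        unfolding q\<psi> lessThan_atLeast0 by (simp add: sum.atLeastLessThan_concat)
      also have "(\<Sum>k=n..<n+m. psum p (4 ^ k) x) \<le> (\<Sum>k=n..<n+m. qf p x)"
        by (intro sum_mono psum_le_self p) simp
      finally show ?thesis by simp
    qed
    have dif: "\<bar>qf \<psi> (act u x) - qf \<psi> x\<bar> \<le> m * qf p x" if u: "unitary u" for u x
      using \<psi>_act[OF u, of x] \<psi>_act[OF unitary_star[OF u], of "act u x"] u invf_qf[OF p(2) u, of x] by simp
    define \<psi>' where "\<psi>' x y = of_real (1 / m) * \<psi> x y" for x y
    have q\<psi>': "qf \<psi>' x = (1 / m) * qf \<psi> x" for x by (simp add: \<psi>'_def)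
    have p\<psi>': "pform \<psi>'" unfolding \<psi>'_def by (rule pform_scale[OF p\<psi>]) simp
    have "\<exists>\<Xi>. hform \<Xi> \<and> invf \<Xi> \<and> (\<forall>x. \<bar>qf \<psi>' x - qf \<Xi> x\<bar> \<le> \<tau> * qf p x)"
    proof (rule split[OF p _ pform_onD(1)[OF p\<psi>'], where c = n])
      show "bddf p" using pN unfolding bddf_def by blast
      show "0 \<le> qf \<psi>' x" for x using pform_onD(2)[OF p\<psi>'] by simp
      show "qf \<psi>' x \<le> real n * qf p x" for x
      proof -
        have "qf \<psi> x \<le> (\<Sum>k<n. qf p x)" unfolding q\<psi> by (intro sum_mono psum_le_self p) simp
        then have "qf \<psi> x \<le> real n * qf p x" by simp
        moreover have "(1 / m) * qf \<psi> x \<le> 1 * qf \<psi> x"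
          using m pform_onD(2)[OF p\<psi>, of x] by (intro mult_right_mono) auto
        ultimately show ?thesis unfolding q\<psi>' by linarith
      qed
      show "\<bar>qf \<psi>' (act u x) - qf \<psi>' x\<bar> \<le> qf p x" if "unitary u" for u x
      proof -
        have "\<bar>qf \<psi>' (act u x) - qf \<psi>' x\<bar> = (1 / m) * \<bar>qf \<psi> (act u x) - qf \<psi> x\<bar>"
          unfolding q\<psi>' by (simp add: abs_mult flip: diff_divide_distrib)
        also have "\<dots> \<le> (1 / m) * (m * qf p x)" by (intro mult_left_mono dif that) simp
        finally show ?thesis using m by simp
      qed
    qed
    then obtain \<Xi>' where \<Xi>': "hform \<Xi>'" "invf \<Xi>'" "\<And>x. \<bar>qf \<psi>' x - qf \<Xi>' x\<bar> \<le> \<tau> * qf p x" by blast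
    have \<Xi>: "\<bar>qf \<psi> x - m * qf \<Xi>' x\<bar> \<le> T * qf p x" for x
    proof -
      have "qf \<psi> x - m * qf \<Xi>' x = m * (qf \<psi>' x - qf \<Xi>' x)" using m by (simp add: q\<psi>' algebra_simps)
      then have "\<bar>qf \<psi> x - m * qf \<Xi>' x\<bar> = m * \<bar>qf \<psi>' x - qf \<Xi>' x\<bar>" by (simp add: abs_mult)
      also have "\<dots> \<le> m * (\<tau> * qf p x)" by (intro mult_left_mono \<Xi>') simp
      also have "\<dots> \<le> m * (max \<tau> 0 * qf p x)" by (intro mult_left_mono mult_right_mono p0) simp_all
      finally show ?thesis by (simp add: T_def mult.assoc)
    qed
    \<comment> \<open>A step of length \<open>s\<close> from \<open>p\<close> in the direction of
      \<open>m \<Xi>' - \<mu> p\<close>. Where \<open>p\<close> is close to \<open>r\<close> the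
      form \<open>m \<Xi>'\<close> is at least about \<open>\<beta> p\<close>, where
      \<open>p\<close> is close to \<open>N e\<close> at most about \<open>p\<close>, both up to
      \<open>T p\<close>. The choice \<open>\<mu> = \<beta> - T\<close> preserves the lower bound
      and decreases the upper one.\<close>
    define p' where "p' x y = of_real (1 - s * \<mu>) * p x y + of_real (s * m) * \<Xi>' x y" for x y
    have qp': "qf p' x = (1 - s * \<mu>) * qf p x + s * (m * qf \<Xi>' x)" for x by (simp add: p'_def mult.assoc)
    have hp': "hform p'" unfolding p'_def by (rule hform_lincomb[OF hp \<Xi>'(1)])
    have lower: "qf r x \<le> qf p' x" for x
    proof -
      have "\<beta> * qf r x \<le> qf \<psi> x"
        unfolding \<beta>_def q\<psi> sum_distrib_right by (intro sum_mono psum_lower p r) simp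
      then have "s * (\<beta> * qf r x) \<le> s * qf \<psi> x" using s by (intro mult_left_mono) auto
      moreover have "s * (qf \<psi> x - T * qf p x) \<le> s * (m * qf \<Xi>' x)" 
        using \<Xi>[of x] s by (intro mult_left_mono) auto
      moreover have "(1 - s * \<beta>) * qf r x \<le> (1 - s * \<beta>) * qf p x" using s r(3) by (intro mult_left_mono) auto
      ultimately show ?thesis unfolding qp' \<mu>_def by (simp add: algebra_simps)
    qed
    have upper: "qf p' x \<le> N * (1 - s) * qf e x" for x
    proof -
      define a where "a = (\<Sum>k<n. (4 ^ k / (N + 4 ^ k))\<^sup>2)"
      define b where "b = (\<Sum>k<n. 4 ^ k * (N / (N + 4 ^ k))\<^sup>2)"
      have a0: "0 \<le> a" by (simp add: a_def sum_nonneg)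
      have "qf \<psi> x \<le> a * qf p x + b * qf e x"
        unfolding q\<psi> a_def b_def sum_distrib_right sum.distrib[symmetric]
        by (intro sum_mono psum_upper p N0) simp
      then have "qf \<psi> x + T * qf p x \<le> a * qf p x + b * qf e x + T * qf p x" by simp
      then have "s * (m * qf \<Xi>' x) \<le> s * (a * qf p x + b * qf e x + T * qf p x)"
        using \<Xi>[of x] s by (intro mult_left_mono) auto
      then have "qf p' x \<le> (1 - s * \<mu> + s * T + s * a) * qf p x + s * b * qf e x"
        unfolding qp' by (simp add: algebra_simps)
      also have "\<dots> \<le> (1 - s * \<mu> + s * T + s * a) * (N * qf e x) + s * b * qf e x"
      proof -
        have "s * \<mu> \<le> s * \<beta>" using s T by (intro mult_left_mono) (auto simp: \<mu>_def)
        moreover have "0 \<le> s * T" "0 \<le> s * a" using s T a0 by simp_all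
        ultimately have "0 \<le> 1 - s * \<mu> + s * T + s * a" using s(3) by linarith
        then show ?thesis using pN by (intro add_right_mono mult_left_mono) auto
      qed
      also have "\<dots> = (N - N * s * (\<mu> - T) + s * (a * N + b)) * qf e x" by (simp add: algebra_simps)
      also have "\<dots> \<le> (N - N * s * (\<mu> - T) + s * N) * qf e x"
      proof -
        \<comment> \<open>The two weights of each level, taken at the extreme value
          \<open>p = N e\<close>, recombine to the parallel sum of \<open>N\<close> and
          \<open>4 ^ k\<close>.\<close>
        have "a * N + b = (\<Sum>k<n. 4 ^ k * N / (N + 4 ^ k))"
          unfolding a_def b_def sum_distrib_right sum.distrib[symmetric]
        proof (rule sum.cong[OF refl])
          fix k
          have D: "N + 4 ^ k > (0 :: real)" using N0 by (simp add: add_pos_pos)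
          have "(4 ^ k / (N + 4 ^ k))\<^sup>2 * N + 4 ^ k * (N / (N + 4 ^ k))\<^sup>2 = (4 ^ k * N * (N + 4 ^ k)) / (N + 4 ^ k)\<^sup>2"
            by (simp add: power_divide add_divide_distrib[symmetric] power2_eq_square algebra_simps)
          also have "\<dots> = 4 ^ k * N / (N + 4 ^ k)" using D by (simp add: power2_eq_square)
          finally show "(4 ^ k / (N + 4 ^ k))\<^sup>2 * N + 4 ^ k * (N / (N + 4 ^ k))\<^sup>2 = 4 ^ k * N / (N + 4 ^ k)" .
        qed
        also have "\<dots> \<le> (\<Sum>k<n. 4 ^ k)"
        proof (rule sum_mono)
          fix k
          have D: "N + 4 ^ k > (0 :: real)" using N0 by (simp add: add_pos_pos)
          have "4 ^ k * N \<le> 4 ^ k * (N + 4 ^ k :: real)" by simp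
          then show "4 ^ k * N / (N + 4 ^ k) \<le> (4 ^ k :: real)" using D by (simp add: pos_divide_le_eq)
        qed
        also have "\<dots> \<le> N" using sum_geometric_4[of n] N by linarith
        finally have "s * (a * N + b) \<le> s * N" using s by (intro mult_left_mono) auto
        then show ?thesis by (intro mult_right_mono e0) simp
      qed
      also have "\<dots> \<le> N * (1 - s) * qf e x"
      proof (intro mult_right_mono e0)
        have "s * N * 2 \<le> s * N * (\<mu> - T)" using s N0 \<beta>1 by (intro mult_left_mono) (auto simp: \<mu>_def)
        then show "N - N * s * (\<mu> - T) + s * N \<le> N * (1 - s)" by (simp add: algebra_simps)
      qed
      finally show ?thesis .
    qed
    have "pform p'" unfolding pform_on_def
      using hp' lower pform_onD(2)[OF r(1)] by (meson UNIV_I order_trans)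
    moreover have "invf p'" using p(2) \<Xi>'(2) by (simp add: invf_def p'_def)
    ultimately show "\<exists>p'. pform p' \<and> invf p' \<and> (\<forall>x. qf r x \<le> qf p' x) \<and> (\<forall>x. qf p' x \<le> N * (1 - s) * qf e x)"
      using lower upper by blast
  qed
qed

text \<open>Repeated use of \<open>improve\<close> lowers the upper bound geometrically until it
  falls below the threshold \<open>B\<close>, which depends neither on \<open>p\<close> nor on
  \<open>r\<close>. The lower bound \<open>r\<close> survives each step.\<close>

lemma uniform_bound:
  obtains C where "\<And>p r. pform p \<Longrightarrow> invf p \<Longrightarrow> bddf p \<Longrightarrow> pform r \<Longrightarrow> (\<And>x. qf r x \<le> qf e x) \<Longrightarrow>
      (\<And>x. qf r x \<le> qf p x) \<Longrightarrow>
      \<exists>p'. pform p' \<and> invf p' \<and> (\<forall>x. qf r x \<le> qf p' x) \<and> (\<forall>x. qf p' x \<le> C * qf e x)"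
proof -
  obtain B s where B: "0 < B" and s: "0 < s" "s < 1" and imp:
    "\<And>p r N. pform p \<Longrightarrow> invf p \<Longrightarrow> pform r \<Longrightarrow> (\<And>x. qf r x \<le> qf e x) \<Longrightarrow> (\<And>x. qf r x \<le> qf p x) \<Longrightarrow>
      (\<And>x. qf p x \<le> N * qf e x) \<Longrightarrow> B \<le> N \<Longrightarrow>
      \<exists>p'. pform p' \<and> invf p' \<and> (\<forall>x. qf r x \<le> qf p' x) \<and> (\<forall>x. qf p' x \<le> N * (1 - s) * qf e x)"
    by (rule improve) blast
  show ?thesis
  proof (rule that[of B])
    fix p r
    assume p: "pform p" "invf p" "bddf p" and r: "pform r" "\<And>x. qf r x \<le> qf e x" "\<And>x. qf r x \<le> qf p x"
    obtain N0 where N0: "\<And>x. qf p x \<le> N0 * qf e x" using p(3) unfolding bddf_def by blast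
    have it: "\<exists>p'. pform p' \<and> invf p' \<and> (\<forall>x. qf r x \<le> qf p' x) \<and> (\<forall>x. qf p' x \<le> max B (N0 * (1 - s) ^ j) * qf e x)" for j
    proof (induction j)
      case 0
      have "qf p x \<le> max B N0 * qf e x" for x
        using N0[of x] mult_right_mono[OF max.cobounded2[of N0 B] e0[of x]] by linarith
      then show ?case using p r by auto
    next
      case (Suc j)
      let ?N = "max B (N0 * (1 - s) ^ j)"
      obtain p1 where p1: "pform p1" "invf p1" "\<And>x. qf r x \<le> qf p1 x" "\<And>x. qf p1 x \<le> ?N * qf e x"
        using Suc by blast
      obtain p2 where p2: "pform p2" "invf p2" "\<And>x. qf r x \<le> qf p2 x" "\<And>x. qf p2 x \<le> ?N * (1 - s) * qf e x"
        using imp[OF p1(1,2) r(1,2) p1(3,4)] by auto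
      have "?N * (1 - s) \<le> max B (N0 * (1 - s) ^ Suc j)"
      proof -
        have "B * (1 - s) \<le> B * 1" using B s by (intro mult_left_mono) auto
        moreover have "N0 * (1 - s) ^ j * (1 - s) = N0 * (1 - s) ^ Suc j" by simp
        moreover have "?N * (1 - s) = max (B * (1 - s)) (N0 * (1 - s) ^ j * (1 - s))"
          using s by (simp add: max_mult_distrib_right)
        ultimately show ?thesis by (metis max.mono mult_1_right order_refl)
      qed
      then have "qf p2 x \<le> max B (N0 * (1 - s) ^ Suc j) * qf e x" for x
        using p2(4)[of x] mult_right_mono[OF _ e0[of x]] by (meson order_trans)
      then show ?case using p2 by blast
    qed
    have "(\<lambda>j. N0 * (1 - s) ^ j) \<longlonglongrightarrow> N0 * 0"
      using s by (intro tendsto_mult tendsto_const LIMSEQ_power_zero) auto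
    then have "\<forall>\<^sub>F j in sequentially. N0 * (1 - s) ^ j < B" using B by (intro order_tendstoD) auto
    then obtain j where "N0 * (1 - s) ^ j < B" by (auto simp: eventually_sequentially)
    then have "max B (N0 * (1 - s) ^ j) = B" by simp
    then show "\<exists>p'. pform p' \<and> invf p' \<and> (\<forall>x. qf r x \<le> qf p' x) \<and> (\<forall>x. qf p' x \<le> B * qf e x)"
      using it[of j] by simp
  qed
qed

end

section \<open>Finite orthonormal systems\<close>

definition orthonormal :: "('v::cvec \<Rightarrow> 'v \<Rightarrow> complex) \<Rightarrow> 'v set \<Rightarrow> bool"
  where "orthonormal e A \<longleftrightarrow> (\<forall>a\<in>A. \<forall>b\<in>A. e a b = (if a = b then 1 else 0))"

text \<open>For an orthonormal \<open>A\<close> this is \<open>e\<close> composed with the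
  orthogonal projection onto the span of \<open>A\<close>.\<close>

definition proj_form :: "('v::cvec \<Rightarrow> 'v \<Rightarrow> complex) \<Rightarrow> 'v set \<Rightarrow> 'v \<Rightarrow> 'v \<Rightarrow> complex"
  where "proj_form e A x y = (\<Sum>a\<in>A. e x a * cnj (e y a))"

lemma qf_proj_form: "qf (proj_form e A) x = (\<Sum>a\<in>A. (cmod (e x a))\<^sup>2)"
  unfolding proj_form_def Re_sum qf_rank_one ..

lemma pform_proj_form: "hform e \<Longrightarrow> pform (proj_form e A)"
  unfolding proj_form_def by (rule pform_sum[OF rank_one_pform])

lemma hf_suml:
  assumes "hform e"
  shows "e (\<Sum>i\<in>I. f i) y = (\<Sum>i\<in>I. e (f i) y)"
  by (induction I rule: infinite_finite_induct) (simp_all add: hf_addl[OF assms] hf_zerol[OF assms])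

lemma orthonormal_component:
  assumes e: "hform e" and A: "orthonormal e A" "finite A" and b: "b \<in> A"
  shows "e (x - (\<Sum>a\<in>A. e x a *\<^sub>V a)) b = 0"
proof -
  have "e (\<Sum>a\<in>A. e x a *\<^sub>V a) b = (\<Sum>a\<in>A. if a = b then e x a else 0)"
    unfolding hf_suml[OF e] using A(1) b
    by (intro sum.cong refl) (auto simp: hf_cscl[OF e] orthonormal_def)
  also have "\<dots> = e x b" using A(2) b by simp
  finally show ?thesis by (simp add: hf_diffl[OF e])
qed

lemma orthonormal_residual:
  assumes e: "hform e" and A: "orthonormal e A" "finite A"
  shows "qf e (x - (\<Sum>a\<in>A. e x a *\<^sub>V a)) = qf e x - qf (proj_form e A) x"
proof -
  define s where "s = (\<Sum>a\<in>A. e x a *\<^sub>V a)"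
  have "e s (x - s) = (\<Sum>a\<in>A. e x a * e a (x - s))"
    unfolding s_def hf_suml[OF e] by (simp add: hf_cscl[OF e])
  also have "\<dots> = 0"
  proof (rule sum.neutral, rule ballI)
    fix a assume a: "a \<in> A"
    have "e a (x - s) = cnj (e (x - s) a)" by (rule hf_sym[OF e]) simp_all
    then show "e x a * e a (x - s) = 0"
      using orthonormal_component[OF e A a, of x] by (simp add: s_def)
  qed
  finally have z: "e s (x - s) = 0" .
  have "e (x - s) (x - s) = e x (x - s)" using z by (simp add: hf_diffl[OF e, of x s "x - s"])
  also have "\<dots> = e x x - e x s" by (simp add: hf_diffr[OF e])
  finally have "qf e (x - s) = qf e x - Re (e x s)" by simp
  moreover have "Re (e x s) = Re (e s x)" by (rule hf_Re_sym[OF e]) simp_all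
  moreover have "e s x = proj_form e A x x"
    unfolding s_def hf_suml[OF e] proj_form_def
  proof (rule sum.cong[OF refl])
    fix a
    have "e a x = cnj (e x a)" by (rule hf_sym[OF e]) simp_all
    then show "e (e x a *\<^sub>V a) x = e x a * cnj (e x a)" by (simp only: hf_cscl[OF e UNIV_I UNIV_I])
  qed
  ultimately show ?thesis by (simp only: s_def)
qed

lemma bessel:
  assumes e: "pform e" and A: "orthonormal e A" "finite A"
  shows "qf (proj_form e A) x \<le> qf e x"
  using orthonormal_residual[OF pform_onD(1)[OF e] A, of x]
    pform_onD(2)[OF e, of "x - (\<Sum>a\<in>A. e x a *\<^sub>V a)"] by simp

text \<open>On \<open>F\<close> the form \<open>e\<close> thus agrees with a finite sum of rank one
  forms, each of which \<open>point_domination\<close> can handle. As \<open>e\<close> may be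
  degenerate, a vector whose residual is null adds nothing to \<open>A\<close>.\<close>

lemma gram_schmidt:
  assumes e: "pform e" and F: "finite F"
  obtains A where "finite A" "orthonormal e A" "\<And>x. x \<in> F \<Longrightarrow> qf (proj_form e A) x = qf e x"
proof -
  note he = pform_onD(1)[OF e]
  have "\<exists>A. finite A \<and> orthonormal e A \<and> (\<forall>x\<in>F. qf (proj_form e A) x = qf e x)"
    using F
  proof induction
    case empty
    show ?case by (auto simp: orthonormal_def)
  next
    case (insert x F)
    then obtain A where A: "finite A" "orthonormal e A" "\<And>y. y \<in> F \<Longrightarrow> qf (proj_form e A) y = qf e y" by blast
    define z where "z = x - (\<Sum>a\<in>A. e x a *\<^sub>V a)"
    have qz: "qf e z = qf e x - qf (proj_form e A) x"
      unfolding z_def by (rule orthonormal_residual[OF he A(2,1)])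
    have za: "e z a = 0" if "a \<in> A" for a
      unfolding z_def by (rule orthonormal_component[OF he A(2,1) that])
    show ?case
    proof (cases "qf e z = 0")
      case True
      then show ?thesis using A qz by auto
    next
      case False
      then have z0: "0 < qf e z" using pform_onD(2)[OF e, of z] by simp
      define c where "c = 1 / sqrt (qf e z)"
      define n where "n = of_real c *\<^sub>V z"
      have c2: "c * c * qf e z = 1" using z0 by (simp add: c_def)
      have nn: "e n n = 1"
      proof -
        have "e n n = of_real (c * c) * e z z" by (simp add: n_def hf_cscl[OF he] hf_cscr[OF he])
        also have "e z z = of_real (qf e z)" by (rule hf_real[OF he]) simp
        finally show ?thesis using c2 by (metis of_real_1 of_real_mult)
      qed
      have na: "e n a = 0" "e a n = 0" if "a \<in> A" for a
      proof -
        show "e n a = 0" using za[OF that] by (simp add: n_def hf_cscl[OF he])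
        then show "e a n = 0" using hf_sym[OF he, of n a] by simp
      qed
      have nA: "n \<notin> A" using na(1)[of n] nn by auto
      have on: "orthonormal e (insert n A)"
        using A(2) nn na nA by (auto simp: orthonormal_def)
      have fi: "finite (insert n A)" using A(1) by simp
      have split: "qf (proj_form e (insert n A)) y = (cmod (e y n))\<^sup>2 + qf (proj_form e A) y" for y
        unfolding qf_proj_form using A(1) nA by simp
      have "qf (proj_form e (insert n A)) y = qf e y" if "y \<in> F" for y
        using bessel[OF e on fi, of y] split[of y] A(3)[OF that] by simp
      moreover have "qf (proj_form e (insert n A)) x = qf e x"
      proof -
        have "e (\<Sum>a\<in>A. e x a *\<^sub>V a) n = 0"
          unfolding hf_suml[OF he] by (simp add: hf_cscl[OF he] na)
        then have "e x n = e z n" by (simp add: z_def hf_diffl[OF he])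
        also have "\<dots> = of_real c * e z z" by (simp add: n_def hf_cscr[OF he])
        also have "e z z = of_real (qf e z)" by (rule hf_real[OF he]) simp
        finally have "(cmod (e x n))\<^sup>2 = (c * qf e z)\<^sup>2" using norm_of_real by (metis of_real_mult power2_abs)
        also have "\<dots> = qf e z" using c2 z0 by (simp add: power2_eq_square mult_ac)
        finally show ?thesis using split[of x] qz by simp
      qed
      ultimately show ?thesis using on fi by blast
    qed
  qed
  then show ?thesis using that by blast
qed

context split_bmod
begin

theorem invariant_equivalent_form:
  obtains p C where "pform p" "invf p" "\<And>x. qf e x \<le> qf p x" "\<And>x. qf p x \<le> C * qf e x"
proof -
  obtain C where C: "\<And>p r. pform p \<Longrightarrow> invf p \<Longrightarrow> bddf p \<Longrightarrow> pform r \<Longrightarrow> (\<And>x. qf r x \<le> qf e x) \<Longrightarrow>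
      (\<And>x. qf r x \<le> qf p x) \<Longrightarrow>
      \<exists>p'. pform p' \<and> invf p' \<and> (\<forall>x. qf r x \<le> qf p' x) \<and> (\<forall>x. qf p' x \<le> C * qf e x)"
    by (rule uniform_bound) blast
  define good where "good F p \<longleftrightarrow> pform p \<and> invf p \<and> (\<forall>x\<in>F. qf e x \<le> qf p x) \<and> (\<forall>x. qf p x \<le> C * qf e x)" for F p
  have ex: "\<exists>p. good F p" if F: "finite F" for F
  proof -
    obtain A where A: "finite A" "orthonormal e A" "\<And>x. x \<in> F \<Longrightarrow> qf (proj_form e A) x = qf e x"
      using gram_schmidt[OF e F] by metis
    have "\<forall>a. \<exists>p L. pform p \<and> invf p \<and> bddf p \<and> 0 < L \<and> (\<forall>y. (cmod (e a y))\<^sup>2 \<le> L * qf p y)"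
      using point_domination by metis
    then obtain P L where PL: "\<And>a. pform (P a)" "\<And>a. invf (P a)" "\<And>a. bddf (P a)" "\<And>a. 0 < L a"
        "\<And>a y. (cmod (e a y))\<^sup>2 \<le> L a * qf (P a) y" by metis
    \<comment> \<open>The weights \<open>L a\<close> make this invariant form dominate the
      projection form of \<open>A\<close>. By Bessel the latter is below \<open>e\<close>, so it can
      serve as the form \<open>r\<close> of the uniform bound, and it equals \<open>e\<close> on
      \<open>F\<close>.\<close>
    define p where "p x y = (\<Sum>a\<in>A. of_real (L a) * P a x y)" for x y
    have "pform p" unfolding p_def by (intro pform_sum pform_scale PL less_imp_le)
    moreover have "invf p" using PL(2) by (simp add: invf_def p_def)
    moreover have "bddf p" unfolding p_def
    proof (rule bddf_sum)
      fix a
      obtain K where "\<And>x. qf (P a) x \<le> K * qf e x" using PL(3)[of a] unfolding bddf_def by blast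
      then have "qf (\<lambda>x y. of_real (L a) * P a x y) x \<le> (L a * K) * qf e x" for x
        using PL(4)[of a] mult_left_mono[of "qf (P a) x" "K * qf e x" "L a"] by (simp add: mult.assoc)
      then show "bddf (\<lambda>x y. of_real (L a) * P a x y)" unfolding bddf_def by blast
    qed
    moreover have "qf (proj_form e A) y \<le> qf p y" for y
    proof -
      have "cmod (e y a) = cmod (e a y)" for a using hf_sym[OF he, of y a] by simp
      then have "qf (proj_form e A) y \<le> (\<Sum>a\<in>A. L a * qf (P a) y)"
        unfolding qf_proj_form by (intro sum_mono) (simp add: PL(5))
      then show ?thesis by (simp add: p_def)
    qed
    ultimately obtain p' where p': "pform p'" "invf p'" "\<And>x. qf (proj_form e A) x \<le> qf p' x" "\<And>x. qf p' x \<le> C * qf e x"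
      using C[OF _ _ _ pform_proj_form[OF he] bessel[OF e A(2,1)]] by blast
    have "good F p'" unfolding good_def
    proof (intro conjI ballI allI p')
      fix x assume "x \<in> F"
      then show "qf e x \<le> qf p' x" using p'(3)[of x] A(3)[of x] by simp
    qed
    then show ?thesis by blast
  qed
  \<comment> \<open>A form is regarded as a point of the product over all pairs of vectors. A closed
    condition counts if it holds for all forms that are good on some finite set; a union of finite
    sets then takes care of finitely many conditions.\<close>
  define nice where "nice S \<longleftrightarrow> closed S \<and> (\<exists>F. finite F \<and> (\<forall>p. good F p \<longrightarrow> (\<lambda>(x, y). p x y) \<in> S))" for S
  obtain f where f: "f \<in> \<Inter>{S. nice S}"
  proof (rule pointwise_bounded_fip)
    show "closed S" if "S \<in> {S. nice S}" for S using that by (simp add: nice_def)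
    fix G assume G: "finite G" "G \<subseteq> {S. nice S}"
    then have "\<exists>F. finite F \<and> (\<forall>p. good F p \<longrightarrow> (\<lambda>(x, y). p x y) \<in> \<Inter>G)"
    proof (induction rule: finite_induct)
      case (insert S G)
      then obtain F1 F2 where F: "finite F1" "finite F2" "\<forall>p. good F1 p \<longrightarrow> (\<lambda>(x, y). p x y) \<in> S"
          "\<forall>p. good F2 p \<longrightarrow> (\<lambda>(x, y). p x y) \<in> \<Inter>G"
        by (auto simp: nice_def)
      then have "\<forall>p. good (F1 \<union> F2) p \<longrightarrow> (\<lambda>(x, y). p x y) \<in> \<Inter>(insert S G)"
        by (simp add: good_def)
      then show ?case using F by (meson finite_UnI)
    qed auto
    then obtain F where F: "finite F" "\<And>p. good F p \<Longrightarrow> (\<lambda>(x, y). p x y) \<in> \<Inter>G" by metis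
    obtain p where "good F p" using ex[OF F(1)] ..
    then have p: "good F p" "(\<lambda>(x, y). p x y) \<in> \<Inter>G" using F(2) by simp_all
    have "cmod ((\<lambda>(x, y). p x y) z) \<le> (\<lambda>(x, y). sqrt (C * qf e x) * sqrt (C * qf e y)) z" for z
    proof (cases z)
      case (Pair x y)
      have pp: "pform p" using p by (simp add: good_def)
      have "cmod (p x y) \<le> sqrt (qf p x) * sqrt (qf p y)" by (rule pf_cauchy_schwarz_sqrt[OF pp]) simp_all
      also have "\<dots> \<le> sqrt (C * qf e x) * sqrt (C * qf e y)"
      proof -
        have l: "qf p x \<le> C * qf e x" for x using p(1) by (simp add: good_def)
        have p0: "0 \<le> qf p x" for x by (rule pform_onD(2)[OF pp]) simp
        then have "0 \<le> C * qf e x" for x using l by (rule order_trans)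
        then show ?thesis by (intro mult_mono real_sqrt_le_mono l real_sqrt_ge_zero p0)
      qed
      finally show ?thesis by (simp add: Pair)
    qed
    with p(2) show "\<exists>f\<in>\<Inter>G. \<forall>z. cmod (f z) \<le> (\<lambda>(x, y). sqrt (C * qf e x) * sqrt (C * qf e y)) z" by blast
  qed
  have inS: "f \<in> S" if "closed S" "finite F" "\<And>p. good F p \<Longrightarrow> (\<lambda>(x, y). p x y) \<in> S" for S F
    using f that by (auto simp: nice_def)
  define p where "p x y = f (x, y)" for x y
  have eq: "L f = R f" if "continuous_on UNIV L" "continuous_on UNIV R"
    "\<And>p. good {} p \<Longrightarrow> L (\<lambda>(x, y). p x y) = (R (\<lambda>(x, y). p x y) :: complex)" for L R
    using inS[OF closed_Collect_eq[OF that(1,2)], of "{}"] that(3) by simp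
  have le: "L f \<le> R f" if "continuous_on UNIV L" "continuous_on UNIV R" "finite F"
    "\<And>p. good F p \<Longrightarrow> L (\<lambda>(x, y). p x y) \<le> (R (\<lambda>(x, y). p x y) :: real)" for L R F
    using inS[OF closed_Collect_le[OF that(1,2)] that(3)] that(4) by simp
  note ci = continuous_intros continuous_on_product_coordinates
  have gh: "hform p" if "good {} p" for p using that by (simp add: good_def pform_on_def)
  have hp: "hform p"
    unfolding hform_on_def p_def
  proof (intro conjI ballI allI)
    fix x y z c
    show "f (x + y, z) = f (x, z) + f (y, z)"
      by (rule eq[where L = "\<lambda>f. f (x + y, z)" and R = "\<lambda>f. f (x, z) + f (y, z)"])
        (intro ci | simp add: hf_addl[OF gh])+
    show "f (c *\<^sub>V x, y) = c * f (x, y)"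
      by (rule eq[where L = "\<lambda>f. f (c *\<^sub>V x, y)" and R = "\<lambda>f. c * f (x, y)"])
        (intro ci | simp add: hf_cscl[OF gh])+
    show "f (y, x) = cnj (f (x, y))"
    proof (rule eq[where L = "\<lambda>f. f (y, x)" and R = "\<lambda>f. cnj (f (x, y))"])
      fix p assume "good {} p"
      then have "hform p" by (simp add: good_def pform_on_def)
      then show "(\<lambda>(x, y). p x y) (y, x) = cnj ((\<lambda>(x, y). p x y) (x, y))" by (simp add: hf_sym[of UNIV p x y])
    qed (intro ci)+
  qed simp
  have ge: "qf e x \<le> qf p x" for x
    unfolding p_def
    by (rule le[where L = "\<lambda>f. qf e x" and R = "\<lambda>f. Re (f (x, x))" and F = "{x}"])
      (intro ci | simp add: good_def)+
  have le: "qf p x \<le> C * qf e x" for x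
    unfolding p_def
    by (rule le[where L = "\<lambda>f. Re (f (x, x))" and R = "\<lambda>f. C * qf e x" and F = "{}"])
      (intro ci | simp add: good_def)+
  have pp: "pform p" unfolding pform_on_def using hp ge e0 by (meson order_trans)
  have inv: "invf p"
    unfolding invf_def p_def
  proof (intro allI impI)
    fix u x y assume u: "unitary (u :: 'b)"
    show "f (act u x, act u y) = f (x, y)"
      by (rule eq[where L = "\<lambda>f. f (act u x, act u y)" and R = "\<lambda>f. f (x, y)"])
        (intro ci | use u in \<open>simp add: good_def invf_def\<close>)+
  qed
  show ?thesis by (rule that[OF pp inv ge le])
qed

end

section \<open>Complemented subspaces\<close>

text \<open>A Hilbert space carried by a subspace of a total vector space. Dual spaces of forms and
  copies of the given Hilbert spaces are both of this kind.\<close>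

locale hilbert_set =
  fixes S :: "'v::cvec set" and ip :: "'v \<Rightarrow> 'v \<Rightarrow> complex"
  assumes ip: "pform_on S ip"
    and definite: "x \<in> S \<Longrightarrow> qf ip x = 0 \<Longrightarrow> x = 0"
    and complete: "(\<And>n. v n \<in> S) \<Longrightarrow> (\<And>\<epsilon>. 0 < \<epsilon> \<Longrightarrow> \<exists>N. \<forall>m\<ge>N. \<forall>n\<ge>N. sqrt (qf ip (v m - v n)) < \<epsilon>) \<Longrightarrow>
      \<exists>l\<in>S. (\<lambda>n. sqrt (qf ip (v n - l))) \<longlonglongrightarrow> 0"
begin

definition nn :: "'v \<Rightarrow> real" where "nn x = sqrt (qf ip x)"

lemmas hip = pform_onD(1)[OF ip]
lemmas sub = hf_csub[OF hip]
lemmas S_intros = csub_add[OF sub] csub_diff[OF sub] csub_csc[OF sub] csub_zero[OF sub] csub_sum[OF sub]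

lemma nn_nonneg [simp]: "x \<in> S \<Longrightarrow> 0 \<le> nn x"
  using pform_onD(2)[OF ip] by (simp add: nn_def)

lemma nn_add: "x \<in> S \<Longrightarrow> y \<in> S \<Longrightarrow> nn (x + y) \<le> nn x + nn y"
  unfolding nn_def by (rule pf_triangle[OF ip])

lemma ip_cauchy_schwarz: "x \<in> S \<Longrightarrow> y \<in> S \<Longrightarrow> cmod (ip x y) \<le> nn x * nn y"
  unfolding nn_def by (rule pf_cauchy_schwarz_sqrt[OF ip])

lemma nn_csc: "x \<in> S \<Longrightarrow> nn (c *\<^sub>V x) = cmod c * nn x"
  using qf_csc[OF hip, of x c] by (simp add: nn_def real_sqrt_mult)

lemma nn_zero: "nn 0 = 0"
  using qf_zero[OF hip] by (simp add: nn_def)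

lemma nn_sym: "x \<in> S \<Longrightarrow> y \<in> S \<Longrightarrow> nn (x - y) = nn (y - x)"
  using nn_csc[of "y - x" "-1"] S_intros by simp

lemma nn_diff: "x \<in> S \<Longrightarrow> y \<in> S \<Longrightarrow> nn (x - y) \<le> nn x + nn y"
  using nn_add[of x "- y"] nn_csc[of y "-1"] csub_minus[OF sub, of y] by simp

lemma nn_dist: "x \<in> S \<Longrightarrow> y \<in> S \<Longrightarrow> z \<in> S \<Longrightarrow> nn (x - z) \<le> nn (x - y) + nn (y - z)"
  using nn_add[of "x - y" "y - z"] S_intros by simp

lemma nn_eq_0: "x \<in> S \<Longrightarrow> nn x = 0 \<Longrightarrow> x = 0"
  using definite by (simp add: nn_def)

lemma complete_nn:
  assumes "\<And>n. v n \<in> S" "\<And>\<epsilon>. 0 < \<epsilon> \<Longrightarrow> \<exists>N. \<forall>m\<ge>N. \<forall>n\<ge>N. nn (v m - v n) < \<epsilon>"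
  obtains l where "l \<in> S" "(\<lambda>n. nn (v n - l)) \<longlonglongrightarrow> 0"
  using complete[of v] assms unfolding nn_def by blast

definition sclosed :: "'v set \<Rightarrow> bool"
  where "sclosed V \<longleftrightarrow> V \<subseteq> S \<and> (\<forall>v l. (\<forall>n. v n \<in> V) \<longrightarrow> l \<in> S \<longrightarrow> (\<lambda>n. nn (v n - l)) \<longlonglongrightarrow> 0 \<longrightarrow> l \<in> V)"

definition hdst :: "'v \<Rightarrow> 'v \<Rightarrow> real"
  where "hdst x y = (if x \<in> S \<and> y \<in> S then nn (x - y) else 0)"

lemma Metric_space_hdst: "Metric_space S hdst"
proof
  show "0 \<le> hdst x y" for x y by (simp add: hdst_def S_intros)
  show "hdst x y = hdst y x" for x y by (simp add: hdst_def nn_sym)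
  show "hdst x y = 0 \<longleftrightarrow> x = y" if "x \<in> S" "y \<in> S" for x y
    using nn_eq_0[of "x - y"] that by (auto simp: hdst_def S_intros nn_zero)
  show "hdst x z \<le> hdst x y + hdst y z" if "x \<in> S" "y \<in> S" "z \<in> S" for x y z
    using that by (simp add: hdst_def nn_dist)
qed

lemma mcomplete_hdst: "Metric_space.mcomplete S hdst"
proof -
  interpret MS: Metric_space S hdst by (rule Metric_space_hdst)
  show ?thesis
    unfolding MS.mcomplete_def
  proof (intro allI impI)
    fix v assume v: "MS.MCauchy v"
    then have vS: "v n \<in> S" for n by (auto simp: MS.MCauchy_def)
    have h: "hdst (v m) (v n) = nn (v m - v n)" for m n by (simp add: hdst_def vS)
    have C: "\<exists>N. \<forall>m\<ge>N. \<forall>n\<ge>N. nn (v m - v n) < \<epsilon>" if "0 < \<epsilon>" for \<epsilon>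
      using v that unfolding MS.MCauchy_def h by meson
    obtain l where l: "l \<in> S" "(\<lambda>n. nn (v n - l)) \<longlonglongrightarrow> 0" by (rule complete_nn[OF vS C])
    then have "limitin MS.mtopology v l sequentially"
      unfolding MS.limitin_metric_dist_null by (simp add: vS hdst_def)
    then show "\<exists>l. limitin MS.mtopology v l sequentially" by blast
  qed
qed

lemma geometric_series:
  assumes a: "\<And>n. a n \<in> V" and V: "csub V" "sclosed V" and bd: "\<And>n. nn (a n) \<le> K * (1/2) ^ n"
  obtains l where "l \<in> V" "(\<lambda>n. nn ((\<Sum>i<n. a i) - l)) \<longlonglongrightarrow> 0" "nn l \<le> 2 * K"
proof -
  have VS: "V \<subseteq> S" using V(2) by (simp add: sclosed_def)
  have aS: "a n \<in> S" for n using a VS by blast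
  define s where "s n = (\<Sum>i<n. a i)" for n
  have sV: "s n \<in> V" for n unfolding s_def by (intro csub_sum V a)
  then have sS: "s n \<in> S" for n using VS by blast
  have K: "0 \<le> K" using bd[of 0] nn_nonneg[OF aS[of 0]] by simp
  have step: "nn (s (n + m) - s n) \<le> 2 * K * ((1/2) ^ n - (1/2) ^ (n + m))" for n m
  proof (induction m)
    case (Suc m)
    have "nn (s (n + Suc m) - s n) \<le> nn (s (n + Suc m) - s (n + m)) + nn (s (n + m) - s n)"
      by (rule nn_dist[OF sS sS sS])
    also have "s (n + Suc m) - s (n + m) = a (n + m)" by (simp add: s_def)
    also have "nn (a (n + m)) \<le> K * (1/2) ^ (n + m)" by (rule bd)
    finally show ?case using Suc by (simp add: algebra_simps)
  qed (simp add: nn_zero)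
  have bnd: "nn (s m - s n) \<le> 2 * K * (1/2) ^ n" if "n \<le> m" for m n
  proof -
    have "nn (s m - s n) \<le> 2 * K * ((1/2) ^ n - (1/2) ^ m)" using step[of n "m - n"] that by simp
    also have "\<dots> \<le> 2 * K * (1/2) ^ n" using K by (intro mult_left_mono) auto
    finally show ?thesis .
  qed
  have "(\<lambda>n. 2 * K * (1/2) ^ n) \<longlonglongrightarrow> 2 * K * 0"
    by (intro tendsto_mult tendsto_const LIMSEQ_power_zero) simp
  then have t0: "(\<lambda>n. 2 * K * (1/2) ^ n) \<longlonglongrightarrow> 0" by simp
  have C: "\<exists>N. \<forall>m\<ge>N. \<forall>n\<ge>N. nn (s m - s n) < \<epsilon>" if \<epsilon>: "0 < \<epsilon>" for \<epsilon>
  proof -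
    obtain N where N: "\<And>n. n \<ge> N \<Longrightarrow> 2 * K * (1/2) ^ n < \<epsilon>"
      using order_tendstoD(2)[OF t0 \<epsilon>] unfolding eventually_sequentially by blast
    have "nn (s m - s n) < \<epsilon>" if "m \<ge> N" "n \<ge> N" for m n
      using bnd[of m n] bnd[of n m] N[OF that(1)] N[OF that(2)] nn_sym[OF sS sS, of m n] by linarith
    then show ?thesis by blast
  qed
  obtain l where l: "l \<in> S" "(\<lambda>n. nn (s n - l)) \<longlonglongrightarrow> 0" by (rule complete_nn[OF sS C])
  have lV: "l \<in> V" using V(2) sV l unfolding sclosed_def by blast
  have "nn l \<le> 2 * K + nn (s n - l)" for n
  proof -
    have "nn l \<le> nn (s n) + nn (s n - l)" using nn_diff[OF sS[of n] S_intros(2)[OF sS[of n] l(1)]] by simp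
    then show ?thesis using bnd[of 0 n] by (simp add: s_def)
  qed
  moreover have "(\<lambda>n. 2 * K + nn (s n - l)) \<longlonglongrightarrow> 2 * K + 0" by (intro tendsto_intros l)
  ultimately have "nn l \<le> 2 * K + 0" by (intro LIMSEQ_le_const) auto
  with lV l(2) show ?thesis by (intro that[of l]) (simp_all add: s_def)
qed

text \<open>The open mapping theorem for addition on \<open>V \<times> W\<close>. By Baire, sums
  with a bounded \<open>V\<close> component are dense in some ball; subtracting two of them moves
  the ball to the origin, and successive approximation turns density into equality.\<close>

theorem bounded_projection:
  assumes V: "csub V" "sclosed V" and W: "csub W" "sclosed W" and VW: "V \<inter> W = {0}"
    and sum: "\<And>x. x \<in> S \<Longrightarrow> \<exists>v\<in>V. \<exists>w\<in>W. x = v + w"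
  obtains C where "0 \<le> C" "\<And>v w. v \<in> V \<Longrightarrow> w \<in> W \<Longrightarrow> nn v \<le> C * nn (v + w)"
proof -
  have VS: "V \<subseteq> S" and WS: "W \<subseteq> S" using V W by (auto simp: sclosed_def)
  interpret MS: Metric_space S hdst by (rule Metric_space_hdst)
  \<comment> \<open>Bounding the \<open>V\<close> component is enough. In the approximation below,
    the \<open>W\<close> component is a difference of remainders minus the \<open>V\<close>
    component and inherits a bound.\<close>
  define B where "B k = {v + w | v w. v \<in> V \<and> w \<in> W \<and> nn v \<le> real k}" for k
  have BS: "B k \<subseteq> S" for k using VS WS by (auto simp: B_def intro!: S_intros)
  have cover: "(\<Union>k. B k) = S"
  proof
    show "S \<subseteq> (\<Union>k. B k)"
    proof
      fix x assume "x \<in> S"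
      then obtain v w where "v \<in> V" "w \<in> W" "x = v + w" using sum by blast
      moreover obtain k where "nn v \<le> real k" using real_arch_simple by blast
      ultimately show "x \<in> (\<Union>k. B k)" by (auto simp: B_def)
    qed
  qed (use BS in blast)
  define cl where "cl k = Abstract_Topology.closure_of MS.mtopology (B k)" for k
  have "\<exists>k. MS.mtopology interior_of (cl k) \<noteq> {}"
  proof (rule ccontr)
    assume "\<not> ?thesis"
    then have "MS.mtopology interior_of (\<Union>(range (\<lambda>k. cl k))) = {}"
      by (intro MS.metric_Baire_category_alt[OF mcomplete_hdst]) (auto simp: cl_def)
    moreover have "\<Union>(range (\<lambda>k. cl k)) = S"
    proof
      show "\<Union>(range (\<lambda>k. cl k)) \<subseteq> S"
        using closure_of_subset_topspace[of MS.mtopology] by (auto simp: cl_def)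
      have "B k \<subseteq> cl k" for k unfolding cl_def using BS by (intro closure_of_subset) simp
      then show "S \<subseteq> \<Union>(range (\<lambda>k. cl k))" using cover by blast
    qed
    moreover have "MS.mtopology interior_of S = S" using interior_of_topspace[of MS.mtopology] by simp
    ultimately show False using S_intros(4) by auto
  qed
  then obtain k x0 where "x0 \<in> MS.mtopology interior_of (cl k)" by blast
  then obtain r where r: "0 < r" and x0: "x0 \<in> S" and ball: "MS.mball x0 r \<subseteq> cl k"
    unfolding MS.metric_interior_of by blast
  have approx: "\<exists>v\<in>V. \<exists>w\<in>W. nn v \<le> real k \<and> nn (x - (v + w)) < \<delta>"
    if x: "x \<in> S" "nn (x0 - x) < r" and \<delta>: "0 < \<delta>" for x \<delta>
  proof -
    have "x \<in> cl k" using ball x x0 by (auto simp: hdst_def)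
    then obtain b where b: "b \<in> B k" "b \<in> MS.mball x \<delta>" unfolding cl_def MS.metric_closure_of using \<delta> by blast
    then have "nn (x - b) < \<delta>" using x(1) BS by (auto simp: hdst_def)
    then show ?thesis using b(1) by (auto simp: B_def)
  qed
  define D where "D = 4 * (real k + 1) / r"
  have D0: "0 \<le> D" using r by (simp add: D_def)
  have half: "\<exists>v\<in>V. \<exists>w\<in>W. nn v \<le> D * nn y \<and> nn (y - (v + w)) \<le> nn y / 2" if y: "y \<in> S" for y
  proof (cases "nn y = 0")
    case True
    then have "y = 0" by (rule nn_eq_0[OF y])
    then show ?thesis using csub_zero[OF V(1)] csub_zero[OF W(1)]
      by (intro bexI[of _ 0]) (simp_all add: nn_zero)
  next
    case False
    then have ny: "0 < nn y" using nn_nonneg[OF y] by simp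
    \<comment> \<open>Scaled to length \<open>r / 2\<close>, the vector keeps \<open>x0 + z\<close>
      inside the ball. Approximations of \<open>x0 + z\<close> and of \<open>x0\<close> within
      \<open>r / 8\<close> subtract to one of \<open>z\<close> within half its length, and scaling
      back turns \<open>2 * real k\<close> into at most \<open>D * nn y\<close>.\<close>
    define t where "t = r / (2 * nn y)"
    have t: "0 < t" using r ny by (simp add: t_def)
    define z where "z = of_real t *\<^sub>V y"
    have z: "z \<in> S" "nn z = r / 2" using y t ny by (simp_all add: z_def S_intros nn_csc) (simp add: t_def)
    have "nn (x0 - (x0 + z)) < r" using nn_csc[OF z(1), of "-1"] z(2) r by simp
    then obtain v1 w1 where 1: "v1 \<in> V" "w1 \<in> W" "nn v1 \<le> real k" "nn (x0 + z - (v1 + w1)) < r / 8"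
      using approx[of "x0 + z" "r / 8"] x0 z r S_intros by auto
    obtain v2 w2 where 2: "v2 \<in> V" "w2 \<in> W" "nn v2 \<le> real k" "nn (x0 - (v2 + w2)) < r / 8"
      using approx[of x0 "r / 8"] x0 r by (auto simp: nn_zero)
    note mem = 1(1,2) 2(1,2)
    have memS: "v1 \<in> S" "w1 \<in> S" "v2 \<in> S" "w2 \<in> S" using mem VS WS by auto
    define v w where "v = of_real (1 / t) *\<^sub>V (v1 - v2)" and "w = of_real (1 / t) *\<^sub>V (w1 - w2)"
    have vV: "v \<in> V" and wW: "w \<in> W"
      unfolding v_def w_def by (intro csub_csc csub_diff V W mem)+
    have "nn v = (1 / t) * nn (v1 - v2)" using t memS by (simp add: v_def nn_csc S_intros norm_divide)
    also have "\<dots> \<le> (1 / t) * (2 * real k)"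
      using nn_diff[OF memS(1,3)] 1(3) 2(3) t by (intro mult_left_mono) auto
    also have "\<dots> \<le> D * nn y" using r ny by (simp add: t_def D_def field_simps)
    finally have nv: "nn v \<le> D * nn y" .
    have "of_real (1 / t) *\<^sub>V of_real t *\<^sub>V y = y" using t by simp
    then have "y - (v + w) = of_real (1 / t) *\<^sub>V ((x0 + z - (v1 + w1)) - (x0 - (v2 + w2)))"
      unfolding v_def w_def z_def by (simp only: csc_add_right csc_diff_right) (simp add: algebra_simps)
    moreover have "(x0 + z - (v1 + w1)) - (x0 - (v2 + w2)) \<in> S" by (intro S_intros x0 z memS)
    ultimately have "nn (y - (v + w)) = (1 / t) * nn ((x0 + z - (v1 + w1)) - (x0 - (v2 + w2)))"
      using t nn_csc[of _ "of_real (1 / t)"] by (simp only:) (simp add: norm_divide)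
    also have "\<dots> \<le> (1 / t) * (r / 8 + r / 8)"
    proof (intro mult_left_mono)
      have "nn ((x0 + z - (v1 + w1)) - (x0 - (v2 + w2))) \<le> nn (x0 + z - (v1 + w1)) + nn (x0 - (v2 + w2))"
        by (intro nn_diff S_intros x0 z memS)
      then show "nn ((x0 + z - (v1 + w1)) - (x0 - (v2 + w2))) \<le> r / 8 + r / 8" using 1(4) 2(4) by linarith
    qed (use t in simp)
    also have "\<dots> = nn y / 2" using r by (simp add: t_def field_simps)
    finally show ?thesis using nv vV wW by blast
  qed
  then obtain gv gw where g: "\<And>y. y \<in> S \<Longrightarrow> gv y \<in> V" "\<And>y. y \<in> S \<Longrightarrow> gw y \<in> W"
      "\<And>y. y \<in> S \<Longrightarrow> nn (gv y) \<le> D * nn y" "\<And>y. y \<in> S \<Longrightarrow> nn (y - (gv y + gw y)) \<le> nn y / 2"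
    by metis
  have main: "\<exists>v\<in>V. \<exists>w\<in>W. x = v + w \<and> nn v \<le> 2 * D * nn x" if x: "x \<in> S" for x
  proof -
    \<comment> \<open>The remainders of the successive approximation. They halve at each step, so
      the collected \<open>V\<close> and \<open>W\<close> parts are dominated by geometric
      series.\<close>
    define Y where "Y n = ((\<lambda>y. y - (gv y + gw y)) ^^ n) x" for n
    have YS: "Y (Suc n) = Y n - (gv (Y n) + gw (Y n))" and Y0: "Y 0 = x" for n by (simp_all add: Y_def)
    have Yin: "Y n \<in> S" for n
      by (induction n) (use x g(1,2) VS WS in \<open>auto simp: Y0 YS intro!: S_intros\<close>)
    have Yn: "nn (Y n) \<le> nn x * (1/2) ^ n" for n
      by (induction n) (use g(4)[OF Yin] in \<open>auto simp: Y0 YS intro: order_trans\<close>)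
    have vb: "nn (gv (Y n)) \<le> (D * nn x) * (1/2) ^ n" for n
      using g(3)[OF Yin, of n] mult_left_mono[OF Yn[of n] D0] by (simp add: mult.assoc)
    have vV: "gv (Y n) \<in> V" and wW: "gw (Y n) \<in> W" for n using g Yin by auto
    have vS: "gv (Y n) \<in> S" and wS: "gw (Y n) \<in> S" for n using vV wW VS WS by auto
    have wb: "nn (gw (Y n)) \<le> ((2 + D) * nn x) * (1/2) ^ n" for n
    proof -
      have "gw (Y n) = (Y n - Y (Suc n)) - gv (Y n)" by (simp add: YS)
      then have "nn (gw (Y n)) \<le> nn (Y n - Y (Suc n)) + nn (gv (Y n))"
        using nn_diff[OF S_intros(2)[OF Yin Yin] vS] by metis
      also have "nn (Y n - Y (Suc n)) \<le> nn (Y n) + nn (Y (Suc n))" by (rule nn_diff[OF Yin Yin])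
      also have "nn (Y (Suc n)) \<le> nn x * (1/2) ^ n"
        using g(4)[OF Yin[of n]] Yn[of n] nn_nonneg[OF Yin[of n]] unfolding YS by linarith
      finally show ?thesis using Yn[of n] vb[of n] by (simp add: algebra_simps)
    qed
    obtain v where v: "v \<in> V" "(\<lambda>n. nn ((\<Sum>i<n. gv (Y i)) - v)) \<longlonglongrightarrow> 0" "nn v \<le> 2 * (D * nn x)"
      by (rule geometric_series[OF vV V vb])
    obtain w where w: "w \<in> W" "(\<lambda>n. nn ((\<Sum>i<n. gw (Y i)) - w)) \<longlonglongrightarrow> 0" "nn w \<le> 2 * ((2 + D) * nn x)"
      by (rule geometric_series[OF wW W wb])
    have part: "x - Y n = (\<Sum>i<n. gv (Y i)) + (\<Sum>i<n. gw (Y i))" for n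
      by (induction n) (simp_all add: Y0 YS algebra_simps)
    have vwS: "v \<in> S" "w \<in> S" using v w VS WS by auto
    have sS: "(\<Sum>i<n. gv (Y i)) \<in> S" "(\<Sum>i<n. gw (Y i)) \<in> S" for n by (intro S_intros vS wS)+
    have "nn (x - (v + w)) \<le> nn x * (1/2) ^ n + (nn ((\<Sum>i<n. gv (Y i)) - v) + nn ((\<Sum>i<n. gw (Y i)) - w))" for n
    proof -
      have e: "x - (v + w) = Y n + (((\<Sum>i<n. gv (Y i)) - v) + ((\<Sum>i<n. gw (Y i)) - w))"
        using part[of n] by (simp add: algebra_simps)
      have "nn (x - (v + w)) \<le> nn (Y n) + nn (((\<Sum>i<n. gv (Y i)) - v) + ((\<Sum>i<n. gw (Y i)) - w))"
        unfolding e by (intro nn_add Yin S_intros sS vwS)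
      then show ?thesis
        using Yn[of n] nn_add[of "(\<Sum>i<n. gv (Y i)) - v" "(\<Sum>i<n. gw (Y i)) - w"] sS vwS S_intros by fastforce
    qed
    moreover have "(\<lambda>n. nn x * (1/2) ^ n + (nn ((\<Sum>i<n. gv (Y i)) - v) + nn ((\<Sum>i<n. gw (Y i)) - w))) \<longlonglongrightarrow> nn x * 0 + (0 + 0)"
      by (intro tendsto_add tendsto_mult tendsto_const LIMSEQ_power_zero v w) simp
    ultimately have "nn (x - (v + w)) \<le> nn x * 0 + (0 + 0)" by (intro LIMSEQ_le_const) auto
    moreover have xvw: "x - (v + w) \<in> S" by (intro S_intros x vwS)
    ultimately have "nn (x - (v + w)) = 0" using nn_nonneg[OF xvw] by linarith
    then have "x = v + w" using nn_eq_0[OF xvw] by simp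
    then show ?thesis using v w by auto
  qed
  show ?thesis
  proof (rule that[of "2 * D"])
    show "0 \<le> 2 * D" using D0 by simp
    fix v w assume vw: "v \<in> V" "w \<in> W"
    then have "v + w \<in> S" using VS WS by (auto intro!: S_intros)
    then obtain v' w' where v': "v' \<in> V" "w' \<in> W" "v + w = v' + w'" "nn v' \<le> 2 * D * nn (v + w)" using main by blast
    then have "v - v' = w' - w" by (simp add: algebra_simps)
    then have "v - v' \<in> V \<inter> W" using vw v' csub_diff[OF V(1)] csub_diff[OF W(1)] by (metis IntI)
    then have "v = v'" using VW by simp
    then show "nn v \<le> 2 * D * nn (v + w)" using v'(4) by simp
  qed
qed

end

section \<open>Transport of the total reduction property\<close>

lemma complex_ring_simps [simp]:
  "carrier complex_ring = UNIV" "a \<oplus>\<^bsub>complex_ring\<^esub> b = a + b" "a \<otimes>\<^bsub>complex_ring\<^esub> b = a * b"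
  "\<one>\<^bsub>complex_ring\<^esub> = 1" "\<zero>\<^bsub>complex_ring\<^esub> = 0"
  by (simp_all add: complex_ring_def)

lemma cring_complex_ring: "cring complex_ring"
  using field_complex_ring by (simp add: field_def domain_def)

lemma (in complex_inner_product_space) hnorm_smult: "x \<in> carrier H \<Longrightarrow> hnorm H (c \<odot>\<^bsub>H\<^esub> x) = cmod c * hnorm H x"
proof -
  assume x: "x \<in> carrier H"
  have "cinner H (c \<odot>\<^bsub>H\<^esub> x) (c \<odot>\<^bsub>H\<^esub> x) = (c * cnj c) * cinner H x x"
    using x by (simp add: cinner_smult_left cinner_smult_right smult_in_carrier)
  also have "\<dots> = of_real ((cmod c * hnorm H x)\<^sup>2)"
    using x complex_norm_square[of c] by (simp add: cinner_self power_mult_distrib)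
  finally have "Re (cinner H (c \<odot>\<^bsub>H\<^esub> x) (c \<odot>\<^bsub>H\<^esub> x)) = (cmod c * hnorm H x)\<^sup>2" by simp
  then show ?thesis using hnorm_nonneg[OF x] by (simp add: hnorm_def[of H "c \<odot>\<^bsub>H\<^esub> x"])
qed

lemma (in complex_inner_product_space) operator_norm_le:
  assumes "\<And>x. x \<in> carrier H \<Longrightarrow> hnorm H (T x) \<le> K * hnorm H x" "0 \<le> K"
  shows "operator_norm H T \<le> K"
  unfolding operator_norm_def
proof (rule cSUP_least)
  show "{x \<in> carrier H. hnorm H x \<le> 1} \<noteq> {}" using hnorm_eq_zero[of "\<zero>\<^bsub>H\<^esub>"] by auto
  fix x assume "x \<in> {x \<in> carrier H. hnorm H x \<le> 1}"
  then show "hnorm H (T x) \<le> K" using assms(1)[of x] mult_left_mono[of "hnorm H x" 1 K] assms(2) by simp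
qed

lemma (in complex_inner_product_space) operator_norm_nonneg:
  assumes "\<And>x. x \<in> carrier H \<Longrightarrow> T x \<in> carrier H" "\<And>x. x \<in> carrier H \<Longrightarrow> hnorm H (T x) \<le> K * hnorm H x"
  shows "0 \<le> operator_norm H T"
proof -
  have z: "\<zero>\<^bsub>H\<^esub> \<in> {x \<in> carrier H. hnorm H x \<le> 1}" using hnorm_eq_zero[of "\<zero>\<^bsub>H\<^esub>"] by auto
  have "bdd_above ((\<lambda>x. hnorm H (T x)) ` {x \<in> carrier H. hnorm H x \<le> 1})"
  proof (rule bdd_aboveI2)
    fix x assume "x \<in> {x \<in> carrier H. hnorm H x \<le> 1}"
    then show "hnorm H (T x) \<le> \<bar>K\<bar>"
      using assms(2)[of x] hnorm_nonneg[of x] mult_mono[OF abs_ge_self[of K], of "hnorm H x" 1] by simp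
  qed
  then have "hnorm H (T \<zero>\<^bsub>H\<^esub>) \<le> operator_norm H T" unfolding operator_norm_def by (rule cSUP_upper[OF z])
  then show ?thesis using hnorm_nonneg[OF assms(1)[of "\<zero>\<^bsub>H\<^esub>"]] by simp
qed

text \<open>Linearity in \<open>a\<close> reduces continuity in operator norm to one bound that is
  linear in \<open>norm a\<close>.\<close>

lemma (in complex_inner_product_space) representationI:
  assumes cl: "\<And>a x. x \<in> carrier H \<Longrightarrow> \<theta> a x \<in> carrier H"
    and addx: "\<And>a x y. x \<in> carrier H \<Longrightarrow> y \<in> carrier H \<Longrightarrow> \<theta> a (x \<oplus>\<^bsub>H\<^esub> y) = \<theta> a x \<oplus>\<^bsub>H\<^esub> \<theta> a y"
    and cscx: "\<And>a c x. x \<in> carrier H \<Longrightarrow> \<theta> a (c \<odot>\<^bsub>H\<^esub> x) = c \<odot>\<^bsub>H\<^esub> \<theta> a x"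
    and adda: "\<And>a b x. x \<in> carrier H \<Longrightarrow> \<theta> (a + b) x = \<theta> a x \<oplus>\<^bsub>H\<^esub> \<theta> b x"
    and csca: "\<And>a c x. x \<in> carrier H \<Longrightarrow> \<theta> (c *\<^sub>C a) x = c \<odot>\<^bsub>H\<^esub> \<theta> a x"
    and mult: "\<And>a b x. x \<in> carrier H \<Longrightarrow> \<theta> (a * b) x = \<theta> a (\<theta> b x)"
    and bd: "\<And>a x. x \<in> carrier H \<Longrightarrow> hnorm H (\<theta> a x) \<le> K * norm a * hnorm H x"
  shows "representation H (\<theta> :: 'a::cstar_algebra \<Rightarrow> _)"
proof -
  have bo: "\<theta> a \<in> bounded_operators H" for a
    unfolding bounded_operators_def mem_Collect_eq
    by (intro conjI ballI allI funcsetI exI[of _ "K * norm a"]) (simp_all add: cl addx cscx bd)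
  have lim: "((\<lambda>b. operator_norm H (\<lambda>x. \<theta> b x \<ominus>\<^bsub>H\<^esub> \<theta> a x)) \<longlongrightarrow> 0) (at a)" for a
  proof (rule tendsto_sandwich)
    have eq: "\<theta> b x \<ominus>\<^bsub>H\<^esub> \<theta> a x = \<theta> (b - a) x" if x: "x \<in> carrier H" for b x
    proof -
      have "\<theta> b x = \<theta> (b - a) x \<oplus>\<^bsub>H\<^esub> \<theta> a x" using adda[OF x, of "b - a" a] by simp
      then show ?thesis using cl[OF x] by (simp add: a_minus_def M.a_assoc M.r_neg)
    qed
    have bd2: "hnorm H (\<theta> b x \<ominus>\<^bsub>H\<^esub> \<theta> a x) \<le> (\<bar>K\<bar> * norm (b - a)) * hnorm H x" if x: "x \<in> carrier H" for b x
      using bd[OF x, of "b - a"] mult_right_mono[OF abs_ge_self[of K], of "norm (b - a) * hnorm H x"] hnorm_nonneg[OF x]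
      by (simp add: eq[OF x] mult.assoc)
    show "\<forall>\<^sub>F b in at a. 0 \<le> operator_norm H (\<lambda>x. \<theta> b x \<ominus>\<^bsub>H\<^esub> \<theta> a x)"
      by (intro always_eventually allI operator_norm_nonneg[OF _ bd2]) (simp_all add: cl)
    show "\<forall>\<^sub>F b in at a. operator_norm H (\<lambda>x. \<theta> b x \<ominus>\<^bsub>H\<^esub> \<theta> a x) \<le> \<bar>K\<bar> * norm (b - a)"
      by (intro always_eventually allI operator_norm_le[OF bd2]) simp_all
    have "((\<lambda>b. \<bar>K\<bar> * norm (b - a)) \<longlongrightarrow> \<bar>K\<bar> * norm (a - a)) (at a)" by (intro tendsto_intros)
    then show "((\<lambda>b. \<bar>K\<bar> * norm (b - a)) \<longlongrightarrow> 0) (at a)" by simp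
  qed simp
  show ?thesis unfolding representation_def using bo adda csca mult lim by blast
qed

section \<open>Isometric copies of Hilbert spaces in another type\<close>

context hilbert_set
begin

text \<open>The total reduction property speaks only of Hilbert spaces inside the type
  \<open>'h\<close>. An injection into \<open>'h\<close>, of whatever nature, installs the structure
  of \<open>S\<close> there. The values of the ring multiplication and unit are arbitrary.\<close>

definition transport :: "('v \<Rightarrow> 'h) \<Rightarrow> 'h inner_structure"
  where "transport f = (let g = the_inv_into S f in
    \<lparr>carrier = f ` S, monoid.mult = (\<lambda>_ _. f 0), one = f 0, ring.zero = f 0,
     add = (\<lambda>x y. f (g x + g y)), smult = (\<lambda>c x. f (c *\<^sub>V g x)), cinner = (\<lambda>x y. ip (g x) (g y))\<rparr>)"

definition isometric_copy :: "('v \<Rightarrow> 'h) \<Rightarrow> 'h inner_structure \<Rightarrow> bool"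
  where "isometric_copy f H \<longleftrightarrow> inj_on f S \<and> carrier H = f ` S \<and> \<zero>\<^bsub>H\<^esub> = f 0 \<and>
    (\<forall>x\<in>S. (\<forall>y\<in>S. f x \<oplus>\<^bsub>H\<^esub> f y = f (x + y) \<and> cinner H (f x) (f y) = ip x y) \<and>
      (\<forall>c. c \<odot>\<^bsub>H\<^esub> f x = f (c *\<^sub>V x)))"

lemma isometric_copy_transport: "inj_on f S \<Longrightarrow> isometric_copy f (transport f)"
  by (simp add: isometric_copy_def transport_def Let_def the_inv_into_f_f)

context
  fixes f :: "'v \<Rightarrow> 'h" and H
  assumes copy: "isometric_copy f H"
begin

lemma copy_inj: "inj_on f S"
  and copy_carrier: "carrier H = f ` S"
  and copy_zero: "\<zero>\<^bsub>H\<^esub> = f 0"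
  using copy by (simp_all add: isometric_copy_def)

lemma copy_ops:
  assumes "x \<in> S"
  shows "y \<in> S \<Longrightarrow> f x \<oplus>\<^bsub>H\<^esub> f y = f (x + y)" "c \<odot>\<^bsub>H\<^esub> f x = f (c *\<^sub>V x)"
    "y \<in> S \<Longrightarrow> cinner H (f x) (f y) = ip x y"
  using assms copy by (simp_all add: isometric_copy_def)

private lemmas [simp] = copy_carrier copy_zero copy_ops

lemma copy_module: "Module.module complex_ring H"
proof (rule moduleI[OF cring_complex_ring])
  show "abelian_group H"
  proof (rule abelian_groupI)
    fix x assume "x \<in> carrier H"
    then obtain x' where x: "x' \<in> S" "x = f x'" by auto
    have "f (- x') \<oplus>\<^bsub>H\<^esub> x = \<zero>\<^bsub>H\<^esub>" using x csub_minus[OF sub x(1)] by simp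
    then show "\<exists>y\<in>carrier H. y \<oplus>\<^bsub>H\<^esub> x = \<zero>\<^bsub>H\<^esub>" using csub_minus[OF sub x(1)] by auto
  qed (auto simp: S_intros add.assoc add.commute add.left_commute)
qed (auto simp: S_intros csc_add_left csc_add_right)

lemma copy_ips: "complex_inner_product_space H"
proof -
  interpret Module.module complex_ring H by (rule copy_module)
  show ?thesis
  proof unfold_locales
    show "cinner H (x \<oplus>\<^bsub>H\<^esub> y) z = cinner H x z + cinner H y z"
      if "x \<in> carrier H" "y \<in> carrier H" "z \<in> carrier H" for x y z
      using that by (auto simp: S_intros hf_addl[OF hip])
    show "cinner H (c \<odot>\<^bsub>H\<^esub> x) y = c * cinner H x y" if "x \<in> carrier H" "y \<in> carrier H" for c x y
      using that by (auto simp: S_intros hf_cscl[OF hip])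
    show "cinner H y x = cnj (cinner H x y)" if xy: "x \<in> carrier H" "y \<in> carrier H" for x y
    proof -
      obtain x' y' where "x' \<in> S" "y' \<in> S" "x = f x'" "y = f y'" using xy unfolding copy_carrier by blast
      then show ?thesis using hf_sym[OF hip, of x' y'] by simp
    qed
    show "0 \<le> Re (cinner H x x)" if "x \<in> carrier H" for x
      using that pform_onD(2)[OF ip] by auto
    show "x = \<zero>\<^bsub>H\<^esub>" if x0: "x \<in> carrier H" "cinner H x x = 0" for x
    proof -
      obtain x' where x: "x' \<in> S" "x = f x'" using x0(1) unfolding copy_carrier by blast
      then have "qf ip x' = 0" using x0 by simp
      then show ?thesis using definite[OF x(1)] x by simp
    qed
  qed
qed

lemma copy_norm: "x \<in> S \<Longrightarrow> hnorm H (f x) = nn x"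
  by (simp add: hnorm_def nn_def)

lemma copy_dist: "x \<in> S \<Longrightarrow> y \<in> S \<Longrightarrow> hdist H (f x) (f y) = nn (x - y)"
proof -
  assume x: "x \<in> S" and y: "y \<in> S"
  interpret I: complex_inner_product_space H by (rule copy_ips)
  have "\<ominus>\<^bsub>H\<^esub> f y = f (- y)" using I.smult_minus_one[of "f y"] y by simp
  then have "f x \<ominus>\<^bsub>H\<^esub> f y = f (x - y)" using x y csub_minus[OF sub y] by (simp add: a_minus_def)
  then show ?thesis using x y by (simp add: hdist_def copy_norm S_intros)
qed

lemma copy_limitin:
  assumes v: "\<And>n. v n \<in> S" and l: "l \<in> S"
  shows "limitin (htopology H) (\<lambda>n. f (v n)) (f l) sequentially \<longleftrightarrow> (\<lambda>n. nn (v n - l)) \<longlonglongrightarrow> 0"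
proof -
  interpret I: complex_inner_product_space H by (rule copy_ips)
  interpret MS: Metric_space "carrier H" "hdist H" by (rule I.Metric_space_hdist)
  show ?thesis unfolding MS.limitin_metric_dist_null using v l by (simp add: copy_dist)
qed

lemma copy_hilbert: "complex_hilbert_space H"
proof -
  interpret I: complex_inner_product_space H by (rule copy_ips)
  interpret MS: Metric_space "carrier H" "hdist H" by (rule I.Metric_space_hdist)
  have "MS.mcomplete"
    unfolding MS.mcomplete_def
  proof (intro allI impI)
    fix \<sigma> assume \<sigma>: "MS.MCauchy \<sigma>"
    then have "range \<sigma> \<subseteq> f ` S" unfolding MS.MCauchy_def by simp
    then have "\<sigma> n \<in> f ` S" for n by blast
    then have "\<forall>n. \<exists>x. x \<in> S \<and> \<sigma> n = f x" by blast
    then obtain v where v: "\<And>n. v n \<in> S" "\<And>n. \<sigma> n = f (v n)" by metis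
    have h: "hdist H (\<sigma> m) (\<sigma> n) = nn (v m - v n)" for m n by (simp add: v copy_dist)
    have C: "\<exists>N. \<forall>m\<ge>N. \<forall>n\<ge>N. nn (v m - v n) < \<epsilon>" if "0 < \<epsilon>" for \<epsilon>
      using \<sigma> that unfolding MS.MCauchy_def h by meson
    obtain l where l: "l \<in> S" "(\<lambda>n. nn (v n - l)) \<longlonglongrightarrow> 0" by (rule complete_nn[OF v(1) C])
    then have "limitin MS.mtopology (\<lambda>n. f (v n)) (f l) sequentially" using copy_limitin v(1) by simp
    moreover have "\<sigma> = (\<lambda>n. f (v n))" using v(2) by auto
    ultimately show "\<exists>l. limitin MS.mtopology \<sigma> l sequentially" by auto
  qed
  then show ?thesis by unfold_locales
qed

lemma copy_submodule: "csub V \<Longrightarrow> V \<subseteq> S \<Longrightarrow> submodule (f ` V) complex_ring H"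
proof -
  assume V: "csub V" "V \<subseteq> S"
  interpret I: complex_inner_product_space H by (rule copy_ips)
  show ?thesis
  proof (rule I.submoduleI)
    show "\<ominus>\<^bsub>H\<^esub> a \<in> f ` V" if a: "a \<in> f ` V" for a
    proof -
      obtain x where x: "x \<in> V" "a = f x" using a by auto
      then have "\<ominus>\<^bsub>H\<^esub> a = f (- x)" using I.smult_minus_one[of "f x"] V by auto
      then show ?thesis using csub_minus[OF V(1) x(1)] by simp
    qed
    show "a \<oplus>\<^bsub>H\<^esub> b \<in> f ` V" if "a \<in> f ` V" "b \<in> f ` V" for a b
      using that csub_add[OF V(1)] V(2) by (auto simp: subset_iff)
    show "a \<odot>\<^bsub>H\<^esub> x \<in> f ` V" if "x \<in> f ` V" for a x
      using that csub_csc[OF V(1)] V(2) by (auto simp: subset_iff)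
  qed (use V csub_zero[OF V(1)] in auto)
qed

lemma copy_closed: "sclosed V \<Longrightarrow> closedin (htopology H) (f ` V)"
proof -
  assume V: "sclosed V"
  then have VS: "V \<subseteq> S" by (simp add: sclosed_def)
  interpret I: complex_inner_product_space H by (rule copy_ips)
  interpret MS: Metric_space "carrier H" "hdist H" by (rule I.Metric_space_hdist)
  show ?thesis
    unfolding MS.metric_closedin_iff_sequentially_closed
  proof (intro conjI allI impI)
    show "f ` V \<subseteq> carrier H" using VS by auto
    fix \<sigma> l assume a: "range \<sigma> \<subseteq> f ` V \<and> limitin MS.mtopology \<sigma> l sequentially"
    then have "\<forall>n. \<exists>x. x \<in> V \<and> \<sigma> n = f x" by blast
    then obtain v where v: "\<And>n. v n \<in> V" "\<And>n. \<sigma> n = f (v n)" by metis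
    have "l \<in> carrier H" using a MS.limitin_mspace by blast
    then obtain l' where l': "l' \<in> S" "l = f l'" by auto
    have "\<sigma> = (\<lambda>n. f (v n))" using v(2) by auto
    then have "(\<lambda>n. nn (v n - l')) \<longlonglongrightarrow> 0" using a copy_limitin[of v l'] v(1) VS l' by auto
    then have "l' \<in> V" using V v(1) l'(1) unfolding sclosed_def by blast
    then show "l \<in> f ` V" using l' by simp
  qed
qed

lemma copy_closedD:
  assumes W: "closedin (htopology H) W"
  shows "sclosed {x \<in> S. f x \<in> W}"
proof -
  interpret I: complex_inner_product_space H by (rule copy_ips)
  interpret MS: Metric_space "carrier H" "hdist H" by (rule I.Metric_space_hdist)
  show ?thesis
    unfolding sclosed_def
  proof (intro conjI allI impI)
    fix v l assume v: "\<forall>n. v n \<in> {x \<in> S. f x \<in> W}" and l: "l \<in> S" and lim: "(\<lambda>n. nn (v n - l)) \<longlonglongrightarrow> 0"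
    then have "limitin (htopology H) (\<lambda>n. f (v n)) (f l) sequentially" using copy_limitin[of v l] by simp
    moreover have "range (\<lambda>n. f (v n)) \<subseteq> W" using v by auto
    ultimately have "f l \<in> W" using W unfolding MS.metric_closedin_iff_sequentially_closed by blast
    then show "l \<in> {x \<in> S. f x \<in> W}" using l by simp
  qed auto
qed

lemma copy_submoduleD:
  assumes W: "submodule W complex_ring H"
  shows "csub {x \<in> S. f x \<in> W}"
  unfolding csub_def
proof (intro conjI ballI allI)
  interpret I: complex_inner_product_space H by (rule copy_ips)
  note WE = I.submoduleE[OF W]
  obtain w where w: "w \<in> W" using WE(2) by blast
  then obtain x where x: "x \<in> S" "f x \<in> W" using WE(1) by auto
  have "f (0 *\<^sub>V x) \<in> W" using WE(4)[of 0, OF _ x(2)] x(1) by simp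
  then show "0 \<in> {x \<in> S. f x \<in> W}" using S_intros(4) by simp
  show "x + y \<in> {x \<in> S. f x \<in> W}" if "x \<in> {x \<in> S. f x \<in> W}" "y \<in> {x \<in> S. f x \<in> W}" for x y
    using that WE(5)[of "f x" "f y"] S_intros(1)[of x y] by simp
  show "c *\<^sub>V x \<in> {x \<in> S. f x \<in> W}" if "x \<in> {x \<in> S. f x \<in> W}" for c x
    using that WE(4)[of c "f x"] S_intros(3)[of x c] by simp
qed

end

theorem transport_reduction:
  fixes \<rho> :: "'a::cstar_algebra \<Rightarrow> 'v \<Rightarrow> 'v" and f :: "'v \<Rightarrow> 'h"
  assumes f: "inj_on f S" and trp: "total_reduction_property TYPE('a) TYPE('h)"
    and cl: "\<And>a x. x \<in> S \<Longrightarrow> \<rho> a x \<in> S"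
    and addx: "\<And>a x y. x \<in> S \<Longrightarrow> y \<in> S \<Longrightarrow> \<rho> a (x + y) = \<rho> a x + \<rho> a y"
    and cscx: "\<And>a c x. x \<in> S \<Longrightarrow> \<rho> a (c *\<^sub>V x) = c *\<^sub>V \<rho> a x"
    and adda: "\<And>a b x. x \<in> S \<Longrightarrow> \<rho> (a + b) x = \<rho> a x + \<rho> b x"
    and csca: "\<And>a c x. x \<in> S \<Longrightarrow> \<rho> (c *\<^sub>C a) x = c *\<^sub>V \<rho> a x"
    and mult: "\<And>a b x. x \<in> S \<Longrightarrow> \<rho> (a * b) x = \<rho> a (\<rho> b x)"
    and bd: "\<And>a x. x \<in> S \<Longrightarrow> nn (\<rho> a x) \<le> K * norm a * nn x"
    and V: "csub V" "sclosed V" "\<And>a x. x \<in> V \<Longrightarrow> \<rho> a x \<in> V"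
  obtains W where "csub W" "sclosed W" "\<And>a x. x \<in> W \<Longrightarrow> \<rho> a x \<in> W" "V \<inter> W = {0}"
    "\<And>x. x \<in> S \<Longrightarrow> \<exists>v\<in>V. \<exists>w\<in>W. x = v + w"
proof -
  define H where "H = transport f"
  have copy: "isometric_copy f H" unfolding H_def by (rule isometric_copy_transport[OF f])
  note [simp] = copy_carrier[OF copy] copy_zero[OF copy] copy_ops[OF copy]
  note copy_norm = copy_norm[OF copy]
  define g where "g = the_inv_into S f"
  have gf: "x \<in> S \<Longrightarrow> g (f x) = x" for x by (simp add: g_def the_inv_into_f_f[OF f])
  define \<theta> where "\<theta> a x = f (\<rho> a (g x))" for a x
  have \<theta>: "\<theta> a (f x) = f (\<rho> a x)" if "x \<in> S" for a x using that by (simp add: \<theta>_def gf)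
  interpret I: complex_hilbert_space H by (rule copy_hilbert[OF copy])
  have VS: "V \<subseteq> S" using V(2) by (simp add: sclosed_def)
  have rep: "representation H \<theta>"
  proof (rule I.representationI)
    show "hnorm H (\<theta> a x) \<le> K * norm a * hnorm H x" if "x \<in> carrier H" for a x
      using that bd cl by (auto simp: \<theta> copy_norm)
  qed (auto simp: \<theta> cl addx cscx adda csca mult S_intros)
  have cV: "closed_invariant_subspace H \<theta> (f ` V)"
    unfolding closed_invariant_subspace_def
    using copy_submodule[OF copy V(1) VS] copy_closed[OF copy V(2)] V(3) VS by (auto simp: \<theta> subset_iff)
  obtain W where W: "closed_invariant_subspace H \<theta> W" "f ` V <+>\<^bsub>H\<^esub> W = carrier H" "f ` V \<inter> W = {\<zero>\<^bsub>H\<^esub>}"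
    using trp[unfolded total_reduction_property_def, rule_format, OF I.complex_hilbert_space_axioms rep cV] by metis
  define W' where "W' = {x \<in> S. f x \<in> W}"
  have Wsub: "submodule W complex_ring H" and Wcl: "closedin (htopology H) W" and Winv: "\<And>a. \<theta> a ` W \<subseteq> W"
    using W(1) by (auto simp: closed_invariant_subspace_def)
  note WE = I.submoduleE[OF Wsub]
  have "\<zero>\<^bsub>H\<^esub> \<in> f ` V \<inter> W" unfolding W(3) by simp
  then have z: "f 0 \<in> W" by simp
  show ?thesis
  proof (rule that[of W'])
    show "csub W'" unfolding W'_def by (rule copy_submoduleD[OF copy Wsub])
    show "sclosed W'" unfolding W'_def by (rule copy_closedD[OF copy Wcl])
    show "\<rho> a x \<in> W'" if "x \<in> W'" for a x
    proof -
      have x: "x \<in> S" "f x \<in> W" using that by (auto simp: W'_def)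
      then have "\<theta> a (f x) \<in> W" using Winv by blast
      then show ?thesis using x cl by (simp add: \<theta> W'_def)
    qed
    show "V \<inter> W' = {0}"
    proof
      show "V \<inter> W' \<subseteq> {0}"
      proof
        fix x assume "x \<in> V \<inter> W'"
        then have "x \<in> S" "f x \<in> f ` V \<inter> W" by (auto simp: W'_def)
        then show "x \<in> {0}" using W(3) inj_onD[OF f, of x 0] S_intros(4) by simp
      qed
      show "{0} \<subseteq> V \<inter> W'" using csub_zero[OF V(1)] S_intros(4) z by (simp add: W'_def)
    qed
    fix x assume x: "x \<in> S"
    then have "f x \<in> f ` V <+>\<^bsub>H\<^esub> W" using W(2) by simp
    then obtain v w where vw: "v \<in> V" "w \<in> W" "f x = f v \<oplus>\<^bsub>H\<^esub> w" by (auto simp: set_add_def')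
    obtain w' where w': "w' \<in> S" "w = f w'" using vw(2) WE(1) by auto
    have "f x = f (v + w')" using vw w' VS by auto
    then have "x = v + w'" using inj_onD[OF f _ x S_intros(1)] vw(1) VS w'(1) by blast
    then show "\<exists>v\<in>V. \<exists>w\<in>W'. x = v + w" using vw w' by (auto simp: W'_def)
  qed
qed

end

section \<open>Derivations are uniformly inner\<close>

lemma fst_csc [simp]: "fst (c *\<^sub>V z) = c *\<^sub>V fst z" and snd_csc [simp]: "snd (c *\<^sub>V z) = c *\<^sub>V snd z"
  by (simp_all add: csc_prod_def)

text \<open>Writing \<open>b\<close> by four unitaries with coefficients of modulus
  \<open>norm b / 2\<close> gives the factor \<open>4 * (norm b / 2) * K\<close>.\<close>

lemma (in bmod) bounded_of_unitaries:
  assumes q: "pform q" and u: "\<And>u x. unitary u \<Longrightarrow> qf q (act u x) \<le> K\<^sup>2 * qf q x" and K: "0 \<le> K"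
  shows "qf q (act b x) \<le> (2 * K * norm b)\<^sup>2 * qf q x"
proof -
  let ?n = "\<lambda>x. sqrt (qf q x)"
  note hq = pform_onD(1)[OF q]
  have q0: "0 \<le> qf q x" for x by (rule pform_onD(2)[OF q]) simp
  have n: "?n (act u x) \<le> K * ?n x" if "unitary u" for u
    using real_sqrt_le_mono[OF u[OF that, of x]] K by (simp add: real_sqrt_mult)
  have nc: "?n (c *\<^sub>V y) = cmod c * ?n y" for c y
    using qf_csc[OF hq UNIV_I, of c y] by (simp add: real_sqrt_mult)
  have tri: "?n (y + z) \<le> ?n y + ?n z" for y z by (rule pf_triangle[OF q]) simp_all
  obtain u1 u2 u3 u4 where u: "unitary u1" "unitary u2" "unitary u3" "unitary u4"
    "b = (norm b / 2) *\<^sub>R (u1 + u2) + \<i> *\<^sub>V ((norm b / 2) *\<^sub>R (u3 + u4))"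
    by (rule unitary_combination[of b])
  let ?c = "complex_of_real (norm b / 2)"
  have "act b x = ?c *\<^sub>V (act u1 x + act u2 x) + \<i> *\<^sub>V ?c *\<^sub>V (act u3 x + act u4 x)"
    by (subst u(5)) (simp only: scaleR_csc act_addl act_csc)
  then have "?n (act b x) \<le> ?n (?c *\<^sub>V (act u1 x + act u2 x)) + ?n (\<i> *\<^sub>V ?c *\<^sub>V (act u3 x + act u4 x))"
    using tri by metis
  also have "\<dots> = norm b / 2 * ?n (act u1 x + act u2 x) + norm b / 2 * ?n (act u3 x + act u4 x)"
    unfolding nc by (simp add: norm_divide)
  also have "\<dots> \<le> norm b / 2 * (2 * (K * ?n x)) + norm b / 2 * (2 * (K * ?n x))"
    using tri[of "act u1 x" "act u2 x"] tri[of "act u3 x" "act u4 x"] n[OF u(1)] n[OF u(2)] n[OF u(3)] n[OF u(4)]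
    by (intro add_mono mult_left_mono) auto
  finally have "?n (act b x) \<le> (2 * K * norm b) * ?n x" by simp
  then have "(?n (act b x))\<^sup>2 \<le> ((2 * K * norm b) * ?n x)\<^sup>2" by (rule power_mono) (rule real_sqrt_ge_zero[OF q0])
  then show ?thesis using q0 by (simp add: power_mult_distrib)
qed

text \<open>The form \<open>q\<close> is the norm of the module on which \<open>act\<close> is conjugated by the shear with off-diagonal
  entry \<open>\<psi>\<close>, that is, of the extension of the completion of \<open>p\<close> by itself defined by the inner derivation
  of \<open>\<psi>\<close>.\<close>

lemma (in bmod) shear_form:
  assumes p: "pform p" "invf p" and \<psi>: "hform \<psi>" "\<And>x. 0 \<le> qf \<psi> x" "\<And>x. qf \<psi> x \<le> c * qf p x"
    and d: "\<And>u x. unitary u \<Longrightarrow> \<bar>qf \<psi> (act u x) - qf \<psi> x\<bar> \<le> qf p x"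
  obtains q C where "pform q" "\<And>w x y. (cmod (p w x + \<psi> w y))\<^sup>2 \<le> qf p w * qf q (x, y)"
    "\<And>y \<epsilon>. 0 < \<epsilon> \<Longrightarrow> \<exists>x. qf q (x, y) < qf p y + \<epsilon>"
    "\<And>u x y. unitary u \<Longrightarrow> qf q (act u x, act u y) \<le> 3\<^sup>2 * qf q (x, y)"
    "\<And>x. qf q (x, 0) \<le> C * qf p x" "\<And>y. qf q (0, y) \<le> C * qf p y"
proof -
  note hp = pform_onD(1)[OF p(1)]
  have p0: "0 \<le> qf p x" for x by (rule pform_onD(2)[OF p(1)]) simp
  have p\<psi>: "pform \<psi>" using \<psi> by (simp add: pform_on_def)
  have \<psi>_cs: "(cmod (\<psi> y z))\<^sup>2 \<le> (\<bar>c\<bar>\<^sup>2 * qf p y) * qf p z" for y z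
  proof -
    have le: "qf \<psi> x \<le> \<bar>c\<bar> * qf p x" for x
      using \<psi>(3)[of x] mult_right_mono[OF abs_ge_self[of c] p0[of x]] by linarith
    have "(cmod (\<psi> y z))\<^sup>2 \<le> qf \<psi> y * qf \<psi> z" by (rule pf_cauchy_schwarz[OF p\<psi>]) simp_all
    also have "\<dots> \<le> (\<bar>c\<bar> * qf p y) * (\<bar>c\<bar> * qf p z)" using \<psi>(2) p0 by (intro mult_mono le) auto
    finally show ?thesis by (simp add: power2_eq_square mult_ac)
  qed
  have \<psi>_dual: "\<psi> y \<in> dualsp p" for y
  proof -
    have "antilin (\<psi> y)" by (simp add: antilin_def hf_addr[OF \<psi>(1)] hf_cscr[OF \<psi>(1)])
    then show ?thesis using \<psi>_cs[of y] unfolding dualsp_def by blast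
  qed
  obtain ip where ip: "pform_on (dualsp p) ip" "\<And>v. v \<in> dualsp p \<Longrightarrow> qf ip v = dualnorm p v"
    using dual_inner_product[OF p(1)] by metis
  note hip = pform_onD(1)[OF ip(1)]
  define v where "v z = p (fst z) + \<psi> (snd z)" for z
  have v_dual: "v z \<in> dualsp p" for z
    unfolding v_def by (rule csub_add[OF csub_dualsp[OF p(1)] dual_embed[OF p(1)] \<psi>_dual])
  have v_add: "v (z + z') = v z + v z'" and v_csc: "v (a *\<^sub>V z) = a *\<^sub>V v z" for z z' a
    by (simp_all add: v_def fun_eq_iff hf_addl[OF hp] hf_addl[OF \<psi>(1)] hf_cscl[OF hp] hf_cscl[OF \<psi>(1)] algebra_simps)
  \<comment> \<open>The squared norm of the sheared pair \<open>(x + \<psi> y, y)\<close>, whose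
    first entry is taken in the completion \<open>dualsp p\<close>, where \<open>\<psi> y\<close> is
    a vector.\<close>
  define q where "q z z' = ip (v z) (v z') + p (snd z) (snd z')" for z z'
  have pq: "pform q"
    unfolding pform_on_def hform_on_def q_def
  proof (intro conjI ballI allI)
    fix z z'
    show "ip (v z') (v z) + p (snd z') (snd z) = cnj (ip (v z) (v z') + p (snd z) (snd z'))"
      using hf_sym[OF hip v_dual v_dual, of z z'] hf_sym[OF hp UNIV_I UNIV_I, of "snd z" "snd z'"] by simp
    show "0 \<le> Re (ip (v z) (v z) + p (snd z) (snd z))"
      using pform_onD(2)[OF ip(1) v_dual[of z]] p0[of "snd z"] by simp
  qed (simp_all add: v_add v_csc hf_addl[OF hip v_dual v_dual v_dual] hf_cscl[OF hip v_dual v_dual]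
      hf_addl[OF hp] hf_cscl[OF hp] algebra_simps)
  have qq: "qf q z = dualnorm p (v z) + qf p (snd z)" for z by (simp add: q_def ip(2) v_dual)
  have dn0: "0 \<le> dualnorm p (v z)" for z by (rule dualnorm_nonneg[OF p(1) v_dual])
  show ?thesis
  proof (rule that[of q "\<bar>c\<bar>\<^sup>2 + 1"])
    show "pform q" by (rule pq)
    fix w x y
    have "p w x + \<psi> w y = cnj (v (x, y) w)"
      using hf_sym[OF hp UNIV_I UNIV_I, of x w] hf_sym[OF \<psi>(1) UNIV_I UNIV_I, of y w] by (simp add: v_def)
    then have "(cmod (p w x + \<psi> w y))\<^sup>2 \<le> dualnorm p (v (x, y)) * qf p w"
      using dualnorm_cauchy_schwarz[OF p(1) v_dual] by simp
    also have "\<dots> \<le> qf q (x, y) * qf p w" using p0[of y] by (intro mult_right_mono p0) (simp add: qq)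
    finally show "(cmod (p w x + \<psi> w y))\<^sup>2 \<le> qf p w * qf q (x, y)" by (simp add: mult.commute)
  next
    fix y and \<epsilon> :: real assume "0 < \<epsilon>"
    then obtain x where "dualnorm p (\<psi> y + p x) < \<epsilon>" by (rule dualnorm_approx[OF p(1) \<psi>_dual])
    then show "\<exists>x. qf q (x, y) < qf p y + \<epsilon>" unfolding qq by (intro exI[of _ x]) (simp add: v_def add.commute)
  next
    fix u x y assume u: "unitary (u :: 'b)"
    \<comment> \<open>The coboundary of \<open>\<psi>\<close>. It alone measures how far the sheared
      action is from preserving \<open>q\<close>; the resulting bound 3 does not involve
      \<open>c\<close>, which is what permits infinitely many such extensions to be added.\<close>
    define D where "D a b = of_real 1 * \<psi> (act u a) (act u b) + of_real (-1) * \<psi> a b" for a b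
    have hD: "hform D" unfolding D_def by (rule hform_lincomb[OF hform_act[OF \<psi>(1)] \<psi>(1)])
    have "\<bar>qf D a\<bar> \<le> qf p a" for a using d[OF u, of a] by (simp add: D_def)
    then have Db: "cmod (D a b) \<le> 2 * sqrt (qf p a) * sqrt (qf p b)" for a b
      by (intro bounded_hform_bound[OF p(1) hD]) simp_all
    \<comment> \<open>The square of a sum is at most twice the sum of the squares, and the constant
      2 in \<open>Db\<close> contributes \<open>2 * 4 = 8\<close>. With the second summand of
      \<open>q\<close> the total stays below 9.\<close>
    have "dualnorm p (v (act u x, act u y)) \<le> 2 * dualnorm p (v (x, y)) + 8 * qf p y"
    proof (rule dualnorm_le[OF p(1)])
      show "0 \<le> 2 * dualnorm p (v (x, y)) + 8 * qf p y" using dn0[of "(x, y)"] p0[of y] by simp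
      fix z
      define z' where "z' = act (star u) z"
      have z: "z = act u z'" using u by (simp add: z'_def)
      have qz: "qf p z = qf p z'" unfolding z by (rule invf_qf[OF p(2) u])
      have "p (act u x) (act u z') = p x z'" using p(2) u unfolding invf_def by blast
      then have "v (act u x, act u y) z = v (x, y) z' + D y z'" unfolding z by (simp add: v_def D_def)
      then have "(cmod (v (act u x, act u y) z))\<^sup>2 \<le> (cmod (v (x, y) z') + cmod (D y z'))\<^sup>2"
        by (metis norm_triangle_ineq norm_ge_zero power_mono)
      also have "\<dots> \<le> 2 * (cmod (v (x, y) z'))\<^sup>2 + 2 * (cmod (D y z'))\<^sup>2"
        using zero_le_power2[of "cmod (v (x, y) z') - cmod (D y z')"] by (simp add: power2_sum power2_diff)
      also have "\<dots> \<le> 2 * (dualnorm p (v (x, y)) * qf p z') + 2 * (2 * sqrt (qf p y) * sqrt (qf p z'))\<^sup>2"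
        by (intro add_mono mult_left_mono dualnorm_cauchy_schwarz[OF p(1) v_dual] power_mono Db) simp_all
      also have "\<dots> = (2 * dualnorm p (v (x, y)) + 8 * qf p y) * qf p z"
        using p0[of y] p0[of z'] by (simp add: power_mult_distrib qz algebra_simps)
      finally show "(cmod (v (act u x, act u y) z))\<^sup>2 \<le> (2 * dualnorm p (v (x, y)) + 8 * qf p y) * qf p z" .
    qed
    then show "qf q (act u x, act u y) \<le> 3\<^sup>2 * qf q (x, y)"
      using invf_qf[OF p(2) u, of y] dn0[of "(x, y)"] p0[of y] by (simp add: qq)
  next
    fix x
    have "v (x, 0) = p x" by (simp add: v_def fun_eq_iff hf_zerol[OF \<psi>(1)])
    then have "qf q (x, 0) = qf p x"
      by (simp add: qq dualnorm_embed[OF p(1)] qf_zero[OF hp, simplified])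
    then show "qf q (x, 0) \<le> (\<bar>c\<bar>\<^sup>2 + 1) * qf p x" using p0[of x] by (simp add: distrib_right)
  next
    fix y
    have "v (0, y) = \<psi> y" by (simp add: v_def fun_eq_iff hf_zerol[OF hp])
    moreover have "dualnorm p (\<psi> y) \<le> \<bar>c\<bar>\<^sup>2 * qf p y"
      by (rule dualnorm_le[OF p(1) _ \<psi>_cs]) (simp add: p0)
    ultimately show "qf q (0, y) \<le> (\<bar>c\<bar>\<^sup>2 + 1) * qf p y" by (simp add: qq distrib_right)
  qed
qed

subsection \<open>Direct sums of forms\<close>

text \<open>The type of polynomials serves as the type of finitely supported sequences.\<close>

instantiation poly :: (cvec) cvec
begin
definition "csc_poly c = map_poly (\<lambda>x :: 'a. c *\<^sub>V x)"
lemma coeff_csc [simp]: "coeff (c *\<^sub>V z) i = c *\<^sub>V coeff (z :: 'a poly) i"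
  by (simp add: csc_poly_def coeff_map_poly)
instance by standard (simp_all add: poly_eq_iff csc_add_right csc_add_left)
end

text \<open>Any upper limit that is at least one of the two degrees gives the same value; the sum of
  the degrees is a symmetric choice.\<close>

definition psumform :: "(nat \<Rightarrow> 'w::cvec \<Rightarrow> 'w \<Rightarrow> complex) \<Rightarrow> 'w poly \<Rightarrow> 'w poly \<Rightarrow> complex"
  where "psumform q z w = (\<Sum>i\<le>degree z + degree w. q i (coeff z i) (coeff w i))"

context
  fixes q :: "nat \<Rightarrow> 'w::cvec \<Rightarrow> 'w \<Rightarrow> complex"
  assumes q: "\<And>i. pform (q i)"
begin

private lemmas hq = pform_onD(1)[OF q]

lemma psumform_eq:
  assumes "degree z \<le> n \<or> degree w \<le> n"
  shows "psumform q z w = (\<Sum>i\<le>n. q i (coeff z i) (coeff w i))"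
proof -
  let ?f = "\<lambda>i. q i (coeff z i) (coeff w i)"
  have z: "?f i = 0" if "degree z < i \<or> degree w < i" for i
    using that by (auto simp: coeff_eq_0 hf_zerol[OF hq] hf_zeror[OF hq])
  have "sum ?f {..degree z + degree w} = sum ?f {..min (degree z) (degree w)}"
    by (rule sum.mono_neutral_right) (auto intro!: z)
  also have "\<dots> = sum ?f {..n}"
    by (rule sum.mono_neutral_left) (use assms in \<open>auto intro!: z\<close>)
  finally show ?thesis by (simp add: psumform_def)
qed

lemma pform_psumform: "pform (psumform q)"
  unfolding pform_on_def hform_on_def
proof (intro conjI ballI allI)
  fix x y z :: "'w poly" and c
  let ?n = "degree z"
  show "psumform q (x + y) z = psumform q x z + psumform q y z"
    by (simp add: psumform_eq[of _ ?n z] hf_addl[OF hq] sum.distrib)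
  show "psumform q (c *\<^sub>V x) z = c * psumform q x z"
    by (simp add: psumform_eq[of _ ?n z] hf_cscl[OF hq] sum_distrib_left)
  have "q i (coeff z i) (coeff x i) = cnj (q i (coeff x i) (coeff z i))" for i
    by (rule hf_sym[OF hq UNIV_I UNIV_I])
  then show "psumform q z x = cnj (psumform q x z)"
    unfolding psumform_eq[of z ?n x, OF disjI1[OF order_refl]] psumform_eq[of x ?n z, OF disjI2[OF order_refl]]
      cnj_sum by (intro sum.cong refl)
  have "0 \<le> qf (q i) (coeff z i)" for i by (rule pform_onD(2)[OF q]) simp
  then show "0 \<le> qf (psumform q) z" by (simp add: psumform_def sum_nonneg)
qed simp

lemma qf_psumform_ge: "qf (q i) (coeff z i) \<le> qf (psumform q) z"
proof (cases "i \<le> degree z")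
  case True
  have "0 \<le> qf (q j) (coeff z j)" for j by (rule pform_onD(2)[OF q]) simp
  then show ?thesis using True
    by (simp add: psumform_eq[of z "degree z" z] member_le_sum[of i "{..degree z}" "\<lambda>j. qf (q j) (coeff z j)"])
next
  case False
  then have "coeff z i = 0" by (simp add: coeff_eq_0)
  then show ?thesis using pform_onD(2)[OF pform_psumform, of z] by (simp add: qf_zero[OF hq, simplified])
qed

lemma qf_psumform_monom: "qf (psumform q) (monom x i) = qf (q i) x"
proof -
  have "psumform q (monom x i) (monom x i) = (\<Sum>j\<le>i. q j (coeff (monom x i) j) (coeff (monom x i) j))"
    by (rule psumform_eq) (simp add: degree_monom_le)
  also have "\<dots> = (\<Sum>j\<le>i. if j = i then q i x x else 0)"
    by (intro sum.cong refl) (auto simp: hf_zerol[OF hq])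
  finally show ?thesis by simp
qed

end

lemma hilbert_set_dual:
  assumes q: "pform q"
  obtains ip where "hilbert_set (dualsp q) ip" "\<And>v. v \<in> dualsp q \<Longrightarrow> qf ip v = dualnorm q v"
    "\<And>v x. v \<in> dualsp q \<Longrightarrow> ip v (q x) = v x"
proof -
  obtain ip where ip: "pform_on (dualsp q) ip" "\<And>v. v \<in> dualsp q \<Longrightarrow> qf ip v = dualnorm q v"
    "\<And>v x. v \<in> dualsp q \<Longrightarrow> ip v (q x) = v x"
    using dual_inner_product[OF q] by metis
  have sub: "v - w \<in> dualsp q" if "v \<in> dualsp q" "w \<in> dualsp q" for v w
    using csub_diff[OF csub_dualsp[OF q]] that .
  have "hilbert_set (dualsp q) ip"
  proof
    show "pform_on (dualsp q) ip" by (rule ip(1))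
    show "v = 0" if "v \<in> dualsp q" "qf ip v = 0" for v
      using dualnorm_eq_zero[OF q that(1)] that ip(2) by simp
    fix v :: "nat \<Rightarrow> _" assume v: "\<And>n. v n \<in> dualsp q"
      and C: "\<And>\<epsilon>. 0 < \<epsilon> \<Longrightarrow> \<exists>N. \<forall>m\<ge>N. \<forall>n\<ge>N. sqrt (qf ip (v m - v n)) < \<epsilon>"
    have "\<exists>N. \<forall>m\<ge>N. \<forall>n\<ge>N. dualnorm q (v m - v n) < \<epsilon>" if "0 < \<epsilon>" for \<epsilon>
    proof -
      have "0 < sqrt \<epsilon>" using that by simp
      from C[OF this] show ?thesis by (simp add: ip(2) sub v)
    qed
    then obtain l where l: "l \<in> dualsp q" "(\<lambda>n. dualnorm q (v n - l)) \<longlonglongrightarrow> 0"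
      by (rule dual_complete[OF q v])
    have "(\<lambda>n. sqrt (dualnorm q (v n - l))) \<longlonglongrightarrow> sqrt 0" by (intro tendsto_real_sqrt l)
    then show "\<exists>l\<in>dualsp q. (\<lambda>n. sqrt (qf ip (v n - l))) \<longlonglongrightarrow> 0"
      using l(1) by (intro bexI[of _ l]) (simp_all add: ip(2) sub v)
  qed
  with ip show ?thesis using that by blast
qed

text \<open>If no constant works, the extensions given by a sequence of counterexamples form one bounded
  representation on the dual \<open>dualsp Q\<close> of their direct sum. A complement of the subrepresentation \<open>V\<close>
  splits all of them with a common bound.\<close>

theorem uniformly_split:
  fixes act :: "'a::cstar_algebra unitz \<Rightarrow> 'v::cvec \<Rightarrow> 'v" and J :: "(nat \<Rightarrow> 'v \<Rightarrow> complex) \<Rightarrow> 'h"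
  assumes B: "bounded_bmod act e M"
    and trp: "total_reduction_property TYPE('a) TYPE('h)"
    and J: "inj_on J {s. \<forall>i. s i \<in> dualsp e}"
  obtains \<tau> where "split_bmod act e M \<tau>"
proof -
  interpret bounded_bmod act e M by (rule B)
  define bad where "bad \<tau> p \<psi> c \<longleftrightarrow> pform p \<and> invf p \<and> bddf p \<and> hform \<psi> \<and>
      (\<forall>x. 0 \<le> qf \<psi> x) \<and> (\<forall>x. qf \<psi> x \<le> c * qf p x) \<and>
      (\<forall>u x. unitary u \<longrightarrow> \<bar>qf \<psi> (act u x) - qf \<psi> x\<bar> \<le> qf p x) \<and>
      \<not> (\<exists>\<Xi>. hform \<Xi> \<and> invf \<Xi> \<and> (\<forall>x. \<bar>qf \<psi> x - qf \<Xi> x\<bar> \<le> \<tau> * qf p x))" for \<tau> :: real and p \<psi> c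
  have "\<exists>\<tau>. \<forall>p \<psi> c. \<not> bad \<tau> p \<psi> c"
  proof (rule ccontr)
    assume "\<not> ?thesis"
    then have "\<forall>i :: nat. \<exists>p \<psi> c. bad (real i) p \<psi> c" by auto
    then obtain p \<psi> c where bad: "\<And>i :: nat. bad (real i) (p i) (\<psi> i) (c i)" by metis
    have p: "pform (p i)" "invf (p i)" "bddf (p i)"
      and \<psi>: "hform (\<psi> i)" "\<And>x. 0 \<le> qf (\<psi> i) x" "\<And>x. qf (\<psi> i) x \<le> c i * qf (p i) x"
        "\<And>u x. unitary u \<Longrightarrow> \<bar>qf (\<psi> i) (act u x) - qf (\<psi> i) x\<bar> \<le> qf (p i) x"
      and no: "\<And>\<Xi>. hform \<Xi> \<Longrightarrow> invf \<Xi> \<Longrightarrow> \<not> (\<forall>x. \<bar>qf (\<psi> i) x - qf \<Xi> x\<bar> \<le> real i * qf (p i) x)" for i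
      using bad[of i] unfolding bad_def by blast+
    have hp: "hform (p i)" for i by (rule pform_onD(1)[OF p(1)])
    have p0: "0 \<le> qf (p i) x" for i x by (rule pform_onD(2)[OF p(1)]) simp
    define good where "good i q C \<longleftrightarrow> pform q \<and>
        (\<forall>w x y. (cmod (p i w x + \<psi> i w y))\<^sup>2 \<le> qf (p i) w * qf q (x, y)) \<and>
        (\<forall>y \<epsilon>. 0 < \<epsilon> \<longrightarrow> (\<exists>x. qf q (x, y) < qf (p i) y + \<epsilon>)) \<and>
        (\<forall>u x y. unitary u \<longrightarrow> qf q (act u x, act u y) \<le> 3\<^sup>2 * qf q (x, y)) \<and>
        (\<forall>x. qf q (x, 0) \<le> C * qf (p i) x) \<and> (\<forall>y. qf q (0, y) \<le> C * qf (p i) y)" for i q C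
    have "\<exists>q C. good i q C" for i
    proof (rule shear_form[OF p(1,2) \<psi>, of i])
      fix q C
      assume "pform q" "\<And>w x y. (cmod (p i w x + \<psi> i w y))\<^sup>2 \<le> qf (p i) w * qf q (x, y)"
        "\<And>y \<epsilon>. 0 < \<epsilon> \<Longrightarrow> \<exists>x. qf q (x, y) < qf (p i) y + \<epsilon>"
        "\<And>u x y. unitary u \<Longrightarrow> qf q (act u x, act u y) \<le> 3\<^sup>2 * qf q (x, y)"
        "\<And>x. qf q (x, 0) \<le> C * qf (p i) x" "\<And>y. qf q (0, y) \<le> C * qf (p i) y"
      then have "good i q C" unfolding good_def by simp
      then show ?thesis by blast
    qed
    then obtain q C where good: "\<And>i. good i (q i) (C i)" by metis
    have q: "pform (q i)" "(cmod (p i w x + \<psi> i w y))\<^sup>2 \<le> qf (p i) w * qf (q i) (x, y)"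
      "0 < \<epsilon> \<Longrightarrow> \<exists>x. qf (q i) (x, y) < qf (p i) y + \<epsilon>"
      "unitary u \<Longrightarrow> qf (q i) (act u x, act u y) \<le> 3\<^sup>2 * qf (q i) (x, y)"
      "qf (q i) (x, 0) \<le> C i * qf (p i) x" "qf (q i) (0, y) \<le> C i * qf (p i) y" for i w x y u \<epsilon>
      using good[of i] unfolding good_def by simp_all
    define Q where "Q = psumform q"
    have pQ: "pform Q" unfolding Q_def by (rule pform_psumform[OF q(1)])
    have Q0: "0 \<le> qf Q z" for z by (rule pform_onD(2)[OF pQ]) simp
    have Q_ge: "qf (q i) (coeff z i) \<le> qf Q z" for i z unfolding Q_def by (rule qf_psumform_ge[OF q(1)])
    have Q_monom: "qf Q (monom z i) = qf (q i) z" for i z unfolding Q_def by (rule qf_psumform_monom[OF q(1)])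
    define A where "A b = map_poly (map_prod (act b) (act b))" for b
    have act0: "act b 0 = 0" for b using act_addr[of b 0 0] by simp
    have cA: "coeff (A b z) i = map_prod (act b) (act b) (coeff z i)" for b z i
      by (simp add: A_def coeff_map_poly act0 zero_prod_def)
    have A_monom: "A b (monom (x, y) i) = monom (act b x, act b y) i" for b x y i
      by (simp add: poly_eq_iff cA) (simp add: zero_prod_def act0)
    have act_zero: "act 0 x = 0" for x using act_addl[of 0 0 x] by simp
    interpret P: bmod A
      by unfold_locales
        (simp_all add: poly_eq_iff cA prod_eq_iff act_addl act_addr act_mult act_csc)
    have dA: "degree (A b z) \<le> degree z" for b z
      by (rule degree_le) (simp add: cA coeff_eq_0 zero_prod_def act0)
    have "qf Q (A u z) \<le> 3\<^sup>2 * qf Q z" if u: "unitary u" for u z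
    proof -
      have "qf Q (A u z) = (\<Sum>i\<le>degree z. qf (q i) (act u (fst (coeff z i)), act u (snd (coeff z i))))"
        unfolding Q_def using psumform_eq[OF q(1), of "A u z" "degree z" "A u z"] dA[of u z]
        by (simp add: cA map_prod_def split_beta)
      also have "\<dots> \<le> (\<Sum>i\<le>degree z. 3\<^sup>2 * qf (q i) (fst (coeff z i), snd (coeff z i)))"
        by (intro sum_mono q(4) u)
      also have "\<dots> = 3\<^sup>2 * qf Q z"
        unfolding Q_def using psumform_eq[OF q(1), of z "degree z" z] by (simp add: sum_distrib_left)
      finally show ?thesis .
    qed
    then have QA: "qf Q (A b z) \<le> (2 * 3 * norm b)\<^sup>2 * qf Q z" for b z
      by (intro P.bounded_of_unitaries[OF pQ]) simp_all
    obtain ip where ip: "hilbert_set (dualsp Q) ip" "\<And>v. v \<in> dualsp Q \<Longrightarrow> qf ip v = dualnorm Q v"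
      using hilbert_set_dual[OF pQ] by metis
    interpret D: hilbert_set "dualsp Q" ip by (rule ip(1))
    have D_cs: "cmod (v z) \<le> D.nn v * sqrt (qf Q z)" if "v \<in> dualsp Q" for v z
      using real_sqrt_le_mono[OF dualnorm_cauchy_schwarz[OF pQ that, of z]] ip(2)[OF that]
      by (simp add: D.nn_def real_sqrt_mult)
    have D_nnI: "D.nn v \<le> K" if "v \<in> dualsp Q" "0 \<le> K" "\<And>z. (cmod (v z))\<^sup>2 \<le> K\<^sup>2 * qf Q z" for v K
      using dualnorm_le[OF pQ _ that(3)] that(2) ip(2)[OF that(1)] real_le_lsqrt
      by (simp add: D.nn_def real_le_lsqrt)
    \<comment> \<open>The adjoint action on functionals. The involution makes it multiplicative in
      the right order, and together with antilinearity of \<open>v\<close> makes it complex linear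
      in \<open>b\<close>.\<close>
    define \<rho> where "\<rho> b v = (\<lambda>z. v (A (star b) z))" for b and v :: "('v \<times> 'v) poly \<Rightarrow> complex"
    have \<rho>_bd: "(cmod (\<rho> b v z))\<^sup>2 \<le> (6 * norm b * D.nn v)\<^sup>2 * qf Q z" if v: "v \<in> dualsp Q" for b v z
    proof -
      have "(cmod (\<rho> b v z))\<^sup>2 \<le> (D.nn v * sqrt (qf Q (A (star b) z)))\<^sup>2"
        unfolding \<rho>_def by (intro power_mono D_cs v) simp
      also have "\<dots> = (D.nn v)\<^sup>2 * qf Q (A (star b) z)" using Q0 by (simp add: power_mult_distrib)
      also have "\<dots> \<le> (D.nn v)\<^sup>2 * ((6 * norm b)\<^sup>2 * qf Q z)"
        using QA[of "star b" z] by (intro mult_left_mono) simp_all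
      finally show ?thesis by (simp add: power_mult_distrib mult_ac)
    qed
    have \<rho>_in: "\<rho> b v \<in> dualsp Q" if v: "v \<in> dualsp Q" for b v
    proof -
      have "antilin (\<rho> b v)"
        using dualsp_antilin[OF pQ v] by (simp add: antilin_def \<rho>_def P.act_addr P.act_cscr)
      then show ?thesis using \<rho>_bd[OF v] unfolding dualsp_def by blast
    qed
    have \<rho>_nn: "D.nn (\<rho> b v) \<le> 6 * norm b * D.nn v" if v: "v \<in> dualsp Q" for b v
      by (rule D_nnI[OF \<rho>_in[OF v] _ \<rho>_bd[OF v]]) (simp add: v)
    have v_lin: "v (x + y) = v x + v y" "v (k *\<^sub>V x) = cnj k * v x" if "v \<in> dualsp Q" for v x y k
      using dualsp_antilin[OF pQ that] by (simp_all add: antilin_def)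
    have \<rho>_lin: "\<rho> b (v + w) = \<rho> b v + \<rho> b w" "\<rho> b (k *\<^sub>V v) = k *\<^sub>V \<rho> b v" for b v w k
      by (simp_all add: \<rho>_def fun_eq_iff)
    have \<rho>_arith: "\<rho> (a + b) v = \<rho> a v + \<rho> b v" "\<rho> (k *\<^sub>V a) v = k *\<^sub>V \<rho> a v" if "v \<in> dualsp Q" for a b v k
      using that by (simp_all add: \<rho>_def fun_eq_iff star_add star_csc P.act_addl P.act_csc v_lin)
    have \<rho>_mult: "\<rho> (a * b) v = \<rho> a (\<rho> b v)" and \<rho>_one: "\<rho> 1 v = v" for a b v
      by (simp_all add: \<rho>_def fun_eq_iff star_mult P.act_mult)
    \<comment> \<open>The annihilator of the sequences of first components. Duality exchanges sub
      and quotient: the vectors \<open>(x, 0)\<close> form a submodule of the pairs, and the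
      functionals killing them form the subrepresentation.\<close>
    define V where "V = {v \<in> dualsp Q. \<forall>z. (\<forall>i. snd (coeff z i) = 0) \<longrightarrow> v z = 0}"
    have VD: "V \<subseteq> dualsp Q" by (auto simp: V_def)
    have csV: "csub V"
      unfolding csub_def V_def using D.S_intros by auto
    have clV: "D.sclosed V"
      unfolding D.sclosed_def
    proof (intro conjI allI impI)
      fix v l assume v: "\<forall>n. v n \<in> V" and l: "l \<in> dualsp Q" and lim: "(\<lambda>n. D.nn (v n - l)) \<longlonglongrightarrow> 0"
      have "l z = 0" if z: "\<forall>i. snd (coeff z i) = 0" for z
      proof -
        have "cmod (l z) \<le> D.nn (v n - l) * sqrt (qf Q z)" for n
        proof -
          have "v n \<in> dualsp Q" "v n z = 0" using v z by (auto simp: V_def)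
          then show ?thesis using D_cs[OF D.S_intros(2)[OF _ l], of "v n" z] by simp
        qed
        moreover have "(\<lambda>n. D.nn (v n - l) * sqrt (qf Q z)) \<longlonglongrightarrow> 0 * sqrt (qf Q z)"
          by (intro tendsto_mult lim tendsto_const)
        ultimately have "cmod (l z) \<le> 0 * sqrt (qf Q z)" by (intro LIMSEQ_le_const) auto
        then show ?thesis by simp
      qed
      then show "l \<in> V" using l by (simp add: V_def)
    qed (rule VD)
    have invV: "\<rho> b v \<in> V" if "v \<in> V" for b v
      using that \<rho>_in by (auto simp: V_def \<rho>_def cA act0)
    define emb :: "'a \<Rightarrow> 'a unitz" where "emb = Unitz 0"
    have emb: "emb (a + b) = emb a + emb b" "emb (a * b) = emb a * emb b" "emb (k *\<^sub>C a) = k *\<^sub>V emb a"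
      "norm (emb a) \<le> norm a" for a b k
      using norm_Unitz_le[of 0 a] by (simp_all add: emb_def unitz_defs)
    \<comment> \<open>A functional on finitely supported sequences of pairs is determined by its
      restrictions to the single components. Even places of the code hold the first components and
      odd places the second ones; each restriction is bounded by a multiple of
      \<open>e\<close>.\<close>
    define code where "code v = (\<lambda>n x. v (monom (if even n then (x, 0) else (0, x)) (n div 2)))"
      for v :: "('v \<times> 'v) poly \<Rightarrow> complex"
    have code_dual: "code v n \<in> dualsp e" if v: "v \<in> dualsp Q" for v n
    proof -
      let ?z = "\<lambda>x :: 'v. if even n then (x, 0) else (0, x)"
      let ?i = "n div 2"
      have z: "monom (?z (x + y)) ?i = monom (?z x) ?i + monom (?z y) ?i"
        "monom (?z (k *\<^sub>V x)) ?i = k *\<^sub>V monom (?z x) ?i" for x y k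
        by (simp_all add: poly_eq_iff prod_eq_iff)
      have "antilin (code v n)" unfolding antilin_def code_def z v_lin[OF v] by simp
      moreover obtain K where K: "\<And>x. qf (p ?i) x \<le> K * qf e x" using p(3)[of ?i] unfolding bddf_def by blast
      have "(cmod (code v n x))\<^sup>2 \<le> (dualnorm Q v * \<bar>C ?i\<bar> * K) * qf e x" for x
      proof -
        have "(cmod (code v n x))\<^sup>2 \<le> dualnorm Q v * qf (q ?i) (?z x)"
          unfolding code_def using dualnorm_cauchy_schwarz[OF pQ v] Q_monom by metis
        also have "qf (q ?i) (?z x) \<le> \<bar>C ?i\<bar> * qf (p ?i) x"
          using q(5)[of ?i x] q(6)[of ?i x] mult_right_mono[OF abs_ge_self[of "C ?i"] p0[of ?i x]] by auto
        also have "\<dots> \<le> \<bar>C ?i\<bar> * (K * qf e x)" by (intro mult_left_mono K) simp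
        finally show ?thesis using dualnorm_nonneg[OF pQ v] by (simp add: mult_left_mono mult.assoc)
      qed
      ultimately show ?thesis unfolding dualsp_def by blast
    qed
    have code_inj: "inj_on code (dualsp Q)"
    proof (rule inj_onI)
      fix v w assume v: "v \<in> dualsp Q" and w: "w \<in> dualsp Q" and eq: "code v = code w"
      have mon: "v (monom (x, y) i) = w (monom (x, y) i)" for x y i
      proof -
        have "v (monom (x, 0) i) = w (monom (x, 0) i)" using fun_cong[OF fun_cong[OF eq, of "2 * i"], of x] by (simp add: code_def)
        moreover have "v (monom (0, y) i) = w (monom (0, y) i)"
          using fun_cong[OF fun_cong[OF eq, of "2 * i + 1"], of y] by (simp add: code_def)
        moreover have "monom (x, y) i = monom (x, 0) i + monom (0, y) i" by (simp add: add_monom)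
        ultimately show ?thesis using v_lin[OF v] v_lin[OF w] by simp
      qed
      have "v z = w z" for z
      proof -
        have vs: "u (\<Sum>i\<in>I. f i) = (\<Sum>i\<in>I. u (f i))" if "u \<in> dualsp Q" for u I and f :: "nat \<Rightarrow> _"
          by (induction I rule: infinite_finite_induct)
            (simp_all add: v_lin[OF that] antilin_zero[OF dualsp_antilin[OF pQ that]])
        have "z = (\<Sum>i\<le>degree z. monom (coeff z i) i)" by (rule poly_as_sum_of_monoms[symmetric])
        then show ?thesis using vs[OF v] vs[OF w] mon by (metis (no_types, lifting) prod.collapse sum.cong)
      qed
      then show "v = w" by auto
    qed
    have Jc: "inj_on (J \<circ> code) (dualsp Q)"
      by (rule comp_inj_on[OF code_inj inj_on_subset[OF J]]) (auto simp: code_dual)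
    obtain W where W: "csub W" "D.sclosed W" "\<And>a x. x \<in> W \<Longrightarrow> \<rho> (emb a) x \<in> W" "V \<inter> W = {0}"
      "\<And>x. x \<in> dualsp Q \<Longrightarrow> \<exists>v\<in>V. \<exists>w\<in>W. x = v + w"
    proof (rule D.transport_reduction[OF Jc trp, of "\<lambda>a. \<rho> (emb a)" 6 V])
      show "D.nn (\<rho> (emb a) x) \<le> 6 * norm a * D.nn x" if x: "x \<in> dualsp Q" for a x
        using \<rho>_nn[OF x, of "emb a"] emb(4)[of a] mult_right_mono[of "norm (emb a)" "norm a" "D.nn x"] x by simp
    qed (simp_all add: \<rho>_in \<rho>_lin \<rho>_arith \<rho>_mult emb csV clV invV)
    \<comment> \<open>The complement is known to be invariant under the algebra; the unitization
      adds only scalars.\<close>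
    have invW: "\<rho> b w \<in> W" if w: "w \<in> W" for b w
    proof -
      have wD: "w \<in> dualsp Q" using w W(2) by (auto simp: D.sclosed_def)
      have "b = usc b *\<^sub>V 1 + emb (uel b)" unfolding emb_def by (rule unitz_split)
      then have "\<rho> b w = usc b *\<^sub>V w + \<rho> (emb (uel b)) w" using \<rho>_arith[OF wD] \<rho>_one by metis
      then show ?thesis using w W(1,3) by (simp add: csub_add csub_csc)
    qed
    obtain K where K: "0 \<le> K" "\<And>v w. v \<in> V \<Longrightarrow> w \<in> W \<Longrightarrow> D.nn v \<le> K * D.nn (v + w)"
      using D.bounded_projection[OF csV clV W(1,2,4,5)] by metis
    define pr where "pr v = (SOME w. w \<in> W \<and> v - w \<in> V)" for v
    have pr: "pr v \<in> W" "v - pr v \<in> V" if v: "v \<in> dualsp Q" for v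
    proof -
      obtain a b where "a \<in> V" "b \<in> W" "v = a + b" using W(5)[OF v] by blast
      then have "b \<in> W \<and> v - b \<in> V" by simp
      then have "pr v \<in> W \<and> v - pr v \<in> V" 
        unfolding pr_def by (rule someI[of "\<lambda>w. w \<in> W \<and> v - w \<in> V" b])
      then show "pr v \<in> W" "v - pr v \<in> V" by simp_all
    qed
    have pr_eq: "pr v = w" if "v \<in> dualsp Q" "w \<in> W" "v - w \<in> V" for v w
    proof -
      have "(v - w) - (v - pr v) \<in> V" by (rule csub_diff[OF csV that(3) pr(2)[OF that(1)]])
      then have "pr v - w \<in> V" by simp
      then have "pr v - w \<in> V \<inter> W" using csub_diff[OF W(1) pr(1)[OF that(1)] that(2)] by simp
      then show ?thesis unfolding W(4) by simp
    qed
    have WD: "W \<subseteq> dualsp Q" using W(2) by (simp add: D.sclosed_def)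
    \<comment> \<open>\<open>K\<close> comes from one projection and is common to all summands. The
      counterexample number \<open>i\<close>, for which no invariant form within \<open>i p\<close>
      exists, is the one that is refuted.\<close>
    obtain i :: nat where i: "K \<le> real i" using real_arch_simple by blast
    define f where "f w z = p i w (fst (coeff z i)) + \<psi> i w (snd (coeff z i))" for w z
    have f_bd: "(cmod (f w z))\<^sup>2 \<le> qf (p i) w * qf Q z" for w z
    proof -
      have "(cmod (f w z))\<^sup>2 \<le> qf (p i) w * qf (q i) (coeff z i)"
        using q(2)[of i w "fst (coeff z i)" "snd (coeff z i)"] by (simp add: f_def)
      also have "\<dots> \<le> qf (p i) w * qf Q z" by (intro mult_left_mono Q_ge p0)
      finally show ?thesis .
    qed
    have f_in: "f w \<in> dualsp Q" for w
    proof -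
      have "antilin (f w)"
        by (simp add: antilin_def f_def hf_addr[OF hp] hf_addr[OF \<psi>(1)] hf_cscr[OF hp] hf_cscr[OF \<psi>(1)] algebra_simps)
      then show ?thesis using f_bd unfolding dualsp_def by blast
    qed
    have f_nn: "D.nn (f w) \<le> sqrt (qf (p i) w)" for w
      by (rule D_nnI[OF f_in]) (simp_all add: p0 f_bd)
    have f_lin: "f (w + w') = f w + f w'" "f (k *\<^sub>V w) = k *\<^sub>V f w" for w w' k
      by (simp_all add: f_def fun_eq_iff hf_addl[OF hp] hf_addl[OF \<psi>(1)] hf_cscl[OF hp] hf_cscl[OF \<psi>(1)] algebra_simps)
    \<comment> \<open>Evaluated on second components, \<open>f w\<close> itself gives
      \<open>\<psi> i w\<close>. Taking its component in \<open>W\<close> instead corrects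
      \<open>\<psi> i\<close> to something invariant.\<close>
    define \<Xi>0 where "\<Xi>0 w y = pr (f w) (monom (0, y) i)" for w y
    have prD: "pr (f w) \<in> dualsp Q" for w using pr(1)[OF f_in] WD by blast
    have X_addl: "\<Xi>0 (w + w') y = \<Xi>0 w y + \<Xi>0 w' y" for w w' y
    proof -
      have "f (w + w') - (pr (f w) + pr (f w')) = (f w - pr (f w)) + (f w' - pr (f w'))" by (simp add: f_lin)
      then have "pr (f (w + w')) = pr (f w) + pr (f w')"
        using csub_add[OF csV pr(2)[OF f_in] pr(2)[OF f_in]]
        by (intro pr_eq f_in csub_add[OF W(1)] pr(1)) metis
      then show ?thesis by (simp add: \<Xi>0_def)
    qed
    have X_cscl: "\<Xi>0 (k *\<^sub>V w) y = k * \<Xi>0 w y" for k w y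
    proof -
      have "f (k *\<^sub>V w) - k *\<^sub>V pr (f w) = k *\<^sub>V (f w - pr (f w))" by (simp add: f_lin csc_diff_right)
      then have "pr (f (k *\<^sub>V w)) = k *\<^sub>V pr (f w)"
        using csub_csc[OF csV pr(2)[OF f_in]]
        by (intro pr_eq f_in csub_csc[OF W(1)] pr(1)) metis
      then show ?thesis by (simp add: \<Xi>0_def)
    qed
    have X_addr: "\<Xi>0 w (y + y') = \<Xi>0 w y + \<Xi>0 w y'" for w y y'
      using v_lin(1)[OF prD, of w "monom (0, y) i" "monom (0, y') i"] by (simp add: \<Xi>0_def add_monom)
    have X_cscr: "\<Xi>0 w (k *\<^sub>V y) = cnj k * \<Xi>0 w y" for w y k
    proof -
      have "monom (0 :: 'v, k *\<^sub>V y) i = k *\<^sub>V monom (0, y) i" by (simp add: poly_eq_iff prod_eq_iff)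
      then show ?thesis unfolding \<Xi>0_def by (simp only: v_lin(2)[OF prD])
    qed
    have X_inv: "\<Xi>0 (act u w) (act u y) = \<Xi>0 w y" if u: "unitary u" for u w y
    proof -
      \<comment> \<open>\<open>f\<close> fails to be equivariant only through
        \<open>\<psi> i\<close>, which is not seen on first components. The defect lies in
        \<open>V\<close> and disappears under the equivariant projection to
        \<open>W\<close>.\<close>
      have "f (act u w) - \<rho> u (f w) \<in> V"
        unfolding V_def
      proof (intro CollectI conjI allI impI)
        show "f (act u w) - \<rho> u (f w) \<in> dualsp Q" by (intro D.S_intros f_in \<rho>_in)
        fix z :: "('v \<times> 'v) poly" assume "\<forall>j. snd (coeff z j) = 0"
        then have "snd (coeff z i) = 0" by simp
        moreover have "p i w (act (star u) (fst (coeff z i))) = p i (act u w) (fst (coeff z i))"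
          using p(2)[of i] u unfolding bmod.invf_def[OF bmod_axioms] by (metis act_unitary(2))
        ultimately show "(f (act u w) - \<rho> u (f w)) z = 0"
          by (simp add: f_def \<rho>_def cA act0 hf_zeror[OF \<psi>(1)])
      qed
      moreover have "\<rho> u (f w - pr (f w)) \<in> V" by (intro invV pr(2) f_in)
      then have "\<rho> u (f w) - \<rho> u (pr (f w)) \<in> V" by (simp add: \<rho>_def fun_diff_def)
      ultimately have "(f (act u w) - \<rho> u (f w)) + (\<rho> u (f w) - \<rho> u (pr (f w))) \<in> V"
        by (rule csub_add[OF csV])
      then have "f (act u w) - \<rho> u (pr (f w)) \<in> V" by simp
      then have "pr (f (act u w)) = \<rho> u (pr (f w))" by (intro pr_eq f_in invW pr(1))
      then show ?thesis using u by (simp add: \<Xi>0_def \<rho>_def A_monom act0)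
    qed
    have X_close: "cmod (\<psi> i w y - \<Xi>0 w y) \<le> K * sqrt (qf (p i) w) * sqrt (qf (p i) y)" for w y
    proof -
      let ?a = "f w - pr (f w)"
      have aV: "?a \<in> V" by (rule pr(2)[OF f_in])
      have na: "D.nn ?a \<le> K * sqrt (qf (p i) w)"
        using K(2)[OF aV pr(1)[OF f_in], of w] mult_left_mono[OF f_nn[of w] K(1)] by simp
      have "\<psi> i w y - \<Xi>0 w y = ?a (monom (0, y) i)"
        by (simp add: \<Xi>0_def f_def hf_zeror[OF hp])
      \<comment> \<open>An element of \<open>V\<close> does not notice the first component, so
        \<open>x\<close> may be chosen to make \<open>q i\<close> at \<open>(x, y)\<close> nearly as
        small as \<open>p i\<close> at \<open>y\<close>. This is why the constant \<open>C i\<close>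
        does not enter the estimate.\<close>
      also have "\<dots> = ?a (monom (x, y) i)" for x
      proof -
        have "?a (monom (x, 0) i) = 0" using aV by (auto simp: V_def)
        moreover have "monom (x, y) i = monom (x, 0) i + monom (0, y) i" by (simp add: add_monom)
        moreover have "?a \<in> dualsp Q" using aV VD by blast
        ultimately show ?thesis by (simp only: v_lin(1) add_0)
      qed
      finally have eq: "\<psi> i w y - \<Xi>0 w y = ?a (monom (x, y) i)" for x .
      let ?k = "K * sqrt (qf (p i) w)"
      have k0: "0 \<le> ?k" using K(1) p0 by simp
      have sq: "(cmod (\<psi> i w y - \<Xi>0 w y))\<^sup>2 \<le> ?k\<^sup>2 * (qf (p i) y + \<epsilon>)" if \<epsilon>: "0 < \<epsilon>" for \<epsilon>
      proof -
        obtain x where x: "qf (q i) (x, y) < qf (p i) y + \<epsilon>" using q(3)[OF \<epsilon>] by blast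
        have "cmod (?a (monom (x, y) i)) \<le> D.nn ?a * sqrt (qf (q i) (x, y))"
          using D_cs[of ?a "monom (x, y) i"] aV VD Q_monom by (metis subsetD)
        also have "\<dots> \<le> ?k * sqrt (qf (p i) y + \<epsilon>)"
          using x na k0 by (intro mult_mono real_sqrt_le_mono) (simp_all add: pform_onD(2)[OF q(1)])
        finally have "(cmod (\<psi> i w y - \<Xi>0 w y))\<^sup>2 \<le> (?k * sqrt (qf (p i) y + \<epsilon>))\<^sup>2"
          unfolding eq[of x] by (rule power_mono) simp
        then show ?thesis using p0[of i y] \<epsilon> by (simp add: power_mult_distrib)
      qed
      have "(cmod (\<psi> i w y - \<Xi>0 w y))\<^sup>2 \<le> ?k\<^sup>2 * qf (p i) y"
      proof (rule field_le_epsilon)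
        fix \<epsilon> :: real assume \<epsilon>: "0 < \<epsilon>"
        have "?k\<^sup>2 * (\<epsilon> / (?k\<^sup>2 + 1)) \<le> \<epsilon>" using \<epsilon> by (simp add: field_simps add_pos_nonneg)
        then show "(cmod (\<psi> i w y - \<Xi>0 w y))\<^sup>2 \<le> ?k\<^sup>2 * qf (p i) y + \<epsilon>"
          using sq[of "\<epsilon> / (?k\<^sup>2 + 1)"] divide_pos_pos[OF \<epsilon>, of "?k\<^sup>2 + 1"] zero_le_power2[of ?k]
          unfolding distrib_left by linarith
      qed
      then have "cmod (\<psi> i w y - \<Xi>0 w y) \<le> sqrt (?k\<^sup>2 * qf (p i) y)" by (rule real_le_rsqrt)
      then show ?thesis using k0 by (simp add: real_sqrt_mult)
    qed
    \<comment> \<open>The complement need not respect Hermitian symmetry; the Hermitian part keeps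
      invariance and the diagonal real values.\<close>
    define \<Xi> where "\<Xi> w y = (\<Xi>0 w y + cnj (\<Xi>0 y w)) / 2" for w y
    have "hform \<Xi>"
      unfolding hform_on_def \<Xi>_def
      by (simp add: X_addl X_addr X_cscl X_cscr add_divide_distrib algebra_simps)
    moreover have "invf \<Xi>" by (simp add: invf_def \<Xi>_def X_inv)
    moreover have "\<bar>qf (\<psi> i) x - qf \<Xi> x\<bar> \<le> real i * qf (p i) x" for x
    proof -
      have "qf (\<psi> i) x - qf \<Xi> x = Re (\<psi> i x x - \<Xi>0 x x)" by (simp add: \<Xi>_def)
      then have "\<bar>qf (\<psi> i) x - qf \<Xi> x\<bar> \<le> cmod (\<psi> i x x - \<Xi>0 x x)" using abs_Re_le_cmod by metis
      also have "\<dots> \<le> K * (sqrt (qf (p i) x) * sqrt (qf (p i) x))" using X_close[of x x] by (simp add: mult.assoc)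
      also have "\<dots> = K * qf (p i) x" using p0[of i x] by simp
      also have "\<dots> \<le> real i * qf (p i) x" by (rule mult_right_mono[OF i p0])
      finally show ?thesis .
    qed
    ultimately show False using no[of \<Xi> i] by blast
  qed
  then obtain \<tau> where \<tau>: "\<And>p \<psi> c. \<not> bad \<tau> p \<psi> c" by blast
  have "split_bmod act e M \<tau>"
  proof
    fix p \<psi> c
    assume "pform p" "invf p" "bddf p" "hform \<psi>" "\<And>x. 0 \<le> qf \<psi> x" "\<And>x. qf \<psi> x \<le> c * qf p x"
      "\<And>u x. unitary u \<Longrightarrow> \<bar>qf \<psi> (act u x) - qf \<psi> x\<bar> \<le> qf p x"
    then show "\<exists>\<Xi>. hform \<Xi> \<and> invf \<Xi> \<and> (\<forall>x. \<bar>qf \<psi> x - qf \<Xi> x\<bar> \<le> \<tau> * qf p x)"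
      using \<tau>[of p \<psi> c] unfolding bad_def by blast
  qed
  then show ?thesis by (rule that)
qed

section \<open>Riesz representation and coding of sequences\<close>

text \<open>A purely algebraic projection of the whole type onto \<open>S\<close>, without any
  continuity. Composing with it extends a form from \<open>S\<close> to a total form with a larger
  null space.\<close>

lemma linear_retraction:
  fixes S :: "'v::cvec set"
  assumes S: "csub S"
  obtains \<kappa> where "\<And>x y. \<kappa> (x + y) = \<kappa> x + \<kappa> y" "\<And>c x. \<kappa> (c *\<^sub>V x) = c *\<^sub>V \<kappa> x"
    "\<And>x. \<kappa> x \<in> S" "\<And>x. x \<in> S \<Longrightarrow> \<kappa> x = x"
proof -
  interpret vector_space "csc :: complex \<Rightarrow> 'v \<Rightarrow> 'v"
    by unfold_locales (simp_all add: csc_add_right csc_add_left)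
  interpret vector_space_pair "csc :: complex \<Rightarrow> 'v \<Rightarrow> 'v" "csc :: complex \<Rightarrow> 'v \<Rightarrow> 'v" ..
  have "subspace S" using S by (simp add: subspace_def csub_def)
  moreover have "Vector_Spaces.linear csc csc (\<lambda>x :: 'v. x)" by (rule linear_ident)
  ultimately obtain \<kappa> where \<kappa>: "range \<kappa> \<subseteq> S" "Vector_Spaces.linear csc csc \<kappa>" "\<forall>x\<in>S. \<kappa> x = x"
    using linear_exists_left_inverse_on[of "\<lambda>x. x" S] by auto
  interpret Vector_Spaces.linear csc csc \<kappa> by (rule \<kappa>(2))
  show ?thesis using that[of \<kappa>] \<kappa>(1,3) add scale by blast
qed

locale hilbert_retract = hilbert_set S ip for S :: "'v::cvec set" and ip +
  fixes \<kappa> :: "'v \<Rightarrow> 'v"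
  assumes \<kappa>_add: "\<kappa> (x + y) = \<kappa> x + \<kappa> y" and \<kappa>_csc: "\<kappa> (c *\<^sub>V x) = c *\<^sub>V \<kappa> x"
    and \<kappa>_in [simp]: "\<kappa> x \<in> S" and \<kappa>_id [simp]: "x \<in> S \<Longrightarrow> \<kappa> x = x"
begin

definition e :: "'v \<Rightarrow> 'v \<Rightarrow> complex" where "e x y = ip (\<kappa> x) (\<kappa> y)"

lemma pform_e: "pform e"
  unfolding pform_on_def hform_on_def e_def
proof (intro conjI ballI allI)
  show "ip (\<kappa> y) (\<kappa> x) = cnj (ip (\<kappa> x) (\<kappa> y))" for x y by (rule hf_sym[OF hip]) simp_all
  show "0 \<le> qf ip (\<kappa> x)" for x by (rule pform_onD(2)[OF ip]) simp
qed (simp_all add: \<kappa>_add \<kappa>_csc hf_addl[OF hip] hf_cscl[OF hip])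

lemmas hform_e = pform_onD(1)[OF pform_e]

lemma qf_e: "qf e x = (nn (\<kappa> x))\<^sup>2"
  using pform_onD(2)[OF ip, of "\<kappa> x"] by (simp add: e_def nn_def)

text \<open>Riesz representation: density of the functionals \<open>e x\<close> yields approximating
  vectors with error \<open>1 / (n + 1)\<close>, and completeness of \<open>S\<close> yields their
  limit.\<close>

lemma dualsp_eq_range:
  assumes v: "v \<in> dualsp e"
  obtains y where "y \<in> S" "v = e y"
proof -
  note av = dualsp_antilin[OF pform_e v]
  have "\<exists>y\<in>S. \<forall>z. cmod (v z - e y z) \<le> inverse (Suc n) * nn (\<kappa> z)" for n
  proof -
    have "0 < (inverse (real (Suc n)))\<^sup>2" by simp
    then obtain x where x: "dualnorm e (v + e x) < (inverse (Suc n))\<^sup>2"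
      by (rule dualnorm_approx[OF pform_e v])
    have vd: "v + e x \<in> dualsp e" by (rule csub_add[OF csub_dualsp[OF pform_e] v dual_embed[OF pform_e]])
    have "cmod (v z - e (- \<kappa> x) z) \<le> inverse (Suc n) * nn (\<kappa> z)" for z
    proof -
      have "\<kappa> (- \<kappa> x) = - \<kappa> x" using csub_minus[OF sub] by simp
      then have "v z - e (- \<kappa> x) z = (v + e x) z" by (simp add: e_def hf_minusl[OF hip])
      then have "(cmod (v z - e (- \<kappa> x) z))\<^sup>2 \<le> dualnorm e (v + e x) * qf e z"
        using dualnorm_cauchy_schwarz[OF pform_e vd, of z] by (simp only:)
      moreover have "dualnorm e (v + e x) * qf e z \<le> (inverse (Suc n))\<^sup>2 * qf e z"
        using x by (intro mult_right_mono) (simp_all add: qf_e)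
      ultimately have "(cmod (v z - e (- \<kappa> x) z))\<^sup>2 \<le> (inverse (Suc n))\<^sup>2 * qf e z" by linarith
      then have "(cmod (v z - e (- \<kappa> x) z))\<^sup>2 \<le> (inverse (Suc n) * nn (\<kappa> z))\<^sup>2"
        unfolding qf_e power_mult_distrib .
      then show ?thesis by (rule power2_le_imp_le) simp
    qed
    then show ?thesis using csub_minus[OF sub \<kappa>_in] by blast
  qed
  then obtain y where y: "\<And>n. y n \<in> S" "\<And>n z. cmod (v z - e (y n) z) \<le> inverse (Suc n) * nn (\<kappa> z)"
    by metis
  have yy: "nn (y m - y n) \<le> inverse (Suc m) + inverse (Suc n)" for m n
  proof -
    let ?z = "y m - y n"
    have z: "?z \<in> S" by (intro S_intros y)
    have "e ?z ?z = (v ?z - e (y n) ?z) - (v ?z - e (y m) ?z)" by (simp add: hf_diffl[OF hform_e])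
    then have "cmod (e ?z ?z) \<le> inverse (Suc n) * nn ?z + inverse (Suc m) * nn ?z"
      using norm_triangle_ineq4[of "v ?z - e (y n) ?z" "v ?z - e (y m) ?z"] y(2)[of ?z n] y(2)[of ?z m] z by simp
    moreover have "nn ?z * nn ?z \<le> cmod (e ?z ?z)"
      using complex_Re_le_cmod[of "e ?z ?z"] qf_e[of ?z] z by (simp add: power2_eq_square)
    ultimately have "nn ?z * nn ?z \<le> (inverse (Suc m) + inverse (Suc n)) * nn ?z" by (simp add: algebra_simps)
    then show ?thesis using nn_nonneg[OF z]
      by (cases "nn ?z = 0") (simp_all add: mult_le_cancel_right)
  qed
  have inv0: "(\<lambda>n. inverse (real (Suc n))) \<longlonglongrightarrow> 0" by (rule LIMSEQ_inverse_real_of_nat)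
  have C: "\<exists>N. \<forall>m\<ge>N. \<forall>n\<ge>N. nn (y m - y n) < \<epsilon>" if "0 < \<epsilon>" for \<epsilon>
  proof -
    have "eventually (\<lambda>n. inverse (real (Suc n)) < \<epsilon> / 2) sequentially"
      using order_tendstoD(2)[OF inv0, of "\<epsilon> / 2"] that by simp
    then obtain N where N: "\<And>n. n \<ge> N \<Longrightarrow> inverse (real (Suc n)) < \<epsilon> / 2" unfolding eventually_sequentially by blast
    then have "nn (y m - y n) < \<epsilon>" if mn: "m \<ge> N" "n \<ge> N" for m n
      using yy[of m n] N[OF mn(1)] N[OF mn(2)] by linarith
    then show ?thesis by blast
  qed
  obtain l where l: "l \<in> S" "(\<lambda>n. nn (y n - l)) \<longlonglongrightarrow> 0" by (rule complete_nn[OF y(1) C])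
  have "v z = e l z" for z
  proof -
    have "cmod (v z - e l z) \<le> inverse (Suc n) * nn (\<kappa> z) + nn (y n - l) * nn (\<kappa> z)" for n
    proof -
      have "cmod (e (y n - l) z) \<le> nn (y n - l) * nn (\<kappa> z)"
        using ip_cauchy_schwarz[of "y n - l" "\<kappa> z"] y(1)[of n] l(1) S_intros(2)[of "y n" l] by (simp add: e_def)
      moreover have "v z - e l z = (v z - e (y n) z) + e (y n - l) z" by (simp add: hf_diffl[OF hform_e])
      then have "cmod (v z - e l z) \<le> cmod (v z - e (y n) z) + cmod (e (y n - l) z)" by (metis norm_triangle_ineq)
      ultimately show ?thesis using y(2)[of z n] by linarith
    qed
    moreover have "(\<lambda>n. inverse (real (Suc n)) * nn (\<kappa> z) + nn (y n - l) * nn (\<kappa> z)) \<longlonglongrightarrow> 0 * nn (\<kappa> z) + 0 * nn (\<kappa> z)"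
      by (intro tendsto_intros inv0 l)
    ultimately have "cmod (v z - e l z) \<le> 0 * nn (\<kappa> z) + 0 * nn (\<kappa> z)"
      by (intro LIMSEQ_le_const) auto
    then show ?thesis by simp
  qed
  then show ?thesis using that l(1) by blast
qed

end

theorem (in hilbert_set) riesz:
  assumes add: "\<And>x y. x \<in> S \<Longrightarrow> y \<in> S \<Longrightarrow> v (x + y) = v x + v y"
    and csc: "\<And>c x. x \<in> S \<Longrightarrow> v (c *\<^sub>V x) = cnj c * v x"
    and bd: "\<And>x. x \<in> S \<Longrightarrow> cmod (v x) \<le> K * nn x"
  obtains y where "y \<in> S" "\<And>x. x \<in> S \<Longrightarrow> v x = ip y x"
proof -
  obtain \<kappa> where \<kappa>: "\<And>x y. \<kappa> (x + y) = \<kappa> x + \<kappa> y" "\<And>c x. \<kappa> (c *\<^sub>V x) = c *\<^sub>V \<kappa> x"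
    "\<And>x. \<kappa> x \<in> S" "\<And>x. x \<in> S \<Longrightarrow> \<kappa> x = x" using linear_retraction[OF sub] by metis
  interpret hilbert_retract S ip \<kappa> by unfold_locales (simp_all add: \<kappa>)
  have "(cmod (v (\<kappa> x)))\<^sup>2 \<le> K\<^sup>2 * qf e x" for x
    using power_mono[OF bd[of "\<kappa> x"], of 2] by (simp add: qf_e power_mult_distrib)
  moreover have "antilin (\<lambda>x. v (\<kappa> x))" by (simp add: antilin_def \<kappa> add csc)
  ultimately have "(\<lambda>x. v (\<kappa> x)) \<in> dualsp e" unfolding dualsp_def by blast
  then obtain y where y: "y \<in> S" "(\<lambda>x. v (\<kappa> x)) = e y" by (rule dualsp_eq_range)
  have "v x = ip y x" if "x \<in> S" for x using fun_cong[OF y(2), of x] y(1) that by (simp add: e_def)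
  then show ?thesis using that y(1) by blast
qed

text \<open>Real numbers are coded by sets of natural numbers, hence sequences of reals by sets of
  pairs of naturals, and these by real numbers again.\<close>

lemma complex_sequences_into_reals:
  obtains g :: "(nat \<Rightarrow> complex) \<Rightarrow> real" where "inj g"
proof -
  obtain k :: "nat set \<Rightarrow> real" where "bij k" using nat_sets_eqpoll_reals unfolding eqpoll_def by blast
  define h where "h = the_inv_into UNIV k"
  have h: "inj h" and k: "inj k" using \<open>bij k\<close> by (simp_all add: h_def bij_is_inj bij_betw_the_inv_into bij_betw_imp_inj_on)
  define s where "s c = (\<lambda>i. h (if even i then Re (c (i div 2)) else Im (c (i div 2))))" for c :: "nat \<Rightarrow> complex"
  have s: "c = d" if eq: "s c = s d" for c d
  proof
    fix n
    have "Re (c n) = Re (d n)" using fun_cong[OF eq, of "2 * n"] injD[OF h] by (simp add: s_def)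
    moreover have "Im (c n) = Im (d n)" using fun_cong[OF eq, of "2 * n + 1"] injD[OF h] by (simp add: s_def)
    ultimately show "c n = d n" by (simp add: complex_eq_iff)
  qed
  define g where "g c = k {prod_encode (i, m) | i m. m \<in> s c i}" for c
  have "inj g"
  proof (rule injI)
    fix c d assume "g c = g d"
    then have eq: "{prod_encode (i, m) | i m. m \<in> s c i} = {prod_encode (i, m) | i m. m \<in> s d i}"
      using injD[OF k] by (simp add: g_def)
    have mem: "prod_encode (i, m) \<in> {prod_encode (i, m) | i m. m \<in> s c i} \<longleftrightarrow> m \<in> s c i" for i m c by auto
    have "m \<in> s c i \<longleftrightarrow> m \<in> s d i" for i m
      using mem[of i m c] mem[of i m d] unfolding eq by simp
    then have "s c = s d" by (simp add: fun_eq_iff set_eq_iff)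
    then show "c = d" by (rule s)
  qed
  then show ?thesis by (rule that)
qed

section \<open>Orthonormal bases and vectors coding sequences\<close>

context hilbert_retract
begin

lemma orthonormal_basis:
  obtains E where "E \<subseteq> S" "orthonormal e E" "\<And>x. x \<in> S \<Longrightarrow> (\<And>a. a \<in> E \<Longrightarrow> e x a = 0) \<Longrightarrow> x = 0"
proof -
  let ?P = "{E. E \<subseteq> S \<and> orthonormal e E}"
  have "\<exists>E\<in>?P. \<forall>X\<in>?P. E \<subseteq> X \<longrightarrow> X = E"
  proof (rule subset_Zorn_nonempty)
    show "?P \<noteq> {}" by (auto simp: orthonormal_def)
    fix C assume C: "C \<noteq> {}" "subset.chain ?P C"
    show "\<Union>C \<in> ?P"
    proof (intro CollectI conjI)
      show "\<Union>C \<subseteq> S" using C(2) by (auto simp: subset_chain_def)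
      show "orthonormal e (\<Union>C)"
        unfolding orthonormal_def
      proof (intro ballI)
        fix a b assume "a \<in> \<Union>C" "b \<in> \<Union>C"
        then obtain A B where AB: "A \<in> C" "B \<in> C" "a \<in> A" "b \<in> B" by blast
        then have "A \<subseteq> B \<or> B \<subseteq> A" using C(2) by (auto simp: subset_chain_def)
        then obtain D where "D \<in> C" "a \<in> D" "b \<in> D" using AB by blast
        then show "e a b = (if a = b then 1 else 0)" using C(2) by (auto simp: subset_chain_def orthonormal_def)
      qed
    qed
  qed
  then obtain E where "E \<in> ?P" and max: "\<forall>X\<in>?P. E \<subseteq> X \<longrightarrow> X = E" ..
  then have E: "E \<subseteq> S" "orthonormal e E" by simp_all
  have E3: "X = E" if "X \<subseteq> S" "orthonormal e X" "E \<subseteq> X" for X using max that by simp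
  have "x = 0" if x: "x \<in> S" and xE: "\<And>a. a \<in> E \<Longrightarrow> e x a = 0" for x
  proof (rule ccontr)
    assume "x \<noteq> 0"
    then have n0: "nn x \<noteq> 0" using nn_eq_0[OF x] by blast
    define b where "b = complex_of_real (1 / nn x) *\<^sub>V x"
    have bS: "b \<in> S" unfolding b_def by (intro S_intros x)
    have ba: "e b a = 0" "e a b = 0" if a: "a \<in> E" for a
    proof -
      show "e b a = 0" using xE[OF a] by (simp add: b_def hf_cscl[OF hform_e])
      then show "e a b = 0" using hf_sym[OF hform_e, of b a] by simp
    qed
    have bb: "e b b = 1"
    proof -
      have "e x x = of_real (qf e x)" by (rule hf_real[OF hform_e]) simp
      also have "qf e x = (nn x)\<^sup>2" using x by (simp add: qf_e)
      finally have "e x x = of_real ((nn x)\<^sup>2)" .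
      then show ?thesis using n0 by (simp add: b_def hf_cscl[OF hform_e] hf_cscr[OF hform_e] power2_eq_square)
    qed
    have "orthonormal e (insert b E)"
      unfolding orthonormal_def using E(2) ba bb by (auto simp: orthonormal_def)
    then have "insert b E = E" using E(1) bS by (intro E3) auto
    then show False using ba(1)[of b] bb by auto
  qed
  then show ?thesis using that E by blast
qed

text \<open>By Bessel, at most \<open>n\<close> vectors of the system have a coefficient whose
  squared modulus exceeds the squared norm of \<open>x\<close> divided by \<open>n\<close>.\<close>

lemma countable_support:
  assumes E: "orthonormal e E"
  shows "countable {a \<in> E. e x a \<noteq> 0}"
proof -
  define A where "A n = {a \<in> E. qf e x < real n * (cmod (e x a))\<^sup>2}" for n :: nat
  have fin: "finite (A n)" for n
  proof (rule ccontr)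
    assume "infinite (A n)"
    then obtain F where F: "F \<subseteq> A n" "finite F" "card F = Suc n" by (meson infinite_arbitrarily_large)
    have FE: "orthonormal e F" using E F(1) unfolding orthonormal_def A_def by blast
    have "real (Suc n) * qf e x = (\<Sum>a\<in>F. qf e x)" using F(3) by simp
    also have "\<dots> \<le> (\<Sum>a\<in>F. real n * (cmod (e x a))\<^sup>2)" using F(1) by (intro sum_mono) (auto simp: A_def)
    also have "\<dots> = real n * qf (proj_form e F) x" by (simp add: qf_proj_form sum_distrib_left)
    also have "\<dots> \<le> real n * qf e x" using bessel[OF pform_e FE F(2), of x] by (simp add: mult_left_mono)
    finally have q0: "qf e x \<le> 0" by (simp add: distrib_right)
    obtain a where a: "a \<in> F" using F(3) by fastforce
    have "orthonormal e {a}" using FE a by (simp add: orthonormal_def)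
    then have "(cmod (e x a))\<^sup>2 \<le> qf e x" using bessel[OF pform_e, of "{a}" x] by (simp add: qf_proj_form)
    then have "(cmod (e x a))\<^sup>2 \<le> 0" using q0 by (rule order_trans)
    then have "e x a = 0" by simp
    then show False using a F(1) qf_e[of x] by (auto simp: A_def)
  qed
  have "{a \<in> E. e x a \<noteq> 0} \<subseteq> (\<Union>n. A n)"
  proof
    fix a assume a: "a \<in> {a \<in> E. e x a \<noteq> 0}"
    then obtain n where "qf e x < real n * (cmod (e x a))\<^sup>2" using reals_Archimedean3[of "(cmod (e x a))\<^sup>2"] by auto
    then show "a \<in> (\<Union>n. A n)" using a by (auto simp: A_def)
  qed
  then show ?thesis using fin by (meson countable_UN countable_finite countable_subset uncountable_infinite countableI_type)
qed

text \<open>A sequence in \<open>S\<close> is determined by its coefficient sequences along an orthonormal basis. All but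
  countably many of them vanish; the others are coded by the directions of the coefficients of a single vector.\<close>

theorem sequences_embed:
  obtains J where "inj_on J {s. \<forall>n :: nat. s n \<in> S}" "\<And>s. (\<forall>n. s n \<in> S) \<Longrightarrow> J s \<in> S"
proof -
  obtain E where E: "E \<subseteq> S" "orthonormal e E" "\<And>x. x \<in> S \<Longrightarrow> (\<And>a. a \<in> E \<Longrightarrow> e x a = 0) \<Longrightarrow> x = 0"
    using orthonormal_basis by metis
  obtain g :: "(nat \<Rightarrow> complex) \<Rightarrow> real" where g: "inj g" by (rule complex_sequences_into_reals)
  define supp where "supp s = {a \<in> E. \<exists>n. e (s n) a \<noteq> 0}" for s :: "nat \<Rightarrow> 'v"
  \<comment> \<open>Real part 1 fixes the scale: the positive factor \<open>r\<close> is the real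
    part of \<open>r * dir s a\<close>, so the imaginary part and with it the coded sequence can be
    recovered. It also keeps the coefficient nonzero, so that the support can be read off.\<close>
  define dir where "dir s a = Complex 1 (g (\<lambda>n. e (s n) a))" for s a
  have ex: "\<exists>w\<in>S. \<forall>a\<in>E. \<exists>r>0. e w a = (if a \<in> supp s then of_real r * dir s a else 0)" for s
  proof -
    have "supp s = (\<Union>n. {a \<in> E. e (s n) a \<noteq> 0})" by (auto simp: supp_def)
    then have cs: "countable (supp s)" using countable_support[OF E(2)] by simp
    define k where "k = to_nat_on (supp s)"
    have k: "inj_on k (supp s)" unfolding k_def by (rule inj_on_to_nat_on[OF cs])
    define b where "b = the_inv_into (supp s) k"
    have bk: "b (k a) = a" if "a \<in> supp s" for a using that by (simp add: b_def the_inv_into_f_f[OF k])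
    \<comment> \<open>Normalizes the direction and attaches a geometric weight along an enumeration
      of the support, so that the sum over the support converges.\<close>
    define R where "R a = (1/2) ^ k a / cmod (dir s a)" for a
    have dir0: "dir s a \<noteq> 0" for a by (simp add: dir_def complex_eq_iff)
    have R: "0 < R a" for a using dir0 by (simp add: R_def)
    define t where "t i = (if i \<in> k ` supp s then (of_real (R (b i)) * dir s (b i)) *\<^sub>V b i else 0)" for i
    have nE: "nn a = 1" if "a \<in> E" for a
    proof -
      have "qf e a = 1" using E(2) that by (simp add: orthonormal_def)
      then have "(nn a)\<^sup>2 = 1" using that E(1) by (auto simp: qf_e)
      moreover have "0 \<le> nn a" using that E(1) by auto
      ultimately show ?thesis by (auto simp: power2_eq_1_iff)
    qed
    have suppS: "supp s \<subseteq> S" using E(1) by (auto simp: supp_def)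
    have tS: "t i \<in> S" for i using suppS by (auto simp: t_def bk S_intros)
    have tn: "nn (t i) \<le> 1 * (1/2) ^ i" for i
    proof (cases "i \<in> k ` supp s")
      case True
      then obtain a where a: "a \<in> supp s" "i = k a" by blast
      then have "nn (t i) = R a * cmod (dir s a) * nn a"
        using suppS R[of a] by (auto simp: t_def bk nn_csc norm_mult)
      also have "\<dots> = (1/2) ^ i" using a nE[of a] dir0 by (simp add: R_def supp_def)
      finally show ?thesis by simp
    qed (simp add: t_def nn_zero)
    have Scl: "sclosed S" by (simp add: sclosed_def)
    obtain w where w: "w \<in> S" "(\<lambda>n. nn ((\<Sum>i<n. t i) - w)) \<longlonglongrightarrow> 0"
      by (rule geometric_series[OF tS sub Scl tn])
    have coef: "e w a = (if a \<in> supp s then of_real (R a) * dir s a else 0)" if a: "a \<in> E" for a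
    proof -
      let ?r = "if a \<in> supp s then of_real (R a) * dir s a else 0"
      have et: "e (t i) a = (if a \<in> supp s \<and> i = k a then ?r else 0)" for i
      proof (cases "i \<in> k ` supp s")
        case True
        then obtain c where c: "c \<in> supp s" "i = k c" by blast
        have "e c a = (if c = a then 1 else 0)" using E(2) a c(1) by (simp add: orthonormal_def supp_def)
        moreover have "a \<in> supp s \<and> i = k a \<longleftrightarrow> c = a" using c inj_onD[OF k, of c a] by auto
        ultimately show ?thesis using c by (auto simp: t_def bk hf_cscl[OF hform_e])
      qed (auto simp: t_def hf_zerol[OF hform_e])
      have lim: "(\<lambda>n. e ((\<Sum>i<n. t i) - w) a) \<longlonglongrightarrow> 0"
      proof (rule Lim_null_comparison[OF always_eventually w(2)], rule allI)
        fix n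
        have "(\<Sum>i<n. t i) - w \<in> S" by (intro S_intros tS w(1)) 
        then show "cmod (e ((\<Sum>i<n. t i) - w) a) \<le> nn ((\<Sum>i<n. t i) - w)"
          using ip_cauchy_schwarz[of "(\<Sum>i<n. t i) - w" a] nE[OF a] a E(1) by (auto simp: e_def)
      qed
      have "\<forall>\<^sub>F n in sequentially. e ((\<Sum>i<n. t i) - w) a = ?r - e w a"
        using eventually_gt_at_top[of "k a"]
      proof eventually_elim
        case (elim n)
        have "e ((\<Sum>i<n. t i) - w) a = (\<Sum>i<n. e (t i) a) - e w a" by (simp add: hf_diffl[OF hform_e] hf_suml[OF hform_e])
        also have "(\<Sum>i<n. e (t i) a) = (\<Sum>i<n. if i = k a then ?r else 0)" unfolding et by (intro sum.cong) auto
        finally show ?case using elim by simp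
      qed
      then have "(\<lambda>n. ?r - e w a) \<longlonglongrightarrow> 0" using lim by (rule Lim_transform_eventually[rotated])
      then have "?r - e w a = 0" by (simp add: LIMSEQ_const_iff)
      then show ?thesis by simp
    qed
    show ?thesis using w(1) coef R by blast
  qed
  then obtain J where J: "\<And>s. J s \<in> S"
    "\<And>s. \<forall>a\<in>E. \<exists>r>0. e (J s) a = (if a \<in> supp s then of_real r * dir s a else 0)" by metis
  have "inj_on J {s. \<forall>n :: nat. s n \<in> S}"
  proof (rule inj_onI)
    fix s s' assume s: "s \<in> {s. \<forall>n. s n \<in> S}" and s': "s' \<in> {s. \<forall>n. s n \<in> S}" and eq: "J s = J s'"
    have coef: "e (s n) a = e (s' n) a" if a: "a \<in> E" for a n
    proof -
      obtain r r' where r: "0 < r" "e (J s) a = (if a \<in> supp s then of_real r * dir s a else 0)"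
        "0 < r'" "e (J s') a = (if a \<in> supp s' then of_real r' * dir s' a else 0)"
        using J(2) a by metis
      have d0: "dir s a \<noteq> 0" for s a by (simp add: dir_def complex_eq_iff)
      have iff: "a \<in> supp s \<longleftrightarrow> a \<in> supp s'" using r eq d0[of s] d0[of s'] by (auto split: if_splits)
      show ?thesis
      proof (cases "a \<in> supp s")
        case True
        then have eq2: "of_real r * dir s a = of_real r' * dir s' a" using r eq iff by simp
        then have "r = r'" by (simp add: dir_def complex_eq_iff)
        then have "dir s a = dir s' a" using eq2 r(1) by simp
        then have "g (\<lambda>n. e (s n) a) = g (\<lambda>n. e (s' n) a)" by (simp add: dir_def)
        then have "(\<lambda>n. e (s n) a) = (\<lambda>n. e (s' n) a)" by (rule injD[OF g])
        then show ?thesis by (rule fun_cong)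
      next
        case False
        then show ?thesis using iff a by (auto simp: supp_def)
      qed
    qed
    show "s = s'"
    proof
      fix n
      have "s n - s' n = 0"
        using s s' coef by (intro E(3)) (auto simp: S_intros hf_diffl[OF hform_e])
      then show "s n = s' n" by simp
    qed
  qed
  then show ?thesis using that J(1) by blast
qed

end

section \<open>Equivalent invariant inner products\<close>

text \<open>For a unitary this is invariance with \<open>x\<close> replaced by
  \<open>act (star u) x\<close>. Four unitaries give the general case, the conjugates of the
  coefficients being absorbed by antilinearity in the second argument.\<close>

lemma (in bmod) invf_adjoint:
  assumes p: "hform p" "invf p"
  shows "p (act (star b) x) y = p x (act b y)"
proof -
  have u: "p (act (star u) x) y = p x (act u y)" if "unitary u" for u
  proof -
    have "p (act u (act (star u) x)) (act u y) = p (act (star u) x) y" using p(2) that unfolding invf_def by blast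
    then show ?thesis using that by simp
  qed
  obtain u1 u2 u3 u4 where b: "unitary u1" "unitary u2" "unitary u3" "unitary u4"
    "b = (norm b / 2) *\<^sub>R (u1 + u2) + \<i> *\<^sub>V ((norm b / 2) *\<^sub>R (u3 + u4))"
    by (rule unitary_combination[of b])
  let ?c = "complex_of_real (norm b / 2)"
  have eq: "b = ?c *\<^sub>V (u1 + u2) + \<i> *\<^sub>V ?c *\<^sub>V (u3 + u4)" using b(5) by (simp only: scaleR_csc)
  have "star b = star (?c *\<^sub>V (u1 + u2) + \<i> *\<^sub>V ?c *\<^sub>V (u3 + u4))" using eq by (rule arg_cong)
  also have "\<dots> = ?c *\<^sub>V (star u1 + star u2) + (- \<i> * ?c) *\<^sub>V (star u3 + star u4)"
    by (simp add: star_add star_csc)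
  finally have "p (act (star b) x) y = ?c * (p x (act u1 y) + p x (act u2 y)) + (- \<i> * ?c) * (p x (act u3 y) + p x (act u4 y))"
    by (simp only: act_addl act_csc hf_addl[OF p(1)] hf_cscl[OF p(1)] UNIV_I u[OF b(1)] u[OF b(2)] u[OF b(3)] u[OF b(4)])
  also have "\<dots> = p x (?c *\<^sub>V (act u1 y + act u2 y) + \<i> *\<^sub>V ?c *\<^sub>V (act u3 y + act u4 y))"
    by (simp add: hf_addr[OF p(1)] hf_cscr[OF p(1)])
  also have "?c *\<^sub>V (act u1 y + act u2 y) + \<i> *\<^sub>V ?c *\<^sub>V (act u3 y + act u4 y) = act b y"
    by (subst (2) eq) (simp only: act_addl act_csc)
  finally show ?thesis .
qed

theorem (in hilbert_set) invariant_inner_product: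
  fixes \<rho> :: "'a::cstar_algebra \<Rightarrow> 'v \<Rightarrow> 'v" and f :: "'v \<Rightarrow> 'h"
  assumes f: "inj_on f S" and trp: "total_reduction_property TYPE('a) TYPE('h)"
    and cl: "\<And>a x. x \<in> S \<Longrightarrow> \<rho> a x \<in> S"
    and addx: "\<And>a x y. x \<in> S \<Longrightarrow> y \<in> S \<Longrightarrow> \<rho> a (x + y) = \<rho> a x + \<rho> a y"
    and cscx: "\<And>a c x. x \<in> S \<Longrightarrow> \<rho> a (c *\<^sub>V x) = c *\<^sub>V \<rho> a x"
    and adda: "\<And>a b x. x \<in> S \<Longrightarrow> \<rho> (a + b) x = \<rho> a x + \<rho> b x"
    and csca: "\<And>a c x. x \<in> S \<Longrightarrow> \<rho> (c *\<^sub>C a) x = c *\<^sub>V \<rho> a x"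
    and mult: "\<And>a b x. x \<in> S \<Longrightarrow> \<rho> (a * b) x = \<rho> a (\<rho> b x)"
    and bd: "\<And>a x. x \<in> S \<Longrightarrow> nn (\<rho> a x) \<le> K * norm a * nn x"
  obtains p C where "pform_on S p" "\<And>x. x \<in> S \<Longrightarrow> qf ip x \<le> qf p x" "\<And>x. x \<in> S \<Longrightarrow> qf p x \<le> C * qf ip x"
    "\<And>a x y. x \<in> S \<Longrightarrow> y \<in> S \<Longrightarrow> p (\<rho> (star a) x) y = p x (\<rho> a y)"
proof -
  obtain \<kappa> where \<kappa>: "\<And>x y. \<kappa> (x + y) = \<kappa> x + \<kappa> y" "\<And>c x. \<kappa> (c *\<^sub>V x) = c *\<^sub>V \<kappa> x"
    "\<And>x. \<kappa> x \<in> S" "\<And>x. x \<in> S \<Longrightarrow> \<kappa> x = x" using linear_retraction[OF sub] by metis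
  interpret hilbert_retract S ip \<kappa> by unfold_locales (simp_all add: \<kappa>)
  \<comment> \<open>Scalars act on the whole type and the algebra through the retraction onto
    \<open>S\<close>. So the unit acts as the identity even if \<open>\<rho>\<close> is
    degenerate.\<close>
  define act where "act b x = usc b *\<^sub>V x + \<rho> (uel b) (\<kappa> x)" for b x
  have \<rho>0: "\<rho> 0 x = 0" if "x \<in> S" for x using adda[OF that, of 0 0] by simp
  \<comment> \<open>The scalar part contributes 1 and the part in the algebra
    \<open>2 * \<bar>K\<bar>\<close>, because \<open>uel\<close> may double the norm.\<close>
  have B: "bounded_bmod act e ((1 + 2 * \<bar>K\<bar>)\<^sup>2)"
  proof
    show "act (a + b) x = act a x + act b x" for a b x
      by (simp add: act_def unitz_defs adda csc_add_left)
    show "act a (x + y) = act a x + act a y" for a x y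
      by (simp add: act_def \<kappa>_add addx csc_add_right)
    show "act (a * b) x = act a (act b x)" for a b x
      by (simp add: act_def unitz_defs adda csca mult cl \<kappa>_add \<kappa>_csc addx cscx csc_add_right S_intros mult.commute)
    show "act 1 x = x" for x by (simp add: act_def unitz_defs \<rho>0)
    show "act (c *\<^sub>V a) x = c *\<^sub>V act a x" for c a x
      by (simp add: act_def unitz_defs csca csc_add_right)
    show "pform e" by (rule pform_e)
    have "(1 :: real)\<^sup>2 \<le> (1 + 2 * \<bar>K\<bar>)\<^sup>2" by (rule power_mono) simp_all
    then show "1 \<le> (1 + 2 * \<bar>K\<bar>)\<^sup>2" by simp
    fix b x
    have "\<kappa> (act b x) = usc b *\<^sub>V \<kappa> x + \<rho> (uel b) (\<kappa> x)" by (simp add: act_def \<kappa>_add \<kappa>_csc cl)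
    then have "nn (\<kappa> (act b x)) \<le> nn (usc b *\<^sub>V \<kappa> x) + nn (\<rho> (uel b) (\<kappa> x))"
      using nn_add[of "usc b *\<^sub>V \<kappa> x" "\<rho> (uel b) (\<kappa> x)"] by (simp add: S_intros cl)
    also have "\<dots> \<le> norm b * nn (\<kappa> x) + \<bar>K\<bar> * (2 * norm b) * nn (\<kappa> x)"
    proof (intro add_mono)
      show "nn (usc b *\<^sub>V \<kappa> x) \<le> norm b * nn (\<kappa> x)"
        by (simp add: nn_csc norm_unitz_def mult_right_mono)
      have "K * norm (uel b) \<le> \<bar>K\<bar> * (2 * norm b)" by (intro mult_mono norm_uel_le) simp_all
      then have "K * norm (uel b) * nn (\<kappa> x) \<le> \<bar>K\<bar> * (2 * norm b) * nn (\<kappa> x)" by (rule mult_right_mono) simp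
      then show "nn (\<rho> (uel b) (\<kappa> x)) \<le> \<bar>K\<bar> * (2 * norm b) * nn (\<kappa> x)" using bd[of "\<kappa> x" "uel b"] by simp
    qed
    finally have "nn (\<kappa> (act b x)) \<le> (1 + 2 * \<bar>K\<bar>) * norm b * nn (\<kappa> x)" by (simp add: algebra_simps)
    then have "(nn (\<kappa> (act b x)))\<^sup>2 \<le> ((1 + 2 * \<bar>K\<bar>) * norm b * nn (\<kappa> x))\<^sup>2" by (rule power_mono) simp
    then show "qf e (act b x) \<le> (1 + 2 * \<bar>K\<bar>)\<^sup>2 * (norm b)\<^sup>2 * qf e x" by (simp add: qf_e power_mult_distrib)
  qed
  obtain j where j: "inj_on j {s. \<forall>n :: nat. s n \<in> S}" "\<And>s. (\<forall>n. s n \<in> S) \<Longrightarrow> j s \<in> S" using sequences_embed by metis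
  have "\<exists>y. v \<in> dualsp e \<longrightarrow> y \<in> S \<and> v = e y" for v using dualsp_eq_range[of v] by metis
  then obtain r where r: "\<And>v. v \<in> dualsp e \<Longrightarrow> r v \<in> S" "\<And>v. v \<in> dualsp e \<Longrightarrow> v = e (r v)" by metis
  \<comment> \<open>Functionals become vectors of \<open>S\<close> by Riesz, the sequence of vectors
    becomes one vector, and \<open>f\<close> carries it into \<open>'h\<close>.\<close>
  define J where "J s = f (j (\<lambda>i. r (s i)))" for s
  have J: "inj_on J {s. \<forall>i. s i \<in> dualsp e}"
  proof (rule inj_onI)
    fix s t assume s: "s \<in> {s. \<forall>i. s i \<in> dualsp e}" and t: "t \<in> {s. \<forall>i. s i \<in> dualsp e}" and eq: "J s = J t"
    have "j (\<lambda>i. r (s i)) = j (\<lambda>i. r (t i))"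
      using eq s t unfolding J_def by (intro inj_onD[OF f]) (simp_all add: j(2) r(1))
    then have "(\<lambda>i. r (s i)) = (\<lambda>i. r (t i))" using s t by (intro inj_onD[OF j(1)]) (simp_all add: r(1))
    then have "r (s i) = r (t i)" for i by (rule fun_cong)
    then show "s = t" using s t r(2) by (metis (no_types, lifting) ext mem_Collect_eq)
  qed
  obtain \<tau> where "split_bmod act e ((1 + 2 * \<bar>K\<bar>)\<^sup>2) \<tau>" by (rule uniformly_split[OF B trp J])
  then interpret split_bmod act e "(1 + 2 * \<bar>K\<bar>)\<^sup>2" \<tau> .
  obtain p C where p: "pform p" "invf p" "\<And>x. qf e x \<le> qf p x" "\<And>x. qf p x \<le> C * qf e x"
    using invariant_equivalent_form by metis
  have act: "act (Unitz 0 a) x = \<rho> a x" if "x \<in> S" for a x using that by (simp add: act_def)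
  show ?thesis
  proof (rule that[of p C])
    show "pform_on S p" using p(1) sub unfolding pform_on_def hform_on_def by blast
    show "qf ip x \<le> qf p x" "qf p x \<le> C * qf ip x" if "x \<in> S" for x
      using p(3,4)[of x] that by (simp_all add: e_def)
    show "p (\<rho> (star a) x) y = p x (\<rho> a y)" if "x \<in> S" "y \<in> S" for a x y
      using invf_adjoint[OF pform_onD(1)[OF p(1)] p(2), of "Unitz 0 a" x y] act that
      by (simp add: star_unitz_def)
  qed
qed

section \<open>Square roots\<close>

context hilbert_set
begin

lemma nn_power2: "x \<in> S \<Longrightarrow> (nn x)\<^sup>2 = qf ip x"
  using pform_onD(2)[OF ip] by (simp add: nn_def)

lemma ip_eqI:
  assumes "x \<in> S" "y \<in> S" "\<And>z. z \<in> S \<Longrightarrow> ip x z = ip y z"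
  shows "x = y"
proof -
  have d: "x - y \<in> S" using assms by (simp add: S_intros)
  have "ip (x - y) (x - y) = 0" using assms(3)[OF d] by (simp add: hf_diffl[OF hip assms(1,2) d])
  then show ?thesis using definite[OF d] by simp
qed

lemma tendsto_ip:
  assumes a: "\<And>n. a n \<in> S" "l \<in> S" "(\<lambda>n. nn (a n - l)) \<longlonglongrightarrow> 0"
    and b: "\<And>n. b n \<in> S" "m \<in> S" "(\<lambda>n. nn (b n - m)) \<longlonglongrightarrow> 0"
  shows "(\<lambda>n. ip (a n) (b n)) \<longlonglongrightarrow> ip l m"
proof -
  have "(\<lambda>n. ip (a n) (b n) - ip l m) \<longlonglongrightarrow> 0"
  proof (rule Lim_null_comparison[OF always_eventually], rule allI)
    fix n
    have d: "a n - l \<in> S" "b n - m \<in> S" using a b by (simp_all add: S_intros)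
    have "ip (a n) (b n) - ip l m = ip (a n - l) (b n - m) + ip (a n - l) m + ip l (b n - m)"
      using a b d by (simp add: hf_diffl[OF hip] hf_diffr[OF hip])
    also have "cmod \<dots> \<le> cmod (ip (a n - l) (b n - m)) + cmod (ip (a n - l) m) + cmod (ip l (b n - m))"
      by (intro order_trans[OF norm_triangle_ineq] add_mono norm_triangle_ineq order_refl)
    also have "\<dots> \<le> nn (a n - l) * nn (b n - m) + nn (a n - l) * nn m + nn l * nn (b n - m)"
      using d a b by (intro add_mono ip_cauchy_schwarz)
    finally show "cmod (ip (a n) (b n) - ip l m) \<le> nn (a n - l) * nn (b n - m) + nn (a n - l) * nn m + nn l * nn (b n - m)" .
  next
    have "(\<lambda>n. nn (a n - l) * nn (b n - m) + nn (a n - l) * nn m + nn l * nn (b n - m)) \<longlonglongrightarrow> 0 * 0 + 0 * nn m + nn l * 0"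
      by (intro tendsto_intros a b)
    then show "(\<lambda>n. nn (a n - l) * nn (b n - m) + nn (a n - l) * nn m + nn l * nn (b n - m)) \<longlonglongrightarrow> 0" by simp
  qed
  then show ?thesis by (simp add: LIM_zero_iff)
qed

text \<open>\<open>Y = 1 - sqrt (1 - A)\<close> is the limit of the iteration \<open>Y \<mapsto> (A + Y\<^sup>2) / 2\<close>, which preserves the ball of
  radius \<open>r\<close> and contracts it by the factor \<open>r\<close>.\<close>

lemma quadratic_fixed_point:
  assumes A_in: "\<And>x. x \<in> S \<Longrightarrow> A x \<in> S"
    and A_add: "\<And>x y. x \<in> S \<Longrightarrow> y \<in> S \<Longrightarrow> A (x + y) = A x + A y"
    and A_csc: "\<And>c x. x \<in> S \<Longrightarrow> A (c *\<^sub>V x) = c *\<^sub>V A x"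
    and A_sym: "\<And>x y. x \<in> S \<Longrightarrow> y \<in> S \<Longrightarrow> ip (A x) y = ip x (A y)"
    and A_bd: "\<And>x. x \<in> S \<Longrightarrow> nn (A x) \<le> d * nn x"
    and r: "0 \<le> r" "r < 1" "d + r\<^sup>2 = 2 * r"
  obtains Y where "\<And>x. x \<in> S \<Longrightarrow> Y x \<in> S" "\<And>x y. x \<in> S \<Longrightarrow> y \<in> S \<Longrightarrow> Y (x + y) = Y x + Y y"
    "\<And>c x. x \<in> S \<Longrightarrow> Y (c *\<^sub>V x) = c *\<^sub>V Y x"
    "\<And>x y. x \<in> S \<Longrightarrow> y \<in> S \<Longrightarrow> ip (Y x) y = ip x (Y y)"
    "\<And>x. x \<in> S \<Longrightarrow> 2 *\<^sub>V Y x = A x + Y (Y x)"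
proof -
  define F where "F n = rec_nat (\<lambda>x. 0) (\<lambda>_ G x. (1/2) *\<^sub>V (A x + G (G x))) n" for n :: nat
  have F0: "F 0 x = 0" and FS: "F (Suc n) x = (1/2) *\<^sub>V (A x + F n (F n x))" for n x
    by (simp_all add: F_def)
  have F_in: "x \<in> S \<Longrightarrow> F n x \<in> S" for n x
    by (induction n arbitrary: x) (simp_all add: F0 FS S_intros A_in)
  have F_add: "x \<in> S \<Longrightarrow> y \<in> S \<Longrightarrow> F n (x + y) = F n x + F n y" for n x y
    by (induction n arbitrary: x y) (simp_all add: F0 FS A_add F_in csc_add_right)
  have F_csc: "x \<in> S \<Longrightarrow> F n (c *\<^sub>V x) = c *\<^sub>V F n x" for n x c
    by (induction n arbitrary: x) (simp_all add: F0 FS A_csc F_in csc_add_right)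
  have F_diff: "F n (x - y) = F n x - F n y" if "x \<in> S" "y \<in> S" for n x y
    using F_add[of "x - y" y n] that by (simp add: S_intros eq_diff_eq)
  have F_sym: "x \<in> S \<Longrightarrow> y \<in> S \<Longrightarrow> ip (F n x) y = ip x (F n y)" for n x y
    by (induction n arbitrary: x y)
      (simp_all add: F0 FS A_sym F_in A_in S_intros hf_addl[OF hip] hf_addr[OF hip] hf_cscl[OF hip] hf_cscr[OF hip]
        hf_zerol[OF hip] hf_zeror[OF hip])
  have half: "nn ((1/2) *\<^sub>V z) = nn z / 2" if "z \<in> S" for z using nn_csc[OF that, of "1/2"] by simp
  have F_bd: "x \<in> S \<Longrightarrow> nn (F n x) \<le> r * nn x" for n x
  proof (induction n arbitrary: x)
    case 0
    then show ?case using r(1) by (simp add: F0 nn_zero)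
  next
    case (Suc n)
    have "nn (F n (F n x)) \<le> r * (r * nn x)"
      using Suc.IH[of "F n x"] Suc.IH[OF Suc.prems] F_in[OF Suc.prems] mult_left_mono[OF _ r(1)] by (meson order_trans)
    then have "nn (A x + F n (F n x)) \<le> d * nn x + r * (r * nn x)"
      using nn_add[of "A x" "F n (F n x)"] A_bd[OF Suc.prems] Suc.prems by (simp add: A_in F_in)
    also have "\<dots> = (d + r\<^sup>2) * nn x" by (simp add: power2_eq_square distrib_right)
    finally show ?case unfolding FS r(3) using Suc.prems by (subst half) (simp_all add: S_intros A_in F_in)
  qed
  have F_step: "x \<in> S \<Longrightarrow> nn (F (Suc n) x - F n x) \<le> r ^ Suc n * nn x" for n x
  proof (induction n arbitrary: x)
    case 0
    then show ?case using F_bd[of x 1] by (simp add: F0)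
  next
    case (Suc n)
    \<comment> \<open>A difference of two squares of operators, split so that no commutation is
      used. Each part gains a factor \<open>r\<close>, and halving compensates for their
      number.\<close>
    let ?u = "F (Suc n) (F (Suc n) x - F n x)" and ?v = "F (Suc n) (F n x) - F n (F n x)"
    have in_S: "F k x \<in> S" for k by (rule F_in[OF Suc.prems])
    have S: "F (Suc n) x - F n x \<in> S" "?u \<in> S" "?v \<in> S" using in_S by (simp_all add: S_intros F_in)
    have "F (Suc (Suc n)) x - F (Suc n) x = (1/2) *\<^sub>V (?u + ?v)"
    proof -
      have "F (Suc (Suc n)) x - F (Suc n) x = (1/2) *\<^sub>V (F (Suc n) (F (Suc n) x) - F n (F n x))"
        by (simp only: FS[of "Suc n" x] FS[of n x] csc_diff_right csc_add_right add_diff_cancel_left)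
      also have "F (Suc n) (F (Suc n) x) - F n (F n x) = ?u + ?v" unfolding F_diff[OF in_S in_S] by simp
      finally show ?thesis .
    qed
    then have "nn (F (Suc (Suc n)) x - F (Suc n) x) \<le> (nn ?u + nn ?v) / 2"
      using nn_add[OF S(2,3)] S by (simp add: half S_intros)
    also have "nn ?u \<le> r * (r ^ Suc n * nn x)"
      using F_bd[OF S(1), of "Suc n"] mult_left_mono[OF Suc.IH[OF Suc.prems] r(1)] by linarith
    also have "nn ?v \<le> r ^ Suc n * (r * nn x)"
      using Suc.IH[OF in_S[of n]] mult_left_mono[OF F_bd[OF Suc.prems, of n], of "r ^ Suc n"] r(1) by (meson order_trans zero_le_power)
    finally show ?case by (simp add: mult_ac)
  qed
  have F_diff_le: "nn (F (n + m) x - F n x) \<le> (r ^ n - r ^ (n + m)) / (1 - r) * nn x" if x: "x \<in> S" for n m x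
  proof (induction m)
    case (Suc m)
    have "nn (F (n + Suc m) x - F n x) \<le> nn (F (Suc (n + m)) x - F (n + m) x) + nn (F (n + m) x - F n x)"
      using nn_dist[OF F_in F_in F_in, OF x x x] by simp
    also have "\<dots> \<le> r ^ (n + m) * nn x + (r ^ n - r ^ (n + m)) / (1 - r) * nn x"
    proof (intro add_mono Suc)
      have "r ^ Suc (n + m) \<le> r ^ (n + m)" using r by (simp add: mult_left_le_one_le)
      then show "nn (F (Suc (n + m)) x - F (n + m) x) \<le> r ^ (n + m) * nn x"
        using F_step[OF x, of "n + m"] mult_right_mono[OF _ nn_nonneg[OF x]] by (meson order_trans)
    qed
    also have "\<dots> = (r ^ n - r ^ (n + Suc m)) / (1 - r) * nn x" using r(2) by (simp add: field_simps)
    finally show ?case .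
  qed (simp add: nn_zero)
  have F_cauchy: "\<exists>l\<in>S. (\<lambda>n. nn (F n x - l)) \<longlonglongrightarrow> 0" if x: "x \<in> S" for x
  proof -
    have bnd: "nn (F m x - F n x) \<le> r ^ n / (1 - r) * nn x" if "n \<le> m" for m n
    proof -
      have "nn (F m x - F n x) \<le> (r ^ n - r ^ m) / (1 - r) * nn x" using F_diff_le[OF x, of n "m - n"] that by simp
      also have "\<dots> \<le> r ^ n / (1 - r) * nn x"
        using r x by (intro mult_right_mono divide_right_mono) simp_all
      finally show ?thesis .
    qed
    have "(\<lambda>n. r ^ n / (1 - r) * nn x) \<longlonglongrightarrow> 0 / (1 - r) * nn x"
      using r by (intro tendsto_intros LIMSEQ_realpow_zero) simp_all
    then have lim: "(\<lambda>n. r ^ n / (1 - r) * nn x) \<longlonglongrightarrow> 0" by simp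
    have C: "\<exists>N. \<forall>m\<ge>N. \<forall>n\<ge>N. nn (F m x - F n x) < \<epsilon>" if \<epsilon>: "0 < \<epsilon>" for \<epsilon>
    proof -
      obtain N where N: "\<And>n. n \<ge> N \<Longrightarrow> r ^ n / (1 - r) * nn x < \<epsilon>"
        using order_tendstoD(2)[OF lim \<epsilon>] unfolding eventually_sequentially by blast
      have "nn (F m x - F n x) < \<epsilon>" if mn: "m \<ge> N" "n \<ge> N" for m n
      proof (cases "n \<le> m")
        case True
        then show ?thesis using bnd[OF True] N[OF mn(2)] by linarith
      next
        case False
        then show ?thesis using bnd[of m n] N[OF mn(1)] nn_sym[OF F_in F_in, OF x x, of m n] by linarith
      qed
      then show ?thesis by blast
    qed
    obtain l where "l \<in> S" "(\<lambda>n. nn (F n x - l)) \<longlonglongrightarrow> 0" by (rule complete_nn[OF F_in[OF x] C])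
    then show ?thesis by blast
  qed
  then obtain Y where Y: "\<And>x. x \<in> S \<Longrightarrow> Y x \<in> S" "\<And>x. x \<in> S \<Longrightarrow> (\<lambda>n. nn (F n x - Y x)) \<longlonglongrightarrow> 0" by metis
  have cst: "(\<lambda>n :: nat. nn (z - z)) \<longlonglongrightarrow> 0" for z by (simp add: nn_zero)
  have lim: "(\<lambda>n. ip (F n x) z) \<longlonglongrightarrow> ip (Y x) z" if x: "x \<in> S" and z: "z \<in> S" for x z
    by (rule tendsto_ip[OF F_in[OF x] Y(1)[OF x] Y(2)[OF x] z z cst])
  show ?thesis
  proof (rule that[of Y])
    show "Y x \<in> S" if "x \<in> S" for x by (rule Y(1)[OF that])
    show "Y (x + y) = Y x + Y y" if x: "x \<in> S" and y: "y \<in> S" for x y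
    proof (rule ip_eqI)
      fix z assume z: "z \<in> S"
      have "(\<lambda>n. ip (F n (x + y)) z) \<longlonglongrightarrow> ip (Y x) z + ip (Y y) z"
        using tendsto_add[OF lim[OF x z] lim[OF y z]] by (simp add: F_add x y hf_addl[OF hip] F_in z)
      then show "ip (Y (x + y)) z = ip (Y x + Y y) z"
        using LIMSEQ_unique[OF lim[OF S_intros(1)[OF x y] z]] by (simp add: hf_addl[OF hip] Y x y z)
    qed (simp_all add: S_intros Y x y)
    show "Y (c *\<^sub>V x) = c *\<^sub>V Y x" if x: "x \<in> S" for c x
    proof (rule ip_eqI)
      fix z assume z: "z \<in> S"
      have "(\<lambda>n. ip (F n (c *\<^sub>V x)) z) \<longlonglongrightarrow> c * ip (Y x) z"
        using tendsto_mult_left[OF lim[OF x z], of c] by (simp add: F_csc x hf_cscl[OF hip] F_in z)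
      then show "ip (Y (c *\<^sub>V x)) z = ip (c *\<^sub>V Y x) z"
        using LIMSEQ_unique[OF lim[OF S_intros(3)[OF x] z]] by (simp add: hf_cscl[OF hip] Y x z)
    qed (simp_all add: S_intros Y x)
    show sym: "ip (Y x) y = ip x (Y y)" if x: "x \<in> S" and y: "y \<in> S" for x y
    proof -
      have "(\<lambda>n. ip x (F n y)) \<longlonglongrightarrow> ip x (Y y)"
        by (rule tendsto_ip[OF x x cst F_in[OF y] Y(1)[OF y] Y(2)[OF y]])
      then show ?thesis using LIMSEQ_unique[OF lim[OF x y]] by (simp add: F_sym x y)
    qed
    show "2 *\<^sub>V Y x = A x + Y (Y x)" if x: "x \<in> S" for x
    proof (rule ip_eqI)
      fix z assume z: "z \<in> S"
      have "(\<lambda>n. ip (A x) z + ip (F n x) (F n z)) \<longlonglongrightarrow> ip (A x) z + ip (Y x) (Y z)"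
        by (intro tendsto_add tendsto_const tendsto_ip F_in Y x z)
      moreover have "ip (A x) z + ip (F n x) (F n z) = 2 * ip (F (Suc n) x) z" for n
        using F_sym[OF F_in[OF x] z, of n n]
        by (simp add: FS hf_cscl[OF hip] hf_addl[OF hip] S_intros A_in F_in x z)
      moreover have "(\<lambda>n. 2 * ip (F (Suc n) x) z) \<longlonglongrightarrow> 2 * ip (Y x) z"
        by (intro tendsto_mult_left LIMSEQ_Suc lim x z)
      ultimately have "2 * ip (Y x) z = ip (A x) z + ip (Y x) (Y z)" by (simp only:) (rule LIMSEQ_unique)
      then show "ip (2 *\<^sub>V Y x) z = ip (A x + Y (Y x)) z"
        using sym[OF Y(1)[OF x] z] by (simp add: hf_cscl[OF hip] hf_addl[OF hip] S_intros A_in Y x z)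
    qed (simp_all add: S_intros A_in Y x)
  qed
qed

text \<open>\<open>T\<close> is the square root of the operator \<open>P\<close> that represents
  \<open>p\<close>. As \<open>P\<close> lies between 1 and \<open>D\<close>, the operator
  \<open>A = 1 - P / D\<close> has norm at most \<open>1 - 1 / D\<close>, and
  \<open>T = sqrt D (1 - Y)\<close> with \<open>Y\<close> the fixed point for
  \<open>A\<close>.\<close>

theorem isometry_of_equivalent_form:
  assumes p: "pform_on S p" and ge: "\<And>x. x \<in> S \<Longrightarrow> qf ip x \<le> qf p x" and le: "\<And>x. x \<in> S \<Longrightarrow> qf p x \<le> C * qf ip x"
  obtains T where "\<And>x. x \<in> S \<Longrightarrow> T x \<in> S" "\<And>x y. x \<in> S \<Longrightarrow> y \<in> S \<Longrightarrow> T (x + y) = T x + T y"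
    "\<And>c x. x \<in> S \<Longrightarrow> T (c *\<^sub>V x) = c *\<^sub>V T x" "\<And>x y. x \<in> S \<Longrightarrow> y \<in> S \<Longrightarrow> ip (T x) (T y) = p x y"
    "\<And>z. z \<in> S \<Longrightarrow> \<exists>x\<in>S. T x = z"
proof -
  note hp = pform_onD(1)[OF p]
  define D where "D = max 1 C"
  have D: "1 \<le> D" by (simp add: D_def)
  have ip0: "0 \<le> qf ip x" if "x \<in> S" for x by (rule pform_onD(2)[OF ip that])
  have leD: "qf p x \<le> D * qf ip x" if "x \<in> S" for x
    using le[OF that] mult_right_mono[of C D, OF _ ip0[OF that]] by (simp add: D_def)
  have p_bd: "sqrt (qf p x) \<le> sqrt D * nn x" if "x \<in> S" for x
    using real_sqrt_le_mono[OF leD[OF that]] by (simp add: nn_def real_sqrt_mult)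
  have "\<exists>y\<in>S. \<forall>z\<in>S. p x z = ip y z" if x: "x \<in> S" for x
  proof -
    have "cmod (p x z) \<le> (sqrt (qf p x) * sqrt D) * nn z" if z: "z \<in> S" for z
    proof -
      have "cmod (p x z) \<le> sqrt (qf p x) * sqrt (qf p z)" by (rule pf_cauchy_schwarz_sqrt[OF p x z])
      also have "\<dots> \<le> sqrt (qf p x) * (sqrt D * nn z)"
        using p_bd[OF z] pform_onD(2)[OF p x] by (intro mult_left_mono) simp_all
      finally show ?thesis by (simp add: mult.assoc)
    qed
    then obtain y where "y \<in> S" "\<And>z. z \<in> S \<Longrightarrow> p x z = ip y z"
      using riesz[of "p x"] hf_addr[OF hp] hf_cscr[OF hp] x by metis
    then show ?thesis by blast
  qed
  then obtain P where P: "\<And>x. x \<in> S \<Longrightarrow> P x \<in> S" "\<And>x z. x \<in> S \<Longrightarrow> z \<in> S \<Longrightarrow> p x z = ip (P x) z" by metis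
  define A where "A x = x - of_real (1 / D) *\<^sub>V P x" for x
  have A_in: "A x \<in> S" if "x \<in> S" for x unfolding A_def by (intro S_intros P that)
  define a where "a x y = ip x y - of_real (1 / D) * p x y" for x y
  have Aa: "ip (A x) y = a x y" if "x \<in> S" "y \<in> S" for x y
    using that P by (simp add: A_def a_def hf_diffl[OF hip] hf_cscl[OF hip] S_intros)
  have pa: "pform_on S a"
    unfolding pform_on_def hform_on_def
  proof (intro conjI ballI allI sub)
    show "a (x + y) z = a x z + a y z" if "x \<in> S" "y \<in> S" "z \<in> S" for x y z
      using that by (simp add: a_def hf_addl[OF hip] hf_addl[OF hp] algebra_simps)
    show "a (c *\<^sub>V x) y = c * a x y" if "x \<in> S" "y \<in> S" for c x y
      using that by (simp add: a_def hf_cscl[OF hip] hf_cscl[OF hp] algebra_simps)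
    show "a y x = cnj (a x y)" if "x \<in> S" "y \<in> S" for x y
      using hf_sym[OF hip that] hf_sym[OF hp that] by (simp add: a_def)
    show "0 \<le> qf a x" if "x \<in> S" for x
      using leD[OF that] D by (simp add: a_def field_simps)
  qed
  have qa: "qf a x \<le> (1 - 1 / D) * qf ip x" if "x \<in> S" for x
    using ge[OF that] D by (simp add: a_def field_simps)
  have d0: "0 \<le> 1 - 1 / D" using D by simp
  have A_bd: "nn (A x) \<le> (1 - 1 / D) * nn x" if x: "x \<in> S" for x
  proof -
    have Ax: "A x \<in> S" by (rule A_in[OF x])
    have sq: "sqrt (qf a y) \<le> sqrt (1 - 1 / D) * nn y" if "y \<in> S" for y
      using real_sqrt_le_mono[OF qa[OF that]] by (simp add: nn_def real_sqrt_mult)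
    have "(nn (A x))\<^sup>2 \<le> cmod (a x (A x))"
      using complex_Re_le_cmod[of "a x (A x)"] nn_power2[OF Ax] Aa[OF x Ax] by simp
    also have "\<dots> \<le> sqrt (qf a x) * sqrt (qf a (A x))" by (rule pf_cauchy_schwarz_sqrt[OF pa x Ax])
    also have "\<dots> \<le> (sqrt (1 - 1 / D) * nn x) * (sqrt (1 - 1 / D) * nn (A x))"
      using pform_onD(2)[OF pa] x Ax d0 by (intro mult_mono sq) simp_all
    also have "\<dots> = (sqrt (1 - 1 / D) * sqrt (1 - 1 / D)) * nn x * nn (A x)" by (simp only: mult_ac)
    also have "sqrt (1 - 1 / D) * sqrt (1 - 1 / D) = 1 - 1 / D" using d0 by simp
    finally have "nn (A x) * nn (A x) \<le> (1 - 1 / D) * nn x * nn (A x)" by (simp add: power2_eq_square)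
    then show ?thesis
      using nn_nonneg[OF Ax] nn_nonneg[OF x] d0 by (cases "nn (A x) = 0") (simp_all add: mult_le_cancel_right)
  qed
  have A_add: "A (x + y) = A x + A y" if "x \<in> S" "y \<in> S" for x y
    using that by (intro ip_eqI) (simp_all add: A_in S_intros Aa hf_addl[OF hip] hf_addl[OF pform_onD(1)[OF pa]])
  have A_csc: "A (c *\<^sub>V x) = c *\<^sub>V A x" if "x \<in> S" for c x
    using that by (intro ip_eqI) (simp_all add: A_in S_intros Aa hf_cscl[OF hip] hf_cscl[OF pform_onD(1)[OF pa]])
  have A_sym: "ip (A x) y = ip x (A y)" if x: "x \<in> S" and y: "y \<in> S" for x y
    using hf_sym[OF hip A_in[OF y] x] hf_sym[OF pform_onD(1)[OF pa] y x] by (simp add: Aa x y)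
  \<comment> \<open>The smaller solution of \<open>d + r\<^sup>2 = 2 * r\<close> for
    \<open>d = 1 - 1 / D\<close>.\<close>
  define r where "r = 1 - 1 / sqrt D"
  have r: "0 \<le> r" "r < 1" "(1 - 1 / D) + r\<^sup>2 = 2 * r"
    using D by (simp_all add: r_def power2_diff power_divide)
  obtain Y where Y: "\<And>x. x \<in> S \<Longrightarrow> Y x \<in> S" "\<And>x y. x \<in> S \<Longrightarrow> y \<in> S \<Longrightarrow> Y (x + y) = Y x + Y y"
    "\<And>c x. x \<in> S \<Longrightarrow> Y (c *\<^sub>V x) = c *\<^sub>V Y x" "\<And>x y. x \<in> S \<Longrightarrow> y \<in> S \<Longrightarrow> ip (Y x) y = ip x (Y y)"
    "\<And>x. x \<in> S \<Longrightarrow> 2 *\<^sub>V Y x = A x + Y (Y x)"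
  proof (rule quadratic_fixed_point[of A "1 - 1 / D" r])
    fix Y
    assume "\<And>x. x \<in> S \<Longrightarrow> Y x \<in> S" "\<And>x y. x \<in> S \<Longrightarrow> y \<in> S \<Longrightarrow> Y (x + y) = Y x + Y y"
      "\<And>c x. x \<in> S \<Longrightarrow> Y (c *\<^sub>V x) = c *\<^sub>V Y x" "\<And>x y. x \<in> S \<Longrightarrow> y \<in> S \<Longrightarrow> ip (Y x) y = ip x (Y y)"
      "\<And>x. x \<in> S \<Longrightarrow> 2 *\<^sub>V Y x = A x + Y (Y x)"
    then show thesis by (rule that)
  qed (use A_in A_add A_csc A_sym A_bd r in simp_all)
  define T where "T x = of_real (sqrt D) *\<^sub>V (x - Y x)" for x
  have T_in: "T x \<in> S" if "x \<in> S" for x unfolding T_def by (intro S_intros Y that)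
  have T_sym: "ip (T x) y = ip x (T y)" if "x \<in> S" "y \<in> S" for x y
    using that by (simp add: T_def hf_cscl[OF hip] hf_cscr[OF hip] hf_diffl[OF hip] hf_diffr[OF hip] S_intros Y)
  have T_ip: "ip (T x) (T y) = p x y" if x: "x \<in> S" and y: "y \<in> S" for x y
  proof -
    have "2 * ip (Y x) y = ip (2 *\<^sub>V Y x) y" using x y by (simp add: hf_cscl[OF hip] Y(1))
    also have "\<dots> = a x y + ip (Y x) (Y y)"
      unfolding Y(5)[OF x] using x y Y(4)[OF Y(1)[OF x] y] by (simp add: hf_addl[OF hip] Aa A_in Y(1))
    finally have eq: "ip (Y x) (Y y) = 2 * ip (Y x) y - a x y" by simp
    have DD: "complex_of_real (sqrt D) * of_real (sqrt D) = of_real D"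
      using D by (simp flip: of_real_mult)
    have "ip (T x) (T y) = of_real D * (ip x y - ip x (Y y) - ip (Y x) y + ip (Y x) (Y y))"
      unfolding DD[symmetric] using x y
      by (simp add: T_def hf_cscl[OF hip] hf_cscr[OF hip] hf_diffl[OF hip] hf_diffr[OF hip] S_intros Y(1) algebra_simps)
    also have "\<dots> = of_real D * (ip x y - a x y)" unfolding eq using Y(4)[OF x y] by simp
    also have "\<dots> = p x y" using D by (simp add: a_def)
    finally show ?thesis .
  qed
  have "hilbert_set S p"
  proof
    show "pform_on S p" by (rule p)
    show "x = 0" if "x \<in> S" "qf p x = 0" for x using definite[of x] ge[of x] ip0[of x] that by simp
    fix v :: "nat \<Rightarrow> _" assume v: "\<And>n. v n \<in> S"
      and C: "\<And>\<epsilon>. 0 < \<epsilon> \<Longrightarrow> \<exists>N. \<forall>m\<ge>N. \<forall>n\<ge>N. sqrt (qf p (v m - v n)) < \<epsilon>"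
    have "nn x \<le> sqrt (qf p x)" if "x \<in> S" for x using ge[OF that] by (simp add: nn_def)
    then have "nn (v m - v n) \<le> sqrt (qf p (v m - v n))" for m n by (simp add: S_intros v)
    then have C': "\<exists>N. \<forall>m\<ge>N. \<forall>n\<ge>N. nn (v m - v n) < \<epsilon>" if "0 < \<epsilon>" for \<epsilon>
      using C[OF that] by (meson order_le_less_trans)
    obtain l where l: "l \<in> S" "(\<lambda>n. nn (v n - l)) \<longlonglongrightarrow> 0" by (rule complete_nn[OF v C'])
    have "(\<lambda>n. sqrt (qf p (v n - l))) \<longlonglongrightarrow> 0"
    proof (rule tendsto_sandwich[OF always_eventually always_eventually tendsto_const])
      show "\<forall>n. 0 \<le> sqrt (qf p (v n - l))" using pform_onD(2)[OF p] by (simp add: S_intros v l)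
      show "\<forall>n. sqrt (qf p (v n - l)) \<le> sqrt D * nn (v n - l)" using p_bd by (simp add: S_intros v l)
      show "(\<lambda>n. sqrt D * nn (v n - l)) \<longlonglongrightarrow> 0" using tendsto_mult_left[OF l(2), of "sqrt D"] by simp
    qed
    then show "\<exists>l\<in>S. (\<lambda>n. sqrt (qf p (v n - l))) \<longlonglongrightarrow> 0" using l(1) by blast
  qed
  then interpret Q: hilbert_set S p .
  \<comment> \<open>The space is also complete for \<open>p\<close>, so \<open>z\<close> is
    represented by some \<open>y\<close> with respect to \<open>p\<close>. Since \<open>T\<close> is
    symmetric with square \<open>P\<close>, this means \<open>T (T y) = z\<close>.\<close>
  have "\<exists>x\<in>S. T x = z" if z: "z \<in> S" for z
  proof -
    have "cmod (ip z x) \<le> nn z * Q.nn x" if x: "x \<in> S" for x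
    proof -
      have "nn x \<le> Q.nn x" using ge[OF x] by (simp add: nn_def Q.nn_def)
      then show ?thesis using ip_cauchy_schwarz[OF z x] mult_left_mono[OF _ nn_nonneg[OF z]] by (meson order_trans)
    qed
    then obtain y where y: "y \<in> S" "\<And>x. x \<in> S \<Longrightarrow> ip z x = p y x"
      using Q.riesz[of "ip z"] hf_addr[OF hip] hf_cscr[OF hip] z by metis
    have "T (T y) = z"
    proof (rule ip_eqI)
      fix x assume x: "x \<in> S"
      show "ip (T (T y)) x = ip z x" unfolding T_sym[OF T_in[OF y(1)] x] T_ip[OF y(1) x] y(2)[OF x] ..
    qed (intro T_in y z)+
    then show ?thesis using T_in[OF y(1)] by blast
  qed
  moreover have "T (x + y) = T x + T y" if "x \<in> S" "y \<in> S" for x y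
    using that by (simp add: T_def Y csc_diff_right csc_add_right)
  moreover have "T (c *\<^sub>V x) = c *\<^sub>V T x" if "x \<in> S" for x c
    using that by (simp add: T_def Y csc_diff_right mult.commute)
  ultimately show ?thesis by (intro that[of T]) (simp_all add: T_in T_ip)
qed

end

section \<open>The two properties are equivalent\<close>

text \<open>Sending \<open>x\<close> to the function \<open>\<langle>x, \<cdot>\<rangle>\<close> embeds a Hilbert space linearly into a total complex vector space.\<close>

lemma isometric_copy_exists:
  fixes H :: "'h inner_structure"
  assumes "complex_hilbert_space H"
  obtains S :: "('h \<Rightarrow> complex) set" and ip f where "hilbert_set S ip" "hilbert_set.isometric_copy S ip f H"
proof -
  interpret H: complex_hilbert_space H by (rule assms)
  interpret MS: Metric_space "carrier H" "hdist H" by (rule H.Metric_space_hdist)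
  define g where "g x = (\<lambda>y. if y \<in> carrier H then cinner H x y else 0)" for x
  have g_add: "g (x \<oplus>\<^bsub>H\<^esub> y) = g x + g y" if "x \<in> carrier H" "y \<in> carrier H" for x y
    using that by (simp add: g_def fun_eq_iff H.cinner_add_left)
  have g_smult: "g (c \<odot>\<^bsub>H\<^esub> x) = c *\<^sub>V g x" if "x \<in> carrier H" for x c
    using that by (simp add: g_def fun_eq_iff H.cinner_smult_left)
  have g_zero: "g \<zero>\<^bsub>H\<^esub> = 0"
    using g_smult[of "\<zero>\<^bsub>H\<^esub>" 0] H.smult_l_null[of "\<zero>\<^bsub>H\<^esub>"] by simp
  have g_minus: "g (x \<ominus>\<^bsub>H\<^esub> y) = g x - g y" if "x \<in> carrier H" "y \<in> carrier H" for x y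
    using that g_add[of x "\<ominus>\<^bsub>H\<^esub> y"] g_smult[of y "-1"] H.smult_minus_one[of y] by (simp add: a_minus_def)
  have g_inj: "inj_on g (carrier H)"
  proof (rule inj_onI)
    fix x y assume x: "x \<in> carrier H" and y: "y \<in> carrier H" and eq: "g x = g y"
    have d: "x \<ominus>\<^bsub>H\<^esub> y \<in> carrier H" using x y by simp
    have "g (x \<ominus>\<^bsub>H\<^esub> y) = 0" using g_minus[OF x y] eq by simp
    then have "g (x \<ominus>\<^bsub>H\<^esub> y) (x \<ominus>\<^bsub>H\<^esub> y) = 0" by simp
    then have "cinner H (x \<ominus>\<^bsub>H\<^esub> y) (x \<ominus>\<^bsub>H\<^esub> y) = 0" using d by (simp add: g_def)
    then have "x \<ominus>\<^bsub>H\<^esub> y = \<zero>\<^bsub>H\<^esub>" by (rule H.cinner_self_eq_zero[OF d])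
    then have "hdist H x y = 0" using x y H.hnorm_eq_zero[of "\<zero>\<^bsub>H\<^esub>"] by (simp add: hdist_def)
    then show "x = y" using x y by simp
  qed
  define S where "S = g ` carrier H"
  define f where "f = the_inv_into (carrier H) g"
  define ip where "ip u v = cinner H (f u) (f v)" for u v
  have fg: "f (g x) = x" if "x \<in> carrier H" for x using that by (simp add: f_def the_inv_into_f_f[OF g_inj])
  have gS: "g x \<in> S" if "x \<in> carrier H" for x using that by (simp add: S_def)
  have Sex: "\<exists>x\<in>carrier H. u = g x" if "u \<in> S" for u using that by (auto simp: S_def)
  have gf: "f u \<in> carrier H" "g (f u) = u" if "u \<in> S" for u using that by (auto simp: S_def fg)
  have ipg: "ip (g x) (g y) = cinner H x y" if "x \<in> carrier H" "y \<in> carrier H" for x y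
    using that by (simp add: ip_def fg)
  have cs: "csub S"
    unfolding csub_def
  proof (intro conjI ballI allI)
    show "0 \<in> S" using gS[of "\<zero>\<^bsub>H\<^esub>"] g_zero by simp
    show "u + v \<in> S" if "u \<in> S" "v \<in> S" for u v
      using that Sex gS g_add by (metis H.M.a_closed)
    show "c *\<^sub>V u \<in> S" if "u \<in> S" for c u
      using that Sex gS g_smult by (metis H.smult_in_carrier)
  qed
  have S: "hilbert_set S ip"
  proof
    show "pform_on S ip"
      unfolding pform_on_def hform_on_def
    proof (intro conjI ballI allI cs)
      fix u v w c assume "u \<in> S" "v \<in> S" "w \<in> S"
      then obtain x y z where x: "x \<in> carrier H" "u = g x" and y: "y \<in> carrier H" "v = g y"
        and z: "z \<in> carrier H" "w = g z" using Sex by metis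
      show "ip (u + v) w = ip u w + ip v w"
        using x y z H.cinner_add_left by (simp add: ipg flip: g_add)
      show "ip (c *\<^sub>V u) v = c * ip u v"
        using x y by (simp add: ipg H.cinner_smult_left H.smult_in_carrier flip: g_smult)
      show "ip v u = cnj (ip u v)" using x y H.cinner_commute[of x y] by (simp add: ipg)
      show "0 \<le> qf ip u" using x H.cinner_self_nonneg by (simp add: ipg)
    qed
    show "u = 0" if u: "u \<in> S" "qf ip u = 0" for u
    proof -
      obtain x where x: "x \<in> carrier H" "u = g x" using Sex[OF u(1)] by blast
      then have "hnorm H x = 0" using u(2) by (simp add: ipg hnorm_def)
      then have "x = \<zero>\<^bsub>H\<^esub>" using H.hnorm_eq_zero[OF x(1)] by simp
      then show ?thesis using x(2) g_zero by simp
    qed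
    fix v :: "nat \<Rightarrow> _" assume v: "\<And>n. v n \<in> S"
      and C: "\<And>\<epsilon>. 0 < \<epsilon> \<Longrightarrow> \<exists>N. \<forall>m\<ge>N. \<forall>n\<ge>N. sqrt (qf ip (v m - v n)) < \<epsilon>"
    define x where "x n = f (v n)" for n
    have x: "x n \<in> carrier H" "v n = g (x n)" for n using gf[OF v] by (simp_all add: x_def)
    have dist: "sqrt (qf ip (g y - g z)) = hdist H y z" if "y \<in> carrier H" "z \<in> carrier H" for y z
      using that by (simp add: hdist_def hnorm_def ipg flip: g_minus)
    have "MS.MCauchy x"
      unfolding MS.MCauchy_def
    proof (intro conjI allI impI)
      show "range x \<subseteq> carrier H" using x(1) by auto
      fix \<epsilon> :: real assume "0 < \<epsilon>"
      then show "\<exists>N. \<forall>n n'. N \<le> n \<longrightarrow> N \<le> n' \<longrightarrow> hdist H (x n) (x n') < \<epsilon>"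
        using C[of \<epsilon>] by (auto simp: x(2) dist[OF x(1) x(1)])
    qed
    then obtain l where l: "limitin MS.mtopology x l sequentially" using H.complete unfolding MS.mcomplete_def by blast
    then have lc: "l \<in> carrier H" by (rule MS.limitin_mspace)
    have "(\<lambda>n. hdist H (x n) l) \<longlonglongrightarrow> 0" using l unfolding MS.limitin_metric_dist_null by blast
    then show "\<exists>l\<in>S. (\<lambda>n. sqrt (qf ip (v n - l))) \<longlonglongrightarrow> 0"
      using gS[OF lc] by (intro bexI[of _ "g l"]) (simp_all add: x(2) dist[OF x(1) lc])
  qed
  interpret S: hilbert_set S ip by (rule S)
  have "S.isometric_copy f H"
    unfolding S.isometric_copy_def
  proof (intro conjI ballI allI)
    show "inj_on f S" by (rule inj_on_inverseI[of S g]) (rule gf)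
    show "carrier H = f ` S" by (simp add: S_def image_image fg cong: image_cong)
    show "\<zero>\<^bsub>H\<^esub> = f 0" using fg[of "\<zero>\<^bsub>H\<^esub>"] g_zero by simp
    show "f u \<oplus>\<^bsub>H\<^esub> f v = f (u + v)" if "u \<in> S" "v \<in> S" for u v
      using that Sex fg g_add by (metis H.M.a_closed)
    show "cinner H (f u) (f v) = ip u v" for u v by (simp add: ip_def)
    show "c \<odot>\<^bsub>H\<^esub> f u = f (c *\<^sub>V u)" if "u \<in> S" for u c
      using that Sex fg g_smult by (metis H.smult_in_carrier)
  qed
  with S show ?thesis by (rule that)
qed

section \<open>Bounds for representations\<close>

lemma (in complex_inner_product_space) le_operator_norm:
  assumes T: "\<And>x. x \<in> carrier H \<Longrightarrow> T x \<in> carrier H" "\<And>c x. x \<in> carrier H \<Longrightarrow> T (c \<odot>\<^bsub>H\<^esub> x) = c \<odot>\<^bsub>H\<^esub> T x"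
    "\<And>x. x \<in> carrier H \<Longrightarrow> hnorm H (T x) \<le> K * hnorm H x"
    and x: "x \<in> carrier H"
  shows "hnorm H (T x) \<le> operator_norm H T * hnorm H x"
proof (cases "hnorm H x = 0")
  case True
  then show ?thesis using T(3)[OF x] by simp
next
  case False
  then have n: "0 < hnorm H x" using hnorm_nonneg[OF x] by simp
  define y where "y = complex_of_real (1 / hnorm H x) \<odot>\<^bsub>H\<^esub> x"
  have y: "y \<in> carrier H" "hnorm H y = 1" using x n by (simp_all add: y_def smult_in_carrier hnorm_smult norm_divide)
  have "bdd_above ((\<lambda>x. hnorm H (T x)) ` {x \<in> carrier H. hnorm H x \<le> 1})"
  proof (rule bdd_aboveI2)
    fix x assume "x \<in> {x \<in> carrier H. hnorm H x \<le> 1}"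
    then show "hnorm H (T x) \<le> \<bar>K\<bar>"
      using T(3)[of x] hnorm_nonneg[of x] mult_mono[OF abs_ge_self[of K], of "hnorm H x" 1] by simp
  qed
  then have "hnorm H (T y) \<le> operator_norm H T" unfolding operator_norm_def using y by (intro cSUP_upper) simp_all
  moreover have "hnorm H (T y) = hnorm H (T x) / hnorm H x"
    using n T(1,2)[OF x] by (simp add: y_def hnorm_smult norm_divide)
  ultimately show ?thesis using n by (simp add: field_simps)
qed

text \<open>Continuity at 0 makes \<open>\<theta>\<close> contractive on a punctured ball of radius
  \<open>\<delta>\<close>. Scaling \<open>a\<close> to norm \<open>\<delta> / 2\<close> gives the
  constant \<open>2 / \<delta>\<close>.\<close>

lemma (in complex_inner_product_space) representation_bounded:
  fixes \<theta> :: "'a::cstar_algebra \<Rightarrow> _"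
  assumes \<theta>: "representation H \<theta>"
  obtains K where "\<And>a x. x \<in> carrier H \<Longrightarrow> hnorm H (\<theta> a x) \<le> K * norm a * hnorm H x"
proof -
  have bo: "\<theta> a \<in> bounded_operators H" for a using \<theta> by (simp add: representation_def)
  have cl: "\<theta> a x \<in> carrier H" if "x \<in> carrier H" for a x using bo[of a] that by (auto simp: bounded_operators_def)
  have cscx: "\<theta> a (c \<odot>\<^bsub>H\<^esub> x) = c \<odot>\<^bsub>H\<^esub> \<theta> a x" if "x \<in> carrier H" for a c x
    using bo[of a] that by (auto simp: bounded_operators_def)
  have csca: "\<theta> (c *\<^sub>C a) x = c \<odot>\<^bsub>H\<^esub> \<theta> a x" if "x \<in> carrier H" for a c x
    using \<theta> that by (simp add: representation_def)
  have zero: "\<theta> 0 x = \<zero>\<^bsub>H\<^esub>" if x: "x \<in> carrier H" for x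
    using csca[OF x, of 0 0] smult_l_null[OF cl[OF x]] by simp
  have "((\<lambda>b. operator_norm H (\<lambda>x. \<theta> b x \<ominus>\<^bsub>H\<^esub> \<theta> 0 x)) \<longlongrightarrow> 0) (at 0)"
    using \<theta> by (simp add: representation_def)
  then have "\<forall>\<^sub>F b in at 0. operator_norm H (\<lambda>x. \<theta> b x \<ominus>\<^bsub>H\<^esub> \<theta> 0 x) < 1"
    by (rule order_tendstoD(2)) simp
  then obtain \<delta> where \<delta>: "0 < \<delta>"
    "\<And>b. b \<noteq> 0 \<Longrightarrow> norm b < \<delta> \<Longrightarrow> operator_norm H (\<lambda>x. \<theta> b x \<ominus>\<^bsub>H\<^esub> \<theta> 0 x) < 1"
    unfolding eventually_at by (auto simp: dist_norm)
  have small: "hnorm H (\<theta> b x) \<le> hnorm H x" if b: "b \<noteq> 0" "norm b < \<delta>" and x: "x \<in> carrier H" for b x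
  proof -
    let ?T = "\<lambda>x. \<theta> b x \<ominus>\<^bsub>H\<^esub> \<theta> 0 x"
    have T: "?T y = \<theta> b y" if "y \<in> carrier H" for y
      using that cl[of y b] by (simp add: zero a_minus_def)
    obtain K where K: "\<forall>y\<in>carrier H. hnorm H (\<theta> b y) \<le> K * hnorm H y"
      using bo[of b] unfolding bounded_operators_def by blast
    have "hnorm H (?T x) \<le> operator_norm H ?T * hnorm H x"
    proof (rule le_operator_norm[where K = K])
      show "?T (c \<odot>\<^bsub>H\<^esub> y) = c \<odot>\<^bsub>H\<^esub> ?T y" if "y \<in> carrier H" for c y
        unfolding T[OF that] T[OF smult_in_carrier[OF that]] by (rule cscx[OF that])
    qed (use K in \<open>simp_all add: T cl x\<close>)
    also have "\<dots> \<le> 1 * hnorm H x" using \<delta>(2)[OF b] hnorm_nonneg[OF x] by (intro mult_right_mono) simp_all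
    finally show ?thesis using T[OF x] by simp
  qed
  have "hnorm H (\<theta> a x) \<le> (2 / \<delta>) * norm a * hnorm H x" if x: "x \<in> carrier H" for a x
  proof (cases "a = 0")
    case True
    then show ?thesis using zero[OF x] hnorm_eq_zero[of "\<zero>\<^bsub>H\<^esub>"] by simp
  next
    case False
    define c where "c = \<delta> / (2 * norm a)"
    have c: "0 < c" using \<delta>(1) False by (simp add: c_def)
    have "norm (complex_of_real c *\<^sub>C a) = \<delta> / 2" using \<delta>(1) False by (simp add: norm_scaleC c_def norm_divide norm_mult)
    then have "hnorm H (\<theta> (complex_of_real c *\<^sub>C a) x) \<le> hnorm H x" using \<delta>(1) by (intro small x) auto
    then have "c * hnorm H (\<theta> a x) \<le> hnorm H x" using c by (simp add: csca x hnorm_smult cl)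
    then show ?thesis using \<delta>(1) False by (simp add: c_def field_simps)
  qed
  then show ?thesis by (rule that)
qed

section \<open>Representations moved to a total vector space and back\<close>

locale represented_copy = hilbert_set S ip for S :: "'v::cvec set" and ip +
  fixes f :: "'v \<Rightarrow> 'h" and H :: "'h inner_structure" and \<theta> :: "'a::cstar_algebra \<Rightarrow> 'h \<Rightarrow> 'h"
  assumes copy: "isometric_copy f H" and rep: "representation H \<theta>"
begin

sublocale H: complex_hilbert_space H by (rule copy_hilbert[OF copy])

lemmas f_inj = copy_inj[OF copy]
lemmas f_simps [simp] = copy_carrier[OF copy] copy_zero[OF copy] copy_ops[OF copy] copy_norm[OF copy]

definition g :: "'h \<Rightarrow> 'v" where "g = the_inv_into S f"

lemma gf [simp]: "x \<in> S \<Longrightarrow> g (f x) = x"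
  by (simp add: g_def the_inv_into_f_f[OF f_inj])

lemma g_in [simp]: "x \<in> f ` S \<Longrightarrow> g x \<in> S" and fg [simp]: "x \<in> f ` S \<Longrightarrow> f (g x) = x"
  by auto

definition \<rho> :: "'a \<Rightarrow> 'v \<Rightarrow> 'v" where "\<rho> a x = g (\<theta> a (f x))"

lemma \<theta>_in: "x \<in> f ` S \<Longrightarrow> \<theta> a x \<in> f ` S"
proof -
  assume x: "x \<in> f ` S"
  have "\<theta> a \<in> bounded_operators H" using rep by (simp add: representation_def)
  then have "\<theta> a \<in> carrier H \<rightarrow> carrier H" unfolding bounded_operators_def by blast
  then show ?thesis using x by auto
qed

lemma \<theta>_f: "x \<in> S \<Longrightarrow> \<theta> a (f x) = f (\<rho> a x)"
  using \<theta>_in[of "f x" a] by (simp add: \<rho>_def)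

lemma \<rho>_in [simp]: "x \<in> S \<Longrightarrow> \<rho> a x \<in> S"
  using \<theta>_in[of "f x" a] by (simp add: \<rho>_def)

lemma f_eq: "x \<in> S \<Longrightarrow> y \<in> S \<Longrightarrow> f x = f y \<Longrightarrow> x = y"
  by (rule inj_onD[OF f_inj])

lemma \<rho>_linear:
  assumes x: "x \<in> S"
  shows "y \<in> S \<Longrightarrow> \<rho> a (x + y) = \<rho> a x + \<rho> a y" "\<rho> a (c *\<^sub>V x) = c *\<^sub>V \<rho> a x"
    "\<rho> (a + b) x = \<rho> a x + \<rho> b x" "\<rho> (c *\<^sub>C a) x = c *\<^sub>V \<rho> a x" "\<rho> (a * b) x = \<rho> a (\<rho> b x)"
proof -
  have bo: "\<theta> a \<in> bounded_operators H" using rep by (simp add: representation_def)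
  show "\<rho> a (x + y) = \<rho> a x + \<rho> a y" if y: "y \<in> S"
  proof -
    have "\<theta> a (f x \<oplus>\<^bsub>H\<^esub> f y) = \<theta> a (f x) \<oplus>\<^bsub>H\<^esub> \<theta> a (f y)"
      using bo x y unfolding bounded_operators_def by simp
    then have "f (\<rho> a (x + y)) = f (\<rho> a x + \<rho> a y)" using x y by (simp add: \<theta>_f S_intros)
    then show ?thesis using x y by (intro f_eq) (simp_all add: S_intros)
  qed
  have "\<theta> a (c \<odot>\<^bsub>H\<^esub> f x) = c \<odot>\<^bsub>H\<^esub> \<theta> a (f x)"
    using bo x unfolding bounded_operators_def by simp
  then have "f (\<rho> a (c *\<^sub>V x)) = f (c *\<^sub>V \<rho> a x)" using x by (simp add: \<theta>_f S_intros)
  then show "\<rho> a (c *\<^sub>V x) = c *\<^sub>V \<rho> a x" using x by (intro f_eq) (simp_all add: S_intros)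
  have "\<theta> (a + b) (f x) = \<theta> a (f x) \<oplus>\<^bsub>H\<^esub> \<theta> b (f x)" using rep x unfolding representation_def by simp
  then have "f (\<rho> (a + b) x) = f (\<rho> a x + \<rho> b x)" using x by (simp add: \<theta>_f)
  then show "\<rho> (a + b) x = \<rho> a x + \<rho> b x" using x by (intro f_eq) (simp_all add: S_intros)
  have "\<theta> (c *\<^sub>C a) (f x) = c \<odot>\<^bsub>H\<^esub> \<theta> a (f x)" using rep x unfolding representation_def by simp
  then have "f (\<rho> (c *\<^sub>C a) x) = f (c *\<^sub>V \<rho> a x)" using x by (simp add: \<theta>_f)
  then show "\<rho> (c *\<^sub>C a) x = c *\<^sub>V \<rho> a x" using x by (intro f_eq) (simp_all add: S_intros)
  have "\<theta> (a * b) (f x) = \<theta> a (\<theta> b (f x))" using rep x unfolding representation_def by simp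
  then have "f (\<rho> (a * b) x) = f (\<rho> a (\<rho> b x))" using x by (simp add: \<theta>_f)
  then show "\<rho> (a * b) x = \<rho> a (\<rho> b x)" using x by (intro f_eq) (simp_all add: S_intros)
qed

lemma \<rho>_bounded: obtains K where "0 \<le> K" "\<And>a x. x \<in> S \<Longrightarrow> nn (\<rho> a x) \<le> K * norm a * nn x"
proof -
  obtain K where K: "\<And>a x. x \<in> carrier H \<Longrightarrow> hnorm H (\<theta> a x) \<le> K * norm a * hnorm H x"
    using H.representation_bounded[OF rep] by metis
  have "nn (\<rho> a x) \<le> \<bar>K\<bar> * norm a * nn x" if x: "x \<in> S" for a x
  proof -
    have "nn (\<rho> a x) \<le> K * norm a * nn x" using K[of "f x" a] x by (simp add: \<theta>_f)
    also have "\<dots> \<le> \<bar>K\<bar> * norm a * nn x" using x by (intro mult_right_mono) simp_all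
    finally show ?thesis .
  qed
  then show ?thesis using that[of "\<bar>K\<bar>"] by simp
qed

lemma transported_operator:
  assumes T: "\<And>x. x \<in> S \<Longrightarrow> T x \<in> S" "\<And>x y. x \<in> S \<Longrightarrow> y \<in> S \<Longrightarrow> T (x + y) = T x + T y"
    "\<And>c x. x \<in> S \<Longrightarrow> T (c *\<^sub>V x) = c *\<^sub>V T x" "\<And>x. x \<in> S \<Longrightarrow> nn (T x) \<le> K * nn x"
  shows "(\<lambda>x. f (T (g x))) \<in> bounded_operators H"
  unfolding bounded_operators_def mem_Collect_eq
proof (intro conjI ballI allI funcsetI exI[of _ K])
  show "f (T (g (x \<oplus>\<^bsub>H\<^esub> y))) = f (T (g x)) \<oplus>\<^bsub>H\<^esub> f (T (g y))" if "x \<in> carrier H" "y \<in> carrier H" for x y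
    using that by (auto simp: T S_intros)
  show "f (T (g (c \<odot>\<^bsub>H\<^esub> x))) = c \<odot>\<^bsub>H\<^esub> f (T (g x))" if "x \<in> carrier H" for c x
    using that by (auto simp: T S_intros)
  show "hnorm H (f (T (g x))) \<le> K * hnorm H x" if "x \<in> carrier H" for x
    using that by (auto simp: T)
qed (auto simp: T)

text \<open>\<open>T\<close> maps \<open>S\<close> with the form \<open>p\<close> isometrically onto
  \<open>S\<close> with \<open>ip\<close>. Conjugation by \<open>T\<close> therefore turns adjoints
  with respect to \<open>p\<close> into adjoints with respect to the given inner product.\<close>

lemma similar_to_star_representation:
  assumes trp: "total_reduction_property TYPE('a) TYPE('h)"
  shows "\<exists>U\<in>bounded_operators H. \<exists>U'\<in>bounded_operators H.
    (\<forall>x\<in>carrier H. U' (U x) = x \<and> U (U' x) = x) \<and> star_representation H (\<lambda>a x. U (\<theta> a (U' x)))"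
proof -
  obtain K where K: "0 \<le> K" "\<And>a x. x \<in> S \<Longrightarrow> nn (\<rho> a x) \<le> K * norm a * nn x" using \<rho>_bounded by metis
  obtain p C where p: "pform_on S p" "\<And>x. x \<in> S \<Longrightarrow> qf ip x \<le> qf p x" "\<And>x. x \<in> S \<Longrightarrow> qf p x \<le> C * qf ip x"
    and p_adj: "\<And>a x y. x \<in> S \<Longrightarrow> y \<in> S \<Longrightarrow> p (\<rho> (star a) x) y = p x (\<rho> a y)"
  proof (rule invariant_inner_product[OF f_inj trp, of \<rho> K])
    fix p C
    assume "pform_on S p" "\<And>x. x \<in> S \<Longrightarrow> qf ip x \<le> qf p x" "\<And>x. x \<in> S \<Longrightarrow> qf p x \<le> C * qf ip x"
      "\<And>a x y. x \<in> S \<Longrightarrow> y \<in> S \<Longrightarrow> p (\<rho> (star a) x) y = p x (\<rho> a y)"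
    then show thesis by (rule that)
  qed (simp_all add: \<rho>_linear K)
  obtain T where T: "\<And>x. x \<in> S \<Longrightarrow> T x \<in> S" "\<And>x y. x \<in> S \<Longrightarrow> y \<in> S \<Longrightarrow> T (x + y) = T x + T y"
    "\<And>c x. x \<in> S \<Longrightarrow> T (c *\<^sub>V x) = c *\<^sub>V T x" and T_ip: "\<And>x y. x \<in> S \<Longrightarrow> y \<in> S \<Longrightarrow> ip (T x) (T y) = p x y"
    and T_surj: "\<And>z. z \<in> S \<Longrightarrow> \<exists>x\<in>S. T x = z"
  proof (rule isometry_of_equivalent_form[OF p(1), of C])
    fix T
    assume "\<And>x. x \<in> S \<Longrightarrow> T x \<in> S" "\<And>x y. x \<in> S \<Longrightarrow> y \<in> S \<Longrightarrow> T (x + y) = T x + T y"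
      "\<And>c x. x \<in> S \<Longrightarrow> T (c *\<^sub>V x) = c *\<^sub>V T x" "\<And>x y. x \<in> S \<Longrightarrow> y \<in> S \<Longrightarrow> ip (T x) (T y) = p x y"
      "\<And>z. z \<in> S \<Longrightarrow> \<exists>x\<in>S. T x = z"
    then show thesis by (rule that)
  qed (simp_all add: p)
  have nT: "nn (T x) = sqrt (qf p x)" if "x \<in> S" for x using T_ip[OF that that] by (simp add: nn_def)
  have T_le: "nn (T x) \<le> sqrt C * nn x" if "x \<in> S" for x
    using real_sqrt_le_mono[OF p(3)[OF that]] nT[OF that] by (simp add: nn_def real_sqrt_mult)
  have T_ge: "nn x \<le> nn (T x)" if "x \<in> S" for x
    using real_sqrt_le_mono[OF p(2)[OF that]] nT[OF that] by (simp add: nn_def)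
  define R where "R z = (SOME x. x \<in> S \<and> T x = z)" for z
  have R: "R z \<in> S" "T (R z) = z" if z: "z \<in> S" for z
  proof -
    obtain x where "x \<in> S \<and> T x = z" using T_surj[OF z] by blast
    then have "R z \<in> S \<and> T (R z) = z" unfolding R_def by (rule someI[of "\<lambda>x. x \<in> S \<and> T x = z"])
    then show "R z \<in> S" "T (R z) = z" by simp_all
  qed
  have T_inj: "x = y" if x: "x \<in> S" and y: "y \<in> S" and eq: "T x = T y" for x y
  proof -
    have d: "x - y \<in> S" by (rule S_intros(2)[OF x y])
    have "T (x - y) + T y = T y" using T(2)[OF d y] eq by simp
    then have "nn (x - y) = 0" using T_ge[OF d] nn_nonneg[OF d] by (simp add: nn_zero)
    then show ?thesis using nn_eq_0[OF d] by simp
  qed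
  have RT: "R (T x) = x" if "x \<in> S" for x using T_inj[OF R(1)[OF T(1)[OF that]] that R(2)[OF T(1)[OF that]]] .
  have R_add: "R (x + y) = R x + R y" if "x \<in> S" "y \<in> S" for x y
    by (rule T_inj) (use that in \<open>simp_all add: T R S_intros\<close>)
  have R_csc: "R (c *\<^sub>V x) = c *\<^sub>V R x" if "x \<in> S" for c x
    by (rule T_inj) (use that in \<open>simp_all add: T R S_intros\<close>)
  have R_le: "nn (R x) \<le> nn x" if "x \<in> S" for x using T_ge[OF R(1)[OF that]] R(2)[OF that] by simp
  have TC: "0 \<le> sqrt C * nn x" if "x \<in> S" for x using T_le[OF that] nn_nonneg[OF T(1)[OF that]] by simp
  define U where "U x = f (T (g x))" for x
  define U' where "U' x = f (R (g x))" for x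
  define \<sigma> where "\<sigma> a x = U (\<theta> a (U' x))" for a x
  have \<sigma>: "\<sigma> a (f x) = f (T (\<rho> a (R x)))" if "x \<in> S" for a x
    using that by (simp add: \<sigma>_def U_def U'_def \<theta>_f R T)
  have U: "U \<in> bounded_operators H"
    unfolding U_def by (rule transported_operator[of T "sqrt C"]) (simp_all add: T T_le)
  have U': "U' \<in> bounded_operators H"
    unfolding U'_def by (rule transported_operator[of R 1]) (simp_all add: R R_add R_csc R_le)
  have inv: "U' (U x) = x \<and> U (U' x) = x" if "x \<in> carrier H" for x
    using that by (auto simp: U_def U'_def T R RT)
  have "representation H \<sigma>"
  proof (rule H.representationI)
    fix a x assume "x \<in> carrier H"
    then obtain u where u: "u \<in> S" "x = f u" by auto
    have Ru: "R u \<in> S" by (rule R(1)[OF u(1)])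
    have "nn (T (\<rho> a (R u))) \<le> \<bar>sqrt C\<bar> * nn (\<rho> a (R u))"
      using T_le[OF \<rho>_in[OF Ru]] nn_nonneg[OF \<rho>_in[OF Ru, of a]] by (meson abs_ge_self mult_right_mono order_trans)
    also have "\<dots> \<le> \<bar>sqrt C\<bar> * (K * norm a * nn u)"
    proof (rule mult_left_mono)
      have "nn (\<rho> a (R u)) \<le> K * norm a * nn (R u)" by (rule K(2)[OF Ru])
      also have "\<dots> \<le> K * norm a * nn u" using K(1) R_le[OF u(1)] by (intro mult_left_mono) simp_all
      finally show "nn (\<rho> a (R u)) \<le> K * norm a * nn u" .
    qed simp
    finally show "hnorm H (\<sigma> a x) \<le> (\<bar>sqrt C\<bar> * K) * norm a * hnorm H x"
      using u Ru by (simp add: \<sigma> T mult.assoc)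
  qed (auto simp: \<sigma> T R R_add R_csc RT \<rho>_linear S_intros)
  moreover have "cinner H (\<sigma> (star a) x) y = cinner H x (\<sigma> a y)" if xy: "x \<in> carrier H" "y \<in> carrier H" for a x y
  proof -
    obtain u v where u: "u \<in> S" "x = f u" and v: "v \<in> S" "y = f v" using xy by auto
    have "cinner H (\<sigma> (star a) x) y = ip (T (\<rho> (star a) (R u))) (T (R v))"
      using u v by (simp add: \<sigma> T R)
    also have "\<dots> = ip (T (R u)) (T (\<rho> a (R v)))" using u v by (simp only: T_ip R(1) \<rho>_in p_adj)
    also have "\<dots> = cinner H x (\<sigma> a y)" using u v by (simp add: \<sigma> T R)
    finally show ?thesis .
  qed
  ultimately have "star_representation H (\<lambda>a x. U (\<theta> a (U' x)))"
    unfolding star_representation_def \<sigma>_def by blast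
  then show ?thesis using U U' inv by blast
qed

lemma complemented_by_similarity:
  assumes U: "U \<in> bounded_operators H" "U' \<in> bounded_operators H" "\<And>x. x \<in> carrier H \<Longrightarrow> U' (U x) = x"
    and star: "star_representation H (\<lambda>a x. U (\<theta> a (U' x)))" and V: "closed_invariant_subspace H \<theta> V"
  shows "\<exists>W. closed_invariant_subspace H \<theta> W \<and> V <+>\<^bsub>H\<^esub> W = carrier H \<and> V \<inter> W = {\<zero>\<^bsub>H\<^esub>}"
proof -
  define A where "A x = g (U (f x))" for x
  define B where "B x = g (U' (f x))" for x
  have bo: "\<exists>K. (\<forall>x\<in>S. T x \<in> S \<and> nn (T x) \<le> K * nn x \<and> f (T x) = Z (f x)) \<and>
      (\<forall>x\<in>S. \<forall>y\<in>S. T (x + y) = T x + T y) \<and> (\<forall>c. \<forall>x\<in>S. T (c *\<^sub>V x) = c *\<^sub>V T x)"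
    if Z: "Z \<in> bounded_operators H" and T: "\<And>x. T x = g (Z (f x))" for Z T
  proof -
    have Z_in: "Z (f x) \<in> f ` S" if "x \<in> S" for x using Z that by (auto simp: bounded_operators_def)
    have T_in: "T x \<in> S" "f (T x) = Z (f x)" if "x \<in> S" for x using Z_in[OF that] by (simp_all add: T)
    obtain K where "\<forall>x\<in>carrier H. hnorm H (Z x) \<le> K * hnorm H x" using Z unfolding bounded_operators_def by blast
    then have K: "hnorm H (Z (f x)) \<le> K * nn x" if "x \<in> S" for x using that by auto
    have "nn (T x) \<le> K * nn x" if "x \<in> S" for x
      using K[OF that] T_in(1)[OF that] by (simp flip: T_in(2)[OF that])
    moreover have "T (x + y) = T x + T y" if x: "x \<in> S" and y: "y \<in> S" for x y
    proof (rule f_eq)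
      have "Z (f x \<oplus>\<^bsub>H\<^esub> f y) = Z (f x) \<oplus>\<^bsub>H\<^esub> Z (f y)" using Z x y unfolding bounded_operators_def by simp
      then show "f (T (x + y)) = f (T x + T y)"
        using x y T_in(1) T_in(2)[OF S_intros(1)[OF x y]] by (simp flip: T_in(2)[OF x] T_in(2)[OF y])
    qed (simp_all add: T_in x y S_intros)
    moreover have "T (c *\<^sub>V x) = c *\<^sub>V T x" if x: "x \<in> S" for c x
    proof (rule f_eq)
      have "Z (c \<odot>\<^bsub>H\<^esub> f x) = c \<odot>\<^bsub>H\<^esub> Z (f x)" using Z x unfolding bounded_operators_def by simp
      then show "f (T (c *\<^sub>V x)) = f (c *\<^sub>V T x)"
        using x T_in(1) T_in(2)[OF S_intros(3)[OF x]] by (simp flip: T_in(2)[OF x])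
    qed (simp_all add: T_in x S_intros)
    ultimately show ?thesis using T_in by blast
  qed
  obtain K where A: "\<And>x. x \<in> S \<Longrightarrow> A x \<in> S" "\<And>x. x \<in> S \<Longrightarrow> nn (A x) \<le> K * nn x" "\<And>x. x \<in> S \<Longrightarrow> f (A x) = U (f x)"
    "\<And>x y. x \<in> S \<Longrightarrow> y \<in> S \<Longrightarrow> A (x + y) = A x + A y" "\<And>c x. x \<in> S \<Longrightarrow> A (c *\<^sub>V x) = c *\<^sub>V A x"
    using bo[OF U(1) A_def] by metis
  obtain L where B: "\<And>x. x \<in> S \<Longrightarrow> B x \<in> S" "\<And>x. x \<in> S \<Longrightarrow> nn (B x) \<le> L * nn x" "\<And>x. x \<in> S \<Longrightarrow> f (B x) = U' (f x)"
    using bo[OF U(2) B_def] by metis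
  have BA: "B (A x) = x" if "x \<in> S" for x
    using that U(3)[of "f x"] by (intro f_eq B A) (simp_all add: A B)
  have A_diff: "A (x - y) = A x - A y" if "x \<in> S" "y \<in> S" for x y
    using A(4)[OF S_intros(2)[OF that] that(2)] by (simp add: eq_diff_eq)
  \<comment> \<open>The inner product pulled back along the similarity; the
    \<open>*\<close>-property of the conjugated representation becomes adjointness of
    \<open>\<rho>\<close> for \<open>p\<close>.\<close>
  define p where "p x y = ip (A x) (A y)" for x y
  have p_adj: "p (\<rho> (star a) x) y = p x (\<rho> a y)" if x: "x \<in> S" and y: "y \<in> S" for a x y
  proof -
    have "cinner H (U (\<theta> (star a) (U' (f (A x))))) (f (A y)) = cinner H (f (A x)) (U (\<theta> a (U' (f (A y)))))"
      using star A(1)[OF x] A(1)[OF y] unfolding star_representation_def by simp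
    then show ?thesis
      using x y by (simp add: p_def BA \<theta>_f A(1) flip: B(3) A(3))
  qed
  have pp: "pform_on S p"
    unfolding pform_on_def hform_on_def p_def
  proof (intro conjI ballI allI sub)
    show "ip (A y) (A x) = cnj (ip (A x) (A y))" if "x \<in> S" "y \<in> S" for x y
      using hf_sym[OF hip A(1)[OF that(1)] A(1)[OF that(2)]] .
    show "0 \<le> qf ip (A x)" if "x \<in> S" for x by (rule pform_onD(2)[OF ip A(1)[OF that]])
  qed (simp_all add: A hf_addl[OF hip] hf_cscl[OF hip])
  note hp = pform_onD(1)[OF pp]
  have qp: "sqrt (qf p x) = nn (A x)" for x by (simp add: p_def nn_def)
  define V' where "V' = {x \<in> S. f x \<in> V}"
  have V_sub: "submodule V complex_ring H" and V_cl: "closedin (htopology H) V" and V_inv: "\<And>a. \<theta> a ` V \<subseteq> V"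
    using V by (auto simp: closed_invariant_subspace_def)
  have csV: "csub V'" unfolding V'_def by (rule copy_submoduleD[OF copy V_sub])
  have clV: "sclosed V'" unfolding V'_def by (rule copy_closedD[OF copy V_cl])
  have VS: "V' \<subseteq> S" by (auto simp: V'_def)
  have V_eq: "V = f ` V'" using H.submoduleE(1)[OF V_sub] by (auto simp: V'_def)
  have invV: "\<rho> a x \<in> V'" if "x \<in> V'" for a x
  proof -
    have x: "x \<in> S" "f x \<in> V" using that by (simp_all add: V'_def)
    then have "\<theta> a (f x) \<in> V" using V_inv by blast
    then show ?thesis using x by (simp add: V'_def \<theta>_f)
  qed
  \<comment> \<open>Completeness for \<open>p\<close> passes to \<open>V'\<close> because the
    similarity is bounded in both directions. Riesz on \<open>V'\<close> then yields the
    \<open>p\<close>-orthogonal projection.\<close>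
  have "hilbert_set V' p"
  proof
    show "pform_on V' p" using pp csV VS unfolding pform_on_def hform_on_def by (meson subsetD)
    show "x = 0" if x: "x \<in> V'" "qf p x = 0" for x
    proof -
      have xS: "x \<in> S" using x(1) VS by blast
      have "A x = 0" using x(2) by (intro definite A xS) (simp add: p_def)
      then have "nn x \<le> L * nn (0 :: 'v)" using B(2)[OF A(1)[OF xS]] BA[OF xS] by simp
      then show ?thesis using nn_eq_0[OF xS] nn_nonneg[OF xS] by (simp add: nn_zero)
    qed
    fix v :: "nat \<Rightarrow> _" assume v: "\<And>n. v n \<in> V'"
      and C: "\<And>\<epsilon>. 0 < \<epsilon> \<Longrightarrow> \<exists>N. \<forall>m\<ge>N. \<forall>n\<ge>N. sqrt (qf p (v m - v n)) < \<epsilon>"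
    have vS: "v n \<in> S" for n using v VS by blast
    have le: "nn (v m - v n) \<le> \<bar>L\<bar> * sqrt (qf p (v m - v n))" for m n
    proof -
      have d: "v m - v n \<in> S" by (intro S_intros vS)
      have "nn (v m - v n) \<le> L * nn (A (v m - v n))" using B(2)[OF A(1)[OF d]] BA[OF d] by simp
      also have "\<dots> \<le> \<bar>L\<bar> * nn (A (v m - v n))" by (intro mult_right_mono nn_nonneg A d) simp
      finally show ?thesis by (simp add: qp)
    qed
    have C': "\<exists>N. \<forall>m\<ge>N. \<forall>n\<ge>N. nn (v m - v n) < \<epsilon>" if \<epsilon>: "0 < \<epsilon>" for \<epsilon>
    proof -
      obtain N where N: "\<And>m n. m \<ge> N \<Longrightarrow> n \<ge> N \<Longrightarrow> sqrt (qf p (v m - v n)) < \<epsilon> / (\<bar>L\<bar> + 1)"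
        using C[of "\<epsilon> / (\<bar>L\<bar> + 1)"] \<epsilon> by (auto simp: add_nonneg_pos)
      have "nn (v m - v n) < \<epsilon>" if "m \<ge> N" "n \<ge> N" for m n
      proof -
        have s0: "0 \<le> sqrt (qf p (v m - v n))" unfolding qp by (intro nn_nonneg A S_intros vS)
        have "\<bar>L\<bar> * sqrt (qf p (v m - v n)) \<le> (\<bar>L\<bar> + 1) * sqrt (qf p (v m - v n))"
          using s0 by (intro mult_right_mono) simp_all
        also have "\<dots> < (\<bar>L\<bar> + 1) * (\<epsilon> / (\<bar>L\<bar> + 1))" by (intro mult_strict_left_mono N that) simp
        also have "\<dots> = \<epsilon>" using abs_ge_zero[of L] by (simp add: add_nonneg_eq_0_iff)
        finally show ?thesis using le[of m n] by linarith
      qed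
      then show ?thesis by blast
    qed
    obtain l where l: "l \<in> S" "(\<lambda>n. nn (v n - l)) \<longlonglongrightarrow> 0" by (rule complete_nn[OF vS C'])
    have "l \<in> V'" using clV v l unfolding sclosed_def by blast
    moreover have "(\<lambda>n. sqrt (qf p (v n - l))) \<longlonglongrightarrow> 0"
      unfolding qp
    proof (rule tendsto_sandwich[OF always_eventually always_eventually tendsto_const])
      show "\<forall>n. 0 \<le> nn (A (v n - l))" by (simp add: S_intros A vS l)
      show "\<forall>n. nn (A (v n - l)) \<le> K * nn (v n - l)" by (simp add: S_intros A vS l)
      show "(\<lambda>n. K * nn (v n - l)) \<longlonglongrightarrow> 0" using tendsto_mult_left[OF l(2), of K] by simp
    qed
    ultimately show "\<exists>l\<in>V'. (\<lambda>n. sqrt (qf p (v n - l))) \<longlonglongrightarrow> 0" by blast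
  qed
  then interpret Q: hilbert_set V' p .
  define W where "W = {x \<in> S. \<forall>v\<in>V'. p x v = 0}"
  have WS: "W \<subseteq> S" by (auto simp: W_def)
  have csW: "csub W"
    using VS unfolding csub_def W_def
    by (auto simp: S_intros hf_addl[OF hp] hf_cscl[OF hp] hf_zerol[OF hp] subset_iff)
  have clW: "sclosed W"
    unfolding sclosed_def
  proof (intro conjI allI impI WS)
    fix w l assume w: "\<forall>n. w n \<in> W" and l: "l \<in> S" and lim: "(\<lambda>n. nn (w n - l)) \<longlonglongrightarrow> 0"
    have wS: "w n \<in> S" for n using w WS by blast
    have limA: "(\<lambda>n. nn (A (w n) - A l)) \<longlonglongrightarrow> 0"
    proof (rule tendsto_sandwich[OF always_eventually always_eventually tendsto_const])
      show "\<forall>n. 0 \<le> nn (A (w n) - A l)" by (simp add: S_intros A wS l)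
      show "\<forall>n. nn (A (w n) - A l) \<le> K * nn (w n - l)" using A(2) by (simp add: S_intros wS l flip: A_diff)
      show "(\<lambda>n. K * nn (w n - l)) \<longlonglongrightarrow> 0" using tendsto_mult_left[OF lim, of K] by simp
    qed
    have "p l v = 0" if v: "v \<in> V'" for v
    proof -
      have vS: "v \<in> S" using v VS by blast
      have "(\<lambda>n. ip (A (w n)) (A v)) \<longlonglongrightarrow> ip (A l) (A v)"
        by (rule tendsto_ip[OF _ _ limA]) (simp_all add: A wS l vS nn_zero)
      moreover have "ip (A (w n)) (A v) = 0" for n using w v by (simp add: W_def p_def)
      ultimately show ?thesis by (simp add: p_def LIMSEQ_const_iff)
    qed
    then show "l \<in> W" using l by (simp add: W_def)
  qed
  have invW: "\<rho> a x \<in> W" if x: "x \<in> W" for a x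
  proof -
    have "p (\<rho> a x) v = 0" if v: "v \<in> V'" for v
      using p_adj[of x v "star a"] x invV[OF v, of "star a"] v VS by (auto simp: W_def star_star)
    then show ?thesis using x by (simp add: W_def)
  qed
  have disj: "V' \<inter> W = {0}"
  proof
    show "V' \<inter> W \<subseteq> {0}"
    proof
      fix x assume "x \<in> V' \<inter> W"
      then have "x \<in> V'" "p x x = 0" by (auto simp: W_def)
      then show "x \<in> {0}" using Q.definite[of x] by simp
    qed
    show "{0} \<subseteq> V' \<inter> W" using csub_zero[OF csV] csub_zero[OF csW] by simp
  qed
  have split: "\<exists>v\<in>V'. \<exists>w\<in>W. x = v + w" if x: "x \<in> S" for x
  proof -
    have "cmod (p x v) \<le> sqrt (qf p x) * Q.nn v" if "v \<in> V'" for v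
      unfolding Q.nn_def using that VS by (intro pf_cauchy_schwarz_sqrt[OF pp x]) auto
    moreover have "p x (c *\<^sub>V v) = cnj c * p x v" if "v \<in> V'" for c v
      using hf_cscr[OF hp _ x] that VS by blast
    moreover have "p x (v + w) = p x v + p x w" if "v \<in> V'" "w \<in> V'" for v w
      using hf_addr[OF hp _ _ x] that VS by blast
    ultimately obtain y where y: "y \<in> V'" "\<And>v. v \<in> V' \<Longrightarrow> p x v = p y v"
      using Q.riesz[of "p x" "sqrt (qf p x)"] by metis
    have "x - y \<in> W"
      using y x VS by (auto simp: W_def S_intros hf_diffl[OF hp] subset_iff)
    then show ?thesis using y(1) by (intro bexI[of _ y] bexI[of _ "x - y"]) simp_all
  qed
  show ?thesis
  proof (intro exI[of _ "f ` W"] conjI)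
    show "closed_invariant_subspace H \<theta> (f ` W)"
      unfolding closed_invariant_subspace_def
      using copy_submodule[OF copy csW WS] copy_closed[OF copy clW] invW WS by (auto simp: \<theta>_f subset_iff)
    show "V <+>\<^bsub>H\<^esub> f ` W = carrier H"
    proof
      show "V <+>\<^bsub>H\<^esub> f ` W \<subseteq> carrier H"
        using VS WS by (auto simp: V_eq set_add_def' S_intros subset_iff)
      show "carrier H \<subseteq> V <+>\<^bsub>H\<^esub> f ` W"
      proof
        fix z assume "z \<in> carrier H"
        then obtain x where x: "x \<in> S" "z = f x" by auto
        obtain v w where vw: "v \<in> V'" "w \<in> W" "x = v + w" using split[OF x(1)] by blast
        then have "z = f v \<oplus>\<^bsub>H\<^esub> f w" using x(2) VS WS by (auto simp: subset_iff)
        then show "z \<in> V <+>\<^bsub>H\<^esub> f ` W" using vw by (auto simp: V_eq set_add_def')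
      qed
    qed
    have "f ` V' \<inter> f ` W = f ` (V' \<inter> W)" by (rule inj_on_image_Int[OF f_inj VS WS, symmetric])
    then show "V \<inter> f ` W = {\<zero>\<^bsub>H\<^esub>}" by (simp add: V_eq disj)
  qed
qed

end

lemma represented_copy_exists:
  fixes H :: "'h inner_structure" and \<theta> :: "'a::cstar_algebra \<Rightarrow> 'h \<Rightarrow> 'h"
  assumes "complex_hilbert_space H" "representation H \<theta>"
  obtains S :: "('h \<Rightarrow> complex) set" and ip f where "represented_copy S ip f H \<theta>"
  using isometric_copy_exists[OF assms(1)] assms(2)
  by (metis represented_copy.intro represented_copy_axioms.intro)

theorem corollary2p4p5:
  shows "total_reduction_property TYPE('a::cstar_algebra) TYPE('h)
    \<longleftrightarrow> similarity_property TYPE('a) TYPE('h)"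
proof
  assume trp: "total_reduction_property TYPE('a) TYPE('h)"
  show "similarity_property TYPE('a) TYPE('h)"
    unfolding similarity_property_def
  proof (intro allI impI)
    fix H :: "'h inner_structure" and \<theta> :: "'a \<Rightarrow> 'h \<Rightarrow> 'h"
    assume H: "complex_hilbert_space H" "representation H \<theta>"
    obtain S :: "('h \<Rightarrow> complex) set" and ip f where "represented_copy S ip f H \<theta>"
      by (rule represented_copy_exists[OF H])
    then show "\<exists>U\<in>bounded_operators H. \<exists>U'\<in>bounded_operators H.
        (\<forall>x\<in>carrier H. U' (U x) = x \<and> U (U' x) = x) \<and> star_representation H (\<lambda>a x. U (\<theta> a (U' x)))"
      by (rule represented_copy.similar_to_star_representation[OF _ trp])
  qed
next
  assume sim: "similarity_property TYPE('a) TYPE('h)"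
  show "total_reduction_property TYPE('a) TYPE('h)"
    unfolding total_reduction_property_def
  proof (intro allI impI)
    fix H :: "'h inner_structure" and \<theta> :: "'a \<Rightarrow> 'h \<Rightarrow> 'h" and V
    assume H: "complex_hilbert_space H" "representation H \<theta>" and V: "closed_invariant_subspace H \<theta> V"
    obtain S :: "('h \<Rightarrow> complex) set" and ip f where R: "represented_copy S ip f H \<theta>"
      by (rule represented_copy_exists[OF H])
    obtain U U' where U: "U \<in> bounded_operators H" "U' \<in> bounded_operators H"
      "\<forall>x\<in>carrier H. U' (U x) = x \<and> U (U' x) = x" "star_representation H (\<lambda>a x. U (\<theta> a (U' x)))"
      using sim[unfolded similarity_property_def, rule_format, OF H] by blast
    show "\<exists>W. closed_invariant_subspace H \<theta> W \<and> V <+>\<^bsub>H\<^esub> W = carrier H \<and> V \<inter> W = {\<zero>\<^bsub>H\<^esub>}"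
      by (rule represented_copy.complemented_by_similarity[OF R U(1,2) _ U(4) V]) (use U(3) in blast)
  qed
qed

end
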